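(* Let $\Omega\subset\mathbb{R}^2$ be a bounded, simply connected open set with Lipschitz boundary. Let $$F^c_\varepsilon(Q)=\frac1{|\log\varepsilon|}\sum_{|i-j|=1}\bigl(1-|u_i\cdot u_j|^2\bigr)\quad\text{if }Q\in C_\varepsilon(\Omega;S^1_\otimes),\ Q(\varepsilon i)=u_i\otimes u_i\ (u_i\in S^1,\ i\in\mathbb{Z}_\varepsilon(\Omega)),$$ and $F^c_\varepsilon(Q)=+\infty$ otherwise. For $Q\in C_\varepsilon(\Omega;S^1_\otimes)$ let $Q^a$ denote its piecewise-affine interpolation, and let $A(Q)=(2Q_{11}-1,2Q_{12})$. Let $J$ denote the Jacobian and $\|\cdot\|$ the dual norm of $C^{0,1}_c(\Omega)$. Then: (i) (Compactness and lower-bound inequality) Let $(Q_\varepsilon)$ be a sequence of functions such that $F^c_\varepsilon(Q_\varepsilon)\le C$. Then one can extract a subsequence (not relabelled) such that $\|J(A(Q^a_\varepsilon))-\pi\mu\|\to0$, where $\mu=\sum_{k=1}^mz_k\delta_{x_k}$ for some $m\in\mathbb{N}$, $z_k\in\mathbb{Z}$ and distinct $x_k\in\Omega$. Moreover $$\liminf_{\varepsilon\to0}F^c_\varepsilon(Q_\varepsilon)\ge\pi|\mu|(\Omega)=\pi\sum_{k=1}^m|z_k|.$$ (ii) (Upper-bound inequality) Let $\mu=\sum_{k=1}^mz_k\delta_{x_k}$ with $m\in\mathbb{N}$, $z_k\in\mathbb{Z}$ and distinct $x_k\in\Omega$. Then there exists a sequence $(Q_\varepsilon)$ such that $\|J(A(Q^a_\varepsilon))-\pi\mu\|\to0$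 and $$\lim_{\varepsilon\to0}F^c_\varepsilon(Q_\varepsilon)=\pi|\mu|(\Omega)=\pi\sum_{k=1}^m|z_k|.$$
   Context: $S^1_\otimes=\{v\otimes v:v\in S^1\}\subset\mathbb{M}^{2\times2}_{sym}$ (symmetric $2\times 2$ real matrices). $\mathbb{Z}_\varepsilon(\Omega)=\{i\in\mathbb{Z}^2:\varepsilon i\in\Omega\}$, $W=[-\frac12,\frac12)^2$, and $C_\varepsilon(\Omega;S^1_\otimes)=\{Q:\Omega\to S^1_\otimes:\ Q(x)=Q(\varepsilon i)\text{ if }x\in\varepsilon\{i+W\},\ i\in\mathbb{Z}_\varepsilon(\Omega)\}$. The sum over $|i-j|=1$ runs over all ordered pairs $(i,j)\in\mathbb{Z}_\varepsilon(\Omega)^2$ with $|i-j|=1$ (each bond is counted twice). The piecewise-affine interpolation $Q^a$ coincides with $Q$ at the lattice points $\varepsilon i$ and is affine on each triangle of the grid obtained by cutting each square of the lattice $\varepsilon\mathbb{Z}^2$ along its diagonal parallel to $e_1-e_2$; it is considered on the triangles of this grid that are contained in $\Omega$. $C^{0,1}_c(\Omega)$ is the space of Lipschitz functions with compact support in $\Omega$, with its Lipschitz norm. For $w\in W^{1,1}(\Omega;\mathbb{R}^2)\cap L^\infty(\Omega;\mathbb{R}^2)$ the distributional Jacobian is $\langle Jw,\varphi\rangle=-\int_\Omega\bigl(w_1(w_2)_{x_2}\varphi_{x_1}-w_1(w_2)_{x_1}\varphi_{x_2}\bigr)dx$ for $\varphi\in C^{0,1}_c(\Omega)$; if $w\in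 W^{1,2}$ then $Jw=\det\nabla w\in L^1$. For the piecewise-affine map $A(Q^a_\varepsilon)$, $J(A(Q^a_\varepsilon))$ is the $L^1$ function $\det\nabla A(Q^a_\varepsilon)$ on the union of the triangles contained in $\Omega$, set equal to $0$ on the rest of $\Omega$. *)

theory Defs
  imports "HOL-Analysis.Analysis"
begin

section \<open>Domains\<close>

text \<open>Near each boundary point the set is, in suitable orthonormal coordinates centred at that
  point, the region strictly above the graph of a Lipschitz function of one variable.\<close>

definition lipschitz_boundary :: "(real^2) set \<Rightarrow> bool" where
  "lipschitz_boundary \<Omega> \<longleftrightarrow>
     (\<forall>p \<in> frontier \<Omega>. \<exists>R r g L. orthogonal_transformation (R :: real^2 \<Rightarrow> real^2) \<and> r > 0 \<and>
        L-lipschitz_on (UNIV :: real set) (g :: real \<Rightarrow> real) \<and>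
        (\<forall>x \<in> ball p r. x \<in> \<Omega> \<longleftrightarrow> g (R (x - p) $ 1) < R (x - p) $ 2))"


section \<open>The lattice and the discrete fields\<close>

definition tensor :: "real^2 \<Rightarrow> real^2 \<Rightarrow> real^2^2" where
  "tensor u v = (\<chi> k l. u $ k * v $ l)"

definition S1_tensor :: "(real^2^2) set" where
  "S1_tensor = {tensor v v | v. v \<in> sphere 0 1}"

definition Z2 :: "(real^2) set" where
  "Z2 = {i. \<forall>k. i $ k \<in> \<int>}"

definition Z_eps :: "real \<Rightarrow> (real^2) set \<Rightarrow> (real^2) set" where
  "Z_eps \<epsilon> \<Omega> = {i \<in> Z2. \<epsilon> *\<^sub>R i \<in> \<Omega>}"

definition unit_cell :: "(real^2) set" where
  "unit_cell = {w. \<forall>k. - (1/2) \<le> w $ k \<and> w $ k < 1/2}"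

text \<open>Fields are total functions on the plane; only their restriction to the domain matters.\<close>

definition C_eps :: "real \<Rightarrow> (real^2) set \<Rightarrow> (real^2 \<Rightarrow> real^2^2) set" where
  "C_eps \<epsilon> \<Omega> = {Q. (\<forall>x \<in> \<Omega>. Q x \<in> S1_tensor) \<and>
     (\<forall>i \<in> Z_eps \<epsilon> \<Omega>. \<forall>x \<in> \<Omega>. x \<in> (\<lambda>w. \<epsilon> *\<^sub>R (i + w)) ` unit_cell \<longrightarrow> Q x = Q (\<epsilon> *\<^sub>R i))}"


section \<open>The energy\<close>

definition bonds :: "real \<Rightarrow> (real^2) set \<Rightarrow> ((real^2) \<times> (real^2)) set" where
  "bonds \<epsilon> \<Omega> = {(i, j). i \<in> Z_eps \<epsilon> \<Omega> \<and> j \<in> Z_eps \<epsilon> \<Omega> \<and> norm (i - j) = 1}"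

text \<open>A unit vector \<open>u\<close> with \<open>M = u \<otimes> u\<close>; it is determined only up to sign, but the energy does
  not depend on the choice (lemma \<open>Fc_eq\<close> below).\<close>

definition director :: "real^2^2 \<Rightarrow> real^2" where
  "director M = (SOME u. u \<in> sphere 0 1 \<and> tensor u u = M)"

definition Fc :: "(real^2) set \<Rightarrow> real \<Rightarrow> (real^2 \<Rightarrow> real^2^2) \<Rightarrow> ereal" where
  "Fc \<Omega> \<epsilon> Q =
     (if Q \<in> C_eps \<epsilon> \<Omega>
      then ereal (1 / \<bar>ln \<epsilon>\<bar> * (\<Sum>(i, j) \<in> bonds \<epsilon> \<Omega>.
             1 - \<bar>director (Q (\<epsilon> *\<^sub>R i)) \<bullet> director (Q (\<epsilon> *\<^sub>R j))\<bar>\<^sup>2))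
      else \<infinity>)"

lemma tensor_self_inner: "(tensor u u *v w) \<bullet> w = (u \<bullet> w)\<^sup>2"
  by (simp add: tensor_def matrix_vector_mult_def inner_vec_def sum_2 power2_eq_square algebra_simps)

lemma director_works:
  assumes "M \<in> S1_tensor"
  shows "director M \<in> sphere 0 1" "tensor (director M) (director M) = M"
proof -
  have "\<exists>u. u \<in> sphere 0 1 \<and> tensor u u = M"
    using assms by (auto simp: S1_tensor_def)
  from someI_ex[OF this] show "director M \<in> sphere 0 1" "tensor (director M) (director M) = M"
    by (simp_all add: director_def)
qed

lemma Fc_eq:
  assumes Q: "Q \<in> C_eps \<epsilon> \<Omega>"
    and u: "\<And>i. i \<in> Z_eps \<epsilon> \<Omega> \<Longrightarrow> u i \<in> sphere 0 1 \<and> Q (\<epsilon> *\<^sub>R i) = tensor (u i) (u i)"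
  shows "Fc \<Omega> \<epsilon> Q = ereal (1 / \<bar>ln \<epsilon>\<bar> * (\<Sum>(i, j) \<in> bonds \<epsilon> \<Omega>. 1 - \<bar>u i \<bullet> u j\<bar>\<^sup>2))"
proof -
  have swap: "(a \<bullet> b)\<^sup>2 = (c \<bullet> d)\<^sup>2" if "tensor a a = tensor c c" "tensor b b = tensor d d"
    for a b c d :: "real^2"
    using tensor_self_inner[of a b] tensor_self_inner[of c b]
      tensor_self_inner[of b c] tensor_self_inner[of d c] that
    by (simp add: inner_commute)
  have "1 - \<bar>director (Q (\<epsilon> *\<^sub>R i)) \<bullet> director (Q (\<epsilon> *\<^sub>R j))\<bar>\<^sup>2 = 1 - \<bar>u i \<bullet> u j\<bar>\<^sup>2"
    if ij: "(i, j) \<in> bonds \<epsilon> \<Omega>" for i j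
  proof -
    have i: "i \<in> Z_eps \<epsilon> \<Omega>" and j: "j \<in> Z_eps \<epsilon> \<Omega>" using ij by (auto simp: bonds_def)
    have "Q (\<epsilon> *\<^sub>R i) \<in> S1_tensor" "Q (\<epsilon> *\<^sub>R j) \<in> S1_tensor"
      using u[OF i] u[OF j] by (auto simp: S1_tensor_def)
    then show ?thesis
      using swap[of "director (Q (\<epsilon> *\<^sub>R i))" "u i" "director (Q (\<epsilon> *\<^sub>R j))" "u j"] u[OF i] u[OF j]
      by (simp add: director_works)
  qed
  then show ?thesis
    using Q by (auto simp: Fc_def intro!: sum.cong)
qed


section \<open>Piecewise affine interpolation\<close>

abbreviation e1 :: "real^2" where "e1 \<equiv> axis 1 1"
abbreviation e2 :: "real^2" where "e2 \<equiv> axis 2 1"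

text \<open>Each square is cut along the diagonal joining \<open>\<epsilon>(i + e1)\<close> to \<open>\<epsilon>(i + e2)\<close>; the
  triangles are closed.\<close>

definition lower_triangle :: "real \<Rightarrow> real^2 \<Rightarrow> (real^2) set" where
  "lower_triangle \<epsilon> i = convex hull {\<epsilon> *\<^sub>R i, \<epsilon> *\<^sub>R (i + e1), \<epsilon> *\<^sub>R (i + e2)}"

definition upper_triangle :: "real \<Rightarrow> real^2 \<Rightarrow> (real^2) set" where
  "upper_triangle \<epsilon> i = convex hull {\<epsilon> *\<^sub>R (i + e1 + e2), \<epsilon> *\<^sub>R (i + e1), \<epsilon> *\<^sub>R (i + e2)}"

definition grid_triangles :: "real \<Rightarrow> (real^2) set set" where
  "grid_triangles \<epsilon> = lower_triangle \<epsilon> ` Z2 \<union> upper_triangle \<epsilon> ` Z2"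

definition inner_region :: "real \<Rightarrow> (real^2) set \<Rightarrow> (real^2) set" where
  "inner_region \<epsilon> \<Omega> = \<Union> {T \<in> grid_triangles \<epsilon>. T \<subseteq> \<Omega>}"

text \<open>Explicit formula on the square with lower left corner \<open>\<epsilon> i\<close> containing \<open>x\<close>, in the
  rescaled local coordinates \<open>t\<close>. The lemmas \<open>interp_lattice\<close> and \<open>interp_affine\<close> below show that
  this is the interpolation, for \<open>\<epsilon> > 0\<close>.  On a triangle contained in the domain only values of
  \<open>Q\<close> at lattice points of the domain enter.\<close>

definition interp :: "real \<Rightarrow> (real^2 \<Rightarrow> 'a::real_vector) \<Rightarrow> real^2 \<Rightarrow> 'a" where
  "interp \<epsilon> Q x =
     (let i = (\<chi> k. of_int \<lfloor>x $ k / \<epsilon>\<rfloor>); t = x /\<^sub>R \<epsilon> - i; q = (\<lambda>j. Q (\<epsilon> *\<^sub>R j)) in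
      if t $ 1 + t $ 2 \<le> 1
      then q i + (t $ 1) *\<^sub>R (q (i + e1) - q i) + (t $ 2) *\<^sub>R (q (i + e2) - q i)
      else q (i + e1 + e2) + (1 - t $ 1) *\<^sub>R (q (i + e2) - q (i + e1 + e2))
                           + (1 - t $ 2) *\<^sub>R (q (i + e1) - q (i + e1 + e2)))"

lemma Z2_add_axis: "i \<in> Z2 \<Longrightarrow> i + e1 \<in> Z2" "i \<in> Z2 \<Longrightarrow> i + e2 \<in> Z2"
  by (auto simp: Z2_def axis_def)

lemma interp_cell:
  fixes s t :: real
  assumes i: "i \<in> Z2" and \<epsilon>: "\<epsilon> > 0" and st: "0 \<le> s" "s < 1" "0 \<le> t" "t < 1"
    and x: "x = \<epsilon> *\<^sub>R (i + s *\<^sub>R e1 + t *\<^sub>R e2)"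
  shows "interp \<epsilon> Q x =
     (if s + t \<le> 1
      then Q (\<epsilon> *\<^sub>R i) + s *\<^sub>R (Q (\<epsilon> *\<^sub>R (i + e1)) - Q (\<epsilon> *\<^sub>R i))
                        + t *\<^sub>R (Q (\<epsilon> *\<^sub>R (i + e2)) - Q (\<epsilon> *\<^sub>R i))
      else Q (\<epsilon> *\<^sub>R (i + e1 + e2))
           + (1 - s) *\<^sub>R (Q (\<epsilon> *\<^sub>R (i + e2)) - Q (\<epsilon> *\<^sub>R (i + e1 + e2)))
           + (1 - t) *\<^sub>R (Q (\<epsilon> *\<^sub>R (i + e1)) - Q (\<epsilon> *\<^sub>R (i + e1 + e2))))"
proof -
  have fl: "of_int \<lfloor>a + b\<rfloor> = a" if "a \<in> \<int>" "0 \<le> b" "b < 1" for a b :: real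
    using that by (elim Ints_cases) (simp add: floor_eq_iff)
  have iZ: "i $ k \<in> \<int>" for k using i by (simp add: Z2_def)
  have x1: "x $ 1 / \<epsilon> = i $ 1 + s" and x2: "x $ 2 / \<epsilon> = i $ 2 + t"
    using \<epsilon> by (simp_all add: x axis_def)
  have c: "(\<chi> k. of_int \<lfloor>x $ k / \<epsilon>\<rfloor>) = i"
    unfolding vec_eq_iff forall_2 vec_lambda_beta x1 x2
    using fl[OF iZ] st by simp
  have t: "(x /\<^sub>R \<epsilon> - i) $ 1 = s" "(x /\<^sub>R \<epsilon> - i) $ 2 = t"
    using \<epsilon> by (simp_all add: x axis_def)
  show ?thesis
    unfolding interp_def c Let_def t ..
qed

lemma interp_lattice:
  assumes "i \<in> Z2" "\<epsilon> > 0"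
  shows "interp \<epsilon> Q (\<epsilon> *\<^sub>R i) = Q (\<epsilon> *\<^sub>R i)"
  using interp_cell[OF assms _ _ _ _ refl, where s = 0 and t = 0] by simp

lemma interp_lower:
  fixes s t :: real
  assumes i: "i \<in> Z2" and \<epsilon>: "\<epsilon> > 0" and st: "0 \<le> s" "0 \<le> t" "s + t \<le> 1"
  shows "interp \<epsilon> Q (\<epsilon> *\<^sub>R (i + s *\<^sub>R e1 + t *\<^sub>R e2)) =
      Q (\<epsilon> *\<^sub>R i) + s *\<^sub>R (Q (\<epsilon> *\<^sub>R (i + e1)) - Q (\<epsilon> *\<^sub>R i))
                  + t *\<^sub>R (Q (\<epsilon> *\<^sub>R (i + e2)) - Q (\<epsilon> *\<^sub>R i))"
proof -
  consider "s < 1" "t < 1" | "s = 1" "t = 0" | "s = 0" "t = 1" using st by linarith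
  then show ?thesis
  proof cases
    case 1 then show ?thesis using interp_cell[OF i \<epsilon> _ _ _ _ refl, where s = s and t = t and Q = Q] st by simp
  next
    case 2 then show ?thesis using interp_lattice[OF Z2_add_axis(1)[OF i] \<epsilon>, of Q] by simp
  next
    case 3 then show ?thesis using interp_lattice[OF Z2_add_axis(2)[OF i] \<epsilon>, of Q] by simp
  qed
qed

lemma interp_upper:
  fixes s t :: real
  assumes i: "i \<in> Z2" and \<epsilon>: "\<epsilon> > 0" and st: "s \<le> 1" "t \<le> 1" "1 \<le> s + t"
  shows "interp \<epsilon> Q (\<epsilon> *\<^sub>R (i + s *\<^sub>R e1 + t *\<^sub>R e2)) =
      Q (\<epsilon> *\<^sub>R (i + e1 + e2))
           + (1 - s) *\<^sub>R (Q (\<epsilon> *\<^sub>R (i + e2)) - Q (\<epsilon> *\<^sub>R (i + e1 + e2)))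
           + (1 - t) *\<^sub>R (Q (\<epsilon> *\<^sub>R (i + e1)) - Q (\<epsilon> *\<^sub>R (i + e1 + e2)))"
proof -
  consider "s < 1" "t < 1" "s + t = 1" | "s < 1" "t < 1" "s + t > 1" | "s = 1" | "t = 1"
    using st by linarith
  then show ?thesis
  proof cases
    case 1
    then have t: "t = 1 - s" by simp
    have "interp \<epsilon> Q (\<epsilon> *\<^sub>R (i + s *\<^sub>R e1 + t *\<^sub>R e2)) =
        Q (\<epsilon> *\<^sub>R i) + s *\<^sub>R (Q (\<epsilon> *\<^sub>R (i + e1)) - Q (\<epsilon> *\<^sub>R i))
                    + t *\<^sub>R (Q (\<epsilon> *\<^sub>R (i + e2)) - Q (\<epsilon> *\<^sub>R i))"
      using interp_lower[OF i \<epsilon>, of s t Q] 1 by simp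
    then show ?thesis by (simp add: t algebra_simps)
  next
    case 2 then show ?thesis using interp_cell[OF i \<epsilon> _ _ _ _ refl, where s = s and t = t and Q = Q] st by simp
  next
    case 3 then show ?thesis
      using interp_lower[OF Z2_add_axis(1)[OF i] \<epsilon>, of 0 t Q] st by (simp add: algebra_simps)
  next
    case 4 then show ?thesis
      using interp_lower[OF Z2_add_axis(2)[OF i] \<epsilon>, of s 0 Q] st by (simp add: algebra_simps)
  qed
qed

lemma interp_affine:
  fixes Q :: "real^2 \<Rightarrow> 'a::real_vector"
  assumes T: "T \<in> grid_triangles \<epsilon>" and \<epsilon>: "\<epsilon> > 0"
  shows "\<exists>L c. linear L \<and> (\<forall>x \<in> T. interp \<epsilon> Q x = L x + c)"
proof -
  have lin: "linear (\<lambda>x::real^2. (x $ 1 / \<epsilon>) *\<^sub>R a + (x $ 2 / \<epsilon>) *\<^sub>R b)" for a b :: 'a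
    by (rule linearI) (simp_all add: algebra_simps add_divide_distrib)
  obtain i where i: "i \<in> Z2" and "T = lower_triangle \<epsilon> i \<or> T = upper_triangle \<epsilon> i"
    using T by (auto simp: grid_triangles_def)
  then consider "T = lower_triangle \<epsilon> i" | "T = upper_triangle \<epsilon> i" by blast
  then show ?thesis
  proof cases
    case 1
    define a b where "a = Q (\<epsilon> *\<^sub>R (i + e1)) - Q (\<epsilon> *\<^sub>R i)" and "b = Q (\<epsilon> *\<^sub>R (i + e2)) - Q (\<epsilon> *\<^sub>R i)"
    have "interp \<epsilon> Q x = (x $ 1 / \<epsilon>) *\<^sub>R a + (x $ 2 / \<epsilon>) *\<^sub>R b
        + (Q (\<epsilon> *\<^sub>R i) - (i $ 1) *\<^sub>R a - (i $ 2) *\<^sub>R b)" if xT: "x \<in> T" for x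
    proof -
      obtain s t where st: "0 \<le> s" "0 \<le> t" "s + t \<le> 1"
        and x': "x = \<epsilon> *\<^sub>R i + s *\<^sub>R (\<epsilon> *\<^sub>R (i + e1) - \<epsilon> *\<^sub>R i)
              + t *\<^sub>R (\<epsilon> *\<^sub>R (i + e2) - \<epsilon> *\<^sub>R i)"
        using xT unfolding 1 lower_triangle_def convex_hull_3_alt mem_Collect_eq by metis
      have x: "x = \<epsilon> *\<^sub>R (i + s *\<^sub>R e1 + t *\<^sub>R e2)"
        unfolding x' by (simp add: algebra_simps)
      have x12: "x $ 1 / \<epsilon> = i $ 1 + s" "x $ 2 / \<epsilon> = i $ 2 + t"
        using \<epsilon> by (simp_all add: x axis_def)
      show ?thesis
        unfolding x12 unfolding x interp_lower[OF i \<epsilon> st] a_def[symmetric] b_def[symmetric]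
        by (simp add: algebra_simps)
    qed
    with lin show ?thesis by blast
  next
    case 2
    define a b where "a = Q (\<epsilon> *\<^sub>R (i + e2)) - Q (\<epsilon> *\<^sub>R (i + e1 + e2))"
      and "b = Q (\<epsilon> *\<^sub>R (i + e1)) - Q (\<epsilon> *\<^sub>R (i + e1 + e2))"
    have "interp \<epsilon> Q x = (x $ 1 / \<epsilon>) *\<^sub>R (-a) + (x $ 2 / \<epsilon>) *\<^sub>R (-b)
        + (Q (\<epsilon> *\<^sub>R (i + e1 + e2)) + (1 + i $ 1) *\<^sub>R a + (1 + i $ 2) *\<^sub>R b)" if xT: "x \<in> T" for x
    proof -
      obtain u v where uv: "0 \<le> u" "0 \<le> v" "u + v \<le> 1"
        and x': "x = \<epsilon> *\<^sub>R (i + e1 + e2) + u *\<^sub>R (\<epsilon> *\<^sub>R (i + e1) - \<epsilon> *\<^sub>R (i + e1 + e2))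
              + v *\<^sub>R (\<epsilon> *\<^sub>R (i + e2) - \<epsilon> *\<^sub>R (i + e1 + e2))"
        using xT unfolding 2 upper_triangle_def convex_hull_3_alt mem_Collect_eq by metis
      define s t where "s = 1 - v" and "t = 1 - u"
      have x: "x = \<epsilon> *\<^sub>R (i + s *\<^sub>R e1 + t *\<^sub>R e2)"
        unfolding x' s_def t_def by (simp add: algebra_simps)
      have st: "s \<le> 1" "t \<le> 1" "1 \<le> s + t" using uv by (auto simp: s_def t_def)
      have x12: "x $ 1 / \<epsilon> = i $ 1 + s" "x $ 2 / \<epsilon> = i $ 2 + t"
        using \<epsilon> by (simp_all add: x axis_def)
      show ?thesis
        unfolding x12 unfolding x interp_upper[OF i \<epsilon> st] a_def[symmetric] b_def[symmetric]
        by (simp add: algebra_simps)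
    qed
    with lin show ?thesis by blast
  qed
qed


section \<open>Jacobians\<close>

definition A_map :: "real^2^2 \<Rightarrow> real^2" where
  "A_map M = vector [2 * M $ 1 $ 1 - 1, 2 * M $ 1 $ 2]"

text \<open>The density of \<open>J(A(Q\<^sup>a))\<close>. On the edges of the grid, a null set, the derivative need not
  exist and the value is irrelevant.\<close>

definition jac_density :: "(real^2) set \<Rightarrow> real \<Rightarrow> (real^2 \<Rightarrow> real^2^2) \<Rightarrow> real^2 \<Rightarrow> real" where
  "jac_density \<Omega> \<epsilon> Q x =
     (if x \<in> inner_region \<epsilon> \<Omega> then det (jacobian (\<lambda>y. A_map (interp \<epsilon> Q y)) (at x)) else 0)"


section \<open>Test functions and the dual norm\<close>

definition C01c :: "(real^2) set \<Rightarrow> (real^2 \<Rightarrow> real) set" where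
  "C01c \<Omega> = {\<phi>. (\<exists>L. L-lipschitz_on \<Omega> \<phi>) \<and>
     compact (closure {x. \<phi> x \<noteq> 0}) \<and> closure {x. \<phi> x \<noteq> 0} \<subseteq> \<Omega>}"

text \<open>Supremum norm plus best Lipschitz constant (the diagonal contributes \<open>0 / 0 = 0\<close>).\<close>

definition C01_norm :: "(real^2) set \<Rightarrow> (real^2 \<Rightarrow> real) \<Rightarrow> ennreal" where
  "C01_norm \<Omega> \<phi> = (SUP x \<in> \<Omega>. ennreal \<bar>\<phi> x\<bar>)
     + (SUP (x, y) \<in> \<Omega> \<times> \<Omega>. ennreal (\<bar>\<phi> x - \<phi> y\<bar> / dist x y))"

definition dual_norm :: "(real^2) set \<Rightarrow> ((real^2 \<Rightarrow> real) \<Rightarrow> real) \<Rightarrow> ennreal" where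
  "dual_norm \<Omega> \<Lambda> = (SUP \<phi> \<in> {\<phi> \<in> C01c \<Omega>. C01_norm \<Omega> \<phi> \<le> 1}. ennreal \<bar>\<Lambda> \<phi>\<bar>)"


section \<open>Sums of Dirac masses\<close>

text \<open>\<open>\<mu> = \<Sum>\<^sub>k z\<^sub>k \<delta>\<^bsub>x\<^sub>k\<^esub>\<close> for \<open>k = 1, \<dots>, m\<close>: as a signed set function, and acting on functions by
  integration.\<close>

definition dirac_sum :: "nat \<Rightarrow> (nat \<Rightarrow> int) \<Rightarrow> (nat \<Rightarrow> real^2) \<Rightarrow> (real^2) set \<Rightarrow> real" where
  "dirac_sum m z x B = (\<Sum>k = 1..m. of_int (z k) * indicator B (x k))"

definition dirac_pairing :: "nat \<Rightarrow> (nat \<Rightarrow> int) \<Rightarrow> (nat \<Rightarrow> real^2) \<Rightarrow> (real^2 \<Rightarrow> real) \<Rightarrow> real" where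
  "dirac_pairing m z x \<phi> = (\<Sum>k = 1..m. of_int (z k) * \<phi> (x k))"

text \<open>\<open>|\<mu>|(B)\<close>: supremum of \<open>\<Sum>\<^sub>n |\<mu>(E\<^sub>n)|\<close> over countable Borel partitions \<open>E\<close> of \<open>B\<close>.\<close>

definition total_variation :: "((real^2) set \<Rightarrow> real) \<Rightarrow> (real^2) set \<Rightarrow> ereal" where
  "total_variation \<mu> B =
     (SUP E \<in> {E :: nat \<Rightarrow> (real^2) set. range E \<subseteq> sets borel \<and> disjoint_family E \<and> (\<Union>n. E n) = B}.
        \<Sum>n. ereal \<bar>\<mu> (E n)\<bar>)"

text \<open>\<open>J(A(Q\<^sup>a)) - \<pi>\<mu>\<close> as a functional on test functions.\<close>

definition jac_defect ::
  "(real^2) set \<Rightarrow> real \<Rightarrow> (real^2 \<Rightarrow> real^2^2) \<Rightarrow> nat \<Rightarrow> (nat \<Rightarrow> int) \<Rightarrow> (nat \<Rightarrow> real^2)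
     \<Rightarrow> (real^2 \<Rightarrow> real) \<Rightarrow> real" where
  "jac_defect \<Omega> \<epsilon> Q m z x \<phi> =
     (LINT y : \<Omega> | lebesgue. jac_density \<Omega> \<epsilon> Q y * \<phi> y) - pi * dirac_pairing m z x \<phi>"

end

theory Submission
  imports Defs "HOL-Real_Asymp.Real_Asymp"
begin

text \<open>
  With \<open>v = A(Q)\<close> on the lattice, \<open>|log \<epsilon>| F\<^sup>c\<^sub>\<epsilon>\<close> is the XY energy, the sum of \<open>1 - cos a\<close> over
  the bonds, where \<open>a \<in> (-\<pi>, \<pi>]\<close> is the angle from one end to the other. The signed area of the
  image of a square under \<open>v\<^sup>a\<close> is half the sum of \<open>sin a\<close> along its boundary, and the sum of \<open>a\<close>
  is \<open>2\<pi>\<close> times the vorticity. As \<open>sin a - a\<close> changes sign with the orientation of the bond, it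
  cancels between neighbouring squares; tested with a Lipschitz function, the Jacobian is therefore
  \<open>\<pi>\<close> times the discrete vorticity up to \<open>O(\<epsilon>)\<close> times the energy.

  The lower bound comes from discrete duality: \<open>1 - cos a \<ge> a X - q X\<^sup>2 / 2\<close> for small \<open>X\<close>, with \<open>q\<close>
  close to 1, is applied with \<open>X\<close> the rotated gradient of a potential \<open>\<psi>\<close>, so that large bond angles
  need no separate treatment. The potential is built along a ball construction around the
  vortices: disjoint balls are dilated by the factor \<open>1 + \<tau>\<close>, a cone signed by the degree is added to
  \<open>\<psi>\<close> on each annulus, and balls whose next dilations would meet are merged. Each step gains about
  \<open>\<pi> \<tau>\<close> per unit of degree, and about \<open>|log \<epsilon>| / \<tau>\<close> steps fit before the radii are macroscopic.
  Replacing the vorticity inside a final ball by its degree at the centre is cheap in the dual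
  norm, which leaves boundedly many signed points, hence compactness.

  For the upper bound, \<open>v\<close> is a product of vortices of degree \<open>\<plusminus>1\<close> centred at lattice squares, those
  sharing a limit point being pulled apart slowly.
\<close>

section \<open>Bond angles, vorticity and duality\<close>

text \<open>The loss factors are tied together. A priori only
  \<open>2 * C * |log \<epsilon>|\<close> bounds the number of vortices, so that many mergers may
  occur, each enlarging the total radius by 1 + \<tau>. This is proportional to the number of
  dilations, about |log \<epsilon>| / \<tau>, and becomes a small fraction of it only when \<tau> is
  small compared with 1 / C. Small \<tau> also makes the gain sharp: on the annulus between r and (1
  + \<tau>) r a cone of slope 1 / r stands in for the logarithm; its linear term is about
  \<open>2 * pi * \<tau>\<close>, half its Dirichlet energy about \<open>pi * \<tau>\<close>, and
  \<open>pi * \<tau>\<close> remains. All radii are at least a large K, measured in lattice units,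
  so the slopes 1 / r are small enough for the duality inequality to be almost sharp. What results
  is a bound with a factor \<kappa> < 1 in front. Degrees being integers, approximate closeness in
  the dual norm gives an exact comparison of total degrees, and \<kappa> can be sent to 1 last.
  Balls that reach out of the domain are forgotten: admissible test functions on them are bounded by
  a multiple of the radius plus the mesh size.\<close>

lemma sin_ge_third: fixes x :: real assumes "0 \<le> x" "x \<le> 2" shows "x / 3 \<le> sin x"
  and "x - x ^ 3 / 6 \<le> sin x"
proof -
  have "\<bar>sin x - (\<Sum>m<3. sin_coeff m * x ^ m)\<bar> \<le> inverse (fact 3) * \<bar>x\<bar> ^ 3"
    by (rule Maclaurin_sin_bound)
  then have "\<bar>sin x - x\<bar> \<le> x ^ 3 / 6"
    using assms by (simp add: eval_nat_numeral sin_coeff_def)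
  then show 1: "x - x ^ 3 / 6 \<le> sin x" by linarith
  have "x * x \<le> 2 * 2" using assms by (intro mult_mono) auto
  then have "x * (x * x) \<le> x * 4" using assms by (intro mult_left_mono) auto
  then have "x ^ 3 \<le> x * 4" by (simp add: power3_eq_cube mult.assoc)
  then show "x / 3 \<le> sin x" using 1 by linarith
qed

lemma one_minus_cos: "1 - cos t = 2 * (sin (t / 2))\<^sup>2" for t :: real
  using cos_double_sin[of "t / 2"] by simp

text \<open>The constant is 2 / 6^2, from \<open>sin_ge_third\<close> at half the angle; since pi <
  4, half the angle stays in the interval [0, 2] allowed there. Far from sharp, but valid for every
  bond angle.\<close>

lemma one_minus_cos_ge: fixes t :: real assumes "\<bar>t\<bar> \<le> pi" shows "t\<^sup>2 / 18 \<le> 1 - cos t"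
proof -
  have "\<bar>t\<bar> / 2 \<le> 2" using assms pi_less_4 by linarith
  then have "\<bar>t\<bar> / 2 / 3 \<le> sin (\<bar>t\<bar> / 2)" by (intro sin_ge_third) auto
  then have "(\<bar>t\<bar> / 2 / 3)\<^sup>2 \<le> (sin (\<bar>t\<bar> / 2))\<^sup>2" by (intro power_mono) auto
  then have "t\<^sup>2 / 36 \<le> (sin (\<bar>t\<bar> / 2))\<^sup>2" by (simp add: power_divide)
  then show ?thesis using one_minus_cos[of "\<bar>t\<bar>"] by simp
qed

text \<open>Squaring the cubic lower bound for the sine of half the angle and dropping a square.
  Unlike the previous bound it is asymptotically sharp at 0, which is what preserves the constant in
  the energy.\<close>

lemma one_minus_cos_ge': fixes t :: real assumes "\<bar>t\<bar> \<le> pi"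
  shows "t\<^sup>2 / 2 * (1 - t\<^sup>2 / 12) \<le> 1 - cos t"
proof -
  define s where "s = \<bar>t\<bar> / 2"
  have s: "0 \<le> s" "s \<le> 2" using assms pi_less_4 by (auto simp: s_def)
  have "s * s \<le> 2 * 2" using s by (intro mult_mono) auto
  then have s2: "s\<^sup>2 \<le> 4" by (simp add: power2_eq_square)
  have "s - s ^ 3 / 6 \<le> sin s" using s by (intro sin_ge_third)
  then have 1: "s * (1 - s\<^sup>2 / 6) \<le> sin s" by (simp add: algebra_simps power2_eq_square power3_eq_cube)
  have "0 \<le> s * (1 - s\<^sup>2 / 6)" using s s2 by (intro mult_nonneg_nonneg) auto
  with 1 have "(s * (1 - s\<^sup>2 / 6))\<^sup>2 \<le> (sin s)\<^sup>2" by (rule power_mono)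
  then have a: "s\<^sup>2 * (1 - s\<^sup>2 / 6)\<^sup>2 \<le> (sin s)\<^sup>2" by (simp add: power_mult_distrib)
  have "1 - s\<^sup>2 / 3 \<le> (1 - s\<^sup>2 / 6)\<^sup>2" by (simp add: power2_diff)
  then have "s\<^sup>2 * (1 - s\<^sup>2 / 3) \<le> s\<^sup>2 * (1 - s\<^sup>2 / 6)\<^sup>2" by (intro mult_left_mono) auto
  with a have "2 * (s\<^sup>2 * (1 - s\<^sup>2 / 3)) \<le> 1 - cos t"
    using one_minus_cos[of "\<bar>t\<bar>"] by (simp add: s_def)
  then show ?thesis by (simp add: s_def power_divide algebra_simps)
qed

text \<open>Angles up to \<open>\<pi>\<close> are allowed because the crude bound \<open>1 - cos t \<ge> t\<^sup>2/18\<close> suffices when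
  \<open>|t| \<ge> 18 |X|\<close>.\<close>

lemma cos_duality:
  fixes t X \<delta> :: real
  assumes t: "\<bar>t\<bar> \<le> pi" and X: "\<bar>X\<bar> \<le> \<delta>" and \<delta>: "27 * \<delta>\<^sup>2 < 1"
  shows "t * X - X\<^sup>2 / (2 * (1 - 27 * \<delta>\<^sup>2)) \<le> 1 - cos t"
proof (cases "\<bar>t\<bar> \<ge> 18 * \<bar>X\<bar>")
  case True
  have "\<bar>t\<bar> * (18 * \<bar>X\<bar>) \<le> \<bar>t\<bar> * \<bar>t\<bar>" using True by (intro mult_left_mono) auto
  then have "18 * (t * X) \<le> t\<^sup>2" by (metis abs_ge_self abs_mult abs_mult_self_eq mult.left_commute order_trans power2_eq_square abs_numeral)
  then have "t * X \<le> 1 - cos t" using one_minus_cos_ge[OF t] by linarith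
  moreover have "0 \<le> X\<^sup>2 / (2 * (1 - 27 * \<delta>\<^sup>2))" using \<delta> by simp
  ultimately show ?thesis by linarith
next
  case False
  define k where "k = 1 - 27 * \<delta>\<^sup>2"
  have k: "k > 0" using \<delta> by (simp add: k_def)
  \<comment> \<open>The constant 27 is 18^2 / 12: the relative correction t^2 / 12 of
    \<open>one_minus_cos_ge'\<close> at the largest angle that is left.\<close>
  have "\<bar>t\<bar> \<le> 18 * \<delta>" using False X by linarith
  then have "t\<^sup>2 \<le> (18 * \<delta>)\<^sup>2" by (metis abs_ge_zero power2_abs power_mono)
  then have "k \<le> 1 - t\<^sup>2 / 12" by (simp add: k_def power_mult_distrib)
  then have "t\<^sup>2 / 2 * k \<le> t\<^sup>2 / 2 * (1 - t\<^sup>2 / 12)" by (intro mult_left_mono) auto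
  then have 1: "t\<^sup>2 / 2 * k \<le> 1 - cos t" using one_minus_cos_ge'[OF t] by linarith
  \<comment> \<open>Legendre duality for a parabola: - X^2 / (2 k) is the minimum of k t^2 / 2 - t X
    over t.\<close>
  have "0 \<le> (t * k - X)\<^sup>2 / (2 * k)" using k by simp
  also have "\<dots> = t\<^sup>2 / 2 * k - t * X + X\<^sup>2 / (2 * k)"
    using k by (simp add: field_simps power2_eq_square)
  finally show ?thesis using 1 by (simp add: k_def)
qed

text \<open>The error of the sine is cubic; one factor is bounded by 4 and the remaining square by
  18 energies, and 4 * 18 / 6 = 12. A bound linear in the bond energy is what can be summed over all
  bonds.\<close>

lemma sin_diff_bound: fixes t :: real assumes "\<bar>t\<bar> \<le> pi" shows "\<bar>sin t - t\<bar> \<le> 12 * (1 - cos t)"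
proof -
  have "\<bar>sin t - (\<Sum>m<3. sin_coeff m * t ^ m)\<bar> \<le> inverse (fact 3) * \<bar>t\<bar> ^ 3"
    by (rule Maclaurin_sin_bound)
  then have "\<bar>sin t - t\<bar> \<le> \<bar>t\<bar> ^ 3 / 6"
    by (simp add: eval_nat_numeral sin_coeff_def)
  also have "\<bar>t\<bar> ^ 3 = \<bar>t\<bar> * t\<^sup>2" by (simp add: power2_eq_square power3_eq_cube)
  also have "\<dots> \<le> 4 * t\<^sup>2" using assms pi_less_4 by (intro mult_right_mono) auto
  finally show ?thesis using one_minus_cos_ge[OF assms] by simp
qed

section \<open>Bond angles, circulation and vorticity of a lattice field\<close>

abbreviation dx :: "int \<times> int" where "dx \<equiv> (1, 0)"
abbreviation dy :: "int \<times> int" where "dy \<equiv> (0, 1)"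

definition pos :: "int \<times> int \<Rightarrow> real^2" where
  "pos i = vector [of_int (fst i), of_int (snd i)]"

definition hb :: "(int \<times> int \<Rightarrow> complex) \<Rightarrow> int \<times> int \<Rightarrow> real" where
  "hb v i = Arg (v (i + dx) / v i)"

definition vb :: "(int \<times> int \<Rightarrow> complex) \<Rightarrow> int \<times> int \<Rightarrow> real" where
  "vb v i = Arg (v (i + dy) / v i)"

definition hbonds :: "(int \<times> int) set \<Rightarrow> (int \<times> int) set" where
  "hbonds Z = {i \<in> Z. i + dx \<in> Z}"

definition vbonds :: "(int \<times> int) set \<Rightarrow> (int \<times> int) set" where
  "vbonds Z = {i \<in> Z. i + dy \<in> Z}"

definition squares :: "(int \<times> int) set \<Rightarrow> (int \<times> int) set" where
  "squares Z = {i. i \<in> Z \<and> i + dx \<in> Z \<and> i + dy \<in> Z \<and> i + dx + dy \<in> Z}"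

definition xy_energy :: "(int \<times> int) set \<Rightarrow> (int \<times> int \<Rightarrow> complex) \<Rightarrow> real" where
  "xy_energy Z v = (\<Sum>i\<in>hbonds Z. 1 - cos (hb v i)) + (\<Sum>i\<in>vbonds Z. 1 - cos (vb v i))"

definition circulation :: "(int \<times> int \<Rightarrow> complex) \<Rightarrow> int \<times> int \<Rightarrow> real" where
  "circulation v i = hb v i + vb v (i + dx) - hb v (i + dy) - vb v i"

text \<open>Rounding only produces an \<open>int\<close> for arbitrary \<open>v\<close>. On a square
  whose corners carry unit vectors the quotient is already an integer, by
  \<open>circulation_eq_vort\<close>.\<close>

definition vort :: "(int \<times> int \<Rightarrow> complex) \<Rightarrow> int \<times> int \<Rightarrow> int" where
  "vort v i = round (circulation v i / (2 * pi))"

lemma bond_angle_le [simp]: "\<bar>hb v i\<bar> \<le> pi" "\<bar>vb v i\<bar> \<le> pi"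
  using Arg_bounded[of "v (i + dx) / v i"] Arg_bounded[of "v (i + dy) / v i"]
  by (auto simp: hb_def vb_def)

lemma cis_bond:
  assumes "norm (z :: complex) = 1" "norm w = 1" shows "cis (Arg (w / z)) = w / z"
proof -
  have "w / z \<noteq> 0" using assms by auto
  then show ?thesis using assms by (simp add: cis_Arg sgn_div_norm norm_divide)
qed

lemma cis_hb: "norm (v i) = 1 \<Longrightarrow> norm (v (i + dx)) = 1 \<Longrightarrow> cis (hb v i) = v (i + dx) / v i"
  and cis_vb: "norm (v i) = 1 \<Longrightarrow> norm (v (i + dy)) = 1 \<Longrightarrow> cis (vb v i) = v (i + dy) / v i"
  by (simp_all add: hb_def vb_def cis_bond)

text \<open>The four quotients of neighbouring values cancel around the square, so
  \<open>cis\<close> of the circulation is 1.\<close>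

lemma circulation_eq_vort:
  assumes "i \<in> squares Z" "\<And>j. j \<in> Z \<Longrightarrow> norm (v j) = 1"
  shows "circulation v i = 2 * pi * of_int (vort v i)"
proof -
  have n: "norm (v i) = 1" "norm (v (i + dx)) = 1" "norm (v (i + dy)) = 1" "norm (v (i + dx + dy)) = 1"
    using assms by (auto simp: squares_def)
  have sw: "i + dy + dx = i + dx + dy" by (simp add: ac_simps)
  have nz: "v i \<noteq> 0" "v (i + dx) \<noteq> 0" "v (i + dy) \<noteq> 0" "v (i + dx + dy) \<noteq> 0" using n by auto
  have c: "cis (hb v i) = v (i + dx) / v i" "cis (vb v (i + dx)) = v (i + dx + dy) / v (i + dx)"
    "cis (hb v (i + dy)) = v (i + dx + dy) / v (i + dy)" "cis (vb v i) = v (i + dy) / v i"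
    using n cis_hb[of v "i + dy"] by (simp_all only: cis_hb cis_vb sw)
  have "cis (circulation v i) = cis (hb v i) * cis (vb v (i + dx)) / cis (hb v (i + dy)) / cis (vb v i)"
    by (simp add: circulation_def cis_mult cis_divide)
  also have "\<dots> = 1"
    unfolding c using nz by (simp add: field_simps)
  finally have "exp (\<i> * complex_of_real (circulation v i)) = 1" by (simp add: cis_conv_exp)
  then obtain k :: int where "circulation v i = of_int (2 * k) * pi" by (auto simp: exp_eq_1)
  then have c: "circulation v i = 2 * pi * of_int k" by simp
  then have "circulation v i / (2 * pi) = of_int k" by simp
  then have "vort v i = k" by (simp only: vort_def round_of_int)
  with c show ?thesis by simp
qed

text \<open>Four angles, each at most pi in size. The crude value 2 suffices, since only a uniform
  bound on the weight of a vortex enters the estimate in the dual norm.\<close>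

lemma vort_le_2:
  assumes "i \<in> squares Z" "\<And>j. j \<in> Z \<Longrightarrow> norm (v j) = 1"
  shows "\<bar>vort v i\<bar> \<le> 2"
proof -
  have "circulation v i = 2 * pi * of_int (vort v i)"
    using assms by (rule circulation_eq_vort)
  then have "\<bar>2 * pi * of_int (vort v i)\<bar> \<le> 4 * pi"
    using bond_angle_le[of v i] bond_angle_le[of v "i + dx"] bond_angle_le[of v "i + dy"]
    unfolding circulation_def by linarith
  then have "2 * pi * \<bar>of_int (vort v i)\<bar> \<le> 2 * pi * 2" by (simp add: abs_mult)
  then have "\<bar>of_int (vort v i) :: real\<bar> \<le> 2" by simp
  then show ?thesis by linarith
qed

text \<open>A potential lives on squares, indexed by their lower left corner. The horizontal bond
  starting at i separates the squares i and i - \<open>dy\<close>, the vertical one i and i -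
  \<open>dx\<close>; backward differences are therefore indexed by the bond that is crossed.\<close>

definition dirichlet :: "(int \<times> int) set \<Rightarrow> (int \<times> int \<Rightarrow> real) \<Rightarrow> real" where
  "dirichlet F \<psi> = (\<Sum>i\<in>F. (\<psi> i - \<psi> (i - dy))\<^sup>2 + (\<psi> i - \<psi> (i - dx))\<^sup>2)"

text \<open>The indices at which a backward difference of a function supported in \<open>D\<close>
  can be nonzero.\<close>

definition nbhd :: "(int \<times> int) set \<Rightarrow> (int \<times> int) set" where
  "nbhd D = D \<union> (\<lambda>i. i + dx) ` D \<union> (\<lambda>i. i + dy) ` D"

lemma sum_shift_support:
  fixes g \<psi> :: "int \<times> int \<Rightarrow> real"
  assumes "finite F" "finite D" "D \<subseteq> F" "(\<lambda>i. i + s) ` D \<subseteq> F" "\<And>i. i \<notin> D \<Longrightarrow> \<psi> i = 0"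
  shows "(\<Sum>i\<in>F. \<psi> i * g (i + s)) = (\<Sum>i\<in>F. \<psi> (i - s) * g i)"
proof -
  have "(\<Sum>i\<in>F. \<psi> i * g (i + s)) = (\<Sum>i\<in>D. \<psi> i * g (i + s))"
    using assms by (intro sum.mono_neutral_right) auto
  also have "\<dots> = (\<Sum>i\<in>(\<lambda>i. i + s) ` D. \<psi> (i - s) * g i)"
    by (subst sum.reindex) (auto simp: inj_on_def)
  also have "\<dots> = (\<Sum>i\<in>F. \<psi> (i - s) * g i)"
  proof (intro sum.mono_neutral_left ballI)
    fix i assume "i \<in> F - (\<lambda>i. i + s) ` D"
    then have "i - s \<notin> D" by (metis DiffD2 diff_add_cancel imageI)
    then show "\<psi> (i - s) * g i = 0" using assms by simp
  qed (use assms in auto)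
  finally show ?thesis .
qed

text \<open>Discrete Stokes: a bond enters the circulations of its two adjacent squares with
  opposite signs, so only the difference of \<psi> across it survives.\<close>

lemma summation_by_parts:
  fixes h w \<psi> :: "int \<times> int \<Rightarrow> real"
  assumes D: "finite D" and \<psi>: "\<And>i. i \<notin> D \<Longrightarrow> \<psi> i = 0"
  shows "(\<Sum>i\<in>D. \<psi> i * (h i + w (i + dx) - h (i + dy) - w i)) =
    (\<Sum>i\<in>nbhd D. h i * (\<psi> i - \<psi> (i - dy)) + w i * (\<psi> (i - dx) - \<psi> i))"
proof -
  let ?F = "nbhd D"
  have F: "finite ?F" "D \<subseteq> ?F" using D by (auto simp: nbhd_def)
  have "(\<Sum>i\<in>D. \<psi> i * (h i + w (i + dx) - h (i + dy) - w i)) = 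
     (\<Sum>i\<in>?F. \<psi> i * (h i + w (i + dx) - h (i + dy) - w i))"
    using F \<psi> by (intro sum.mono_neutral_left) auto
  also have "\<dots> = (\<Sum>i\<in>?F. \<psi> i * h i) + (\<Sum>i\<in>?F. \<psi> i * w (i + dx)) - (\<Sum>i\<in>?F. \<psi> i * h (i + dy))
      - (\<Sum>i\<in>?F. \<psi> i * w i)"
    by (simp add: sum.distrib sum_subtractf algebra_simps)
  also have "\<dots> = (\<Sum>i\<in>?F. \<psi> i * h i) + (\<Sum>i\<in>?F. \<psi> (i - dx) * w i) - (\<Sum>i\<in>?F. \<psi> (i - dy) * h i)
      - (\<Sum>i\<in>?F. \<psi> i * w i)"
    by (subst (1 2) sum_shift_support[where D = D]) (use F D \<psi> in \<open>auto simp: nbhd_def\<close>)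
  also have "\<dots> = (\<Sum>i\<in>?F. h i * (\<psi> i - \<psi> (i - dy)) + w i * (\<psi> (i - dx) - \<psi> i))"
    by (simp add: sum.distrib sum_subtractf algebra_simps)
  finally show ?thesis .
qed

text \<open>A bond across which a potential supported in \<open>D\<close> can vary is a side of a
  square of \<open>D\<close>. Extending the potential by zero thus never charges a bond with an
  endpoint outside \<open>Z\<close>.\<close>

lemma bonds_of_support:
  assumes "D \<subseteq> squares Z"
  shows "i \<in> D \<or> i - dy \<in> D \<Longrightarrow> i \<in> hbonds Z" "i \<in> D \<or> i - dx \<in> D \<Longrightarrow> i \<in> vbonds Z"
proof -
  have sh: "j \<in> Z" "j + dx \<in> Z" "j + dy \<in> Z" "j + dx + dy \<in> Z" "j + dy + dx \<in> Z" if "j \<in> D" for j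
    using assms that by (auto simp: squares_def ac_simps)
  show "i \<in> hbonds Z" if "i \<in> D \<or> i - dy \<in> D"
    using that sh[of i] sh[of "i - dy"] by (auto simp: hbonds_def simp del: add_Pair)
  show "i \<in> vbonds Z" if "i \<in> D \<or> i - dx \<in> D"
    using that sh[of i] sh[of "i - dx"] by (auto simp: vbonds_def simp del: add_Pair)
qed

text \<open>\<open>cos_duality\<close> is summed over the bonds, with X the difference of \<psi>
  across the bond. After summation by parts the angles appear only through the vorticity. Any
  admissible potential gives a lower bound; the ball construction supplies a nearly optimal
  one.\<close>

lemma energy_duality:
  fixes \<psi> :: "int \<times> int \<Rightarrow> real"
  assumes Z: "finite Z" and D: "D \<subseteq> squares Z" and v: "\<And>j. j \<in> Z \<Longrightarrow> norm (v j) = 1"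
    and \<psi>: "\<And>i. i \<notin> D \<Longrightarrow> \<psi> i = 0"
    and small: "\<And>i. \<bar>\<psi> i - \<psi> (i - dy)\<bar> \<le> \<delta>" "\<And>i. \<bar>\<psi> i - \<psi> (i - dx)\<bar> \<le> \<delta>"
    and \<delta>: "27 * \<delta>\<^sup>2 < 1"
  shows "2 * pi * (\<Sum>i\<in>D. of_int (vort v i) * \<psi> i) - dirichlet (nbhd D) \<psi> / (2 * (1 - 27 * \<delta>\<^sup>2)) \<le> xy_energy Z v"
proof -
  let ?F = "nbhd D" and ?k = "2 * (1 - 27 * \<delta>\<^sup>2)"
  have "D \<subseteq> Z" using D by (auto simp: squares_def)
  then have fD: "finite D" using Z finite_subset by blast
  then have fF: "finite ?F" by (auto simp: nbhd_def)
  have fh: "finite (hbonds Z)" "finite (vbonds Z)" using Z by (auto simp: hbonds_def vbonds_def)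
  have c0: "0 \<le> 1 - cos t" for t :: real by simp
  have H: "(\<Sum>i\<in>?F. hb v i * (\<psi> i - \<psi> (i - dy)) - (\<psi> i - \<psi> (i - dy))\<^sup>2 / ?k) \<le> (\<Sum>i\<in>hbonds Z. 1 - cos (hb v i))"
  proof -
    have "(\<Sum>i\<in>?F. hb v i * (\<psi> i - \<psi> (i - dy)) - (\<psi> i - \<psi> (i - dy))\<^sup>2 / ?k)
      = (\<Sum>i\<in>?F \<inter> hbonds Z. hb v i * (\<psi> i - \<psi> (i - dy)) - (\<psi> i - \<psi> (i - dy))\<^sup>2 / ?k)"
    proof (intro sum.mono_neutral_right ballI)
      fix i assume "i \<in> ?F - ?F \<inter> hbonds Z"
      then have "i \<notin> D" "i - dy \<notin> D" using bonds_of_support(1)[OF D, of i] by auto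
      then have "\<psi> i = 0" "\<psi> (i - dy) = 0" using \<psi> by blast+
      then show "hb v i * (\<psi> i - \<psi> (i - dy)) - (\<psi> i - \<psi> (i - dy))\<^sup>2 / ?k = 0" by simp
    qed (use fF in auto)
    also have "\<dots> \<le> (\<Sum>i\<in>?F \<inter> hbonds Z. 1 - cos (hb v i))"
      using cos_duality[OF _ small(1) \<delta>] by (intro sum_mono) simp
    also have "\<dots> \<le> (\<Sum>i\<in>hbonds Z. 1 - cos (hb v i))"
      using fh c0 by (intro sum_mono2) auto
    finally show ?thesis .
  qed
  have W: "(\<Sum>i\<in>?F. vb v i * (\<psi> (i - dx) - \<psi> i) - (\<psi> i - \<psi> (i - dx))\<^sup>2 / ?k) \<le> (\<Sum>i\<in>vbonds Z. 1 - cos (vb v i))"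
  proof -
    have "(\<Sum>i\<in>?F. vb v i * (\<psi> (i - dx) - \<psi> i) - (\<psi> i - \<psi> (i - dx))\<^sup>2 / ?k)
      = (\<Sum>i\<in>?F \<inter> vbonds Z. vb v i * (\<psi> (i - dx) - \<psi> i) - (\<psi> (i - dx) - \<psi> i)\<^sup>2 / ?k)"
    proof (subst power2_commute, intro sum.mono_neutral_right ballI)
      fix i assume "i \<in> ?F - ?F \<inter> vbonds Z"
      then have "i \<notin> D" "i - dx \<notin> D" using bonds_of_support(2)[OF D, of i] by auto
      then have "\<psi> i = 0" "\<psi> (i - dx) = 0" using \<psi> by blast+
      then show "vb v i * (\<psi> (i - dx) - \<psi> i) - (\<psi> (i - dx) - \<psi> i)\<^sup>2 / ?k = 0" by simp
    qed (use fF in auto)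
    also have "\<dots> \<le> (\<Sum>i\<in>?F \<inter> vbonds Z. 1 - cos (vb v i))"
      using small(2) by (intro sum_mono cos_duality \<delta>) (auto simp: abs_minus_commute)
    also have "\<dots> \<le> (\<Sum>i\<in>vbonds Z. 1 - cos (vb v i))"
      using fh c0 by (intro sum_mono2) auto
    finally show ?thesis .
  qed
  have "2 * pi * (\<Sum>i\<in>D. of_int (vort v i) * \<psi> i) = (\<Sum>i\<in>D. \<psi> i * circulation v i)"
    unfolding sum_distrib_left using D v
    by (intro sum.cong refl) (subst circulation_eq_vort[of _ Z], auto)
  also have "\<dots> = (\<Sum>i\<in>?F. hb v i * (\<psi> i - \<psi> (i - dy)) + vb v i * (\<psi> (i - dx) - \<psi> i))"
    unfolding circulation_def by (rule summation_by_parts[OF fD \<psi>])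
  finally show ?thesis using H W
    by (simp add: xy_energy_def dirichlet_def sum.distrib sum_subtractf sum_divide_distrib add_divide_distrib)
qed

text \<open>At a vortex the circulation is at least 2 pi in size, so one of the four angles is at
  least pi / 2 and its bond costs at least 1. Each bond is a side of at most two squares, whence the
  factor 2.\<close>

lemma card_vortices_le:
  assumes Z: "finite Z" and D: "D \<subseteq> squares Z" and v: "\<And>j. j \<in> Z \<Longrightarrow> norm (v j) = 1"
  shows "real (card {i\<in>D. vort v i \<noteq> 0}) \<le> 2 * xy_energy Z v"
proof -
  have "D \<subseteq> Z" using D by (auto simp: squares_def)
  then have fD: "finite D" using Z finite_subset by blast
  have fh: "finite (hbonds Z)" "finite (vbonds Z)" using Z by (auto simp: hbonds_def vbonds_def)
  define P where "P = {i\<in>D. vort v i \<noteq> 0}"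
  have fP: "finite P" using fD by (simp add: P_def)
  have c0: "0 \<le> 1 - cos t" for t :: real by simp
  have big: "1 \<le> 1 - cos t" if "pi / 2 \<le> \<bar>t\<bar>" "\<bar>t\<bar> \<le> pi" for t :: real
  proof -
    have "cos \<bar>t\<bar> \<le> cos (pi / 2)" using that by (intro cos_monotone_0_pi_le) auto
    then show ?thesis by simp
  qed
  have 1: "1 \<le> (1 - cos (hb v i)) + (1 - cos (vb v (i + dx))) + (1 - cos (hb v (i + dy))) + (1 - cos (vb v i))"
    if "i \<in> P" for i
  proof -
    have i: "i \<in> squares Z" "vort v i \<noteq> 0" using that D by (auto simp: P_def)
    have "1 \<le> \<bar>real_of_int (vort v i)\<bar>" using i(2) by linarith
    then have "2 * pi * 1 \<le> 2 * pi * \<bar>real_of_int (vort v i)\<bar>" by (intro mult_left_mono) auto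
    then have "2 * pi \<le> \<bar>circulation v i\<bar>"
      by (simp add: circulation_eq_vort[OF i(1) v] abs_mult)
    then consider "pi / 2 \<le> \<bar>hb v i\<bar>" | "pi / 2 \<le> \<bar>vb v (i + dx)\<bar>" | "pi / 2 \<le> \<bar>hb v (i + dy)\<bar>" | "pi / 2 \<le> \<bar>vb v i\<bar>"
      unfolding circulation_def by linarith
    then show ?thesis
      using big[of "hb v i"] big[of "vb v (i + dx)"] big[of "hb v (i + dy)"] big[of "vb v i"]
        c0[of "hb v i"] c0[of "vb v (i + dx)"] c0[of "hb v (i + dy)"] c0[of "vb v i"] 
      by cases (auto simp del: cos_le_one)
  qed
  have PZ: "P \<subseteq> hbonds Z" "P \<subseteq> vbonds Z" "(\<lambda>i. i + dy) ` P \<subseteq> hbonds Z" "(\<lambda>i. i + dx) ` P \<subseteq> vbonds Z"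
    using D by (auto simp: P_def squares_def hbonds_def vbonds_def dest!: subsetD)
  have "real (card P) = (\<Sum>i\<in>P. 1)" by simp
  also have "\<dots> \<le> (\<Sum>i\<in>P. (1 - cos (hb v i)) + (1 - cos (vb v (i + dx))) + (1 - cos (hb v (i + dy))) + (1 - cos (vb v i)))"
    using 1 by (intro sum_mono) auto
  also have "\<dots> = (\<Sum>i\<in>P. 1 - cos (hb v i)) + (\<Sum>i\<in>(\<lambda>i. i + dx) ` P. 1 - cos (vb v i))
      + (\<Sum>i\<in>(\<lambda>i. i + dy) ` P. 1 - cos (hb v i)) + (\<Sum>i\<in>P. 1 - cos (vb v i))"
    by (subst (1 2) sum.reindex) (auto simp: inj_on_def sum.distrib sum_subtractf sum_negf o_def)
  also have "\<dots> \<le> (\<Sum>i\<in>hbonds Z. 1 - cos (hb v i)) + (\<Sum>i\<in>vbonds Z. 1 - cos (vb v i))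
      + (\<Sum>i\<in>hbonds Z. 1 - cos (hb v i)) + (\<Sum>i\<in>vbonds Z. 1 - cos (vb v i))"
    using PZ fh c0 by (intro add_mono sum_mono2) auto
  finally show ?thesis by (simp add: P_def xy_energy_def)
qed

section \<open>Euclidean geometry of the lattice\<close>

lemma pos_nth [simp]: "pos i $ 1 = of_int (fst i)" "pos i $ 2 = of_int (snd i)"
  by (simp_all add: pos_def)

lemma norm_real2: "norm (x :: real^2) = sqrt ((x $ 1)\<^sup>2 + (x $ 2)\<^sup>2)"
  by (simp add: norm_eq_sqrt_inner inner_vec_def sum_2 power2_eq_square)

lemma norm_real2_le: "norm (x :: real^2) \<le> \<bar>x $ 1\<bar> + \<bar>x $ 2\<bar>"
  using norm_le_l1_cart[of x] by (simp add: sum_2)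

lemma pos_diff: "pos (i - dx) = pos i - e1" "pos (i - dy) = pos i - e2"
  "pos (i + dx) = pos i + e1" "pos (i + dy) = pos i + e2"
  by (simp_all add: vec_eq_iff forall_2 axis_def)

lemma norm_e [simp]: "norm e1 = 1" "norm e2 = 1"
  by (simp_all add: norm_real2 axis_def)

lemma dist_pos_step [simp]:
  "dist (pos i) (pos (i - dx)) = 1" "dist (pos i) (pos (i - dy)) = 1"
  by (simp_all add: pos_diff dist_norm)

section \<open>Counting lattice points\<close>

text \<open>Area comparison: the open unit cells centred at the lattice points are disjoint and lie
  within distance 1 of their centres, hence inside the annulus enlarged by 1 on both sides.\<close>

lemma annulus_card_le:
  assumes F: "finite F" and r: "1 \<le> r1" "r1 \<le> r2"
    and in_ann: "\<And>i. i \<in> F \<Longrightarrow> r1 < dist (pos i) c \<and> dist (pos i) c < r2"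
  shows "real (card F) \<le> pi * ((r2 + 1)\<^sup>2 - (r1 - 1)\<^sup>2)"
proof -
  define h :: "real^2" where "h = (\<chi> k. 1/2)"
  define cell where "cell i = box (pos i - h) (pos i + h)" for i
  have cell1: "measure lborel (cell i) = 1" for i
  proof -
    have "(pos i + h - (pos i - h)) \<bullet> b = 1" if "b \<in> Basis" for b
      using that by (auto simp: Basis_vec_def h_def inner_axis)
    moreover have "\<forall>b\<in>Basis. (pos i - h) \<bullet> b \<le> (pos i + h) \<bullet> b"
      by (auto simp: Basis_vec_def h_def inner_axis)
    ultimately show ?thesis by (simp add: cell_def)
  qed
  have cells: "cell i \<in> sets lborel" "emeasure lborel (cell i) \<noteq> \<infinity>" for i
    by (simp_all add: cell_def emeasure_lborel_box_eq)
  have near: "dist x (pos i) < 1" if "x \<in> cell i" for x i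
  proof -
    have "\<bar>(x - pos i) $ 1\<bar> < 1/2" "\<bar>(x - pos i) $ 2\<bar> < 1/2"
      using that by (simp_all add: cell_def mem_box_cart forall_2 h_def abs_if)
    then show ?thesis using norm_real2_le[of "x - pos i"] by (simp add: dist_norm)
  qed
  have disj: "disjoint_family_on cell F"
    unfolding disjoint_family_on_def
  proof (intro ballI impI equals0I)
    fix i j x assume "i \<noteq> j" and x: "x \<in> cell i \<inter> cell j"
    have "\<bar>of_int (fst i) - of_int (fst j) :: real\<bar> < 1" "\<bar>of_int (snd i) - of_int (snd j) :: real\<bar> < 1"
      using x by (auto simp: cell_def mem_box_cart forall_2 h_def)
    then have "fst i = fst j" "snd i = snd j" by linarith+
    with \<open>i \<noteq> j\<close> show False by (simp add: prod_eq_iff)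
  qed
  have bd: "ball c (r1 - 1) \<subseteq> ball c (r2 + 1)" using r by (intro subset_ball) auto
  have "real (card F) = (\<Sum>i\<in>F. measure lborel (cell i))" using cell1 by simp
  also have "\<dots> = measure lborel (\<Union>i\<in>F. cell i)"
    by (rule measure_finite_Union[symmetric]) (use F disj cells in auto)
  also have "\<dots> \<le> measure lborel (ball c (r2 + 1) - ball c (r1 - 1))"
  proof (rule measure_mono_fmeasurable)
    show "(\<Union>i\<in>F. cell i) \<subseteq> ball c (r2 + 1) - ball c (r1 - 1)"
    proof
      fix x assume "x \<in> (\<Union>i\<in>F. cell i)"
      then obtain i where i: "i \<in> F" "x \<in> cell i" by blast
      have "dist x (pos i) < 1" by (rule near[OF i(2)])
      then have "dist c x < r2 + 1" "r1 - 1 < dist c x"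
        using in_ann[OF i(1)] dist_triangle[of "pos i" c x] dist_triangle[of x c "pos i"]
        by (auto simp: dist_commute)
      then show "x \<in> ball c (r2 + 1) - ball c (r1 - 1)" by auto
    qed
    show "ball c (r2 + 1) - ball c (r1 - 1) \<in> fmeasurable lborel"
      by (intro fmeasurable.Diff) (auto simp: fmeasurable_def emeasure_lborel_ball_finite[unfolded infinity_ennreal_def])
  qed (auto simp: cell_def)
  also have "\<dots> = measure lborel (ball c (r2 + 1)) - measure lborel (ball c (r1 - 1))"
    using bd emeasure_lborel_ball_finite[of c "r2 + 1"] by (intro measure_Diff) auto
  also have "\<dots> = pi * ((r2 + 1)\<^sup>2 - (r1 - 1)\<^sup>2)"
    using r by (simp add: content_ball unit_ball_vol_2 right_diff_distrib)
  finally show ?thesis .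
qed

text \<open>A unit step changes the norm by the radial component of the step up to the curvature
  error 1 / (2 |y|). Cauchy-Schwarz gives the upper side; the lower side compares squared norms and
  uses 2 a b <= a^2 + b^2.\<close>

lemma norm_step_square_le:
  fixes y e :: "'a :: real_inner"
  assumes y: "norm y \<ge> 1" and e: "norm e = 1"
  shows "(norm y - norm (y - e))\<^sup>2 \<le> ((y \<bullet> e) / norm y)\<^sup>2 + (1 / norm y + 1 / (4 * (norm y)\<^sup>2))"
proof -
  define \<nu> where "\<nu> = (y \<bullet> e) / norm y"
  define \<delta> where "\<delta> = 1 / (2 * norm y)"
  define a where "a = norm y - norm (y - e)"
  have ny: "norm y > 0" using y by linarith
  have \<nu>1: "\<bar>\<nu>\<bar> \<le> 1"
    using Cauchy_Schwarz_ineq2[of y e] ny e by (simp add: \<nu>_def divide_le_eq)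
  have ee: "e \<bullet> e = 1" using e by (simp add: norm_eq_sqrt_inner)
  have "norm y * norm y - y \<bullet> e = (y - e) \<bullet> y"
    by (simp add: inner_diff_left inner_diff_right inner_commute dot_square_norm power2_eq_square)
  also have "\<dots> \<le> norm (y - e) * norm y" by (rule norm_cauchy_schwarz)
  finally have "norm y * a \<le> y \<bullet> e" by (simp add: a_def algebra_simps)
  then have up: "a \<le> \<nu>" using ny by (simp add: \<nu>_def pos_le_divide_eq mult.commute)
  have "(norm (y - e))\<^sup>2 = (norm y)\<^sup>2 - 2 * (y \<bullet> e) + 1"
    by (simp add: power2_norm_eq_inner inner_diff_left inner_diff_right inner_commute ee)
  moreover have "2 * norm y * norm (y - e) \<le> (norm (y - e))\<^sup>2 + (norm y)\<^sup>2"
    using sum_squares_bound[of "norm y" "norm (y - e)"] by simp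
  ultimately have "norm y * (2 * norm (y - e)) \<le> norm y * (2 * norm y) - 2 * (y \<bullet> e) + 1"
    by (simp add: power2_eq_square)
  then have "2 * (y \<bullet> e) - 1 \<le> norm y * (2 * a)" by (simp add: a_def algebra_simps)
  then have lo: "\<nu> - \<delta> \<le> a" using ny by (simp add: \<nu>_def \<delta>_def field_simps)
  have \<delta>0: "\<delta> \<ge> 0" by (simp add: \<delta>_def)
  have "a\<^sup>2 \<le> (\<bar>\<nu>\<bar> + \<delta>)\<^sup>2" using up lo \<delta>0 by (intro abs_le_square_iff[THEN iffD1]) auto
  also have "\<dots> = \<nu>\<^sup>2 + 2 * \<delta> * \<bar>\<nu>\<bar> + \<delta>\<^sup>2" by (simp add: power2_sum)
  also have "\<dots> \<le> \<nu>\<^sup>2 + 2 * \<delta> * 1 + \<delta>\<^sup>2" using \<nu>1 \<delta>0 by (intro add_mono mult_left_mono) auto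
  also have "\<nu>\<^sup>2 + 2 * \<delta> * 1 + \<delta>\<^sup>2 = \<nu>\<^sup>2 + (1 / norm y + 1 / (4 * (norm y)\<^sup>2))"
    by (simp add: \<delta>_def power_divide power_mult_distrib)
  finally show ?thesis by (simp add: a_def \<nu>_def)
qed

text \<open>The squared direction cosines of y add up to 1, so the discrete gradient of the norm has
  length about 1 as in the continuum. The two curvature errors amount to at most 5 / (2 K).\<close>

lemma two_steps_square_le:
  fixes y :: "real^2"
  assumes K: "1 \<le> K" "K \<le> norm y"
  shows "(norm y - norm (y - e2))\<^sup>2 + (norm y - norm (y - e1))\<^sup>2 \<le> 1 + 3 / K"
proof -
  have y: "1 \<le> norm y" using K by linarith
  have s: "((y \<bullet> e1) / norm y)\<^sup>2 + ((y \<bullet> e2) / norm y)\<^sup>2 = 1"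
  proof -
    have "(norm y)\<^sup>2 = (y $ 1)\<^sup>2 + (y $ 2)\<^sup>2" by (simp add: norm_real2)
    moreover have "(norm y)\<^sup>2 \<noteq> 0" using y by auto
    ultimately show ?thesis
      by (simp add: inner_axis power_divide add_divide_distrib[symmetric])
  qed
  have u1: "1 / norm y \<le> 1 / K" using K by (intro divide_left_mono mult_pos_pos) auto
  have u2: "1 / (4 * (norm y)\<^sup>2) \<le> (1 / K) / 4"
  proof -
    have "K * 1 \<le> norm y * norm y" using K y by (intro mult_mono) auto
    then have "1 / (norm y)\<^sup>2 \<le> 1 / K" using K y by (intro divide_left_mono mult_pos_pos) (auto simp: power2_eq_square)
    then show ?thesis by simp
  qed
  have "a + b \<le> 1 + 3 * q" if "b \<le> s1 + (p + w)" "a \<le> s2 + (p + w)" "s1 + s2 = 1"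
    "p \<le> q" "w \<le> q / 4" "0 \<le> q" for a b s1 s2 p w q :: real
    using that by linarith
  from this[OF norm_step_square_le[OF y norm_e(1)] norm_step_square_le[OF y norm_e(2)] s u1 u2]
  show ?thesis using K by simp
qed

section \<open>Merging balls\<close>

text \<open>A ball is a pair of centre and radius. What is asked is that the dilations by 1 + \<tau>
  remain disjoint, so that the cones of the next growth step do not interact.\<close>

definition bsep :: "real \<Rightarrow> ((real^2) \<times> real) set \<Rightarrow> bool" where
  "bsep \<tau> \<B> \<longleftrightarrow> (\<forall>B\<in>\<B>. \<forall>B'\<in>\<B>. B \<noteq> B' \<longrightarrow> (1 + \<tau>) * (snd B + snd B') < dist (fst B) (fst B'))"

text \<open>Inclusion of balls in arithmetic form; the triangle inequality makes it transitive and
  compatible with \<open>inball\<close>.\<close>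

definition bin :: "(real^2) \<times> real \<Rightarrow> (real^2) \<times> real \<Rightarrow> bool" where
  "bin B B' \<longleftrightarrow> dist (fst B) (fst B') + snd B \<le> snd B'"

definition inball :: "int \<times> int \<Rightarrow> (real^2) \<times> real \<Rightarrow> bool" where
  "inball i B \<longleftrightarrow> dist (pos i) (fst B) \<le> snd B"

definition dilate :: "real \<Rightarrow> (real^2) \<times> real \<Rightarrow> (real^2) \<times> real" where
  "dilate \<tau> B = (fst B, (1 + \<tau>) * snd B)"

lemma bin_refl [simp]: "bin B B" by (simp add: bin_def)

lemma bin_trans: "bin A B \<Longrightarrow> bin B C \<Longrightarrow> bin A C"
  unfolding bin_def using dist_triangle[of "fst A" "fst C" "fst B"] by linarith

lemma bin_dilate: "0 \<le> \<tau> \<Longrightarrow> 0 \<le> snd B \<Longrightarrow> bin B (dilate \<tau> B)"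
  by (simp add: bin_def dilate_def algebra_simps)

lemma bin_inball: "bin A B \<Longrightarrow> inball i A \<Longrightarrow> inball i B"
  unfolding bin_def inball_def using dist_triangle[of "pos i" "fst B" "fst A"] by linarith

text \<open>Induction on the number of balls: two balls that are too close are replaced by one. A
  merger multiplies the sum of the radii by at most 1 + \<tau>, and the difference of the
  cardinalities bounds the number of mergers.\<close>

lemma merge_balls:
  assumes "finite \<B>" "\<forall>B\<in>\<B>. K \<le> snd B" "0 < K" "0 \<le> \<tau>"
  shows "\<exists>\<B>'. finite \<B>' \<and> (\<forall>B\<in>\<B>'. K \<le> snd B) \<and> bsep \<tau> \<B>' \<and> card \<B>' \<le> card \<B> \<and>
    sum snd \<B>' \<le> (1 + \<tau>) ^ (card \<B> - card \<B>') * sum snd \<B> \<and> (\<forall>B\<in>\<B>. \<exists>B'\<in>\<B>'. bin B B')"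
  using assms
proof (induction "card \<B>" arbitrary: \<B> rule: less_induct)
  case less
  show ?case
  proof (cases "bsep \<tau> \<B>")
    case True
    have "\<forall>B\<in>\<B>. \<exists>B'\<in>\<B>. bin B B'" by (intro ballI, rule bexI[rotated]) auto
    then show ?thesis using less.prems True by (intro exI[of _ \<B>]) simp
  next
    case False
    then obtain B B' where B: "B \<in> \<B>" "B' \<in> \<B>" "B \<noteq> B'"
      and d: "dist (fst B) (fst B') \<le> (1 + \<tau>) * (snd B + snd B')"
      by (auto simp: bsep_def not_less)
    define c r c' r' where "c = fst B" "r = snd B" "c' = fst B'" "r' = snd B'"
    note defs = this
    have r: "K \<le> r" "K \<le> r'" "0 < r + r'"
      using less.prems(2,3) B(1,2) by (auto simp: defs intro!: add_pos_pos dest: order_less_le_trans)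
    \<comment> \<open>With each centre weighted by its own radius, c lies at distance at most (1 +
      \<tau>) r' from the new centre and c' at distance at most (1 + \<tau>) r; adding r or r' stays
      below the new radius.\<close>
    define M where "M = ((r / (r + r')) *\<^sub>R c + (r' / (r + r')) *\<^sub>R c', (1 + \<tau>) * (r + r'))"
    have \<tau>r: "0 \<le> \<tau> * r" "0 \<le> \<tau> * r'" using r less.prems(3,4) by simp_all
    have one: "r / (r + r') + r' / (r + r') = 1" using r by (simp add: add_divide_distrib[symmetric])
    have c1: "c = (r / (r + r')) *\<^sub>R c + (r' / (r + r')) *\<^sub>R c"
      and c2: "c' = (r / (r + r')) *\<^sub>R c' + (r' / (r + r')) *\<^sub>R c'"
      using one by (metis scaleR_left_distrib scaleR_one)+
    have "c - fst M = (r' / (r + r')) *\<^sub>R (c - c')" by (subst c1) (simp add: M_def algebra_simps)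
    then have "dist c (fst M) = r' / (r + r') * dist c c'" using r less.prems(3) by (simp add: dist_norm)
    also have "\<dots> \<le> r' / (r + r') * ((1 + \<tau>) * (r + r'))"
      using d r less.prems(3) by (intro mult_left_mono) (auto simp: defs)
    also have "\<dots> = (1 + \<tau>) * r'" using r by simp
    finally have b1: "bin B M" using less.prems(3,4)
      by (simp add: bin_def M_def defs[symmetric] algebra_simps, use \<tau>r in linarith)
    have "c' - fst M = (r / (r + r')) *\<^sub>R (c' - c)" by (subst c2) (simp add: M_def algebra_simps)
    then have "dist c' (fst M) = r / (r + r') * dist c c'" using r less.prems(3) by (simp add: dist_norm norm_minus_commute)
    also have "\<dots> \<le> r / (r + r') * ((1 + \<tau>) * (r + r'))"
      using d r less.prems(3) by (intro mult_left_mono) (auto simp: defs)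
    also have "\<dots> = (1 + \<tau>) * r" using r by simp
    finally have b2: "bin B' M" using less.prems(3,4)
      by (simp add: bin_def M_def defs[symmetric] algebra_simps, use \<tau>r in linarith)
    define \<C> where "\<C> = insert M (\<B> - {B, B'})"
    have fin: "finite (\<B> - {B, B'})" using less.prems by simp
    have c2: "card (\<B> - {B, B'}) + 2 = card \<B>"
      using B less.prems(1) card_mono[of \<B> "{B, B'}"] by (simp add: card_Diff_subset)
    have cC: "card \<C> < card \<B>"
      using c2 card_insert_le_m1[of "Suc (card (\<B> - {B, B'}))" "\<B> - {B, B'}" M] by (simp add: \<C>_def)
    have sB: "sum snd \<B> = sum snd (\<B> - {B, B'}) + (r + r')"
    proof -
      have "sum snd \<B> = sum snd (\<B> - {B, B'}) + sum snd {B, B'}"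
        using B less.prems(1) by (intro sum.subset_diff) auto
      then show ?thesis using B by (simp add: defs)
    qed
    have nn: "0 \<le> sum snd (\<B> - {B, B'})" using less.prems(2,3) by (intro sum_nonneg) fastforce
    \<comment> \<open>Families are sets, so the merged ball may coincide with one already present.
      The sum then only becomes smaller.\<close>
    have "sum snd \<C> \<le> (1 + \<tau>) * (r + r') + sum snd (\<B> - {B, B'})"
      using fin r less.prems(3,4) by (cases "M \<in> \<B> - {B, B'}") (auto simp: \<C>_def insert_absorb M_def sum.insert_if)
    also have "\<dots> \<le> (1 + \<tau>) * sum snd \<B>" using nn less.prems(4) unfolding sB by (simp add: algebra_simps)
    finally have sC: "sum snd \<C> \<le> (1 + \<tau>) * sum snd \<B>" .
    have KC: "\<forall>A\<in>\<C>. K \<le> snd A"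
    proof -
      have "K * 1 \<le> (r + r') * (1 + \<tau>)" using r less.prems(3,4) by (intro mult_mono) auto
      then show ?thesis using less.prems(2) by (auto simp: \<C>_def M_def mult.commute)
    qed
    have "finite \<C>" using fin by (simp add: \<C>_def)
    from less.hyps[OF cC this KC less.prems(3,4)] obtain \<B>' where
      I: "finite \<B>'" "\<forall>B\<in>\<B>'. K \<le> snd B" "bsep \<tau> \<B>'" "card \<B>' \<le> card \<C>"
        "sum snd \<B>' \<le> (1 + \<tau>) ^ (card \<C> - card \<B>') * sum snd \<C>" "\<forall>B\<in>\<C>. \<exists>B'\<in>\<B>'. bin B B'"
      by blast
    have nB: "0 \<le> sum snd \<B>" using less.prems(2,3) by (intro sum_nonneg) fastforce
    have "sum snd \<B>' \<le> (1 + \<tau>) ^ (card \<C> - card \<B>') * ((1 + \<tau>) * sum snd \<B>)"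
      using I(5) sC less.prems(4) by (meson mult_left_mono order_trans zero_le_power add_nonneg_nonneg zero_le_one)
    also have "\<dots> = (1 + \<tau>) ^ Suc (card \<C> - card \<B>') * sum snd \<B>" by simp
    \<comment> \<open>The extra factor for this merger fits because the number of balls has dropped
      by at least one.\<close>
    also have "\<dots> \<le> (1 + \<tau>) ^ (card \<B> - card \<B>') * sum snd \<B>"
      using cC I(4) less.prems(4) nB by (intro mult_right_mono power_increasing) auto
    finally have "sum snd \<B>' \<le> (1 + \<tau>) ^ (card \<B> - card \<B>') * sum snd \<B>" .
    moreover have "\<forall>A\<in>\<B>. \<exists>B'\<in>\<B>'. bin A B'"
    proof
      fix A assume A: "A \<in> \<B>"
      have "\<exists>A'\<in>\<C>. bin A A'"
      proof (cases "A \<in> {B, B'}")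
        case True then show ?thesis using b1 b2 by (auto simp: \<C>_def)
      next
        case False then show ?thesis using A by (intro bexI[of _ A]) (auto simp: \<C>_def)
      qed
      then show "\<exists>B'\<in>\<B>'. bin A B'" using I(6) bin_trans by blast
    qed
    ultimately show ?thesis using I cC by (intro exI[of _ \<B>']) auto
  qed
qed

section \<open>The ball construction\<close>

text \<open>The cone is constant within distance 2 of the ball and vanishes within distance 2 of the boundary
  of the dilated ball. Bonds on which the cones of disjoint annuli vary are then disjoint, so their
  Dirichlet energies add up.\<close>

definition chi :: "real \<Rightarrow> (real^2) \<times> real \<Rightarrow> int \<times> int \<Rightarrow> real" where
  "chi \<tau> B i = min (\<tau> - 4 / snd B) (max 0 (((1 + \<tau>) * snd B - 2 - dist (pos i) (fst B)) / snd B))"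

lemma chi_inside:
  assumes "0 < snd B" "dist (pos i) (fst B) \<le> snd B + 2" "4 \<le> \<tau> * snd B"
  shows "chi \<tau> B i = \<tau> - 4 / snd B"
proof -
  have "0 \<le> \<tau> - 4 / snd B" using assms by (simp add: field_simps)
  moreover have "\<tau> - 4 / snd B \<le> ((1 + \<tau>) * snd B - 2 - dist (pos i) (fst B)) / snd B"
  proof -
    have "\<tau> - 4 / snd B = (\<tau> * snd B - 4) / snd B" using assms by (simp add: diff_divide_distrib)
    also have "\<dots> \<le> ((1 + \<tau>) * snd B - 2 - dist (pos i) (fst B)) / snd B"
      using assms by (intro divide_right_mono) (auto simp: algebra_simps)
    finally show ?thesis .
  qed
  ultimately show ?thesis by (simp add: chi_def)
qed

lemma chi_outside:
  assumes "0 < snd B" "(1 + \<tau>) * snd B - 2 \<le> dist (pos i) (fst B)" "4 \<le> \<tau> * snd B"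
  shows "chi \<tau> B i = 0"
proof -
  have "0 \<le> \<tau> - 4 / snd B" using assms by (simp add: field_simps)
  moreover have "((1 + \<tau>) * snd B - 2 - dist (pos i) (fst B)) / snd B \<le> 0"
    using assms by (simp add: divide_le_0_iff)
  ultimately show ?thesis by (simp add: chi_def max_def)
qed

lemma chi_lipschitz:
  assumes "0 < snd B"
  shows "\<bar>chi \<tau> B i - chi \<tau> B j\<bar> \<le> \<bar>dist (pos i) (fst B) - dist (pos j) (fst B)\<bar> / snd B"
proof -
  have "\<bar>min a (max 0 x) - min a (max 0 y)\<bar> \<le> \<bar>x - y\<bar>" for a x y :: real by linarith
  note this[of "\<tau> - 4 / snd B" "((1 + \<tau>) * snd B - 2 - dist (pos i) (fst B)) / snd B"
      "((1 + \<tau>) * snd B - 2 - dist (pos j) (fst B)) / snd B"]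
  then show ?thesis
    unfolding chi_def using assms
    by (simp add: diff_divide_distrib[symmetric] abs_minus_commute)
qed

text \<open>The cone is flat within distance 2 of both edges of the annulus; a unit step uses up 1
  of this margin and leaves 1.\<close>

lemma chi_step_annulus:
  assumes "chi \<tau> B i \<noteq> chi \<tau> B j" "dist (pos i) (pos j) \<le> 1" "0 < snd B" "4 \<le> \<tau> * snd B"
  shows "snd B + 1 < dist (pos i) (fst B)" "dist (pos i) (fst B) < (1 + \<tau>) * snd B - 1"
proof -
  have d: "\<bar>dist (pos i) (fst B) - dist (pos j) (fst B)\<bar> \<le> 1"
    using assms(2) dist_triangle[of "pos i" "fst B" "pos j"] dist_triangle[of "pos j" "fst B" "pos i"]
    by (simp add: dist_commute abs_le_iff)
  show "snd B + 1 < dist (pos i) (fst B)"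
  proof (rule ccontr)
    assume "\<not> ?thesis"
    then have "chi \<tau> B i = \<tau> - 4 / snd B" "chi \<tau> B j = \<tau> - 4 / snd B"
      using d assms(3,4) by (auto intro!: chi_inside)
    with assms(1) show False by simp
  qed
  show "dist (pos i) (fst B) < (1 + \<tau>) * snd B - 1"
  proof (rule ccontr)
    assume "\<not> ?thesis"
    then have "chi \<tau> B i = 0" "chi \<tau> B j = 0"
      using d assms(3,4) by (auto intro!: chi_outside)
    with assms(1) show False by simp
  qed
qed

text \<open>Scale invariance: about \<open>pi * r\<^sup>2 * (2 * \<tau> + \<tau>\<^sup>2)\<close>
  points, each contributing about 1 / r^2. The margin of 1 from \<open>chi_step_annulus\<close>
  exactly absorbs the enlargement in \<open>annulus_card_le\<close>, so the count has no boundary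
  error.\<close>

lemma dirichlet_chi_le:
  assumes F: "finite F" and K: "1 \<le> K" "K \<le> snd B" and \<tau>: "0 < \<tau>" "4 \<le> \<tau> * K"
  shows "dirichlet F (chi \<tau> B) \<le> (1 + 3 / K) * (pi * (2 * \<tau> + \<tau>\<^sup>2))"
proof -
  define r c where "r = snd B" "c = fst B"
  note defs = this
  have r: "1 \<le> r" "K \<le> r" "0 < snd B" using K by (auto simp: defs)
  have \<tau>r: "4 \<le> \<tau> * snd B" using \<tau> K by (meson mult_left_mono less_imp_le order_trans)
  let ?g = "\<lambda>i. (chi \<tau> B i - chi \<tau> B (i - dy))\<^sup>2 + (chi \<tau> B i - chi \<tau> B (i - dx))\<^sup>2"
  define A where "A = {i\<in>F. r + 1 < dist (pos i) c \<and> dist (pos i) c < (1 + \<tau>) * r - 1}"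
  have out: "?g i = 0" if "i \<in> F - A" for i
  proof -
    have "chi \<tau> B i = chi \<tau> B j" if "dist (pos i) (pos j) \<le> 1" for j
    proof (rule ccontr)
      assume ne: "chi \<tau> B i \<noteq> chi \<tau> B j"
      show False using chi_step_annulus[OF ne that r(3) \<tau>r] \<open>i \<in> F - A\<close> by (auto simp: A_def defs)
    qed
    from this[of "i - dx"] this[of "i - dy"] show ?thesis by simp
  qed
  have "card A \<le> pi * ((((1 + \<tau>) * r - 1) + 1)\<^sup>2 - ((r + 1) - 1)\<^sup>2)" if "A \<noteq> {}"
    using that r F by (intro annulus_card_le[of A "r + 1" "(1 + \<tau>) * r - 1" c]) (auto simp: A_def)
  moreover have "0 \<le> pi * ((((1 + \<tau>) * r - 1) + 1)\<^sup>2 - ((r + 1) - 1)\<^sup>2)"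
    using r \<tau> by (intro mult_nonneg_nonneg) (auto intro!: power_mono simp: algebra_simps)
  ultimately have "card A \<le> pi * ((((1 + \<tau>) * r - 1) + 1)\<^sup>2 - ((r + 1) - 1)\<^sup>2)" by (cases "A = {}") auto
  also have "\<dots> = r\<^sup>2 * (pi * (2 * \<tau> + \<tau>\<^sup>2))" by (simp add: algebra_simps power2_eq_square)
  finally have cA: "card A \<le> r\<^sup>2 * (pi * (2 * \<tau> + \<tau>\<^sup>2))" .
  have step: "?g i \<le> (1 + 3 / K) / r\<^sup>2" if "i \<in> A" for i
  proof -
    define y where "y = pos i - c"
    have ny: "K \<le> norm y" using that r by (auto simp: A_def y_def dist_norm)
    have d: "dist (pos i) (fst B) = norm y" "dist (pos (i - dy)) (fst B) = norm (y - e2)"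
      "dist (pos (i - dx)) (fst B) = norm (y - e1)"
      by (simp_all add: y_def defs dist_norm pos_diff algebra_simps)
    have sq: "(chi \<tau> B i - chi \<tau> B j)\<^sup>2 \<le> ((dist (pos i) (fst B) - dist (pos j) (fst B)) / r)\<^sup>2" for j
      using chi_lipschitz[of B \<tau> i j] r by (intro abs_le_square_iff[THEN iffD1]) (simp add: defs)
    have "?g i \<le> ((norm y - norm (y - e2)) / r)\<^sup>2 + ((norm y - norm (y - e1)) / r)\<^sup>2"
      using sq[of "i - dy"] sq[of "i - dx"] unfolding d by (rule add_mono)
    also have "\<dots> = ((norm y - norm (y - e2))\<^sup>2 + (norm y - norm (y - e1))\<^sup>2) / r\<^sup>2"
      by (simp add: power_divide add_divide_distrib)
    also have "\<dots> \<le> (1 + 3 / K) / r\<^sup>2"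
      using two_steps_square_le[OF K(1) ny] by (intro divide_right_mono) auto
    finally show ?thesis .
  qed
  have "dirichlet F (chi \<tau> B) = sum ?g A"
    unfolding dirichlet_def
  proof (rule sum.mono_neutral_right)
    show "\<forall>i\<in>F - A. ?g i = 0" using out by blast
  qed (use F in \<open>auto simp: A_def\<close>)
  also have "\<dots> \<le> (\<Sum>i\<in>A. (1 + 3 / K) / r\<^sup>2)" using step by (intro sum_mono)
  also have "\<dots> = real (card A) * ((1 + 3 / K) / r\<^sup>2)" by simp
  also have "\<dots> \<le> (r\<^sup>2 * (pi * (2 * \<tau> + \<tau>\<^sup>2))) * ((1 + 3 / K) / r\<^sup>2)"
    using cA K by (intro mult_right_mono) auto
  also have "\<dots> = (1 + 3 / K) * (pi * (2 * \<tau> + \<tau>\<^sup>2))" using r by simp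
  finally show ?thesis .
qed

text \<open>At a given bond, or a given point, at most one of several disjointly supported functions
  contributes; the square and the size of the sum are then those of a single term.\<close>

lemma sum_at_most_one_nonzero:
  fixes g :: "'a \<Rightarrow> real"
  assumes A: "finite A" and orth: "\<And>a b. a \<in> A \<Longrightarrow> b \<in> A \<Longrightarrow> a \<noteq> b \<Longrightarrow> g a = 0 \<or> g b = 0"
  shows "(\<Sum>a\<in>A. g a)\<^sup>2 = (\<Sum>a\<in>A. (g a)\<^sup>2)"
    and "0 \<le> M \<Longrightarrow> (\<And>a. a \<in> A \<Longrightarrow> \<bar>g a\<bar> \<le> M) \<Longrightarrow> \<bar>\<Sum>a\<in>A. g a\<bar> \<le> M"
proof -
  have "(\<forall>a\<in>A. g a = 0) \<or> (\<exists>a\<in>A. (\<Sum>a\<in>A. g a) = g a \<and> (\<Sum>a\<in>A. (g a)\<^sup>2) = (g a)\<^sup>2)"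
  proof (cases "\<forall>a\<in>A. g a = 0")
    case False
    then obtain a where a: "a \<in> A" "g a \<noteq> 0" by blast
    have z: "g b = 0" if "b \<in> A - {a}" for b using orth[of a b] a that by auto
    have "(\<Sum>a\<in>A. g a) = (\<Sum>a\<in>{a}. g a)" "(\<Sum>a\<in>A. (g a)\<^sup>2) = (\<Sum>a\<in>{a}. (g a)\<^sup>2)"
      by (rule sum.mono_neutral_right; use A a z in auto)+
    then show ?thesis using a by auto
  qed simp
  then show "(\<Sum>a\<in>A. g a)\<^sup>2 = (\<Sum>a\<in>A. (g a)\<^sup>2)"
    and "0 \<le> M \<Longrightarrow> (\<And>a. a \<in> A \<Longrightarrow> \<bar>g a\<bar> \<le> M) \<Longrightarrow> \<bar>\<Sum>a\<in>A. g a\<bar> \<le> M"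
    by auto
qed

definition bdeg :: "(int \<times> int) set \<Rightarrow> (int \<times> int \<Rightarrow> int) \<Rightarrow> (real^2) \<times> real \<Rightarrow> int" where
  "bdeg D d B = (\<Sum>i\<in>{i\<in>D. inball i B}. d i)"

text \<open>A ball holding an index outside \<open>D\<close> comes near the complement of the
  domain. A cone around it need not be supported in \<open>D\<close>, and test functions are small
  there, so such balls are left out of the degree count.\<close>

definition interior_ball :: "(int \<times> int) set \<Rightarrow> (real^2) \<times> real \<Rightarrow> bool" where
  "interior_ball D B \<longleftrightarrow> (\<forall>i. inball i B \<longrightarrow> i \<in> D)"

definition covers :: "((real^2) \<times> real) set \<Rightarrow> (int \<times> int) set \<Rightarrow> (int \<times> int \<Rightarrow> int) \<Rightarrow> bool" where
  "covers \<B> D d \<longleftrightarrow> (\<forall>i\<in>D. d i \<noteq> 0 \<longrightarrow> (\<exists>B\<in>\<B>. inball i B))"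

definition total_deg :: "(int \<times> int) set \<Rightarrow> (int \<times> int \<Rightarrow> int) \<Rightarrow> ((real^2) \<times> real) set \<Rightarrow> int" where
  "total_deg D d \<B> = (\<Sum>B\<in>{B\<in>\<B>. interior_ball D B}. \<bar>bdeg D d B\<bar>)"

lemma interior_ball_bin: "bin B B' \<Longrightarrow> interior_ball D B' \<Longrightarrow> interior_ball D B"
  using bin_inball unfolding interior_ball_def by blast

lemma bsep_disjoint:
  assumes "bsep \<tau> \<B>" "0 \<le> \<tau>" "\<forall>B\<in>\<B>. 0 < snd B" "B \<in> \<B>" "B' \<in> \<B>"
    "dist x (fst B) \<le> (1 + \<tau>) * snd B" "dist x (fst B') \<le> (1 + \<tau>) * snd B'"
  shows "B = B'"
proof (rule ccontr)
  assume "B \<noteq> B'"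
  then have "(1 + \<tau>) * (snd B + snd B') < dist (fst B) (fst B')" using assms(1,4,5) by (auto simp: bsep_def)
  then show False using assms(6,7) dist_triangle[of "fst B" "fst B'" x]
    by (simp add: dist_commute algebra_simps)
qed

lemma inball_dilate: 
  assumes "inball i B" "0 \<le> \<tau>" "0 < snd B" shows "dist (pos i) (fst B) \<le> (1 + \<tau>) * snd B"
proof -
  have "0 \<le> \<tau> * snd B" using assms by simp
  then show ?thesis using assms(1) unfolding inball_def distrib_right by linarith
qed

lemma bsep_unique:
  assumes "bsep \<tau> \<B>" "0 \<le> \<tau>" "\<forall>B\<in>\<B>. 0 < snd B" "B \<in> \<B>" "B' \<in> \<B>" "inball i B" "inball i B'"
  shows "B = B'"
  using assms by (intro bsep_disjoint[of \<tau> \<B> B B' "pos i"] inball_dilate) auto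

text \<open>Degrees add when balls are absorbed, so the sum of their absolute values can drop only
  by cancellation, or because the absorbing ball is no longer interior. Every ball inside an
  interior one is interior itself, which is why the right-hand side may be restricted to interior
  dilations.\<close>

lemma total_deg_mono:
  assumes D: "finite D" and \<B>: "finite \<B>" "\<forall>B\<in>\<B>. 0 < snd B" "bsep \<tau> \<B>" "covers \<B> D d"
    and \<B>': "finite \<B>'" "\<forall>B\<in>\<B>'. 0 < snd B" "bsep \<tau> \<B>'"
    and \<tau>: "0 \<le> \<tau>" and sub: "\<forall>B\<in>\<B>. \<exists>B'\<in>\<B>'. bin (dilate \<tau> B) B'"
  shows "total_deg D d \<B>' \<le> (\<Sum>B\<in>{B\<in>\<B>. interior_ball D (dilate \<tau> B)}. \<bar>bdeg D d B\<bar>)"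
proof -
  obtain f where f: "\<And>B. B \<in> \<B> \<Longrightarrow> f B \<in> \<B>' \<and> bin (dilate \<tau> B) (f B)" using sub by metis
  have bf: "bin B (f B)" if "B \<in> \<B>" for B
    using bin_trans[OF bin_dilate f[OF that, THEN conjunct2]] \<tau> \<B>(2) that by (simp add: less_imp_le)
  have deg: "bdeg D d B' = (\<Sum>B\<in>{B\<in>\<B>. f B = B'}. bdeg D d B)" if B': "B' \<in> \<B>'" for B'
  proof -
    let ?S = "\<lambda>B. {i\<in>D. d i \<noteq> 0 \<and> inball i B}"
    have e: "bdeg D d B = sum d (?S B)" for B
      unfolding bdeg_def using D by (intro sum.mono_neutral_right) auto
    have U: "?S B' = (\<Union>B\<in>{B\<in>\<B>. f B = B'}. ?S B)"
    proof (intro equalityI subsetI)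
      fix i assume i: "i \<in> ?S B'"
      then obtain B where B: "B \<in> \<B>" "inball i B" using \<B>(4) by (auto simp: covers_def)
      then have "inball i (f B)" using bf bin_inball by blast
      \<comment> \<open>A vortex in the new ball B' lies in some old ball, hence in the host of that
        ball; separation of the new family forces this host to be B'.\<close>
      then have "f B = B'" using bsep_unique[OF \<B>'(3) \<tau> \<B>'(2), of "f B" B' i] f[OF B(1)] B' i by auto
      then show "i \<in> (\<Union>B\<in>{B\<in>\<B>. f B = B'}. ?S B)" by (intro UN_I[of B]) (use B i in auto)
    next
      fix i assume "i \<in> (\<Union>B\<in>{B\<in>\<B>. f B = B'}. ?S B)"
      then obtain B where "B \<in> \<B>" "f B = B'" "i \<in> ?S B" by blast
      then show "i \<in> ?S B'" using bin_inball[OF bf[of B], of i] by auto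
    qed
    have "bdeg D d B' = sum d (\<Union>B\<in>{B\<in>\<B>. f B = B'}. ?S B)" unfolding e U ..
    also have "\<dots> = (\<Sum>B\<in>{B\<in>\<B>. f B = B'}. sum d (?S B))"
    proof (rule sum.UNION_disjoint)
      show "\<forall>A\<in>{B \<in> \<B>. f B = B'}. \<forall>B\<in>{B \<in> \<B>. f B = B'}. A \<noteq> B \<longrightarrow> ?S A \<inter> ?S B = {}"
        using bsep_unique[OF \<B>(3) \<tau> \<B>(2)] by blast
    qed (use D \<B> in auto)
    finally show ?thesis unfolding e .
  qed
  let ?I' = "{B'\<in>\<B>'. interior_ball D B'}"
  have "total_deg D d \<B>' \<le> (\<Sum>B'\<in>?I'. \<Sum>B\<in>{B\<in>\<B>. f B = B'}. \<bar>bdeg D d B\<bar>)"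
    unfolding total_deg_def
  proof (rule sum_mono)
    fix B' assume "B' \<in> ?I'"
    then have "bdeg D d B' = (\<Sum>B\<in>{B\<in>\<B>. f B = B'}. bdeg D d B)" using deg by auto
    then show "\<bar>bdeg D d B'\<bar> \<le> (\<Sum>B\<in>{B\<in>\<B>. f B = B'}. \<bar>bdeg D d B\<bar>)" by (simp add: sum_abs)
  qed
  also have "\<dots> = (\<Sum>B\<in>(\<Union>B'\<in>?I'. {B\<in>\<B>. f B = B'}). \<bar>bdeg D d B\<bar>)"
    by (rule sum.UNION_disjoint[symmetric]) (use \<B> \<B>' in auto)
  also have "\<dots> \<le> (\<Sum>B\<in>{B\<in>\<B>. interior_ball D (dilate \<tau> B)}. \<bar>bdeg D d B\<bar>)"
  proof (rule sum_mono2)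
    show "(\<Union>B'\<in>?I'. {B\<in>\<B>. f B = B'}) \<subseteq> {B\<in>\<B>. interior_ball D (dilate \<tau> B)}"
      using interior_ball_bin[OF conjunct2[OF f]] by blast
  qed (use \<B> in auto)
  finally show ?thesis .
qed

text \<open>A lower bound for the gain per unit of degree when \<open>\<plusminus>chi\<close> is added to the potential: its linear
  term is \<open>2\<pi>\<close> times the plateau of the cone, and the Dirichlet energy enters with weight \<open>c\<close>.\<close>

definition growth_rate :: "real \<Rightarrow> real \<Rightarrow> real \<Rightarrow> real" where
  "growth_rate c \<tau> K = 2 * pi * (\<tau> - 4 / K) - c * ((1 + 3 / K) * (pi * (2 * \<tau> + \<tau>\<^sup>2)))"

text \<open>For each ball with interior dilation a cone is added, with the sign of the degree. Its
  plateau covers all vortices of the ball and it vanishes at all others, so the linear term sees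
  exactly the degree. At each bond at most one of the old potential and the cones varies: Dirichlet
  energies add up and the Lipschitz bound 1 / K is inherited.\<close>

lemma ball_growth_step:
  fixes d :: "int \<times> int \<Rightarrow> int" and \<psi> :: "int \<times> int \<Rightarrow> real"
  assumes D: "finite D" and \<tau>: "0 < \<tau>" and K: "2 \<le> K" "4 \<le> \<tau> * K" and c: "0 \<le> c"
    and \<B>: "finite \<B>" "\<forall>B\<in>\<B>. K \<le> snd B" "bsep \<tau> \<B>" "covers \<B> D d"
    and supp0: "\<forall>i. \<psi> i \<noteq> 0 \<longrightarrow> i \<in> D \<and> (\<exists>B\<in>\<B>. dist (pos i) (fst B) \<le> snd B - 2)"
    and lip0: "\<forall>i. \<bar>\<psi> i - \<psi> (i - dy)\<bar> \<le> 1 / K \<and> \<bar>\<psi> i - \<psi> (i - dx)\<bar> \<le> 1 / K"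
    and \<gamma>: "0 \<le> growth_rate c \<tau> K"
  shows "\<exists>\<psi>'.
    (\<forall>i. \<psi>' i \<noteq> 0 \<longrightarrow> i \<in> D \<and> (\<exists>B\<in>\<B>. dist (pos i) (fst B) \<le> (1 + \<tau>) * snd B - 2)) \<and>
    (\<forall>i. \<bar>\<psi>' i - \<psi>' (i - dy)\<bar> \<le> 1 / K \<and> \<bar>\<psi>' i - \<psi>' (i - dx)\<bar> \<le> 1 / K) \<and>
    2 * pi * (\<Sum>i\<in>D. of_int (d i) * \<psi> i) - c * dirichlet (nbhd D) \<psi>
       + growth_rate c \<tau> K * of_int (\<Sum>B\<in>{B\<in>\<B>. interior_ball D (dilate \<tau> B)}. \<bar>bdeg D d B\<bar>)
      \<le> 2 * pi * (\<Sum>i\<in>D. of_int (d i) * \<psi>' i) - c * dirichlet (nbhd D) \<psi>'"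
proof -
  have \<psi>: "i \<in> D \<and> (\<exists>B\<in>\<B>. dist (pos i) (fst B) \<le> snd B - 2)" if "\<psi> i \<noteq> 0" for i
    using supp0 that by blast
  have lip: "\<bar>\<psi> i - \<psi> (i - dy)\<bar> \<le> 1 / K" "\<bar>\<psi> i - \<psi> (i - dx)\<bar> \<le> 1 / K" for i
    using lip0 by blast+
  define I where "I = {B\<in>\<B>. interior_ball D (dilate \<tau> B)}"
  have fI: "finite I" using \<B> by (simp add: I_def)
  have rp: "0 < snd B" "2 \<le> snd B" "4 \<le> \<tau> * snd B" if "B \<in> \<B>" for B
  proof -
    have "K \<le> snd B" using \<B> that by auto
    then show "0 < snd B" "2 \<le> snd B" using K by auto
    show "4 \<le> \<tau> * snd B" using K \<tau> \<open>K \<le> snd B\<close> by (meson mult_left_mono less_imp_le order_trans)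
  qed
  define s where "s B = real_of_int (sgn (bdeg D d B))" for B
  have s1: "\<bar>s B\<bar> \<le> 1" for B by (simp add: s_def sgn_if)
  define \<psi>' where "\<psi>' i = \<psi> i + (\<Sum>B\<in>I. s B * chi \<tau> B i)" for i
  have chi_supp: "dist (pos i) (fst B) \<le> (1 + \<tau>) * snd B - 2" if "B \<in> \<B>" "chi \<tau> B i \<noteq> 0" for B i
    using chi_outside[of B \<tau> i] rp[OF that(1)] that(2) by linarith
  have supp: "i \<in> D \<and> (\<exists>B\<in>\<B>. dist (pos i) (fst B) \<le> (1 + \<tau>) * snd B - 2)" if "\<psi>' i \<noteq> 0" for i
  proof (cases "\<psi> i = 0")
    case True
    with that have "(\<Sum>B\<in>I. s B * chi \<tau> B i) \<noteq> 0" by (simp add: \<psi>'_def)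
    have "\<exists>B\<in>I. chi \<tau> B i \<noteq> 0"
    proof (rule ccontr)
      assume "\<not> ?thesis"
      then have "(\<Sum>B\<in>I. s B * chi \<tau> B i) = 0" by (intro sum.neutral) simp
      with \<open>(\<Sum>B\<in>I. s B * chi \<tau> B i) \<noteq> 0\<close> show False by simp
    qed
    then obtain B where B: "B \<in> I" "chi \<tau> B i \<noteq> 0" by blast
    then have d: "dist (pos i) (fst B) \<le> (1 + \<tau>) * snd B - 2" using chi_supp by (auto simp: I_def)
    then have "inball i (dilate \<tau> B)" by (simp add: inball_def dilate_def)
    then have "i \<in> D" using B by (unfold I_def interior_ball_def, blast)
    then show ?thesis using d B unfolding I_def by blast
  next
    case False
    then obtain B where B: "i \<in> D" "B \<in> \<B>" "dist (pos i) (fst B) \<le> snd B - 2" using \<psi> by blast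
    moreover have "0 \<le> \<tau> * snd B" using rp[OF B(2)] \<tau> by simp
    ultimately show ?thesis by (intro conjI bexI[of _ B]) (auto simp: algebra_simps)
  qed
  have chi_ann: "snd B + 1 < dist (pos i) (fst B) \<and> dist (pos i) (fst B) < (1 + \<tau>) * snd B - 1"
    if "B \<in> \<B>" "s B * (chi \<tau> B i - chi \<tau> B j) \<noteq> 0" "dist (pos i) (pos j) = 1" for B i j
    using chi_step_annulus[of \<tau> B i j] rp[OF that(1)] that(2,3) by auto
  have sB0: "\<forall>B\<in>\<B>. 0 < snd B" using rp by blast
  have step: "(\<psi>' i - \<psi>' j)\<^sup>2 = (\<psi> i - \<psi> j)\<^sup>2 + (\<Sum>B\<in>I. (s B)\<^sup>2 * (chi \<tau> B i - chi \<tau> B j)\<^sup>2)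
      \<and> \<bar>\<psi>' i - \<psi>' j\<bar> \<le> 1 / K" if ij: "dist (pos i) (pos j) = 1" and l: "\<bar>\<psi> i - \<psi> j\<bar> \<le> 1 / K" for i j
  proof -
    let ?g = "\<lambda>B. s B * (chi \<tau> B i - chi \<tau> B j)"
    have e: "\<psi>' i - \<psi>' j = (\<psi> i - \<psi> j) + (\<Sum>B\<in>I. ?g B)"
      by (simp add: \<psi>'_def sum_subtractf right_diff_distrib)
    have orth: "?g A = 0 \<or> ?g B = 0" if "A \<in> I" "B \<in> I" "A \<noteq> B" for A B
    proof (rule ccontr)
      assume "\<not> ?thesis"
      then have "dist (pos i) (fst A) \<le> (1 + \<tau>) * snd A" "dist (pos i) (fst B) \<le> (1 + \<tau>) * snd B"
        using chi_ann[OF _ _ ij, of A] chi_ann[OF _ _ ij, of B] that by (auto simp: I_def)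
      then show False using bsep_disjoint[OF \<B>(3) _ sB0, of A B "pos i"] that \<tau> by (auto simp: I_def)
    qed
    have gM: "\<bar>?g B\<bar> \<le> 1 / K" if "B \<in> I" for B
    proof -
      have B: "B \<in> \<B>" "K \<le> snd B" using that \<B> by (auto simp: I_def)
      have "\<bar>dist (pos i) (fst B) - dist (pos j) (fst B)\<bar> \<le> 1"
        using ij dist_triangle[of "pos i" "fst B" "pos j"] dist_triangle[of "pos j" "fst B" "pos i"]
        by (simp add: dist_commute abs_le_iff)
      then have "\<bar>chi \<tau> B i - chi \<tau> B j\<bar> \<le> 1 / snd B"
        using chi_lipschitz[of B \<tau> i j] rp[OF B(1)] by (meson divide_right_mono less_imp_le order_trans)
      also have "\<dots> \<le> 1 / K" using B K by (intro divide_left_mono mult_pos_pos) auto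
      finally have "\<bar>chi \<tau> B i - chi \<tau> B j\<bar> \<le> 1 / K" .
      then have "\<bar>s B\<bar> * \<bar>chi \<tau> B i - chi \<tau> B j\<bar> \<le> 1 * (1 / K)" using s1 by (intro mult_mono) auto
      then show ?thesis by (simp add: abs_mult)
    qed
    note S = sum_at_most_one_nonzero[OF fI, of ?g, OF orth]
    have SM: "\<bar>\<Sum>B\<in>I. ?g B\<bar> \<le> 1 / K" using gM K by (intro S(2)) auto
    \<comment> \<open>The old potential is supported at depth 2 inside the balls and can vary only
      on bonds at depth at least 1; a cone varies only at distance more than 1 outside its
      ball.\<close>
    have alt: "\<psi> i - \<psi> j = 0 \<or> (\<forall>B\<in>I. ?g B = 0)"
    proof (rule ccontr)
      assume n: "\<not> ?thesis"
      then obtain B where B: "B \<in> I" "?g B \<noteq> 0" by blast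
      then have BB: "B \<in> \<B>" by (simp add: I_def)
      from n have "\<psi> i \<noteq> 0 \<or> \<psi> j \<noteq> 0" by auto
      then obtain A where A: "A \<in> \<B>" "dist (pos i) (fst A) \<le> snd A - 2 \<or> dist (pos j) (fst A) \<le> snd A - 2"
        using \<psi> by blast
      then have dA: "dist (pos i) (fst A) \<le> snd A - 1"
        using ij dist_triangle[of "pos i" "fst A" "pos j"] by auto
      moreover have t: "0 \<le> \<tau> * snd A" using rp[OF A(1)] \<tau> by simp
      ultimately have "dist (pos i) (fst A) \<le> (1 + \<tau>) * snd A" unfolding distrib_right by linarith
      moreover note ann = chi_ann[OF BB B(2) ij]
      ultimately have "A = B" using bsep_disjoint[OF \<B>(3) _ sB0 A(1) BB, of "pos i"] \<tau> by auto
      then show False using dA ann by auto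
    qed
    then have alt: "\<psi> i - \<psi> j = 0 \<or> (\<Sum>B\<in>I. ?g B) = 0" using sum.neutral[of I ?g] by blast
    then have "(\<psi>' i - \<psi>' j)\<^sup>2 = (\<psi> i - \<psi> j)\<^sup>2 + (\<Sum>B\<in>I. ?g B)\<^sup>2" unfolding e by auto
    also have "(\<Sum>B\<in>I. ?g B)\<^sup>2 = (\<Sum>B\<in>I. (?g B)\<^sup>2)" by (rule S(1)) blast+
    finally have "(\<psi>' i - \<psi>' j)\<^sup>2 = (\<psi> i - \<psi> j)\<^sup>2 + (\<Sum>B\<in>I. (s B)\<^sup>2 * (chi \<tau> B i - chi \<tau> B j)\<^sup>2)"
      by (simp add: power_mult_distrib)
    moreover have "\<bar>\<psi>' i - \<psi>' j\<bar> \<le> 1 / K" unfolding e using alt l SM by auto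
    ultimately show ?thesis by blast
  qed
  note sy = step[OF dist_pos_step(2) lip(1)] and sx = step[OF dist_pos_step(1) lip(2)]
  have dir: "dirichlet (nbhd D) \<psi>' = dirichlet (nbhd D) \<psi> + (\<Sum>B\<in>I. (s B)\<^sup>2 * dirichlet (nbhd D) (chi \<tau> B))"
  proof -
    have "dirichlet (nbhd D) \<psi>' = dirichlet (nbhd D) \<psi> + (\<Sum>i\<in>nbhd D. \<Sum>B\<in>I.
        (s B)\<^sup>2 * ((chi \<tau> B i - chi \<tau> B (i - dy))\<^sup>2 + (chi \<tau> B i - chi \<tau> B (i - dx))\<^sup>2))"
      unfolding dirichlet_def sy[THEN conjunct1] sx[THEN conjunct1]
      by (simp add: sum.distrib distrib_left)
    also have "(\<Sum>i\<in>nbhd D. \<Sum>B\<in>I.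
        (s B)\<^sup>2 * ((chi \<tau> B i - chi \<tau> B (i - dy))\<^sup>2 + (chi \<tau> B i - chi \<tau> B (i - dx))\<^sup>2))
       = (\<Sum>B\<in>I. (s B)\<^sup>2 * dirichlet (nbhd D) (chi \<tau> B))"
      unfolding dirichlet_def sum_distrib_left by (rule sum.swap)
    finally show ?thesis .
  qed
  \<comment> \<open>A vortex outside B lies in another ball of the family, whose dilation is
    disjoint from that of B; the cone of B is zero there.\<close>
  have coup: "(\<Sum>i\<in>D. of_int (d i) * chi \<tau> B i) = (\<tau> - 4 / snd B) * of_int (bdeg D d B)" if "B \<in> \<B>" for B
  proof -
    have "(\<Sum>i\<in>D. of_int (d i) * chi \<tau> B i) = (\<Sum>i\<in>{i\<in>D. inball i B}. of_int (d i) * chi \<tau> B i)"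
    proof (intro sum.mono_neutral_right ballI)
      fix i assume i: "i \<in> D - {i\<in>D. inball i B}"
      show "of_int (d i) * chi \<tau> B i = 0"
      proof (cases "d i = 0")
        case False
        then obtain A where A: "A \<in> \<B>" "inball i A" using \<B>(4) i by (auto simp: covers_def)
        have "chi \<tau> B i = 0"
        proof (rule ccontr)
          assume "chi \<tau> B i \<noteq> 0"
          then have "dist (pos i) (fst B) \<le> (1 + \<tau>) * snd B" using chi_supp[OF that, of i] by linarith
          moreover have "dist (pos i) (fst A) \<le> (1 + \<tau>) * snd A"
            using A rp[OF A(1)] \<tau> by (intro inball_dilate) auto
          ultimately have "A = B" using bsep_disjoint[OF \<B>(3) _ sB0 A(1) that, of "pos i"] \<tau> by auto
          then show False using A i by auto
        qed
        then show ?thesis by simp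
      qed simp
    qed (use D in auto)
    also have "\<dots> = (\<Sum>i\<in>{i\<in>D. inball i B}. of_int (d i) * (\<tau> - 4 / snd B))"
      using rp[OF that] by (intro sum.cong refl) (auto simp: inball_def chi_inside)
    also have "\<dots> = (\<tau> - 4 / snd B) * of_int (bdeg D d B)"
      by (simp add: bdeg_def sum_distrib_left mult.commute)
    finally show ?thesis .
  qed
  have gain: "growth_rate c \<tau> K * \<bar>of_int (bdeg D d B)\<bar>
      \<le> 2 * pi * (s B * ((\<tau> - 4 / snd B) * of_int (bdeg D d B))) - c * ((s B)\<^sup>2 * dirichlet (nbhd D) (chi \<tau> B))"
    if "B \<in> I" for B
  proof (cases "bdeg D d B = 0")
    case False
    have B: "B \<in> \<B>" "K \<le> snd B" using that \<B> by (auto simp: I_def)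
    define m where "m = \<bar>real_of_int (bdeg D d B)\<bar>"
    have m: "1 \<le> m" using False by (simp add: m_def)
    have sm: "s B * real_of_int (bdeg D d B) = m" "(s B)\<^sup>2 = 1"
      using False by (auto simp: s_def m_def sgn_if)
    have fF: "finite (nbhd D)" using D by (simp add: nbhd_def)
    have cost: "dirichlet (nbhd D) (chi \<tau> B) \<le> (1 + 3 / K) * (pi * (2 * \<tau> + \<tau>\<^sup>2))"
      using fF K \<tau> B by (intro dirichlet_chi_le) auto
    have p: "0 \<le> (1 + 3 / K) * (pi * (2 * \<tau> + \<tau>\<^sup>2))" using K \<tau> by simp
    have "4 / snd B \<le> 4 / K" using B K by (intro divide_left_mono mult_pos_pos) auto
    then have 1: "2 * pi * (\<tau> - 4 / K) * m \<le> 2 * pi * (\<tau> - 4 / snd B) * m"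
      using m by (intro mult_right_mono mult_left_mono) auto
    \<comment> \<open>The height of the cone, and hence its cost, does not depend on the degree.
      Charging the cost m >= 1 times makes the whole bound proportional to m.\<close>
    have 2: "c * dirichlet (nbhd D) (chi \<tau> B) \<le> c * ((1 + 3 / K) * (pi * (2 * \<tau> + \<tau>\<^sup>2))) * m"
    proof -
      have "c * dirichlet (nbhd D) (chi \<tau> B) \<le> c * ((1 + 3 / K) * (pi * (2 * \<tau> + \<tau>\<^sup>2)))"
        using c cost by (intro mult_left_mono)
      also have "\<dots> \<le> c * ((1 + 3 / K) * (pi * (2 * \<tau> + \<tau>\<^sup>2))) * m"
        using mult_left_mono[OF m, of "c * ((1 + 3 / K) * (pi * (2 * \<tau> + \<tau>\<^sup>2)))"] c p by simp
      finally show ?thesis .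
    qed
    have 3: "s B * ((\<tau> - 4 / snd B) * of_int (bdeg D d B)) = (\<tau> - 4 / snd B) * m"
      using sm(1) by (simp add: mult.left_commute)
    have "growth_rate c \<tau> K * m = 2 * pi * (\<tau> - 4 / K) * m - c * ((1 + 3 / K) * (pi * (2 * \<tau> + \<tau>\<^sup>2))) * m"
      by (simp only: growth_rate_def left_diff_distrib)
    then show ?thesis using 1 2 unfolding 3 sm(2) m_def[symmetric] mult.assoc mult_1 by linarith
  qed (simp add: s_def)
  have "growth_rate c \<tau> K * of_int (\<Sum>B\<in>I. \<bar>bdeg D d B\<bar>) = (\<Sum>B\<in>I. growth_rate c \<tau> K * \<bar>of_int (bdeg D d B)\<bar>)"
    by (simp add: sum_distrib_left)
  also have "\<dots> \<le> (\<Sum>B\<in>I. 2 * pi * (s B * ((\<tau> - 4 / snd B) * of_int (bdeg D d B)))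
       - c * ((s B)\<^sup>2 * dirichlet (nbhd D) (chi \<tau> B)))"
    by (intro sum_mono gain)
  also have "\<dots> = 2 * pi * (\<Sum>B\<in>I. s B * ((\<tau> - 4 / snd B) * of_int (bdeg D d B)))
      - c * (\<Sum>B\<in>I. (s B)\<^sup>2 * dirichlet (nbhd D) (chi \<tau> B))"
    by (simp add: sum_subtractf sum_distrib_left)
  also have "(\<Sum>B\<in>I. s B * ((\<tau> - 4 / snd B) * of_int (bdeg D d B))) = (\<Sum>B\<in>I. s B * (\<Sum>i\<in>D. of_int (d i) * chi \<tau> B i))"
    by (intro sum.cong refl) (simp add: coup I_def)
  also have "\<dots> = (\<Sum>i\<in>D. of_int (d i) * (\<Sum>B\<in>I. s B * chi \<tau> B i))"
    unfolding sum_distrib_left by (subst sum.swap) (simp add: ac_simps)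
  also have "\<dots> = (\<Sum>i\<in>D. of_int (d i) * \<psi>' i) - (\<Sum>i\<in>D. of_int (d i) * \<psi> i)"
    by (simp add: \<psi>'_def distrib_left sum.distrib)
  also have "(\<Sum>B\<in>I. (s B)\<^sup>2 * dirichlet (nbhd D) (chi \<tau> B)) = dirichlet (nbhd D) \<psi>' - dirichlet (nbhd D) \<psi>"
    using dir by simp
  finally have fin: "2 * pi * (\<Sum>i\<in>D. of_int (d i) * \<psi> i) - c * dirichlet (nbhd D) \<psi>
       + growth_rate c \<tau> K * of_int (\<Sum>B\<in>I. \<bar>bdeg D d B\<bar>)
      \<le> 2 * pi * (\<Sum>i\<in>D. of_int (d i) * \<psi>' i) - c * dirichlet (nbhd D) \<psi>'"
    by (simp only: right_diff_distrib)
  show ?thesis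
    using supp sy sx fin unfolding I_def by (intro exI[of _ \<psi>'] conjI allI impI; blast)
qed

text \<open>One step dilates all balls, adds the cones and merges. The exponent counts dilations
  plus mergers. The invariant that the potential is supported at depth 2 inside the balls is what
  makes the next cones orthogonal to it.\<close>

lemma ball_growth:
  fixes d :: "int \<times> int \<Rightarrow> int"
  assumes D: "finite D" and \<tau>: "0 < \<tau>" and K: "2 \<le> K" "4 \<le> \<tau> * K" and c: "0 \<le> c"
    and \<B>0: "finite \<B>0" "\<forall>B\<in>\<B>0. K \<le> snd B" "covers \<B>0 D d"
    and \<gamma>: "0 \<le> growth_rate c \<tau> K"
  shows "\<exists>\<B> \<psi>. finite \<B> \<and> (\<forall>B\<in>\<B>. K \<le> snd B) \<and> bsep \<tau> \<B> \<and> card \<B> \<le> card \<B>0 \<and>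
    sum snd \<B> \<le> (1 + \<tau>) ^ (n + (card \<B>0 - card \<B>)) * sum snd \<B>0 \<and> covers \<B> D d \<and>
    (\<forall>i. \<psi> i \<noteq> 0 \<longrightarrow> i \<in> D \<and> (\<exists>B\<in>\<B>. dist (pos i) (fst B) \<le> snd B - 2)) \<and>
    (\<forall>i. \<bar>\<psi> i - \<psi> (i - dy)\<bar> \<le> 1 / K \<and> \<bar>\<psi> i - \<psi> (i - dx)\<bar> \<le> 1 / K) \<and>
    real n * growth_rate c \<tau> K * of_int (total_deg D d \<B>)
      \<le> 2 * pi * (\<Sum>i\<in>D. of_int (d i) * \<psi> i) - c * dirichlet (nbhd D) \<psi>"
proof (induction n)
  case 0
  obtain \<B> where B: "finite \<B>" "\<forall>B\<in>\<B>. K \<le> snd B" "bsep \<tau> \<B>" "card \<B> \<le> card \<B>0"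
    "sum snd \<B> \<le> (1 + \<tau>) ^ (card \<B>0 - card \<B>) * sum snd \<B>0" "\<forall>B\<in>\<B>0. \<exists>B'\<in>\<B>. bin B B'"
    using merge_balls[OF \<B>0(1,2), of \<tau>] \<tau> K by auto
  have "covers \<B> D d" using \<B>0(3) B(6) bin_inball unfolding covers_def by blast
  then show ?case using B K by (intro exI[of _ \<B>] exI[of _ "\<lambda>_. 0"]) (auto simp: dirichlet_def)
next
  case (Suc n)
  then obtain \<B> \<psi> where B: "finite \<B>" "\<forall>B\<in>\<B>. K \<le> snd B" "bsep \<tau> \<B>" "card \<B> \<le> card \<B>0"
    "sum snd \<B> \<le> (1 + \<tau>) ^ (n + (card \<B>0 - card \<B>)) * sum snd \<B>0" "covers \<B> D d"
    and \<psi>: "\<forall>i. \<psi> i \<noteq> 0 \<longrightarrow> i \<in> D \<and> (\<exists>B\<in>\<B>. dist (pos i) (fst B) \<le> snd B - 2)"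
    "\<forall>i. \<bar>\<psi> i - \<psi> (i - dy)\<bar> \<le> 1 / K \<and> \<bar>\<psi> i - \<psi> (i - dx)\<bar> \<le> 1 / K"
    and g: "real n * growth_rate c \<tau> K * of_int (total_deg D d \<B>)
      \<le> 2 * pi * (\<Sum>i\<in>D. of_int (d i) * \<psi> i) - c * dirichlet (nbhd D) \<psi>"
    by (elim exE conjE)
  define S where "S = (\<Sum>B\<in>{B\<in>\<B>. interior_ball D (dilate \<tau> B)}. \<bar>bdeg D d B\<bar>)"
  from ball_growth_step[OF D \<tau> K c B(1,2,3,6) \<psi> \<gamma>, folded S_def]
  obtain \<psi>' where \<psi>': "\<forall>i. \<psi>' i \<noteq> 0 \<longrightarrow> i \<in> D \<and> (\<exists>B\<in>\<B>. dist (pos i) (fst B) \<le> (1 + \<tau>) * snd B - 2)"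
    "\<forall>i. \<bar>\<psi>' i - \<psi>' (i - dy)\<bar> \<le> 1 / K \<and> \<bar>\<psi>' i - \<psi>' (i - dx)\<bar> \<le> 1 / K"
    and g': "2 * pi * (\<Sum>i\<in>D. of_int (d i) * \<psi> i) - c * dirichlet (nbhd D) \<psi>
       + growth_rate c \<tau> K * of_int S
      \<le> 2 * pi * (\<Sum>i\<in>D. of_int (d i) * \<psi>' i) - c * dirichlet (nbhd D) \<psi>'"
    by (elim exE conjE)
  have inj: "inj (dilate \<tau>)" using \<tau> by (auto simp: inj_def dilate_def prod_eq_iff)
  define \<B>d where "\<B>d = dilate \<tau> ` \<B>"
  have cd: "finite \<B>d" "card \<B>d = card \<B>" using B(1) inj by (auto simp: \<B>d_def intro!: card_image intro: inj_on_subset)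
  have Kd: "\<forall>B\<in>\<B>d. K \<le> snd B"
  proof
    fix B' assume "B' \<in> \<B>d"
    then obtain B where "B' = dilate \<tau> B" "K \<le> snd B" using B(2) by (auto simp: \<B>d_def)
    moreover have "1 * snd B \<le> (1 + \<tau>) * snd B" using \<tau> K \<open>K \<le> snd B\<close> by (intro mult_right_mono) auto
    ultimately show "K \<le> snd B'" by (simp add: dilate_def)
  qed
  have sd: "sum snd \<B>d = (1 + \<tau>) * sum snd \<B>"
    unfolding \<B>d_def using inj
    by (subst sum.reindex) (auto simp: dilate_def sum_distrib_left o_def intro: inj_on_subset)
  obtain \<B>' where B': "finite \<B>'" "\<forall>B\<in>\<B>'. K \<le> snd B" "bsep \<tau> \<B>'" "card \<B>' \<le> card \<B>"
    "sum snd \<B>' \<le> (1 + \<tau>) ^ (card \<B> - card \<B>') * sum snd \<B>d" "\<forall>B\<in>\<B>d. \<exists>B'\<in>\<B>'. bin B B'"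
    using merge_balls[OF cd(1) Kd, of \<tau>] \<tau> K unfolding cd(2) by auto
  have sub: "\<forall>B\<in>\<B>. \<exists>B'\<in>\<B>'. bin (dilate \<tau> B) B'" using B'(6) by (auto simp: \<B>d_def)
  have pos: "\<forall>B\<in>\<B>. 0 < snd B" "\<forall>B\<in>\<B>'. 0 < snd B" using B(2) B'(2) K by fastforce+
  have "sum snd \<B>' \<le> (1 + \<tau>) ^ (card \<B> - card \<B>') * ((1 + \<tau>) * sum snd \<B>)" using B'(5) by (simp add: sd)
  also have "\<dots> \<le> (1 + \<tau>) ^ (card \<B> - card \<B>') * ((1 + \<tau>) * ((1 + \<tau>) ^ (n + (card \<B>0 - card \<B>)) * sum snd \<B>0))"
    using B(5) \<tau> by (intro mult_left_mono) auto
  also have "\<dots> = (1 + \<tau>) ^ ((card \<B> - card \<B>') + Suc (n + (card \<B>0 - card \<B>))) * sum snd \<B>0"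
    by (simp add: power_add)
  \<comment> \<open>The truncated differences telescope because the number of balls never
    increases.\<close>
  also have "(card \<B> - card \<B>') + Suc (n + (card \<B>0 - card \<B>)) = Suc n + (card \<B>0 - card \<B>')"
    using B(4) B'(4) by simp
  finally have sums: "sum snd \<B>' \<le> (1 + \<tau>) ^ (Suc n + (card \<B>0 - card \<B>')) * sum snd \<B>0" .
  have cov: "covers \<B>' D d"
  proof -
    have "\<exists>B'\<in>\<B>'. bin B B'" if "B \<in> \<B>" for B
      using sub that bin_trans[OF bin_dilate[of \<tau> B]] \<tau> pos(1) by (meson less_imp_le)
    then show ?thesis using B(6) bin_inball unfolding covers_def by blast
  qed
  have m1: "total_deg D d \<B>' \<le> S" unfolding S_def
    using total_deg_mono[OF D B(1) pos(1) B(3,6) B'(1) pos(2) B'(3) _ sub] \<tau> by simp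
  have m2: "S \<le> total_deg D d \<B>" unfolding S_def total_deg_def
  proof (rule sum_mono2)
    show "{B\<in>\<B>. interior_ball D (dilate \<tau> B)} \<subseteq> {B\<in>\<B>. interior_ball D B}"
      using interior_ball_bin[OF bin_dilate[of \<tau>]] \<tau> pos(1) less_imp_le by blast
  qed (use B in auto)
  have "real (Suc n) * growth_rate c \<tau> K * of_int (total_deg D d \<B>')
     = real n * growth_rate c \<tau> K * of_int (total_deg D d \<B>') + growth_rate c \<tau> K * of_int (total_deg D d \<B>')"
    by (simp add: algebra_simps)
  \<comment> \<open>The total degree only decreases, so every earlier gain was at least the rate
    times the present degree.\<close>
  also have "\<dots> \<le> real n * growth_rate c \<tau> K * of_int (total_deg D d \<B>) + growth_rate c \<tau> K * of_int S"
    using m1 m2 \<gamma> by (intro add_mono mult_left_mono) auto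
  also have "\<dots> \<le> 2 * pi * (\<Sum>i\<in>D. of_int (d i) * \<psi>' i) - c * dirichlet (nbhd D) \<psi>'"
    using g g' by linarith
  finally have gg: "real (Suc n) * growth_rate c \<tau> K * of_int (total_deg D d \<B>') \<le> \<dots>" .
  \<comment> \<open>The depth 2 survives merging, because \<open>bin\<close> puts the whole dilated
    ball inside the new one.\<close>
  have loc: "i \<in> D \<and> (\<exists>B\<in>\<B>'. dist (pos i) (fst B) \<le> snd B - 2)" if "\<psi>' i \<noteq> 0" for i
  proof -
    obtain B where B: "i \<in> D" "B \<in> \<B>" "dist (pos i) (fst B) \<le> (1 + \<tau>) * snd B - 2" using \<psi>'(1) \<open>\<psi>' i \<noteq> 0\<close> by blast
    then obtain B' where B': "B' \<in> \<B>'" "bin (dilate \<tau> B) B'" using sub by blast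
    then have "dist (pos i) (fst B') \<le> snd B' - 2"
      using B(3) dist_triangle[of "pos i" "fst B'" "fst B"] by (simp add: bin_def dilate_def)
    then show ?thesis using B B' by blast
  qed
  show ?case
    using B' sums cov loc \<psi>'(2) gg B(4) by (intro exI[of _ \<B>'] exI[of _ \<psi>'] conjI allI impI) (blast | simp)+
qed

text \<open>The rate divided by \<open>pi * \<tau>\<close> tends to 2 - 1 = 1: the linear term
  contributes 2, the Dirichlet energy 2 with weight 1 / 2. The weight is the one of
  \<open>energy_duality\<close> for the slope bound 1 / K.\<close>

lemma growth_rate_small:
  fixes \<kappa> \<tau>0 :: real
  assumes "\<kappa> < 1" "0 < \<tau>0"
  obtains \<tau> K where "0 < \<tau>" "\<tau> < \<tau>0" "2 \<le> K" "4 \<le> \<tau> * K" "27 * (1 / K)\<^sup>2 < 1"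
    "\<kappa> * pi * \<tau> \<le> growth_rate (1 / (2 * (1 - 27 * (1 / K)\<^sup>2))) \<tau> K"
proof -
  define f :: "real \<Rightarrow> real" where
    "f \<tau> = 2 * (1 - 4 * \<tau>) - 1 / (2 * (1 - 27 * \<tau> ^ 4)) * ((1 + 3 * \<tau>\<^sup>2) * (2 + \<tau>))" for \<tau>
  have "(f \<longlongrightarrow> 1) (at_right 0)"
    unfolding f_def by (rule tendsto_eq_intros refl | simp)+
  then have "\<forall>\<^sub>F \<tau> in at_right 0. \<kappa> < f \<tau>" using assms(1) by (rule order_tendstoD)
  moreover have "\<forall>\<^sub>F \<tau> in at_right 0. \<tau> \<in> {0<..<min \<tau>0 (1/4)}"
    using assms(2) by (intro eventually_at_right_real) auto
  ultimately have "\<forall>\<^sub>F \<tau> in at_right 0. \<kappa> < f \<tau> \<and> \<tau> \<in> {0<..<min \<tau>0 (1/4)}" by (rule eventually_conj)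
  then obtain \<tau> where "\<kappa> < f \<tau> \<and> \<tau> \<in> {0<..<min \<tau>0 (1/4)}"
    using eventually_happens[of _ "at_right (0::real)"] trivial_limit_at_right_real by blast
  then have \<tau>: "\<kappa> < f \<tau>" "0 < \<tau>" "\<tau> < \<tau>0" "\<tau> < 1/4" by auto
  \<comment> \<open>This choice makes the plateau loss 4 / K negligible against \<tau>, while \<tau>
    K = 1 / \<tau> still exceeds 4.\<close>
  define K where "K = 1 / \<tau>\<^sup>2"
  have K1: "1 / K = \<tau>\<^sup>2" by (simp add: K_def)
  have t2: "\<tau>\<^sup>2 \<le> (1/4)\<^sup>2" using \<tau> by (intro power_mono) auto
  have "(1 / 4)\<^sup>2 = (1 / 16 :: real)" by (simp add: power2_eq_square)
  with t2 have t2': "\<tau>\<^sup>2 \<le> 1 / 16" by (simp only:)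
  have t4: "(\<tau>\<^sup>2)\<^sup>2 \<le> ((1/4)\<^sup>2)\<^sup>2" by (rule power_mono[OF t2]) simp
  show thesis
  proof
    show "2 \<le> K" using \<tau> t2' by (simp add: K_def pos_le_divide_eq del: power2_less_eq_zero_iff)
    show "4 \<le> \<tau> * K" using \<tau> by (simp add: K_def field_simps power2_eq_square)
    show "27 * (1 / K)\<^sup>2 < 1" unfolding K1 using t4 by (simp add: power2_eq_square)
    have "\<kappa> * pi * \<tau> \<le> f \<tau> * (pi * \<tau>)" using \<tau> mult_right_mono[of \<kappa> "f \<tau>" "pi * \<tau>"] by simp
    also have "\<dots> = growth_rate (1 / (2 * (1 - 27 * (1 / K)\<^sup>2))) \<tau> K"
    proof -
      have K4: "4 / K = 4 * \<tau>\<^sup>2" "3 / K = 3 * \<tau>\<^sup>2" "(\<tau>\<^sup>2)\<^sup>2 = \<tau> ^ 4" by (simp_all add: K_def)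
      define w where "w = 1 / (2 * (1 - 27 * \<tau> ^ 4))"
      show ?thesis
        unfolding growth_rate_def f_def K1 K4 w_def[symmetric] by (simp add: algebra_simps power2_eq_square)
    qed
    finally show "\<kappa> * pi * \<tau> \<le> growth_rate (1 / (2 * (1 - 27 * (1 / K)\<^sup>2))) \<tau> K" .
  qed (use \<tau> in auto)
qed

text \<open>Duality with the potential of the ball construction. \<tau> and K depend only on
  \<kappa> and \<tau>0, not on the lattice or the field; the number n of dilations stays free and is
  fixed later from the radius that can be afforded.\<close>

theorem discrete_lower_bound:
  fixes \<kappa> \<tau>0 :: real
  assumes \<kappa>: "0 < \<kappa>" "\<kappa> < 1" and \<tau>0: "0 < \<tau>0"
  obtains \<tau> K where "0 < \<tau>" "\<tau> < \<tau>0" "2 \<le> K"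
    "\<And>Z D v n. finite Z \<Longrightarrow> D \<subseteq> squares Z \<Longrightarrow> (\<forall>j\<in>Z. norm (v j) = 1) \<Longrightarrow>
       \<exists>\<B>. finite \<B> \<and> (\<forall>B\<in>\<B>. 0 < snd B) \<and> bsep \<tau> \<B> \<and> covers \<B> D (vort v) \<and>
         sum snd \<B> \<le> (1 + \<tau>) ^ (n + card {i\<in>D. vort v i \<noteq> 0}) * (real (card {i\<in>D. vort v i \<noteq> 0}) * K) \<and>
         \<kappa> * pi * \<tau> * real n * of_int (total_deg D (vort v) \<B>) \<le> xy_energy Z v"
proof -
  from growth_rate_small[OF \<kappa>(2) \<tau>0] obtain \<tau> K where
    \<tau>: "0 < \<tau>" "\<tau> < \<tau>0" and K: "2 \<le> K" "4 \<le> \<tau> * K" "27 * (1 / K)\<^sup>2 < 1"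
    and g: "\<kappa> * pi * \<tau> \<le> growth_rate (1 / (2 * (1 - 27 * (1 / K)\<^sup>2))) \<tau> K" by blast
  define c where "c = 1 / (2 * (1 - 27 * (1 / K)\<^sup>2))"
  have c: "0 \<le> c" using K by (simp add: c_def)
  have g0: "0 \<le> growth_rate c \<tau> K" using g \<kappa> \<tau> unfolding c_def by (meson mult_nonneg_nonneg less_imp_le pi_ge_zero order_trans)
  show thesis
  proof (rule that[OF \<tau> K(1)])
    fix Z D :: "(int \<times> int) set" and v :: "int \<times> int \<Rightarrow> complex" and n
    assume Z: "finite Z" and D: "D \<subseteq> squares Z" and v: "\<forall>j\<in>Z. norm (v j) = 1"
    have "D \<subseteq> Z" using D by (auto simp: squares_def)
    then have fD: "finite D" using Z finite_subset by blast
    define P where "P = {i\<in>D. vort v i \<noteq> 0}"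
    \<comment> \<open>The construction starts from radius K rather than 1, so that every cone has
      slope at most 1 / K.\<close>
    define \<B>0 where "\<B>0 = (\<lambda>i. (pos i, K)) ` P"
    have fP: "finite P" using fD by (simp add: P_def)
    have card0: "card \<B>0 \<le> card P" unfolding \<B>0_def using fP by (rule card_image_le)
    have "sum snd \<B>0 = (\<Sum>B\<in>\<B>0. K)" by (intro sum.cong) (auto simp: \<B>0_def)
    then have s0: "sum snd \<B>0 \<le> real (card P) * K" using card0 K by (simp add: mult_right_mono)
    have b0: "finite \<B>0" "\<forall>B\<in>\<B>0. K \<le> snd B" "covers \<B>0 D (vort v)"
    proof -
      show "finite \<B>0" "\<forall>B\<in>\<B>0. K \<le> snd B" using fP by (auto simp: \<B>0_def)
      have "inball i (pos i, K)" for i using K by (simp add: inball_def)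
      then show "covers \<B>0 D (vort v)" unfolding covers_def \<B>0_def P_def by blast
    qed
    from ball_growth[OF fD \<tau>(1) K(1,2) c b0 g0, of n] obtain \<B> \<psi> where
      B: "finite \<B>" "\<forall>B\<in>\<B>. K \<le> snd B" "bsep \<tau> \<B>" "card \<B> \<le> card \<B>0"
      "sum snd \<B> \<le> (1 + \<tau>) ^ (n + (card \<B>0 - card \<B>)) * sum snd \<B>0" "covers \<B> D (vort v)"
      and \<psi>: "\<forall>i. \<psi> i \<noteq> 0 \<longrightarrow> i \<in> D \<and> (\<exists>B\<in>\<B>. dist (pos i) (fst B) \<le> snd B - 2)"
      "\<forall>i. \<bar>\<psi> i - \<psi> (i - dy)\<bar> \<le> 1 / K \<and> \<bar>\<psi> i - \<psi> (i - dx)\<bar> \<le> 1 / K"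
      and G: "real n * growth_rate c \<tau> K * of_int (total_deg D (vort v) \<B>)
      \<le> 2 * pi * (\<Sum>i\<in>D. of_int (vort v i) * \<psi> i) - c * dirichlet (nbhd D) \<psi>"
      by (elim exE conjE)
    have dual: "2 * pi * (\<Sum>i\<in>D. of_int (vort v i) * \<psi> i) - dirichlet (nbhd D) \<psi> / (2 * (1 - 27 * (1 / K)\<^sup>2)) \<le> xy_energy Z v"
      using \<psi> v by (intro energy_duality[OF Z D _ _ _ _ K(3)]) blast+
    have t0: "0 \<le> real_of_int (total_deg D (vort v) \<B>)"
      unfolding total_deg_def of_int_0_le_iff by (intro sum_nonneg) simp
    have "\<kappa> * pi * \<tau> * real n * of_int (total_deg D (vort v) \<B>)
        \<le> growth_rate c \<tau> K * real n * of_int (total_deg D (vort v) \<B>)"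
      using g t0 unfolding c_def by (intro mult_right_mono) auto
    also have "\<dots> \<le> xy_energy Z v" using G dual by (simp add: c_def mult.commute)
    finally have e: "\<kappa> * pi * \<tau> * real n * of_int (total_deg D (vort v) \<B>) \<le> xy_energy Z v" .
    have "sum snd \<B> \<le> (1 + \<tau>) ^ (n + (card \<B>0 - card \<B>)) * (real (card P) * K)"
      using B(5) s0 \<tau> by (meson mult_left_mono order_trans zero_le_power add_nonneg_nonneg zero_le_one less_imp_le)
    also have "\<dots> \<le> (1 + \<tau>) ^ (n + card P) * (real (card P) * K)"
      using card0 \<tau> K by (intro mult_right_mono power_increasing) auto
    finally have s: "sum snd \<B> \<le> (1 + \<tau>) ^ (n + card P) * (real (card P) * K)" .
    have "\<forall>B\<in>\<B>. 0 < snd B" using B(2) K by fastforce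
    then show "\<exists>\<B>. finite \<B> \<and> (\<forall>B\<in>\<B>. 0 < snd B) \<and> bsep \<tau> \<B> \<and> covers \<B> D (vort v) \<and>
         sum snd \<B> \<le> (1 + \<tau>) ^ (n + card {i\<in>D. vort v i \<noteq> 0}) * (real (card {i\<in>D. vort v i \<noteq> 0}) * K) \<and>
         \<kappa> * pi * \<tau> * real n * of_int (total_deg D (vort v) \<B>) \<le> xy_energy Z v"
      using B(1,3,6) s e unfolding P_def by blast
  qed
qed

section \<open>From tensor fields to the lattice\<close>

definition lat :: "real \<Rightarrow> (real^2) set \<Rightarrow> (int \<times> int) set" where
  "lat \<epsilon> \<Omega> = {i. \<epsilon> *\<^sub>R pos i \<in> \<Omega>}"

text \<open>If Q is u \<otimes> u with u at angle t, this is the unit complex number at angle 2 t;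
  doubling the angle removes the sign ambiguity of u.\<close>

definition field :: "real \<Rightarrow> (real^2 \<Rightarrow> real^2^2) \<Rightarrow> int \<times> int \<Rightarrow> complex" where
  "field \<epsilon> Q i = Complex (A_map (Q (\<epsilon> *\<^sub>R pos i)) $ 1) (A_map (Q (\<epsilon> *\<^sub>R pos i)) $ 2)"

lemma pos_add: "pos (i + j) = pos i + pos j" "pos (i - j) = pos i - pos j"
  by (simp_all add: vec_eq_iff forall_2)

lemma pos_d [simp]: "pos dx = e1" "pos dy = e2"
  by (simp_all add: vec_eq_iff forall_2 axis_def)

lemma inj_pos: "inj pos"
  by (auto simp: inj_def vec_eq_iff forall_2 prod_eq_iff)

lemma Z2_eq_range_pos: "Z2 = range pos"
proof (intro equalityI subsetI)
  fix x assume "x \<in> Z2"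
  then obtain a b where "x $ 1 = of_int a" "x $ 2 = of_int b"
    unfolding Z2_def by (metis (mono_tags) Ints_cases mem_Collect_eq)
  then have "x = pos (a, b)" by (simp add: vec_eq_iff forall_2)
  then show "x \<in> range pos" by blast
qed (auto simp: Z2_def forall_2)

lemma Z_eps_eq: "Z_eps \<epsilon> \<Omega> = pos ` lat \<epsilon> \<Omega>"
  by (auto simp: Z_eps_def lat_def Z2_eq_range_pos)

lemma finite_lat:
  assumes "bounded \<Omega>" "0 < \<epsilon>" shows "finite (lat \<epsilon> \<Omega>)"
proof -
  obtain R where R: "\<And>x. x \<in> \<Omega> \<Longrightarrow> norm x \<le> R" using assms(1) by (auto simp: bounded_iff)
  define M where "M = \<lceil>R / \<epsilon>\<rceil>"
  have "lat \<epsilon> \<Omega> \<subseteq> {-M..M} \<times> {-M..M}"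
  proof
    fix i assume "i \<in> lat \<epsilon> \<Omega>"
    then have "norm (\<epsilon> *\<^sub>R pos i) \<le> R" by (intro R) (simp add: lat_def)
    then have n: "norm (pos i) \<le> R / \<epsilon>" using assms(2) by (simp add: field_simps)
    have "\<bar>of_int (fst i)\<bar> \<le> R / \<epsilon>" "\<bar>of_int (snd i)\<bar> \<le> R / \<epsilon>"
      using n component_le_norm_cart[of "pos i" 1] component_le_norm_cart[of "pos i" 2] by auto
    moreover have "R / \<epsilon> \<le> of_int M" by (simp add: M_def)
    ultimately have "\<bar>fst i\<bar> \<le> M" "\<bar>snd i\<bar> \<le> M" by linarith+
    then show "i \<in> {-M..M} \<times> {-M..M}" by (cases i) auto
  qed
  then show ?thesis by (rule finite_subset) simp
qed

lemma A_map_nth [simp]: "A_map M $ 1 = 2 * M $ 1 $ 1 - 1" "A_map M $ 2 = 2 * M $ 1 $ 2"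
  by (simp_all add: A_map_def)

text \<open>The identity cos 2a = 2 (cos a)^2 - 1 for the angle a between the two unit
  vectors.\<close>

lemma Complex_of_angle_doubling:
  assumes "norm (u :: real^2) = 1" "norm (w :: real^2) = 1"
  shows "(2 * u $ 1 * u $ 1 - 1) * (2 * w $ 1 * w $ 1 - 1) + (2 * u $ 1 * u $ 2) * (2 * w $ 1 * w $ 2)
    = 2 * (u \<bullet> w)\<^sup>2 - 1"
proof -
  have u: "(u $ 2)\<^sup>2 = 1 - (u $ 1)\<^sup>2" and w: "(w $ 2)\<^sup>2 = 1 - (w $ 1)\<^sup>2"
    using assms by (simp_all add: norm_real2 real_sqrt_eq_1_iff)
  have "(u \<bullet> w)\<^sup>2 = (u $ 1)\<^sup>2 * (w $ 1)\<^sup>2 + 2 * (u $ 1 * w $ 1 * u $ 2 * w $ 2) + (u $ 2)\<^sup>2 * (w $ 2)\<^sup>2"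
    by (simp add: inner_vec_def sum_2 power2_sum power_mult_distrib)
  then show ?thesis unfolding u w by (simp add: algebra_simps power2_eq_square)
qed

lemma field_tensor:
  assumes "Q (\<epsilon> *\<^sub>R pos i) = tensor u u"
  shows "field \<epsilon> Q i = Complex (2 * u $ 1 * u $ 1 - 1) (2 * u $ 1 * u $ 2)"
  using assms by (simp add: field_def tensor_def)

lemma field_norm:
  assumes Q: "Q \<in> C_eps \<epsilon> \<Omega>" and i: "i \<in> lat \<epsilon> \<Omega>"
  shows "norm (field \<epsilon> Q i) = 1"
proof -
  obtain u where u: "norm u = 1" "Q (\<epsilon> *\<^sub>R pos i) = tensor u u"
    using Q i by (auto simp: C_eps_def lat_def S1_tensor_def)
  have "u \<bullet> u = 1" using u by (simp add: norm_eq_sqrt_inner)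
  then show ?thesis using Complex_of_angle_doubling[OF u(1) u(1)]
    by (simp add: field_tensor[of Q \<epsilon>, OF u(2)] cmod_def power2_eq_square)
qed

lemma cos_Arg_quotient:
  assumes "norm z = 1" "norm w = 1"
  shows "cos (Arg (w / z)) = Re z * Re w + Im z * Im w" "sin (Arg (w / z)) = Re z * Im w - Im z * Re w"
proof -
  have "(Re z)\<^sup>2 + (Im z)\<^sup>2 = 1" using assms(1) by (simp add: cmod_def real_sqrt_eq_1_iff)
  then have "Re (cis (Arg (w / z))) = Re z * Re w + Im z * Im w" "Im (cis (Arg (w / z))) = Re z * Im w - Im z * Re w"
    unfolding cis_bond[OF assms] by (simp_all add: Re_divide Im_divide algebra_simps)
  then show "cos (Arg (w / z)) = Re z * Re w + Im z * Im w" "sin (Arg (w / z)) = Re z * Im w - Im z * Re w"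
    by simp_all
qed

lemma int_square_sum_1:
  fixes a b :: int assumes "a\<^sup>2 + b\<^sup>2 = 1"
  shows "(a, b) \<in> {(1, 0), (-1, 0), (0, 1), (0, -1)}"
proof -
  have "\<bar>a\<bar> \<le> 1"
  proof (rule ccontr)
    assume "\<not> ?thesis"
    then have "2 * 2 \<le> \<bar>a\<bar> * \<bar>a\<bar>" by (intro mult_mono) auto
    then show False using assms zero_le_square[of b] unfolding power2_eq_square abs_mult_self_eq by linarith
  qed
  moreover have "\<bar>b\<bar> \<le> 1"
  proof (rule ccontr)
    assume "\<not> ?thesis"
    then have "2 * 2 \<le> \<bar>b\<bar> * \<bar>b\<bar>" by (intro mult_mono) auto
    then show False using assms zero_le_square[of a] unfolding power2_eq_square abs_mult_self_eq by linarith
  qed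
  ultimately have "a \<in> {-1, 0, 1}" "b \<in> {-1, 0, 1}" by auto
  then show ?thesis using assms by auto
qed

lemma bonds_eq:
  "bonds \<epsilon> \<Omega> = (\<lambda>i. (pos i, pos (i + dx))) ` hbonds (lat \<epsilon> \<Omega>) \<union> (\<lambda>i. (pos (i + dx), pos i)) ` hbonds (lat \<epsilon> \<Omega>)
     \<union> (\<lambda>i. (pos i, pos (i + dy))) ` vbonds (lat \<epsilon> \<Omega>) \<union> (\<lambda>i. (pos (i + dy), pos i)) ` vbonds (lat \<epsilon> \<Omega>)"
  (is "_ = ?R")
proof (intro equalityI subsetI)
  fix p assume "p \<in> bonds \<epsilon> \<Omega>"
  then obtain i j where p: "p = (pos i, pos j)" and ij: "i \<in> lat \<epsilon> \<Omega>" "j \<in> lat \<epsilon> \<Omega>" "norm (pos i - pos j) = 1"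
    by (auto simp: bonds_def Z_eps_eq)
  have "(real_of_int (fst i - fst j))\<^sup>2 + (real_of_int (snd i - snd j))\<^sup>2 = 1"
    using ij(3) by (simp add: norm_real2 real_sqrt_eq_1_iff)
  then have "real_of_int ((fst i - fst j)\<^sup>2 + (snd i - snd j)\<^sup>2) = 1" by simp
  then have "(fst i - fst j)\<^sup>2 + (snd i - snd j)\<^sup>2 = 1" by linarith
  from int_square_sum_1[OF this] have "i - j \<in> {dx, -dx, dy, -dy}"
    by (simp add: prod_eq_iff)
  then consider "i = j + dx" | "j = i + dx" | "i = j + dy" | "j = i + dy"
    by (auto simp: prod_eq_iff)
  then show "p \<in> ?R"
    by cases (use ij(1,2) p in \<open>simp_all only: hbonds_def vbonds_def\<close>, blast+)
next
  fix p assume "p \<in> ?R"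
  have b: "(pos i, pos j) \<in> bonds \<epsilon> \<Omega>" if "i \<in> lat \<epsilon> \<Omega>" "j \<in> lat \<epsilon> \<Omega>" "norm (pos i - pos j) = 1" for i j
    using that by (auto simp: bonds_def Z_eps_eq)
  have n: "norm (pos i - pos (i + dx)) = 1" "norm (pos (i + dx) - pos i) = 1"
    "norm (pos i - pos (i + dy)) = 1" "norm (pos (i + dy) - pos i) = 1" for i
    by (simp_all add: pos_add(1))
  from \<open>p \<in> ?R\<close> show "p \<in> bonds \<epsilon> \<Omega>"
    by (elim UnE imageE) (simp_all only: hbonds_def vbonds_def mem_Collect_eq b n)
qed

lemma sum_bonds:
  fixes f :: "real^2 \<Rightarrow> real^2 \<Rightarrow> real"
  assumes fin: "finite (lat \<epsilon> \<Omega>)" and sym: "\<And>a b. f a b = f b a"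
  shows "(\<Sum>(a, b)\<in>bonds \<epsilon> \<Omega>. f a b) =
    2 * ((\<Sum>i\<in>hbonds (lat \<epsilon> \<Omega>). f (pos i) (pos (i + dx))) + (\<Sum>i\<in>vbonds (lat \<epsilon> \<Omega>). f (pos i) (pos (i + dy))))"
proof -
  let ?H = "hbonds (lat \<epsilon> \<Omega>)" and ?V = "vbonds (lat \<epsilon> \<Omega>)"
  have fh: "finite ?H" "finite ?V" using fin by (auto simp: hbonds_def vbonds_def)
  have peq: "pos i = pos j \<longleftrightarrow> i = j" for i j by (metis injD inj_pos)
  have e: "(\<Sum>p\<in>(\<lambda>i. (pos (g i), pos (h i))) ` A. f (fst p) (snd p)) = (\<Sum>i\<in>A. f (pos (g i)) (pos (h i)))"
    if "inj g" for g h :: "int \<times> int \<Rightarrow> int \<times> int" and A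
    by (subst sum.reindex) (use that in \<open>auto simp: inj_on_def inj_def peq o_def\<close>)
  have i: "inj (\<lambda>i. i :: int \<times> int)" "inj (\<lambda>i. i + s :: int \<times> int)" for s by (auto simp: inj_def)
  have "(\<Sum>(a, b)\<in>bonds \<epsilon> \<Omega>. f a b) = (\<Sum>p\<in>bonds \<epsilon> \<Omega>. f (fst p) (snd p))"
    by (simp add: case_prod_beta)
  also have "\<dots> = (\<Sum>p\<in>(\<lambda>i. (pos i, pos (i + dx))) ` ?H. f (fst p) (snd p))
     + (\<Sum>p\<in>(\<lambda>i. (pos (i + dx), pos i)) ` ?H. f (fst p) (snd p))
     + (\<Sum>p\<in>(\<lambda>i. (pos i, pos (i + dy))) ` ?V. f (fst p) (snd p))
     + (\<Sum>p\<in>(\<lambda>i. (pos (i + dy), pos i)) ` ?V. f (fst p) (snd p))"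
    unfolding bonds_eq using fh
    by (subst sum.union_disjoint; (subst sum.union_disjoint)?; (subst sum.union_disjoint)?)
      (auto simp: peq prod_eq_iff)
  also have "\<dots> = (\<Sum>i\<in>?H. f (pos i) (pos (i + dx))) + (\<Sum>i\<in>?H. f (pos (i + dx)) (pos i))
     + (\<Sum>i\<in>?V. f (pos i) (pos (i + dy))) + (\<Sum>i\<in>?V. f (pos (i + dy)) (pos i))"
    by (simp only: e[OF i(1)] e[OF i(2)])
  finally show ?thesis using sym by simp
qed

text \<open>Doubling the angle turns 1 - (u . w)^2 into half of 1 - cos; this half is compensated by
  counting each bond in both orders.\<close>

lemma Fc_eq_energy:
  assumes Q: "Q \<in> C_eps \<epsilon> \<Omega>" and \<Omega>: "bounded \<Omega>" "0 < \<epsilon>"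
  shows "Fc \<Omega> \<epsilon> Q = ereal (xy_energy (lat \<epsilon> \<Omega>) (field \<epsilon> Q) / \<bar>ln \<epsilon>\<bar>)"
proof -
  let ?Z = "lat \<epsilon> \<Omega>"
  define u where "u x = director (Q (\<epsilon> *\<^sub>R x))" for x
  have u: "norm (u (pos i)) = 1" "Q (\<epsilon> *\<^sub>R pos i) = tensor (u (pos i)) (u (pos i))" if "i \<in> ?Z" for i
  proof -
    have "Q (\<epsilon> *\<^sub>R pos i) \<in> S1_tensor" using that Q by (auto simp: C_eps_def lat_def)
    from director_works[OF this] show "norm (u (pos i)) = 1" "Q (\<epsilon> *\<^sub>R pos i) = tensor (u (pos i)) (u (pos i))"
      by (simp_all add: u_def)
  qed
  have c: "1 - \<bar>u (pos i) \<bullet> u (pos j)\<bar>\<^sup>2 = (1 - cos (Arg (field \<epsilon> Q j / field \<epsilon> Q i))) / 2"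
    if "i \<in> ?Z" "j \<in> ?Z" for i j
    using Complex_of_angle_doubling[OF u(1)[OF that(1)] u(1)[OF that(2)]]
    unfolding cos_Arg_quotient(1)[OF field_norm[OF Q that(1)] field_norm[OF Q that(2)]]
    unfolding field_tensor[of Q \<epsilon>, OF u(2)[OF that(1)]] field_tensor[of Q \<epsilon>, OF u(2)[OF that(2)]]
    by simp
  have "(\<Sum>(a, b)\<in>bonds \<epsilon> \<Omega>. 1 - \<bar>u a \<bullet> u b\<bar>\<^sup>2) = xy_energy ?Z (field \<epsilon> Q)"
    unfolding xy_energy_def hb_def vb_def
  proof (subst sum_bonds)
    show "2 * ((\<Sum>i\<in>hbonds ?Z. 1 - \<bar>u (pos i) \<bullet> u (pos (i + dx))\<bar>\<^sup>2)
        + (\<Sum>i\<in>vbonds ?Z. 1 - \<bar>u (pos i) \<bullet> u (pos (i + dy))\<bar>\<^sup>2))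
      = (\<Sum>i\<in>hbonds ?Z. 1 - cos (Arg (field \<epsilon> Q (i + dx) / field \<epsilon> Q i)))
        + (\<Sum>i\<in>vbonds ?Z. 1 - cos (Arg (field \<epsilon> Q (i + dy) / field \<epsilon> Q i)))"
      unfolding distrib_left sum_distrib_left
      by (intro arg_cong2[where f = "(+)"] sum.cong refl; subst c) (auto simp: hbonds_def vbonds_def)
  qed (use finite_lat[OF \<Omega>] in \<open>auto simp: inner_commute\<close>)
  then show ?thesis using Q by (simp add: Fc_def u_def)
qed

section \<open>The Jacobian of the interpolation\<close>

abbreviation lowT :: "real \<Rightarrow> int \<times> int \<Rightarrow> (real^2) set" where "lowT \<epsilon> i \<equiv> lower_triangle \<epsilon> (pos i)"
abbreviation uppT :: "real \<Rightarrow> int \<times> int \<Rightarrow> (real^2) set" where "uppT \<epsilon> i \<equiv> upper_triangle \<epsilon> (pos i)"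

lemma e_nth [simp]: "e1 $ 1 = 1" "e1 $ 2 = 0" "e2 $ 1 = 0" "e2 $ 2 = 1"
  by (simp_all add: axis_def)

lemma lowT_iff:
  assumes "0 < \<epsilon>"
  shows "x \<in> lowT \<epsilon> i \<longleftrightarrow> of_int (fst i) \<le> x $ 1 / \<epsilon> \<and> of_int (snd i) \<le> x $ 2 / \<epsilon> \<and>
    x $ 1 / \<epsilon> + x $ 2 / \<epsilon> \<le> of_int (fst i) + of_int (snd i) + 1"
proof
  assume "x \<in> lowT \<epsilon> i"
  then obtain u v where uv: "0 \<le> u" "0 \<le> v" "u + v \<le> 1"
    and x: "x = \<epsilon> *\<^sub>R pos i + u *\<^sub>R (\<epsilon> *\<^sub>R (pos i + e1) - \<epsilon> *\<^sub>R pos i) + v *\<^sub>R (\<epsilon> *\<^sub>R (pos i + e2) - \<epsilon> *\<^sub>R pos i)"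
    unfolding lower_triangle_def convex_hull_3_alt mem_Collect_eq by metis
  have "x $ 1 / \<epsilon> = of_int (fst i) + u" "x $ 2 / \<epsilon> = of_int (snd i) + v"
    using assms by (simp_all add: x field_simps)
  then show "of_int (fst i) \<le> x $ 1 / \<epsilon> \<and> of_int (snd i) \<le> x $ 2 / \<epsilon> \<and>
    x $ 1 / \<epsilon> + x $ 2 / \<epsilon> \<le> of_int (fst i) + of_int (snd i) + 1" using uv by simp
next
  define u v where "u = x $ 1 / \<epsilon> - of_int (fst i)" and "v = x $ 2 / \<epsilon> - of_int (snd i)"
  assume "of_int (fst i) \<le> x $ 1 / \<epsilon> \<and> of_int (snd i) \<le> x $ 2 / \<epsilon> \<and>
    x $ 1 / \<epsilon> + x $ 2 / \<epsilon> \<le> of_int (fst i) + of_int (snd i) + 1"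
  then have uv: "0 \<le> u" "0 \<le> v" "u + v \<le> 1" by (auto simp: u_def v_def)
  have "x = \<epsilon> *\<^sub>R pos i + u *\<^sub>R (\<epsilon> *\<^sub>R (pos i + e1) - \<epsilon> *\<^sub>R pos i) + v *\<^sub>R (\<epsilon> *\<^sub>R (pos i + e2) - \<epsilon> *\<^sub>R pos i)"
    using assms by (simp add: vec_eq_iff forall_2 u_def v_def field_simps)
  then show "x \<in> lowT \<epsilon> i"
    unfolding lower_triangle_def convex_hull_3_alt using uv by blast
qed

lemma uppT_iff:
  assumes "0 < \<epsilon>"
  shows "x \<in> uppT \<epsilon> i \<longleftrightarrow> x $ 1 / \<epsilon> \<le> of_int (fst i) + 1 \<and> x $ 2 / \<epsilon> \<le> of_int (snd i) + 1 \<and>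
    of_int (fst i) + of_int (snd i) + 1 \<le> x $ 1 / \<epsilon> + x $ 2 / \<epsilon>"
proof
  assume "x \<in> uppT \<epsilon> i"
  then obtain u v where uv: "0 \<le> u" "0 \<le> v" "u + v \<le> 1"
    and x: "x = \<epsilon> *\<^sub>R (pos i + e1 + e2) + u *\<^sub>R (\<epsilon> *\<^sub>R (pos i + e1) - \<epsilon> *\<^sub>R (pos i + e1 + e2))
      + v *\<^sub>R (\<epsilon> *\<^sub>R (pos i + e2) - \<epsilon> *\<^sub>R (pos i + e1 + e2))"
    unfolding upper_triangle_def convex_hull_3_alt mem_Collect_eq by metis
  have "x $ 1 / \<epsilon> = of_int (fst i) + 1 - v" "x $ 2 / \<epsilon> = of_int (snd i) + 1 - u"
    using assms by (simp_all add: x field_simps)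
  then show "x $ 1 / \<epsilon> \<le> of_int (fst i) + 1 \<and> x $ 2 / \<epsilon> \<le> of_int (snd i) + 1 \<and>
    of_int (fst i) + of_int (snd i) + 1 \<le> x $ 1 / \<epsilon> + x $ 2 / \<epsilon>" using uv by simp
next
  define v u where "v = of_int (fst i) + 1 - x $ 1 / \<epsilon>" and "u = of_int (snd i) + 1 - x $ 2 / \<epsilon>"
  assume "x $ 1 / \<epsilon> \<le> of_int (fst i) + 1 \<and> x $ 2 / \<epsilon> \<le> of_int (snd i) + 1 \<and>
    of_int (fst i) + of_int (snd i) + 1 \<le> x $ 1 / \<epsilon> + x $ 2 / \<epsilon>"
  then have uv: "0 \<le> u" "0 \<le> v" "u + v \<le> 1" by (auto simp: u_def v_def)
  have "x = \<epsilon> *\<^sub>R (pos i + e1 + e2) + u *\<^sub>R (\<epsilon> *\<^sub>R (pos i + e1) - \<epsilon> *\<^sub>R (pos i + e1 + e2))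
      + v *\<^sub>R (\<epsilon> *\<^sub>R (pos i + e2) - \<epsilon> *\<^sub>R (pos i + e1 + e2))"
    using assms by (simp add: vec_eq_iff forall_2 u_def v_def field_simps)
  then show "x \<in> uppT \<epsilon> i"
    unfolding upper_triangle_def convex_hull_3_alt using uv by blast
qed

text \<open>Off this null set a point lies in exactly one triangle of the grid, identified by
  \<open>cell\<close> and \<open>below_diag\<close>, and the interpolation is affine in a
  neighbourhood.\<close>

definition gridlines :: "real \<Rightarrow> (real^2) set" where
  "gridlines \<epsilon> = {x. x $ 1 / \<epsilon> \<in> \<int> \<or> x $ 2 / \<epsilon> \<in> \<int> \<or> x $ 1 / \<epsilon> + x $ 2 / \<epsilon> \<in> \<int>}"

lemma negligible_gridlines:
  assumes "0 < \<epsilon>" shows "negligible (gridlines \<epsilon>)"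
proof -
  define L where "L a k = {x :: real^2. a \<bullet> x = \<epsilon> * of_int k}" for a :: "real^2" and k :: int
  have "negligible (L a k)" if "a \<noteq> 0" for a k unfolding L_def using that by (intro negligible_hyperplane) simp
  moreover have "e1 \<noteq> 0" "e2 \<noteq> 0" "e1 + e2 \<noteq> 0" by (simp_all add: vec_eq_iff forall_2)
  ultimately have "negligible (\<Union>(L e1 ` UNIV \<union> L e2 ` UNIV \<union> L (e1 + e2) ` UNIV))"
    by (intro negligible_countable_Union) auto
  moreover have "gridlines \<epsilon> \<subseteq> \<Union>(L e1 ` UNIV \<union> L e2 ` UNIV \<union> L (e1 + e2) ` UNIV)"
  proof
    fix x assume "x \<in> gridlines \<epsilon>"
    then consider k where "x $ 1 / \<epsilon> = of_int k" | k where "x $ 2 / \<epsilon> = of_int k"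
      | k where "x $ 1 / \<epsilon> + x $ 2 / \<epsilon> = of_int k"
      unfolding gridlines_def by (auto elim!: Ints_cases)
    then show "x \<in> \<Union>(L e1 ` UNIV \<union> L e2 ` UNIV \<union> L (e1 + e2) ` UNIV)"
    proof cases
      case (1 k) then have "x \<in> L e1 k" using assms by (simp add: L_def inner_axis' field_simps)
      then show ?thesis by blast
    next
      case (2 k) then have "x \<in> L e2 k" using assms by (simp add: L_def inner_axis' field_simps)
      then show ?thesis by blast
    next
      case (3 k) then have "x \<in> L (e1 + e2) k" using assms by (simp add: L_def inner_axis' inner_add_left field_simps)
      then show ?thesis by (intro UnionI[of "L (e1 + e2) k"]) simp_all
    qed
  qed
  ultimately show ?thesis by (rule negligible_subset)
qed

definition cell :: "real \<Rightarrow> real^2 \<Rightarrow> int \<times> int" where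
  "cell \<epsilon> x = (\<lfloor>x $ 1 / \<epsilon>\<rfloor>, \<lfloor>x $ 2 / \<epsilon>\<rfloor>)"

definition below_diag :: "real \<Rightarrow> real^2 \<Rightarrow> bool" where
  "below_diag \<epsilon> x \<longleftrightarrow> x $ 1 / \<epsilon> + x $ 2 / \<epsilon> < of_int \<lfloor>x $ 1 / \<epsilon>\<rfloor> + of_int \<lfloor>x $ 2 / \<epsilon>\<rfloor> + 1"

lemma generic_mem:
  assumes \<epsilon>: "0 < \<epsilon>" and x: "x \<notin> gridlines \<epsilon>"
  shows "x \<in> lowT \<epsilon> i \<longleftrightarrow> i = cell \<epsilon> x \<and> below_diag \<epsilon> x"
    and "x \<in> uppT \<epsilon> i \<longleftrightarrow> i = cell \<epsilon> x \<and> \<not> below_diag \<epsilon> x"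
proof -
  define s t where "s = x $ 1 / \<epsilon>" and "t = x $ 2 / \<epsilon>"
  have n: "s \<noteq> of_int k" "t \<noteq> of_int k" "s + t \<noteq> of_int k" for k
    using x by (auto simp: gridlines_def s_def t_def)
  have st: "s + t \<noteq> of_int a + of_int b + 1" "s \<noteq> of_int a + 1" "t \<noteq> of_int a + 1" for a b
    using n(3)[of "a + b + 1"] n(1)[of "a + 1"] n(2)[of "a + 1"] by simp_all
  have fl: "of_int \<lfloor>s\<rfloor> \<le> s" "s < of_int \<lfloor>s\<rfloor> + 1" "of_int \<lfloor>t\<rfloor> \<le> t" "t < of_int \<lfloor>t\<rfloor> + 1" by linarith+
  show "x \<in> lowT \<epsilon> i \<longleftrightarrow> i = cell \<epsilon> x \<and> below_diag \<epsilon> x"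
    unfolding lowT_iff[OF \<epsilon>] cell_def below_diag_def s_def[symmetric] t_def[symmetric]
  proof (intro iffI conjI)
    assume a: "of_int (fst i) \<le> s \<and> of_int (snd i) \<le> t \<and> s + t \<le> of_int (fst i) + of_int (snd i) + 1"
    then have "s < of_int (fst i) + 1" "t < of_int (snd i) + 1"
      using n(1)[of "fst i"] n(2)[of "snd i"] by linarith+
    then have "\<lfloor>s\<rfloor> = fst i" "\<lfloor>t\<rfloor> = snd i" using a by (auto intro!: floor_unique)
    then show "i = (\<lfloor>s\<rfloor>, \<lfloor>t\<rfloor>)" "s + t < of_int \<lfloor>s\<rfloor> + of_int \<lfloor>t\<rfloor> + 1"
      using a st(1)[of "fst i" "snd i"] by (auto simp: prod_eq_iff)
  qed (use fl in auto)
  show "x \<in> uppT \<epsilon> i \<longleftrightarrow> i = cell \<epsilon> x \<and> \<not> below_diag \<epsilon> x"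
    unfolding uppT_iff[OF \<epsilon>] cell_def below_diag_def s_def[symmetric] t_def[symmetric]
  proof (intro iffI conjI)
    assume a: "s \<le> of_int (fst i) + 1 \<and> t \<le> of_int (snd i) + 1 \<and> of_int (fst i) + of_int (snd i) + 1 \<le> s + t"
    then have "s < of_int (fst i) + 1" "t < of_int (snd i) + 1"
      using st(2)[of "fst i"] st(3)[of "snd i"] by linarith+
    moreover from this have "of_int (fst i) \<le> s" "of_int (snd i) \<le> t" using a by linarith+
    ultimately have "\<lfloor>s\<rfloor> = fst i" "\<lfloor>t\<rfloor> = snd i" by (auto intro!: floor_unique)
    then show "i = (\<lfloor>s\<rfloor>, \<lfloor>t\<rfloor>)" "\<not> s + t < of_int \<lfloor>s\<rfloor> + of_int \<lfloor>t\<rfloor> + 1"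
      using a by (auto simp: prod_eq_iff)
  qed (use fl in auto)
qed

lemma det_jacobian_affine:
  fixes f :: "real^2 \<Rightarrow> real^2"
  assumes S: "open S" "x \<in> S" and f: "\<And>y. y \<in> S \<Longrightarrow> f y = c + (y $ 1) *\<^sub>R a + (y $ 2) *\<^sub>R b"
  shows "det (jacobian f (at x)) = a $ 1 * b $ 2 - a $ 2 * b $ 1"
proof -
  have "((\<lambda>y. c + (y $ 1) *\<^sub>R a + (y $ 2) *\<^sub>R b) has_derivative (\<lambda>h. (h $ 1) *\<^sub>R a + (h $ 2) *\<^sub>R b)) (at x)"
    by (auto intro!: derivative_eq_intros bounded_linear.has_derivative[OF bounded_linear_vec_nth])
  then have "(f has_derivative (\<lambda>h. (h $ 1) *\<^sub>R a + (h $ 2) *\<^sub>R b)) (at x)"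
    using S f by (auto intro: has_derivative_transform_within_open)
  then have "frechet_derivative f (at x) = (\<lambda>h. (h $ 1) *\<^sub>R a + (h $ 2) *\<^sub>R b)"
    by (rule frechet_derivative_at[symmetric])
  then show ?thesis by (simp add: jacobian_def det_2 matrix_def)
qed

text \<open>Half a cross product: the signed area of the image of the lower triangle. In
  \<open>aU\<close> the edges of the upper triangle are directed along the positive axes, so that
  both areas carry the same orientation.\<close>

definition aL :: "(int \<times> int \<Rightarrow> complex) \<Rightarrow> int \<times> int \<Rightarrow> real" where
  "aL v i = Im (cnj (v (i + dx) - v i) * (v (i + dy) - v i)) / 2"

definition aU :: "(int \<times> int \<Rightarrow> complex) \<Rightarrow> int \<times> int \<Rightarrow> real" where
  "aU v i = Im (cnj (v (i + dx + dy) - v (i + dy)) * (v (i + dx + dy) - v (i + dx))) / 2"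

text \<open>The determinant of an affine map is the ratio of signed areas, and the triangle itself
  has area \<open>\<epsilon>\<^sup>2 / 2\<close>.\<close>

lemma det_jacobian_interp_low:
  assumes \<epsilon>: "0 < \<epsilon>" and x: "x \<notin> gridlines \<epsilon>" "below_diag \<epsilon> x"
  shows "det (jacobian (\<lambda>y. A_map (interp \<epsilon> Q y)) (at x)) = 2 * aL (field \<epsilon> Q) (cell \<epsilon> x) / \<epsilon>\<^sup>2"
proof -
  define i where "i = cell \<epsilon> x"
  define S where "S = {y :: real^2. of_int (fst i) < y $ 1 / \<epsilon> \<and> of_int (snd i) < y $ 2 / \<epsilon> \<and>
    y $ 1 / \<epsilon> + y $ 2 / \<epsilon> < of_int (fst i) + of_int (snd i) + 1}"
  have oS: "open S" unfolding S_def
    by (intro open_Collect_conj open_Collect_less continuous_intros) (use \<epsilon> in auto)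
  have "x $ 1 / \<epsilon> \<noteq> of_int (fst i)" "x $ 2 / \<epsilon> \<noteq> of_int (snd i)" using x by (auto simp: gridlines_def)
  moreover have "of_int (fst i) \<le> x $ 1 / \<epsilon>" "of_int (snd i) \<le> x $ 2 / \<epsilon>" by (simp_all add: i_def cell_def)
  moreover have "x $ 1 / \<epsilon> + x $ 2 / \<epsilon> < of_int (fst i) + of_int (snd i) + 1"
    using x(2) by (simp add: i_def below_diag_def cell_def)
  ultimately have xS: "x \<in> S" unfolding S_def by simp
  define A where "A j = A_map (Q (\<epsilon> *\<^sub>R pos j))" for j
  let ?a = "(1 / \<epsilon>) *\<^sub>R (A (i + dx) - A i)" and ?b = "(1 / \<epsilon>) *\<^sub>R (A (i + dy) - A i)"
  have f: "A_map (interp \<epsilon> Q y) = (A i - of_int (fst i) *\<^sub>R (A (i + dx) - A i) - of_int (snd i) *\<^sub>R (A (i + dy) - A i))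
       + (y $ 1) *\<^sub>R ?a + (y $ 2) *\<^sub>R ?b" if "y \<in> S" for y
  proof -
    define s t where "s = y $ 1 / \<epsilon> - of_int (fst i)" and "t = y $ 2 / \<epsilon> - of_int (snd i)"
    have y: "y = \<epsilon> *\<^sub>R (pos i + s *\<^sub>R e1 + t *\<^sub>R e2)"
      using \<epsilon> by (simp add: vec_eq_iff forall_2 s_def t_def field_simps)
    have "pos i \<in> Z2" by (simp add: Z2_eq_range_pos)
    then have I: "interp \<epsilon> Q y = Q (\<epsilon> *\<^sub>R pos i) + s *\<^sub>R (Q (\<epsilon> *\<^sub>R (pos i + e1)) - Q (\<epsilon> *\<^sub>R pos i))
        + t *\<^sub>R (Q (\<epsilon> *\<^sub>R (pos i + e2)) - Q (\<epsilon> *\<^sub>R pos i))"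
      unfolding y using \<epsilon> that by (intro interp_lower) (auto simp: S_def s_def t_def)
    have "A_map (interp \<epsilon> Q y) = A i + s *\<^sub>R (A (i + dx) - A i) + t *\<^sub>R (A (i + dy) - A i)"
      unfolding I A_def by (simp add: vec_eq_iff forall_2 pos_add algebra_simps)
    then show ?thesis
      by (simp add: s_def t_def algebra_simps)
  qed
  have "det (jacobian (\<lambda>y. A_map (interp \<epsilon> Q y)) (at x)) = ?a $ 1 * ?b $ 2 - ?a $ 2 * ?b $ 1"
    by (rule det_jacobian_affine[OF oS xS]) (rule f)
  also have "\<dots> = 2 * aL (field \<epsilon> Q) i / \<epsilon>\<^sup>2" using \<epsilon>
    by (simp add: aL_def field_def A_def[symmetric] power2_eq_square field_simps del: A_map_nth)
  finally show ?thesis by (simp add: i_def)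
qed

lemma det_jacobian_interp_upp:
  assumes \<epsilon>: "0 < \<epsilon>" and x: "x \<notin> gridlines \<epsilon>" "\<not> below_diag \<epsilon> x"
  shows "det (jacobian (\<lambda>y. A_map (interp \<epsilon> Q y)) (at x)) = 2 * aU (field \<epsilon> Q) (cell \<epsilon> x) / \<epsilon>\<^sup>2"
proof -
  define i where "i = cell \<epsilon> x"
  define S where "S = {y :: real^2. y $ 1 / \<epsilon> < of_int (fst i) + 1 \<and> y $ 2 / \<epsilon> < of_int (snd i) + 1 \<and>
    of_int (fst i) + of_int (snd i) + 1 < y $ 1 / \<epsilon> + y $ 2 / \<epsilon>}"
  have oS: "open S" unfolding S_def
    by (intro open_Collect_conj open_Collect_less continuous_intros) (use \<epsilon> in auto)
  have "x $ 1 / \<epsilon> + x $ 2 / \<epsilon> \<noteq> of_int (fst i + snd i + 1)" using x by (auto simp: gridlines_def)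
  moreover have "x $ 1 / \<epsilon> < of_int (fst i) + 1" "x $ 2 / \<epsilon> < of_int (snd i) + 1" by (simp_all add: i_def cell_def)
  ultimately have xS: "x \<in> S" using x(2) by (simp add: S_def i_def below_diag_def cell_def)
  define A where "A j = A_map (Q (\<epsilon> *\<^sub>R pos j))" for j
  let ?k = "i + dx + dy"
  let ?a = "(1 / \<epsilon>) *\<^sub>R (A ?k - A (i + dy))" and ?b = "(1 / \<epsilon>) *\<^sub>R (A ?k - A (i + dx))"
  have f: "A_map (interp \<epsilon> Q y) = (A ?k - (of_int (fst i) + 1) *\<^sub>R (A ?k - A (i + dy)) - (of_int (snd i) + 1) *\<^sub>R (A ?k - A (i + dx)))
       + (y $ 1) *\<^sub>R ?a + (y $ 2) *\<^sub>R ?b" if "y \<in> S" for y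
  proof -
    define s t where "s = y $ 1 / \<epsilon> - of_int (fst i)" and "t = y $ 2 / \<epsilon> - of_int (snd i)"
    have y: "y = \<epsilon> *\<^sub>R (pos i + s *\<^sub>R e1 + t *\<^sub>R e2)"
      using \<epsilon> by (simp add: vec_eq_iff forall_2 s_def t_def field_simps)
    have "pos i \<in> Z2" by (simp add: Z2_eq_range_pos)
    then have I: "interp \<epsilon> Q y = Q (\<epsilon> *\<^sub>R (pos i + e1 + e2))
        + (1 - s) *\<^sub>R (Q (\<epsilon> *\<^sub>R (pos i + e2)) - Q (\<epsilon> *\<^sub>R (pos i + e1 + e2)))
        + (1 - t) *\<^sub>R (Q (\<epsilon> *\<^sub>R (pos i + e1)) - Q (\<epsilon> *\<^sub>R (pos i + e1 + e2)))"
      unfolding y using \<epsilon> that by (intro interp_upper) (auto simp: S_def s_def t_def)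
    have p: "pos ?k = pos i + e1 + e2" "pos (i + dx) = pos i + e1" "pos (i + dy) = pos i + e2"
      by (simp_all only: pos_add pos_d)
    have "A_map (interp \<epsilon> Q y) = A ?k + (1 - s) *\<^sub>R (A (i + dy) - A ?k) + (1 - t) *\<^sub>R (A (i + dx) - A ?k)"
      unfolding I A_def p by (simp add: vec_eq_iff forall_2 algebra_simps)
    then show ?thesis
      by (simp add: s_def t_def algebra_simps)
  qed
  have "det (jacobian (\<lambda>y. A_map (interp \<epsilon> Q y)) (at x)) = ?a $ 1 * ?b $ 2 - ?a $ 2 * ?b $ 1"
    by (rule det_jacobian_affine[OF oS xS]) (rule f)
  also have "\<dots> = 2 * aU (field \<epsilon> Q) i / \<epsilon>\<^sup>2" using \<epsilon>
    by (simp add: aU_def field_def A_def[symmetric] power2_eq_square field_simps del: A_map_nth)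
  finally show ?thesis by (simp add: i_def)
qed

definition lowset :: "real \<Rightarrow> (real^2) set \<Rightarrow> (int \<times> int) set" where
  "lowset \<epsilon> \<Omega> = {i. lowT \<epsilon> i \<subseteq> \<Omega>}"

definition uppset :: "real \<Rightarrow> (real^2) set \<Rightarrow> (int \<times> int) set" where
  "uppset \<epsilon> \<Omega> = {i. uppT \<epsilon> i \<subseteq> \<Omega>}"

lemma inner_region_iff:
  assumes \<epsilon>: "0 < \<epsilon>" and x: "x \<notin> gridlines \<epsilon>"
  shows "x \<in> inner_region \<epsilon> \<Omega> \<longleftrightarrow>
    (if below_diag \<epsilon> x then cell \<epsilon> x \<in> lowset \<epsilon> \<Omega> else cell \<epsilon> x \<in> uppset \<epsilon> \<Omega>)"
proof -
  have "x \<in> inner_region \<epsilon> \<Omega> \<longleftrightarrow> (\<exists>i. lowT \<epsilon> i \<subseteq> \<Omega> \<and> x \<in> lowT \<epsilon> i) \<or> (\<exists>i. uppT \<epsilon> i \<subseteq> \<Omega> \<and> x \<in> uppT \<epsilon> i)"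
    unfolding inner_region_def grid_triangles_def Z2_eq_range_pos by blast
  then show ?thesis unfolding generic_mem[OF \<epsilon> x] lowset_def uppset_def
    by (simp del: split_paired_Ex)
qed

lemma jac_density_eq:
  assumes \<epsilon>: "0 < \<epsilon>" and x: "x \<notin> gridlines \<epsilon>"
    and fin: "finite (lowset \<epsilon> \<Omega>)" "finite (uppset \<epsilon> \<Omega>)"
  shows "jac_density \<Omega> \<epsilon> Q x =
    (\<Sum>i\<in>lowset \<epsilon> \<Omega>. 2 * aL (field \<epsilon> Q) i / \<epsilon>\<^sup>2 * indicator (lowT \<epsilon> i) x)
    + (\<Sum>i\<in>uppset \<epsilon> \<Omega>. 2 * aU (field \<epsilon> Q) i / \<epsilon>\<^sup>2 * indicator (uppT \<epsilon> i) x)"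
proof -
  have L: "(\<Sum>i\<in>lowset \<epsilon> \<Omega>. 2 * aL (field \<epsilon> Q) i / \<epsilon>\<^sup>2 * indicator (lowT \<epsilon> i) x)
    = (\<Sum>i\<in>lowset \<epsilon> \<Omega>. if i = cell \<epsilon> x then (if below_diag \<epsilon> x then 2 * aL (field \<epsilon> Q) i / \<epsilon>\<^sup>2 else 0) else 0)"
    by (intro sum.cong refl) (simp add: indicator_def generic_mem[OF \<epsilon> x])
  have U: "(\<Sum>i\<in>uppset \<epsilon> \<Omega>. 2 * aU (field \<epsilon> Q) i / \<epsilon>\<^sup>2 * indicator (uppT \<epsilon> i) x)
    = (\<Sum>i\<in>uppset \<epsilon> \<Omega>. if i = cell \<epsilon> x then (if \<not> below_diag \<epsilon> x then 2 * aU (field \<epsilon> Q) i / \<epsilon>\<^sup>2 else 0) else 0)"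
    by (intro sum.cong refl) (simp add: indicator_def generic_mem[OF \<epsilon> x])
  show ?thesis
    unfolding L U sum.delta[OF fin(1)] sum.delta[OF fin(2)] jac_density_def inner_region_iff[OF \<epsilon> x]
    using det_jacobian_interp_low[OF \<epsilon> x] det_jacobian_interp_upp[OF \<epsilon> x] by auto
qed

text \<open>Containment of both triangles is asked, not just of the four corners: a square that
  fails this meets the complement of the domain, where test functions vanish.\<close>

definition sq :: "real \<Rightarrow> (real^2) set \<Rightarrow> (int \<times> int) set" where
  "sq \<epsilon> \<Omega> = lowset \<epsilon> \<Omega> \<inter> uppset \<epsilon> \<Omega>"

lemma lowset_lat:
  assumes "0 < \<epsilon>" "i \<in> lowset \<epsilon> \<Omega>"
  shows "i \<in> lat \<epsilon> \<Omega>" "i + dx \<in> lat \<epsilon> \<Omega>" "i + dy \<in> lat \<epsilon> \<Omega>"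
proof -
  have "\<epsilon> *\<^sub>R pos i \<in> lowT \<epsilon> i" "\<epsilon> *\<^sub>R pos (i + dx) \<in> lowT \<epsilon> i" "\<epsilon> *\<^sub>R pos (i + dy) \<in> lowT \<epsilon> i"
    unfolding lower_triangle_def pos_add pos_d by (auto intro: hull_inc)
  then show "i \<in> lat \<epsilon> \<Omega>" "i + dx \<in> lat \<epsilon> \<Omega>" "i + dy \<in> lat \<epsilon> \<Omega>"
    using assms(2) unfolding lowset_def lat_def by blast+
qed

lemma uppset_lat:
  assumes "0 < \<epsilon>" "i \<in> uppset \<epsilon> \<Omega>"
  shows "i + dx + dy \<in> lat \<epsilon> \<Omega>" "i + dx \<in> lat \<epsilon> \<Omega>" "i + dy \<in> lat \<epsilon> \<Omega>"
proof -
  have "\<epsilon> *\<^sub>R pos (i + dx + dy) \<in> uppT \<epsilon> i" "\<epsilon> *\<^sub>R pos (i + dx) \<in> uppT \<epsilon> i" "\<epsilon> *\<^sub>R pos (i + dy) \<in> uppT \<epsilon> i"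
    unfolding upper_triangle_def pos_add pos_d by (auto intro: hull_inc)
  then show "i + dx + dy \<in> lat \<epsilon> \<Omega>" "i + dx \<in> lat \<epsilon> \<Omega>" "i + dy \<in> lat \<epsilon> \<Omega>"
    using assms(2) unfolding uppset_def lat_def by blast+
qed

lemma sq_squares: "0 < \<epsilon> \<Longrightarrow> sq \<epsilon> \<Omega> \<subseteq> squares (lat \<epsilon> \<Omega>)"
  using lowset_lat uppset_lat unfolding sq_def squares_def by blast

lemma finite_lowset: "bounded \<Omega> \<Longrightarrow> 0 < \<epsilon> \<Longrightarrow> finite (lowset \<epsilon> \<Omega>)"
  using lowset_lat(1) by (intro finite_subset[OF _ finite_lat[of \<Omega> \<epsilon>]]) blast+

lemma finite_uppset: 
  assumes "bounded \<Omega>" "0 < \<epsilon>" shows "finite (uppset \<epsilon> \<Omega>)"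
proof -
  have "(\<lambda>i. i + dx) ` uppset \<epsilon> \<Omega> \<subseteq> lat \<epsilon> \<Omega>" using uppset_lat(2)[OF assms(2)] by blast
  then have "finite ((\<lambda>i. i + dx) ` uppset \<epsilon> \<Omega>)" using finite_lat[OF assms] finite_subset by blast
  then show ?thesis by (rule finite_imageD) (auto simp: inj_on_def)
qed

text \<open>Extended by zero, the test functions in the unit ball of the norm satisfy this on the
  whole plane (\<open>C01c_imp_adm\<close>). The global form yields at once that the value at a
  point is at most its distance to the complement of \<Omega>, and gives a meaning to values at
  points outside \<Omega>.\<close>

definition adm :: "(real^2) set \<Rightarrow> (real^2 \<Rightarrow> real) \<Rightarrow> bool" where
  "adm \<Omega> \<phi> \<longleftrightarrow> (\<forall>x y. \<bar>\<phi> x - \<phi> y\<bar> \<le> dist x y) \<and> (\<forall>x. \<bar>\<phi> x\<bar> \<le> 1) \<and> (\<forall>x. x \<notin> \<Omega> \<longrightarrow> \<phi> x = 0)"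

lemma adm_near:
  assumes "adm \<Omega> \<phi>" "y \<notin> \<Omega>" shows "\<bar>\<phi> x\<bar> \<le> dist x y"
  using assms unfolding adm_def by (metis diff_zero)

lemma dist_in_square:
  assumes \<epsilon>: "0 < \<epsilon>" and y: "y \<in> lowT \<epsilon> i \<or> y \<in> uppT \<epsilon> i"
  shows "dist y (\<epsilon> *\<^sub>R pos i) \<le> 2 * \<epsilon>"
proof -
  have "\<bar>y $ 1 / \<epsilon> - of_int (fst i)\<bar> \<le> 1" "\<bar>y $ 2 / \<epsilon> - of_int (snd i)\<bar> \<le> 1"
    using y unfolding lowT_iff[OF \<epsilon>] uppT_iff[OF \<epsilon>] by linarith+
  then have "\<epsilon> * \<bar>y $ 1 / \<epsilon> - of_int (fst i)\<bar> \<le> \<epsilon> * 1" "\<epsilon> * \<bar>y $ 2 / \<epsilon> - of_int (snd i)\<bar> \<le> \<epsilon> * 1"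
    using \<epsilon> by (intro mult_left_mono; simp)+
  then have "\<bar>\<epsilon> * (y $ 1 / \<epsilon> - of_int (fst i))\<bar> \<le> \<epsilon>" "\<bar>\<epsilon> * (y $ 2 / \<epsilon> - of_int (snd i))\<bar> \<le> \<epsilon>"
    using \<epsilon> by (simp_all add: abs_mult)
  then have "\<bar>(y - \<epsilon> *\<^sub>R pos i) $ 1\<bar> \<le> \<epsilon>" "\<bar>(y - \<epsilon> *\<^sub>R pos i) $ 2\<bar> \<le> \<epsilon>"
    using \<epsilon> by (simp_all add: right_diff_distrib)
  then show ?thesis using norm_real2_le[of "y - \<epsilon> *\<^sub>R pos i"] by (simp add: dist_norm)
qed

lemma triangle_measure:
  assumes "0 < \<epsilon>"
  shows "measure lebesgue (lowT \<epsilon> i) = \<epsilon>\<^sup>2 / 2" "measure lebesgue (uppT \<epsilon> i) = \<epsilon>\<^sup>2 / 2"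
    "lowT \<epsilon> i \<in> lmeasurable" "uppT \<epsilon> i \<in> lmeasurable"
proof -
  have c: "compact (lowT \<epsilon> i)" "compact (uppT \<epsilon> i)"
    unfolding lower_triangle_def upper_triangle_def by (intro finite_imp_compact_convex_hull; simp)+
  then show "lowT \<epsilon> i \<in> lmeasurable" "uppT \<epsilon> i \<in> lmeasurable" by (auto intro: lmeasurable_compact)
  have b: "lowT \<epsilon> i \<in> sets lborel" "uppT \<epsilon> i \<in> sets lborel" using c by (auto intro: borel_compact)
  show "measure lebesgue (lowT \<epsilon> i) = \<epsilon>\<^sup>2 / 2" "measure lebesgue (uppT \<epsilon> i) = \<epsilon>\<^sup>2 / 2"
    unfolding measure_completion[OF b(1)] measure_completion[OF b(2)]
    unfolding lower_triangle_def upper_triangle_def content_triangle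
    using assms by (simp_all add: algebra_simps power2_eq_square abs_mult)
qed

lemma triangle_integral:
  assumes \<epsilon>: "0 < \<epsilon>" and \<phi>: "adm \<Omega> \<phi>"
    and T: "T \<in> lmeasurable" "measure lebesgue T = \<epsilon>\<^sup>2 / 2" "\<And>y. y \<in> T \<Longrightarrow> dist y p \<le> 2 * \<epsilon>"
  shows "integrable lebesgue (\<lambda>y. indicator T y * \<phi> y)"
    and "\<bar>(LINT y|lebesgue. indicator T y * \<phi> y) - \<epsilon>\<^sup>2 / 2 * \<phi> p\<bar> \<le> \<epsilon>\<^sup>2 / 2 * (2 * \<epsilon>)"
proof -
  have lip: "\<bar>\<phi> x - \<phi> y\<bar> \<le> dist x y" for x y using \<phi> by (simp add: adm_def)
  have iT: "integrable lebesgue (indicator T :: real^2 \<Rightarrow> real)"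
    using T(1) by (intro integrable_real_indicator) (auto simp: fmeasurable_def)
  have "1-lipschitz_on UNIV \<phi>" using lip by (intro lipschitz_onI) (auto simp: dist_real_def)
  then have "continuous_on UNIV \<phi>" by (rule lipschitz_on_continuous_on)
  then have "\<phi> \<in> borel_measurable borel" by (rule borel_measurable_continuous_onI)
  then have mb: "\<phi> \<in> borel_measurable lebesgue" by (intro measurable_completion) simp
  have mT: "(indicator T :: real^2 \<Rightarrow> real) \<in> borel_measurable lebesgue" using T(1) by auto
  show int: "integrable lebesgue (\<lambda>y. indicator T y * \<phi> y)"
  proof (rule Bochner_Integration.integrable_bound[OF iT])
    show "AE x in lebesgue. norm (indicator T x * \<phi> x) \<le> norm (indicator T x :: real)"
      using \<phi> by (intro AE_I2) (simp add: adm_def indicator_def)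
  qed (use mb mT in measurable)
  have m: "(LINT y|lebesgue. indicator T y * \<phi> p) = \<epsilon>\<^sup>2 / 2 * \<phi> p"
    using iT T by simp
  have "(LINT y|lebesgue. indicator T y * \<phi> y) - \<epsilon>\<^sup>2 / 2 * \<phi> p
      = (LINT y|lebesgue. indicator T y * \<phi> y - indicator T y * \<phi> p)"
    unfolding m[symmetric] using int iT by (intro Bochner_Integration.integral_diff[symmetric]) auto
  also have "\<bar>\<dots>\<bar> \<le> (LINT y|lebesgue. indicator T y * (2 * \<epsilon>))"
  proof (rule integral_abs_bound[THEN order_trans], rule integral_mono)
    show "integrable lebesgue (\<lambda>x. \<bar>indicator T x * \<phi> x - indicator T x * \<phi> p\<bar>)"
      using int iT by (intro integrable_abs Bochner_Integration.integrable_diff) auto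
    show "integrable lebesgue (\<lambda>y. indicator T y * (2 * \<epsilon>))" using iT by simp
    show "\<bar>indicator T x * \<phi> x - indicator T x * \<phi> p\<bar> \<le> indicator T x * (2 * \<epsilon>)" for x
      using lip[of x p] T(3)[of x] by (auto simp: indicator_def)
  qed
  also have "\<dots> = \<epsilon>\<^sup>2 / 2 * (2 * \<epsilon>)" using iT T by simp
  finally show "\<bar>(LINT y|lebesgue. indicator T y * \<phi> y) - \<epsilon>\<^sup>2 / 2 * \<phi> p\<bar> \<le> \<epsilon>\<^sup>2 / 2 * (2 * \<epsilon>)" .
qed

lemma jac_integral_eq:
  fixes Q :: "real^2 \<Rightarrow> real^2^2"
  assumes \<epsilon>: "0 < \<epsilon>" and \<Omega>: "bounded \<Omega>" and \<phi>: "adm \<Omega> \<phi>"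
  defines "v \<equiv> field \<epsilon> Q"
  shows "(LINT y : \<Omega> | lebesgue. jac_density \<Omega> \<epsilon> Q y * \<phi> y) =
    (\<Sum>i\<in>lowset \<epsilon> \<Omega>. 2 * aL v i / \<epsilon>\<^sup>2 * (LINT y|lebesgue. indicator (lowT \<epsilon> i) y * \<phi> y))
    + (\<Sum>i\<in>uppset \<epsilon> \<Omega>. 2 * aU v i / \<epsilon>\<^sup>2 * (LINT y|lebesgue. indicator (uppT \<epsilon> i) y * \<phi> y))"
proof -
  note fin = finite_lowset[OF \<Omega> \<epsilon>] finite_uppset[OF \<Omega> \<epsilon>]
  define F where "F y = indicator \<Omega> y *\<^sub>R (jac_density \<Omega> \<epsilon> Q y * \<phi> y)" for y
  define G where "G y = (\<Sum>i\<in>lowset \<epsilon> \<Omega>. 2 * aL v i / \<epsilon>\<^sup>2 * (indicator (lowT \<epsilon> i) y * \<phi> y))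
    + (\<Sum>i\<in>uppset \<epsilon> \<Omega>. 2 * aU v i / \<epsilon>\<^sup>2 * (indicator (uppT \<epsilon> i) y * \<phi> y))" for y
  have iL: "integrable lebesgue (\<lambda>y. indicator (lowT \<epsilon> i) y * \<phi> y)" for i
    using triangle_measure[OF \<epsilon>] dist_in_square[OF \<epsilon>] by (intro triangle_integral(1)[OF \<epsilon> \<phi>, of _ "\<epsilon> *\<^sub>R pos i"]) auto
  have iU: "integrable lebesgue (\<lambda>y. indicator (uppT \<epsilon> i) y * \<phi> y)" for i
    using triangle_measure[OF \<epsilon>] dist_in_square[OF \<epsilon>] by (intro triangle_integral(1)[OF \<epsilon> \<phi>, of _ "\<epsilon> *\<^sub>R pos i"]) auto
  have iG: "integrable lebesgue G" unfolding G_def using iL iU by (intro Bochner_Integration.integrable_add Bochner_Integration.integrable_sum integrable_mult_right) auto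
  have FG: "F y = G y" if "y \<notin> gridlines \<epsilon>" for y
  proof (cases "y \<in> \<Omega>")
    case True
    then show ?thesis
      unfolding F_def G_def jac_density_eq[OF \<epsilon> that fin] v_def
      by (simp add: distrib_right sum_distrib_right mult.assoc)
  next
    case False
    then have "\<phi> y = 0" using \<phi> by (simp add: adm_def)
    then show ?thesis by (simp add: F_def G_def)
  qed
  have neg: "negligible (gridlines \<epsilon>)" by (rule negligible_gridlines[OF \<epsilon>])
  \<comment> \<open>Measurability of \<open>F\<close> is inherited from the step function
    \<open>G\<close>: they differ only on the grid lines, where \<open>jacobian\<close> takes
    unspecified values.\<close>
  have "(G has_integral (integral\<^sup>L lebesgue G)) UNIV" using iG by (rule has_integral_integral_lebesgue)
  then have "(F has_integral (integral\<^sup>L lebesgue G)) UNIV"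
    by (rule has_integral_spike[OF neg, rotated]) (use FG in auto)
  then have "F \<in> borel_measurable (lebesgue_on UNIV)" by (intro integrable_imp_measurable) (auto simp: integrable_on_def)
  then have mF: "F \<in> borel_measurable lebesgue" by (simp add: lebesgue_on_UNIV_eq)
  have "AE y in lebesgue. F y = G y"
    using neg FG unfolding negligible_iff_null_sets by (intro AE_I'[of "gridlines \<epsilon>"]) auto
  then have "integral\<^sup>L lebesgue F = integral\<^sup>L lebesgue G"
    using mF iG by (intro integral_cong_AE) auto
  also have "\<dots> = (\<Sum>i\<in>lowset \<epsilon> \<Omega>. 2 * aL v i / \<epsilon>\<^sup>2 * (LINT y|lebesgue. indicator (lowT \<epsilon> i) y * \<phi> y))
    + (\<Sum>i\<in>uppset \<epsilon> \<Omega>. 2 * aU v i / \<epsilon>\<^sup>2 * (LINT y|lebesgue. indicator (uppT \<epsilon> i) y * \<phi> y))"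
    unfolding G_def using iL iU
    by (subst Bochner_Integration.integral_add) (auto simp: Bochner_Integration.integral_sum)
  finally show ?thesis unfolding set_lebesgue_integral_def F_def[abs_def, symmetric] .
qed

text \<open>Two errors of \<open>2 * \<epsilon>\<close> per unit of area: replacing the test
  function by its value at the corner of the square, and discarding triangles outside
  \<open>sq\<close>, whose corner is within \<open>2 * \<epsilon>\<close> of the complement of
  \<Omega>.\<close>

lemma jac_integral_near:
  fixes Q :: "real^2 \<Rightarrow> real^2^2"
  assumes \<epsilon>: "0 < \<epsilon>" and \<Omega>: "bounded \<Omega>" and \<phi>: "adm \<Omega> \<phi>"
  defines "v \<equiv> field \<epsilon> Q"
  shows "\<bar>(LINT y : \<Omega> | lebesgue. jac_density \<Omega> \<epsilon> Q y * \<phi> y) - (\<Sum>i\<in>sq \<epsilon> \<Omega>. (aL v i + aU v i) * \<phi> (\<epsilon> *\<^sub>R pos i))\<bar>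
    \<le> 4 * \<epsilon> * ((\<Sum>i\<in>lowset \<epsilon> \<Omega>. \<bar>aL v i\<bar>) + (\<Sum>i\<in>uppset \<epsilon> \<Omega>. \<bar>aU v i\<bar>))"
proof -
  note fin = finite_lowset[OF \<Omega> \<epsilon>] finite_uppset[OF \<Omega> \<epsilon>]
  let ?p = "\<lambda>i. \<epsilon> *\<^sub>R pos i"
  have one: "\<bar>2 * a / \<epsilon>\<^sup>2 * I - a * \<phi> p\<bar> \<le> 2 * \<epsilon> * \<bar>a\<bar>"
    if "\<bar>I - \<epsilon>\<^sup>2 / 2 * \<phi> p\<bar> \<le> \<epsilon>\<^sup>2 / 2 * (2 * \<epsilon>)" for a I p
  proof -
    have "2 * a / \<epsilon>\<^sup>2 * I - a * \<phi> p = 2 * a / \<epsilon>\<^sup>2 * (I - \<epsilon>\<^sup>2 / 2 * \<phi> p)"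
      using \<epsilon> by (simp add: right_diff_distrib)
    then have "\<bar>2 * a / \<epsilon>\<^sup>2 * I - a * \<phi> p\<bar> = 2 * \<bar>a\<bar> / \<epsilon>\<^sup>2 * \<bar>I - \<epsilon>\<^sup>2 / 2 * \<phi> p\<bar>"
      by (simp add: abs_mult)
    also have "\<dots> \<le> 2 * \<bar>a\<bar> / \<epsilon>\<^sup>2 * (\<epsilon>\<^sup>2 / 2 * (2 * \<epsilon>))" using that by (intro mult_left_mono) auto
    also have "\<dots> = 2 * \<epsilon> * \<bar>a\<bar>" using \<epsilon> by simp
    finally show ?thesis .
  qed
  have bL: "\<bar>(\<Sum>i\<in>lowset \<epsilon> \<Omega>. 2 * aL v i / \<epsilon>\<^sup>2 * (LINT y|lebesgue. indicator (lowT \<epsilon> i) y * \<phi> y))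
      - (\<Sum>i\<in>lowset \<epsilon> \<Omega>. aL v i * \<phi> (?p i))\<bar> \<le> (\<Sum>i\<in>lowset \<epsilon> \<Omega>. 2 * \<epsilon> * \<bar>aL v i\<bar>)"
    unfolding sum_subtractf[symmetric]
  proof (rule sum_abs[THEN order_trans], rule sum_mono, rule one)
    fix i show "\<bar>(LINT y|lebesgue. indicator (lowT \<epsilon> i) y * \<phi> y) - \<epsilon>\<^sup>2 / 2 * \<phi> (?p i)\<bar> \<le> \<epsilon>\<^sup>2 / 2 * (2 * \<epsilon>)"
      using triangle_measure[OF \<epsilon>] dist_in_square[OF \<epsilon>] by (intro triangle_integral(2)[OF \<epsilon> \<phi>]) auto
  qed
  have bU: "\<bar>(\<Sum>i\<in>uppset \<epsilon> \<Omega>. 2 * aU v i / \<epsilon>\<^sup>2 * (LINT y|lebesgue. indicator (uppT \<epsilon> i) y * \<phi> y))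
      - (\<Sum>i\<in>uppset \<epsilon> \<Omega>. aU v i * \<phi> (?p i))\<bar> \<le> (\<Sum>i\<in>uppset \<epsilon> \<Omega>. 2 * \<epsilon> * \<bar>aU v i\<bar>)"
    unfolding sum_subtractf[symmetric]
  proof (rule sum_abs[THEN order_trans], rule sum_mono, rule one)
    fix i show "\<bar>(LINT y|lebesgue. indicator (uppT \<epsilon> i) y * \<phi> y) - \<epsilon>\<^sup>2 / 2 * \<phi> (?p i)\<bar> \<le> \<epsilon>\<^sup>2 / 2 * (2 * \<epsilon>)"
      using triangle_measure[OF \<epsilon>] dist_in_square[OF \<epsilon>] by (intro triangle_integral(2)[OF \<epsilon> \<phi>]) auto
  qed
  have near: "\<bar>\<phi> (?p i)\<bar> \<le> 2 * \<epsilon>" if "i \<notin> sq \<epsilon> \<Omega>" for i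
  proof -
    obtain y where y: "y \<in> lowT \<epsilon> i \<or> y \<in> uppT \<epsilon> i" "y \<notin> \<Omega>"
      using \<open>i \<notin> sq \<epsilon> \<Omega>\<close> unfolding sq_def lowset_def uppset_def by blast
    then show ?thesis using adm_near[OF \<phi> y(2), of "?p i"] dist_in_square[OF \<epsilon> y(1)] by (simp add: dist_commute)
  qed
  have cut: "\<bar>(\<Sum>i\<in>A. a i * \<phi> (?p i)) - (\<Sum>i\<in>sq \<epsilon> \<Omega>. a i * \<phi> (?p i))\<bar> \<le> (\<Sum>i\<in>A. 2 * \<epsilon> * \<bar>a i\<bar>)"
    if A: "finite A" "sq \<epsilon> \<Omega> \<subseteq> A" for a A
  proof -
    have "(\<Sum>i\<in>A. a i * \<phi> (?p i)) - (\<Sum>i\<in>sq \<epsilon> \<Omega>. a i * \<phi> (?p i)) = (\<Sum>i\<in>A - sq \<epsilon> \<Omega>. a i * \<phi> (?p i))"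
      using A by (simp add: sum_diff)
    also have "\<bar>\<dots>\<bar> \<le> (\<Sum>i\<in>A - sq \<epsilon> \<Omega>. \<bar>a i * \<phi> (?p i)\<bar>)" by (rule sum_abs)
    also have "\<dots> \<le> (\<Sum>i\<in>A - sq \<epsilon> \<Omega>. 2 * \<epsilon> * \<bar>a i\<bar>)"
    proof (rule sum_mono)
      fix i assume "i \<in> A - sq \<epsilon> \<Omega>"
      then have "\<bar>a i\<bar> * \<bar>\<phi> (?p i)\<bar> \<le> \<bar>a i\<bar> * (2 * \<epsilon>)" using near by (intro mult_left_mono) auto
      then show "\<bar>a i * \<phi> (?p i)\<bar> \<le> 2 * \<epsilon> * \<bar>a i\<bar>" by (simp add: abs_mult mult.commute)
    qed
    also have "\<dots> \<le> (\<Sum>i\<in>A. 2 * \<epsilon> * \<bar>a i\<bar>)" using A \<epsilon> by (intro sum_mono2) auto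
    finally show ?thesis .
  qed
  have "sq \<epsilon> \<Omega> \<subseteq> lowset \<epsilon> \<Omega>" "sq \<epsilon> \<Omega> \<subseteq> uppset \<epsilon> \<Omega>" by (auto simp: sq_def)
  note c = cut[OF fin(1) this(1), of "aL v"] cut[OF fin(2) this(2), of "aU v"]
  have s: "(\<Sum>i\<in>sq \<epsilon> \<Omega>. (aL v i + aU v i) * \<phi> (?p i))
     = (\<Sum>i\<in>sq \<epsilon> \<Omega>. aL v i * \<phi> (?p i)) + (\<Sum>i\<in>sq \<epsilon> \<Omega>. aU v i * \<phi> (?p i))"
    by (simp add: distrib_right sum.distrib)
  show ?thesis
    unfolding jac_integral_eq[OF \<epsilon> \<Omega> \<phi>, of Q, folded v_def] s
    using bL bU c unfolding sum_distrib_left[symmetric] distrib_left by linarith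
qed

section \<open>Areas of image triangles, compared with the energy and the bond angles\<close>

lemma chord_square:
  assumes "norm (z :: complex) = 1" "norm w = 1"
  shows "(norm (w - z))\<^sup>2 = 2 * (1 - cos (Arg (w / z)))"
proof -
  have "(Re z)\<^sup>2 + (Im z)\<^sup>2 = 1" "(Re w)\<^sup>2 + (Im w)\<^sup>2 = 1"
    using assms by (simp_all add: cmod_def real_sqrt_eq_1_iff)
  then show ?thesis
    unfolding cos_Arg_quotient(1)[OF assms] cmod_power2 by (simp add: power2_diff algebra_simps)
qed

lemma half_cross_le: "\<bar>Im (cnj a * b) / 2\<bar> \<le> ((norm a)\<^sup>2 + (norm b)\<^sup>2) / 4"
proof -
  have "\<bar>Im (cnj a * b)\<bar> \<le> norm a * norm b" using abs_Im_le_cmod[of "cnj a * b"] by (simp add: norm_mult)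
  moreover have "2 * norm a * norm b \<le> (norm a)\<^sup>2 + (norm b)\<^sup>2" by (rule sum_squares_bound)
  ultimately show ?thesis by simp
qed

text \<open>The area of an image triangle is at most half the energy of its two legs. A bond is a
  leg of at most one lower and one upper triangle, so each family contributes at most half the
  energy.\<close>

lemma sum_areas_le:
  assumes \<epsilon>: "0 < \<epsilon>" and \<Omega>: "bounded \<Omega>" and v: "\<And>i. i \<in> lat \<epsilon> \<Omega> \<Longrightarrow> norm (v i) = 1"
  shows "(\<Sum>i\<in>lowset \<epsilon> \<Omega>. \<bar>aL v i\<bar>) + (\<Sum>i\<in>uppset \<epsilon> \<Omega>. \<bar>aU v i\<bar>) \<le> xy_energy (lat \<epsilon> \<Omega>) v"
proof -
  let ?Z = "lat \<epsilon> \<Omega>" and ?L = "lowset \<epsilon> \<Omega>" and ?U = "uppset \<epsilon> \<Omega>"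
  note fin = finite_lowset[OF \<Omega> \<epsilon>] finite_uppset[OF \<Omega> \<epsilon>] finite_lat[OF \<Omega> \<epsilon>]
  have fh: "finite (hbonds ?Z)" "finite (vbonds ?Z)" using fin by (auto simp: hbonds_def vbonds_def)
  have c0: "0 \<le> 1 - cos t" for t :: real by simp
  have "\<bar>aL v i\<bar> \<le> ((1 - cos (hb v i)) + (1 - cos (vb v i))) / 2" if "i \<in> ?L" for i
  proof -
    note l = lowset_lat[OF \<epsilon> that, THEN v]
    show ?thesis
      using half_cross_le[of "v (i + dx) - v i" "v (i + dy) - v i"]
      unfolding chord_square[OF l(1,2)] chord_square[OF l(1,3)] aL_def hb_def vb_def by simp
  qed
  then have "(\<Sum>i\<in>?L. \<bar>aL v i\<bar>) \<le> (\<Sum>i\<in>?L. ((1 - cos (hb v i)) + (1 - cos (vb v i))) / 2)" by (rule sum_mono)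
  also have "\<dots> = ((\<Sum>i\<in>?L. 1 - cos (hb v i)) + (\<Sum>i\<in>?L. 1 - cos (vb v i))) / 2"
    by (simp only: sum.distrib sum_divide_distrib[symmetric])
  also have "\<dots> \<le> xy_energy ?Z v / 2"
  proof -
    have "?L \<subseteq> hbonds ?Z" "?L \<subseteq> vbonds ?Z" using lowset_lat[OF \<epsilon>] unfolding hbonds_def vbonds_def by blast+
    then show ?thesis unfolding xy_energy_def using fh c0 by (intro divide_right_mono add_mono sum_mono2) auto
  qed
  finally have L: "(\<Sum>i\<in>?L. \<bar>aL v i\<bar>) \<le> xy_energy ?Z v / 2" .
  have "\<bar>aU v i\<bar> \<le> ((1 - cos (hb v (i + dy))) + (1 - cos (vb v (i + dx)))) / 2" if "i \<in> ?U" for i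
  proof -
    note l = uppset_lat[OF \<epsilon> that, THEN v]
    have sw: "i + dy + dx = i + dx + dy" by (simp only: ac_simps)
    show ?thesis
      using half_cross_le[of "v (i + dx + dy) - v (i + dy)" "v (i + dx + dy) - v (i + dx)"]
      unfolding chord_square[OF l(3,1)] chord_square[OF l(2,1)] aU_def hb_def vb_def sw by simp
  qed
  then have "(\<Sum>i\<in>?U. \<bar>aU v i\<bar>) \<le> (\<Sum>i\<in>?U. ((1 - cos (hb v (i + dy))) + (1 - cos (vb v (i + dx)))) / 2)" by (rule sum_mono)
  also have "\<dots> = ((\<Sum>i\<in>(\<lambda>i. i + dy) ` ?U. 1 - cos (hb v i)) + (\<Sum>i\<in>(\<lambda>i. i + dx) ` ?U. 1 - cos (vb v i))) / 2"
    by (subst (1 2) sum.reindex) (auto simp: inj_on_def sum.distrib sum_subtractf sum_negf o_def sum_divide_distrib[symmetric])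
  also have "\<dots> \<le> xy_energy ?Z v / 2"
  proof -
    have sw: "i + dy + dx = i + dx + dy" for i :: "int \<times> int" by (simp only: ac_simps)
    have "(\<lambda>i. i + dy) ` ?U \<subseteq> hbonds ?Z" "(\<lambda>i. i + dx) ` ?U \<subseteq> vbonds ?Z"
      using uppset_lat[OF \<epsilon>] unfolding hbonds_def vbonds_def by (auto simp only: sw)
    then show ?thesis unfolding xy_energy_def using fh c0 by (intro divide_right_mono add_mono sum_mono2) auto
  qed
  finally show ?thesis using L by linarith
qed

text \<open>Shoelace formula: the contributions of the diagonal cancel, and the cross product of two
  unit vectors is the sine of the angle between them.\<close>

lemma quad_area:
  assumes i: "i \<in> squares Z" and v: "\<And>j. j \<in> Z \<Longrightarrow> norm (v j) = 1"
  shows "aL v i + aU v i = (sin (hb v i) + sin (vb v (i + dx)) - sin (hb v (i + dy)) - sin (vb v i)) / 2"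
proof -
  have sw: "i + dy + dx = i + dx + dy" by (simp only: ac_simps)
  have n: "norm (v i) = 1" "norm (v (i + dx)) = 1" "norm (v (i + dy)) = 1" "norm (v (i + dx + dy)) = 1"
    using assms by (auto simp: squares_def)
  show ?thesis
    unfolding hb_def vb_def sw cos_Arg_quotient(2)[OF n(1,2)] cos_Arg_quotient(2)[OF n(2,4)]
      cos_Arg_quotient(2)[OF n(3,4)] cos_Arg_quotient(2)[OF n(1,3)] aL_def aU_def
    by (simp add: algebra_simps add_divide_distrib[symmetric] diff_divide_distrib[symmetric] del: add_Pair)
qed

text \<open>Signed area minus pi times vorticity is half the circulation of sin a - a. Summation by
  parts moves the difference onto the test function, which varies by O(\<epsilon>) across a bond,
  while \<open>sin_diff_bound\<close> controls the rest by the energy.\<close>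

theorem jacobian_vorticity:
  fixes Q :: "real^2 \<Rightarrow> real^2^2"
  assumes \<epsilon>: "0 < \<epsilon>" and \<Omega>: "bounded \<Omega>" and Q: "Q \<in> C_eps \<epsilon> \<Omega>" and \<phi>: "adm \<Omega> \<phi>"
  defines "v \<equiv> field \<epsilon> Q"
  shows "\<bar>(LINT y : \<Omega> | lebesgue. jac_density \<Omega> \<epsilon> Q y * \<phi> y)
      - pi * (\<Sum>i\<in>sq \<epsilon> \<Omega>. of_int (vort v i) * \<phi> (\<epsilon> *\<^sub>R pos i))\<bar> \<le> 40 * \<epsilon> * xy_energy (lat \<epsilon> \<Omega>) v"
proof -
  let ?Z = "lat \<epsilon> \<Omega>" and ?D = "sq \<epsilon> \<Omega>" and ?p = "\<lambda>i. \<epsilon> *\<^sub>R pos i"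
  have v: "\<And>i. i \<in> ?Z \<Longrightarrow> norm (v i) = 1" unfolding v_def by (rule field_norm[OF Q])
  have DZ: "?D \<subseteq> squares ?Z" by (rule sq_squares[OF \<epsilon>])
  have fD: "finite ?D" using finite_lowset[OF \<Omega> \<epsilon>] by (simp add: sq_def)
  have fh: "finite (hbonds ?Z)" "finite (vbonds ?Z)" using finite_lat[OF \<Omega> \<epsilon>] by (auto simp: hbonds_def vbonds_def)
  have lip: "\<bar>\<phi> x - \<phi> y\<bar> \<le> dist x y" for x y using \<phi> by (simp add: adm_def)
  define h w where "h i = sin (hb v i) - hb v i" and "w i = sin (vb v i) - vb v i" for i
  define \<psi> where "\<psi> i = (if i \<in> ?D then \<phi> (?p i) else 0)" for i
  have near: "\<bar>\<phi> x\<bar> \<le> 2 * \<epsilon> + dist x (?p i)" if "i \<notin> ?D" for i x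
  proof -
    obtain y where y: "y \<in> lowT \<epsilon> i \<or> y \<in> uppT \<epsilon> i" "y \<notin> \<Omega>"
      using \<open>i \<notin> ?D\<close> unfolding sq_def lowset_def uppset_def by blast
    then show ?thesis using adm_near[OF \<phi> y(2), of x] dist_in_square[OF \<epsilon> y(1)] dist_triangle[of x y "?p i"]
      by (simp add: dist_commute)
  qed
  \<comment> \<open>Between two squares of \<open>sq\<close> the jump is at most \<epsilon>. At the
    edge of \<open>sq\<close> the test function is cut to zero, but there it is at most 2 \<epsilon>
    + \<epsilon>.\<close>
  have \<psi>d: "\<bar>\<psi> i - \<psi> j\<bar> \<le> 3 * \<epsilon>" if "dist (pos i) (pos j) = 1" for i j
  proof -
    have "dist (?p i) (?p j) = \<epsilon>" using that \<epsilon> by (simp add: dist_norm scaleR_diff_right[symmetric])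
    then have d: "dist (?p i) (?p j) = \<epsilon>" "dist (?p j) (?p i) = \<epsilon>" by (simp_all add: dist_commute)
    then show ?thesis using lip[of "?p i" "?p j"] near[of i "?p j"] near[of j "?p i"] \<epsilon> unfolding \<psi>_def by auto
  qed
  have "(\<Sum>i\<in>?D. (aL v i + aU v i) * \<phi> (?p i)) - pi * (\<Sum>i\<in>?D. of_int (vort v i) * \<phi> (?p i))
      = (\<Sum>i\<in>?D. \<psi> i * (h i + w (i + dx) - h (i + dy) - w i)) / 2"
    unfolding sum_distrib_left sum_subtractf[symmetric] sum_divide_distrib
  proof (rule sum.cong[OF refl])
    fix i assume i: "i \<in> ?D"
    then have iS: "i \<in> squares ?Z" using DZ by blast
    have "pi * of_int (vort v i) = (hb v i + vb v (i + dx) - hb v (i + dy) - vb v i) / 2"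
      using circulation_eq_vort[OF iS v] by (simp add: circulation_def)
    moreover have "aL v i + aU v i = (sin (hb v i) + sin (vb v (i + dx)) - sin (hb v (i + dy)) - sin (vb v i)) / 2"
      using iS v by (rule quad_area)
    ultimately have X: "(aL v i + aU v i) - pi * of_int (vort v i) = (h i + w (i + dx) - h (i + dy) - w i) / 2"
      unfolding h_def w_def by argo
    have "(aL v i + aU v i) * \<phi> (?p i) - pi * (of_int (vort v i) * \<phi> (?p i))
        = ((aL v i + aU v i) - pi * of_int (vort v i)) * \<phi> (?p i)"
      by (simp only: left_diff_distrib mult.assoc)
    also have "\<dots> = \<psi> i * (h i + w (i + dx) - h (i + dy) - w i) / 2"
      unfolding X using i by (simp add: \<psi>_def)
    finally show "(aL v i + aU v i) * \<phi> (?p i) - pi * (of_int (vort v i) * \<phi> (?p i)) = \<psi> i * (h i + w (i + dx) - h (i + dy) - w i) / 2" .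
  qed
  also have "(\<Sum>i\<in>?D. \<psi> i * (h i + w (i + dx) - h (i + dy) - w i))
     = (\<Sum>i\<in>nbhd ?D. h i * (\<psi> i - \<psi> (i - dy)) + w i * (\<psi> (i - dx) - \<psi> i))"
    by (rule summation_by_parts[OF fD]) (simp add: \<psi>_def)
  finally have e: "(\<Sum>i\<in>?D. (aL v i + aU v i) * \<phi> (?p i)) - pi * (\<Sum>i\<in>?D. of_int (vort v i) * \<phi> (?p i))
     = (\<Sum>i\<in>nbhd ?D. h i * (\<psi> i - \<psi> (i - dy)) + w i * (\<psi> (i - dx) - \<psi> i)) / 2" .
  have fN: "finite (nbhd ?D)" using fD by (simp add: nbhd_def)
  have bh: "\<bar>\<Sum>i\<in>nbhd ?D. h i * (\<psi> i - \<psi> (i - dy))\<bar> \<le> 36 * \<epsilon> * (\<Sum>i\<in>hbonds ?Z. 1 - cos (hb v i))"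
  proof -
    have "(\<Sum>i\<in>nbhd ?D. h i * (\<psi> i - \<psi> (i - dy))) = (\<Sum>i\<in>nbhd ?D \<inter> hbonds ?Z. h i * (\<psi> i - \<psi> (i - dy)))"
    proof (intro sum.mono_neutral_right ballI)
      fix i assume "i \<in> nbhd ?D - nbhd ?D \<inter> hbonds ?Z"
      then have "i \<notin> ?D" "i - dy \<notin> ?D" using bonds_of_support(1)[OF DZ, of i] by auto
      then show "h i * (\<psi> i - \<psi> (i - dy)) = 0" by (simp add: \<psi>_def)
    qed (use fN in auto)
    also have "\<bar>\<dots>\<bar> \<le> (\<Sum>i\<in>nbhd ?D \<inter> hbonds ?Z. 36 * \<epsilon> * (1 - cos (hb v i)))"
    proof (rule sum_abs[THEN order_trans], rule sum_mono)
      fix i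
      have "\<bar>h i\<bar> * \<bar>\<psi> i - \<psi> (i - dy)\<bar> \<le> (12 * (1 - cos (hb v i))) * (3 * \<epsilon>)"
        using sin_diff_bound[of "hb v i"] \<psi>d[OF dist_pos_step(2)] by (intro mult_mono) (auto simp: h_def)
      then show "\<bar>h i * (\<psi> i - \<psi> (i - dy))\<bar> \<le> 36 * \<epsilon> * (1 - cos (hb v i))" by (simp add: abs_mult mult_ac)
    qed
    also have "\<dots> \<le> (\<Sum>i\<in>hbonds ?Z. 36 * \<epsilon> * (1 - cos (hb v i)))" using fh \<epsilon> by (intro sum_mono2) auto
    finally show ?thesis by (simp add: sum_distrib_left)
  qed
  have bw: "\<bar>\<Sum>i\<in>nbhd ?D. w i * (\<psi> (i - dx) - \<psi> i)\<bar> \<le> 36 * \<epsilon> * (\<Sum>i\<in>vbonds ?Z. 1 - cos (vb v i))"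
  proof -
    have "(\<Sum>i\<in>nbhd ?D. w i * (\<psi> (i - dx) - \<psi> i)) = (\<Sum>i\<in>nbhd ?D \<inter> vbonds ?Z. w i * (\<psi> (i - dx) - \<psi> i))"
    proof (intro sum.mono_neutral_right ballI)
      fix i assume "i \<in> nbhd ?D - nbhd ?D \<inter> vbonds ?Z"
      then have "i \<notin> ?D" "i - dx \<notin> ?D" using bonds_of_support(2)[OF DZ, of i] by auto
      then show "w i * (\<psi> (i - dx) - \<psi> i) = 0" by (simp add: \<psi>_def)
    qed (use fN in auto)
    also have "\<bar>\<dots>\<bar> \<le> (\<Sum>i\<in>nbhd ?D \<inter> vbonds ?Z. 36 * \<epsilon> * (1 - cos (vb v i)))"
    proof (rule sum_abs[THEN order_trans], rule sum_mono)
      fix i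
      have "\<bar>w i\<bar> * \<bar>\<psi> (i - dx) - \<psi> i\<bar> \<le> (12 * (1 - cos (vb v i))) * (3 * \<epsilon>)"
        using sin_diff_bound[of "vb v i"] \<psi>d[OF dist_pos_step(1)[of i]] by (intro mult_mono) (auto simp: w_def abs_minus_commute)
      then show "\<bar>w i * (\<psi> (i - dx) - \<psi> i)\<bar> \<le> 36 * \<epsilon> * (1 - cos (vb v i))" by (simp add: abs_mult mult_ac)
    qed
    also have "\<dots> \<le> (\<Sum>i\<in>vbonds ?Z. 36 * \<epsilon> * (1 - cos (vb v i)))" using fh \<epsilon> by (intro sum_mono2) auto
    finally show ?thesis by (simp add: sum_distrib_left)
  qed
  have E0: "0 \<le> xy_energy ?Z v" unfolding xy_energy_def by (intro add_nonneg_nonneg sum_nonneg) auto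
  have "\<bar>(\<Sum>i\<in>?D. (aL v i + aU v i) * \<phi> (?p i)) - pi * (\<Sum>i\<in>?D. of_int (vort v i) * \<phi> (?p i))\<bar>
      \<le> 18 * \<epsilon> * xy_energy ?Z v"
  proof -
    have "\<bar>(a + b) / 2\<bar> \<le> 18 * \<epsilon> * (A + B)" if "\<bar>a\<bar> \<le> 36 * \<epsilon> * A" "\<bar>b\<bar> \<le> 36 * \<epsilon> * B" for a b A B
    proof -
      have "\<bar>a + b\<bar> \<le> 36 * \<epsilon> * A + 36 * \<epsilon> * B" using that by linarith
      then show ?thesis by (simp add: algebra_simps)
    qed
    then show ?thesis unfolding e xy_energy_def sum.distrib using bh bw by blast
  qed
  moreover have "4 * \<epsilon> * ((\<Sum>i\<in>lowset \<epsilon> \<Omega>. \<bar>aL v i\<bar>) + (\<Sum>i\<in>uppset \<epsilon> \<Omega>. \<bar>aU v i\<bar>)) \<le> 4 * \<epsilon> * xy_energy ?Z v"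
    using sum_areas_le[OF \<epsilon> \<Omega> v] \<epsilon> by (intro mult_left_mono) auto
  moreover note jac_integral_near[OF \<epsilon> \<Omega> \<phi>, of Q, folded v_def]
  moreover have "0 \<le> \<epsilon> * xy_energy ?Z v" using \<epsilon> E0 by simp
  \<comment> \<open>The contributions are 12 * 3 / 2 = 18 from the summation by parts and 4 from the
    triangles; 40 leaves room.\<close>
  ultimately show ?thesis by linarith
qed

section \<open>Vortex structure at bounded energy\<close>

text \<open>The only issue is a pair with one point outside \<Omega>, where the norm gives no
  information. The compact support inside the open set provides an intermediate point of \<Omega> at
  which the function already vanishes.\<close>

lemma C01c_imp_adm:
  assumes \<Omega>: "open \<Omega>" and \<phi>: "\<phi> \<in> C01c \<Omega>" "C01_norm \<Omega> \<phi> \<le> 1"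
  shows "adm \<Omega> \<phi>"
proof -
  define S where "S = closure {x. \<phi> x \<noteq> 0}"
  have S: "closed S" "S \<subseteq> \<Omega>" using \<phi>(1) by (auto simp: C01c_def S_def)
  have zero: "\<phi> x = 0" if "x \<notin> S" for x using that closure_subset[of "{x. \<phi> x \<noteq> 0}"] by (auto simp: S_def)
  have sup1: "(SUP x \<in> \<Omega>. ennreal \<bar>\<phi> x\<bar>) \<le> 1" "(SUP (x, y) \<in> \<Omega> \<times> \<Omega>. ennreal (\<bar>\<phi> x - \<phi> y\<bar> / dist x y)) \<le> 1"
    using \<phi>(2) unfolding C01_norm_def by (auto intro: order_trans[rotated])
  have b: "\<bar>\<phi> x\<bar> \<le> 1" if "x \<in> \<Omega>" for x
  proof -
    have "ennreal \<bar>\<phi> x\<bar> \<le> 1" using sup1(1) that by (simp add: SUP_le_iff)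
    then show ?thesis by (simp add: ennreal_le_1)
  qed
  have l: "\<bar>\<phi> x - \<phi> y\<bar> \<le> dist x y" if "x \<in> \<Omega>" "y \<in> \<Omega>" for x y
  proof (cases "x = y")
    case False
    have "ennreal (\<bar>\<phi> x - \<phi> y\<bar> / dist x y) \<le> 1" using sup1(2) that by (auto simp: SUP_le_iff)
    then have "\<bar>\<phi> x - \<phi> y\<bar> / dist x y \<le> 1" by (simp add: ennreal_le_1)
    then show ?thesis using False by (simp add: divide_le_eq)
  qed simp
  have out: "\<bar>\<phi> x\<bar> \<le> dist x y" if "y \<notin> \<Omega>" for x y
  proof (cases "x \<in> S")
    case True
    \<comment> \<open>Otherwise the disjoint closed sets \<open>S\<close> and the complement of
      \<Omega> would disconnect the segment.\<close>
    have "\<exists>z\<in>closed_segment x y. z \<in> \<Omega> \<and> z \<notin> S"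
    proof (rule ccontr)
      assume n: "\<not> ?thesis"
      have "connected (closed_segment x y)" by simp
      moreover have "closed_segment x y \<subseteq> S \<union> - \<Omega>" using n by blast
      moreover have "S \<inter> closed_segment x y \<noteq> {}" "- \<Omega> \<inter> closed_segment x y \<noteq> {}" using True that by auto
      moreover have "closed S" "closed (- \<Omega>)" using S \<Omega> by auto
      moreover have "S \<inter> - \<Omega> \<inter> closed_segment x y = {}" using S by blast
      ultimately show False unfolding connected_closed by blast
    qed
    then obtain z where z: "z \<in> closed_segment x y" "z \<in> \<Omega>" "z \<notin> S" by blast
    then have "\<bar>\<phi> x\<bar> \<le> dist x z" using l[of x z] zero[of z] True S by auto
    also have "\<dots> \<le> dist x y" using z(1) by (metis between_mem_segment between dist_commute le_add_same_cancel1 zero_le_dist)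
    finally show ?thesis .
  qed (simp add: zero)
  have "\<bar>\<phi> x - \<phi> y\<bar> \<le> dist x y" for x y
  proof -
    have "\<phi> x = 0" if "x \<notin> \<Omega>" for x using zero S that by auto
    then show ?thesis
      using l[of x y] out[of y x] out[of x y] by (cases "x \<in> \<Omega>"; cases "y \<in> \<Omega>") (auto simp: dist_commute)
  qed
  moreover have "\<bar>\<phi> x\<bar> \<le> 1" for x using b[of x] zero[of x] S by (cases "x \<in> S") auto
  moreover have "\<phi> x = 0" if "x \<notin> \<Omega>" for x using zero S that by auto
  ultimately show ?thesis by (simp add: adm_def)
qed

lemma dual_norm_le:
  assumes "open \<Omega>" "\<And>\<phi>. adm \<Omega> \<phi> \<Longrightarrow> \<bar>\<Lambda> \<phi>\<bar> \<le> h"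
  shows "dual_norm \<Omega> \<Lambda> \<le> ennreal h"
  unfolding dual_norm_def using assms C01c_imp_adm[OF assms(1)] by (intro SUP_least) (auto intro!: ennreal_leI)

text \<open>Listing points with multiplicity and weights of size 1 turns a bound on the total degree
  into a bound on the length of a list, the form needed for extracting a subsequence; it also serves
  to split a given measure into unit vortices.\<close>

lemma weighted_points_list:
  fixes w :: "'b \<Rightarrow> int" and c :: "'b \<Rightarrow> real^2"
  assumes "finite I"
  shows "\<exists>xs :: (real \<times> (real^2)) list. (\<forall>p\<in>set xs. \<bar>fst p\<bar> = 1) \<and> int (length xs) = (\<Sum>B\<in>I. \<bar>w B\<bar>) \<and>
    (\<forall>\<phi>. (\<Sum>p\<leftarrow>xs. fst p * \<phi> (snd p)) = (\<Sum>B\<in>I. of_int (w B) * \<phi> (c B))) \<and> snd ` set xs \<subseteq> c ` I"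
  using assms
proof induction
  case empty then show ?case by (intro exI[of _ "[]"]) simp
next
  case (insert B I)
  then obtain xs :: "(real \<times> (real^2)) list" where xs: "\<forall>p\<in>set xs. \<bar>fst p\<bar> = 1" "int (length xs) = (\<Sum>B\<in>I. \<bar>w B\<bar>)"
    "\<forall>\<phi>. (\<Sum>p\<leftarrow>xs. fst p * \<phi> (snd p)) = (\<Sum>B\<in>I. of_int (w B) * \<phi> (c B))" "snd ` set xs \<subseteq> c ` I" by blast
  define ys where "ys = (if w B = 0 then [] else replicate (nat \<bar>w B\<bar>) (of_int (sgn (w B)) :: real, c B))"
  have "\<bar>fst p\<bar> = 1" if "p \<in> set ys" for p
    using that by (cases "w B = 0") (auto simp: ys_def sgn_if)
  moreover have "int (length ys) = \<bar>w B\<bar>" by (simp add: ys_def)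
  moreover have "(\<Sum>p\<leftarrow>ys. fst p * \<phi> (snd p)) = of_int (w B) * \<phi> (c B)" for \<phi>
    by (auto simp: ys_def sum_list_replicate sgn_if)
  moreover have "snd ` set ys \<subseteq> {c B}" by (auto simp: ys_def)
  ultimately show ?case using insert.hyps xs by (intro exI[of _ "ys @ xs"]) auto
qed

text \<open>Moving a vortex to the centre of its ball costs at most \<rho> for a 1-Lipschitz
  function. Vortices in balls that are not interior are dropped, because the test function is of the
  order of \<rho> + \<epsilon> on them.\<close>

lemma vortex_balls_flat:
  fixes v :: "int \<times> int \<Rightarrow> complex"
  assumes \<epsilon>: "0 < \<epsilon>" and \<Omega>: "bounded \<Omega>" and v: "\<And>i. i \<in> lat \<epsilon> \<Omega> \<Longrightarrow> norm (v i) = 1" and \<phi>: "adm \<Omega> \<phi>"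
    and \<B>: "finite \<B>" "\<forall>B\<in>\<B>. 0 < snd B" "bsep \<tau> \<B>" "0 \<le> \<tau>" "covers \<B> (sq \<epsilon> \<Omega>) (vort v)"
    and \<rho>: "\<epsilon> * sum snd \<B> \<le> \<rho>"
  shows "\<bar>(\<Sum>i\<in>sq \<epsilon> \<Omega>. of_int (vort v i) * \<phi> (\<epsilon> *\<^sub>R pos i))
      - (\<Sum>B\<in>{B\<in>\<B>. interior_ball (sq \<epsilon> \<Omega>) B}. of_int (bdeg (sq \<epsilon> \<Omega>) (vort v) B) * \<phi> (\<epsilon> *\<^sub>R fst B))\<bar>
    \<le> real (card {i\<in>sq \<epsilon> \<Omega>. vort v i \<noteq> 0}) * (4 * \<rho> + 4 * \<epsilon>)"
proof -
  let ?D = "sq \<epsilon> \<Omega>" and ?p = "\<lambda>i. \<epsilon> *\<^sub>R pos i"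
  define P where "P = {i\<in>?D. vort v i \<noteq> 0}"
  define J where "J = {B\<in>\<B>. interior_ball ?D B}"
  have fD: "finite ?D" using finite_lowset[OF \<Omega> \<epsilon>] by (simp add: sq_def)
  then have fP: "finite P" by (simp add: P_def)
  have lip: "\<bar>\<phi> x - \<phi> y\<bar> \<le> dist x y" for x y using \<phi> by (simp add: adm_def)
  have rad: "\<epsilon> * snd B \<le> \<rho>" if "B \<in> \<B>" for B
  proof -
    have "snd B \<le> sum snd \<B>" using \<B>(1,2) that by (intro member_le_sum) (auto simp: less_imp_le)
    then show ?thesis using \<rho> \<epsilon> by (meson mult_left_mono less_imp_le order_trans)
  qed
  obtain b where b: "\<And>i. i \<in> P \<Longrightarrow> b i \<in> \<B> \<and> inball i (b i)"
    using \<B>(5) unfolding covers_def P_def by (metis (mono_tags, lifting) mem_Collect_eq)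
  have bu: "B = b i" if "i \<in> P" "B \<in> \<B>" "inball i B" for i B
    using bsep_unique[OF \<B>(3,4,2) that(2) _ that(3)] b[OF that(1)] by blast
  have dsc: "dist (?p i) (\<epsilon> *\<^sub>R y) = \<epsilon> * dist (pos i) y" for i y
    using \<epsilon> by (simp add: dist_norm scaleR_diff_right[symmetric])
  have each: "\<bar>of_int (vort v i) * \<phi> (?p i) - of_int (vort v i) * (if b i \<in> J then \<phi> (\<epsilon> *\<^sub>R fst (b i)) else 0)\<bar> \<le> 4 * \<rho> + 4 * \<epsilon>"
    if i: "i \<in> P" for i
  proof -
    have iD: "i \<in> squares (lat \<epsilon> \<Omega>)" using i sq_squares[OF \<epsilon>] by (auto simp: P_def)
    have "\<bar>vort v i\<bar> \<le> 2" using vort_le_2[OF iD v] .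
    then have v2: "\<bar>of_int (vort v i) :: real\<bar> \<le> 2" by linarith
    note bi = b[OF i]
    have r0: "0 \<le> \<rho>" using rad[of "b i"] bi \<B>(2) \<epsilon> by (meson mult_nonneg_nonneg less_imp_le order_trans)
    have dc: "dist (?p i) (\<epsilon> *\<^sub>R fst (b i)) \<le> \<rho>"
      using bi rad[of "b i"] \<epsilon> unfolding dsc inball_def by (meson mult_left_mono less_imp_le order_trans)
    have "\<bar>\<phi> (?p i) - (if b i \<in> J then \<phi> (\<epsilon> *\<^sub>R fst (b i)) else 0)\<bar> \<le> 2 * \<rho> + 2 * \<epsilon>"
    proof (cases "b i \<in> J")
      case True
      then show ?thesis using lip[of "?p i" "\<epsilon> *\<^sub>R fst (b i)"] dc r0 \<epsilon> by simp
    next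
      case False
      \<comment> \<open>An index of the ball outside \<open>sq\<close> has a point outside \<Omega>
        in its square, so the vortex is within \<open>2 * \<rho> + 2 * \<epsilon>\<close> of the
        complement.\<close>
      then obtain j where j: "inball j (b i)" "j \<notin> ?D" using bi unfolding J_def interior_ball_def by blast
      have dj: "dist (?p j) (\<epsilon> *\<^sub>R fst (b i)) \<le> \<rho>"
        using j bi rad[of "b i"] \<epsilon> unfolding dsc inball_def by (meson mult_left_mono less_imp_le order_trans)
      obtain y where y: "y \<in> lowT \<epsilon> j \<or> y \<in> uppT \<epsilon> j" "y \<notin> \<Omega>"
        using j(2) unfolding sq_def lowset_def uppset_def by blast
      have "\<bar>\<phi> (?p i)\<bar> \<le> dist (?p i) y" by (rule adm_near[OF \<phi> y(2)])
      also have "\<dots> \<le> dist (?p i) (\<epsilon> *\<^sub>R fst (b i)) + dist (?p j) (\<epsilon> *\<^sub>R fst (b i)) + dist y (?p j)"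
        by metric
      finally show ?thesis using False dj dc dist_in_square[OF \<epsilon> y(1)] by simp
    qed
    then have "\<bar>of_int (vort v i)\<bar> * \<bar>\<phi> (?p i) - (if b i \<in> J then \<phi> (\<epsilon> *\<^sub>R fst (b i)) else 0)\<bar> \<le> 2 * (2 * \<rho> + 2 * \<epsilon>)"
      using v2 by (intro mult_mono) auto
    then show ?thesis by (simp add: abs_mult[symmetric] right_diff_distrib)
  qed
  have s1: "(\<Sum>i\<in>?D. of_int (vort v i) * \<phi> (?p i)) = (\<Sum>i\<in>P. of_int (vort v i) * \<phi> (?p i))"
    unfolding P_def using fD by (intro sum.mono_neutral_right) auto
  have "(\<Sum>B\<in>J. of_int (bdeg ?D (vort v) B) * \<phi> (\<epsilon> *\<^sub>R fst B))
      = (\<Sum>B\<in>J. \<Sum>i\<in>P. if inball i B then of_int (vort v i) * \<phi> (\<epsilon> *\<^sub>R fst B) else 0)"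
  proof (rule sum.cong[OF refl])
    fix B
    have "bdeg ?D (vort v) B = (\<Sum>i\<in>P. if inball i B then vort v i else 0)"
    proof -
      have "bdeg ?D (vort v) B = (\<Sum>i\<in>{i\<in>P. inball i B}. vort v i)"
        unfolding bdeg_def P_def using fD by (intro sum.mono_neutral_right) auto
      also have "\<dots> = (\<Sum>i\<in>P. if inball i B then vort v i else 0)" using fP by (rule sum.inter_filter)
      finally show ?thesis .
    qed
    then show "of_int (bdeg ?D (vort v) B) * \<phi> (\<epsilon> *\<^sub>R fst B)
      = (\<Sum>i\<in>P. if inball i B then of_int (vort v i) * \<phi> (\<epsilon> *\<^sub>R fst B) else 0)"
      by (simp add: sum_distrib_right if_distrib[of "\<lambda>x. x * _"] if_distrib[of real_of_int] cong: if_cong)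
  qed
  also have "\<dots> = (\<Sum>i\<in>P. \<Sum>B\<in>J. if inball i B then of_int (vort v i) * \<phi> (\<epsilon> *\<^sub>R fst B) else 0)"
    by (rule sum.swap)
  also have "\<dots> = (\<Sum>i\<in>P. of_int (vort v i) * (if b i \<in> J then \<phi> (\<epsilon> *\<^sub>R fst (b i)) else 0))"
  proof (rule sum.cong[OF refl])
    fix i assume i: "i \<in> P"
    have eq: "inball i B \<longleftrightarrow> B = b i" if "B \<in> J" for B
      using bu[OF i] b[OF i] that unfolding J_def by blast
    have "(\<Sum>B\<in>J. if inball i B then of_int (vort v i) * \<phi> (\<epsilon> *\<^sub>R fst B) else 0)
       = (\<Sum>B\<in>J. if B = b i then of_int (vort v i) * \<phi> (\<epsilon> *\<^sub>R fst B) else 0)"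
      by (rule sum.cong[OF refl]) (simp only: eq)
    also have "\<dots> = of_int (vort v i) * (if b i \<in> J then \<phi> (\<epsilon> *\<^sub>R fst (b i)) else 0)"
      using \<B>(1) by (simp add: J_def sum.delta)
    finally show "(\<Sum>B\<in>J. if inball i B then of_int (vort v i) * \<phi> (\<epsilon> *\<^sub>R fst B) else 0) = \<dots>" .
  qed
  finally have s2: "(\<Sum>B\<in>J. of_int (bdeg ?D (vort v) B) * \<phi> (\<epsilon> *\<^sub>R fst B))
      = (\<Sum>i\<in>P. of_int (vort v i) * (if b i \<in> J then \<phi> (\<epsilon> *\<^sub>R fst (b i)) else 0))" .
  have "\<bar>(\<Sum>i\<in>P. of_int (vort v i) * \<phi> (?p i)) - (\<Sum>i\<in>P. of_int (vort v i) * (if b i \<in> J then \<phi> (\<epsilon> *\<^sub>R fst (b i)) else 0))\<bar>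
      \<le> (\<Sum>i\<in>P. 4 * \<rho> + 4 * \<epsilon>)"
    unfolding sum_subtractf[symmetric] by (rule sum_abs[THEN order_trans], rule sum_mono, rule each)
  then show ?thesis unfolding s1 J_def[symmetric] s2 P_def[symmetric] by simp
qed

text \<open>Change of variable L = |log \<epsilon>|: all asymptotic comparisons are made for L
  tending to infinity.\<close>

lemma eventually_at_right_log:
  assumes "eventually P at_top"
  shows "\<forall>\<^sub>F \<epsilon> in at_right 0. P \<bar>ln (\<epsilon> :: real)\<bar>"
proof -
  have "filterlim (\<lambda>\<epsilon>::real. - ln \<epsilon>) at_top (at_right 0)"
    using ln_at_0 by (simp add: filterlim_uminus_at_bot)
  then have "\<forall>\<^sub>F \<epsilon> in at_right 0. P (- ln (\<epsilon> :: real))" using assms by (rule eventually_compose_filterlim[rotated])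
  moreover have "\<forall>\<^sub>F \<epsilon> in at_right 0. \<epsilon> \<in> {0<..<1::real}" by (rule eventually_at_right_real) simp
  ultimately show ?thesis by eventually_elim simp
qed

lemma tendsto_at_right_log:
  assumes "(f \<longlongrightarrow> l) at_top" shows "((\<lambda>\<epsilon>::real. f \<bar>ln \<epsilon>\<bar>) \<longlongrightarrow> l) (at_right 0)"
  using assms eventually_at_right_log unfolding tendsto_def by blast

definition point_pairing :: "(real \<times> (real^2)) list \<Rightarrow> (real^2 \<Rightarrow> real) \<Rightarrow> real" where
  "point_pairing xs \<phi> = (\<Sum>p\<leftarrow>xs. fst p * \<phi> (snd p))"

abbreviation jac_pairing :: "(real^2) set \<Rightarrow> real \<Rightarrow> (real^2 \<Rightarrow> real^2^2) \<Rightarrow> (real^2 \<Rightarrow> real) \<Rightarrow> real" where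
  "jac_pairing \<Omega> \<epsilon> Q \<phi> \<equiv> (LINT y : \<Omega> | lebesgue. jac_density \<Omega> \<epsilon> Q y * \<phi> y)"

text \<open>The first summand is the error of \<open>jacobian_vorticity\<close>, the second that of \<open>vortex_balls_flat\<close>
  for at most \<open>2 C |log \<epsilon>|\<close> vortices in balls of total radius \<open>1/|log \<epsilon>|\<^sup>2\<close>.\<close>

definition flat_err :: "real \<Rightarrow> real \<Rightarrow> real" where
  "flat_err C \<epsilon> = 40 * C * (\<epsilon> * \<bar>ln \<epsilon>\<bar>) + pi * (2 * C * (4 / \<bar>ln \<epsilon>\<bar> + 4 * (\<epsilon> * \<bar>ln \<epsilon>\<bar>)))"

lemma tendsto_eps_log: "((\<lambda>\<epsilon>::real. \<epsilon> * \<bar>ln \<epsilon>\<bar>) \<longlongrightarrow> 0) (at_right 0)"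
proof -
  have "((\<lambda>x::real. exp (- x) * x) \<longlongrightarrow> 0) at_top" by real_asymp
  from tendsto_at_right_log[OF this] show ?thesis
  proof (rule Lim_transform_eventually)
    have "\<forall>\<^sub>F \<epsilon> in at_right 0. \<epsilon> \<in> {0<..<1::real}" by (rule eventually_at_right_real) simp
    then show "\<forall>\<^sub>F \<epsilon> in at_right (0::real). exp (- \<bar>ln \<epsilon>\<bar>) * \<bar>ln \<epsilon>\<bar> = \<epsilon> * \<bar>ln \<epsilon>\<bar>"
      by (rule eventually_mono) (auto simp: abs_if)
  qed
qed

lemma flat_err_tendsto: "(flat_err C \<longlongrightarrow> 0) (at_right 0)"
proof -
  have "((\<lambda>x::real. 4 / x) \<longlongrightarrow> 0) at_top" by real_asymp
  note t = tendsto_at_right_log[OF this]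
  have "((\<lambda>\<epsilon>. 40 * C * (\<epsilon> * \<bar>ln \<epsilon>\<bar>) + pi * (2 * C * (4 / \<bar>ln \<epsilon>\<bar> + 4 * (\<epsilon> * \<bar>ln \<epsilon>\<bar>))))
     \<longlongrightarrow> 40 * C * 0 + pi * (2 * C * (0 + 4 * 0))) (at_right 0)"
    by (intro tendsto_intros tendsto_eps_log t)
  then show ?thesis by (simp add: flat_err_def[abs_def])
qed

text \<open>The growth is stopped when the total radius, in the original scale, is at most
  \<open>1 / L\<^sup>2\<close> with L = |log \<epsilon>|. This is small enough to move up to 2 C L
  vortices at vanishing total cost, and still leaves almost L / \<tau> dilations.\<close>

theorem vortex_structure:
  fixes \<kappa> C :: real
  assumes \<Omega>: "bounded \<Omega>" and \<kappa>: "0 < \<kappa>" "\<kappa> < 1" and C: "0 < C"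
  shows "\<forall>\<^sub>F \<epsilon> in at_right 0. \<forall>Q. Fc \<Omega> \<epsilon> Q \<le> ereal C \<longrightarrow>
    (\<exists>xs. (\<forall>p\<in>set xs. \<bar>fst p\<bar> = 1) \<and> ereal (\<kappa> * pi * real (length xs)) \<le> Fc \<Omega> \<epsilon> Q \<and>
      (\<forall>\<phi>. adm \<Omega> \<phi> \<longrightarrow> \<bar>jac_pairing \<Omega> \<epsilon> Q \<phi> - pi * point_pairing xs \<phi>\<bar> \<le> flat_err C \<epsilon>))"
proof -
  \<comment> \<open>The loss is split: one factor \<open>\<kappa>1\<close> for the gain per
    dilation, another for the number of dilations.\<close>
  define \<kappa>1 where "\<kappa>1 = (1 + \<kappa>) / 2"
  have \<kappa>1: "0 < \<kappa>1" "\<kappa>1 < 1" using \<kappa> by (auto simp: \<kappa>1_def)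
  have \<kappa>2: "\<kappa> \<le> \<kappa>1 * \<kappa>1"
    using zero_le_power2[of "1 - \<kappa>"] by (simp add: \<kappa>1_def power2_eq_square field_simps)
  \<comment> \<open>With at most 2 C L vortices, and hence mergers, this bounds their share
    \<open>\<tau> * N\<close> by \<open>(1 - \<kappa>) / 4 * L\<close>.\<close>
  define \<tau>0 where "\<tau>0 = (1 - \<kappa>) / (8 * C)"
  have "0 < \<tau>0" using \<kappa> C by (simp add: \<tau>0_def)
  from discrete_lower_bound[OF \<kappa>1 this] obtain \<tau> K where \<tau>: "0 < \<tau>" "\<tau> < \<tau>0" and K: "2 \<le> K"
    and LB: "\<And>Z D v n. finite Z \<Longrightarrow> D \<subseteq> squares Z \<Longrightarrow> (\<forall>j\<in>Z. norm (v j) = 1) \<Longrightarrow>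
       \<exists>\<B>. finite \<B> \<and> (\<forall>B\<in>\<B>. 0 < snd B) \<and> bsep \<tau> \<B> \<and> covers \<B> D (vort v) \<and>
         sum snd \<B> \<le> (1 + \<tau>) ^ (n + card {i\<in>D. vort v i \<noteq> 0}) * (real (card {i\<in>D. vort v i \<noteq> 0}) * K) \<and>
         \<kappa>1 * pi * \<tau> * real n * of_int (total_deg D (vort v) \<B>) \<le> xy_energy Z v" by blast
  have \<tau>C: "2 * C * \<tau> \<le> (1 - \<kappa>) / 4" using \<tau>(2) C by (simp add: \<tau>0_def field_simps)
  \<comment> \<open>\<open>T L\<close> is the logarithm of the permitted expansion:
    \<open>exp (T L)\<close> times the initial total radius, at most 2 C L K, times \<epsilon> = exp
    (- L), must not exceed \<open>1 / L\<^sup>2\<close>.\<close>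
  define T where "T L = L - 3 * ln L - ln (2 * C * K)" for L :: real
  \<comment> \<open>The coefficients on the left add up to 1 - (1 - \<kappa>) / 4, so the
    logarithmic terms of \<open>T\<close> and the constant fit asymptotically into the remaining
    multiple of L.\<close>
  have ev: "\<forall>\<^sub>F L in at_top. 1 < L \<and> \<kappa>1 * L + (1 - \<kappa>) / 4 * L + \<tau> \<le> T L"
  proof -
    have "0 < (1 - \<kappa>) / 4" using \<kappa> by simp
    then have "\<forall>\<^sub>F L in at_top. 3 * ln L + (ln (2 * C * K) + \<tau>) \<le> (1 - \<kappa>) / 4 * L" by real_asymp
    moreover have "\<forall>\<^sub>F L in at_top. (1::real) < L" by (rule eventually_gt_at_top)
    ultimately show ?thesis by eventually_elim (simp add: T_def \<kappa>1_def field_simps)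
  qed
  have "\<forall>\<^sub>F \<epsilon> in at_right 0. \<epsilon> \<in> {0<..<1::real}" by (rule eventually_at_right_real) simp
  with eventually_at_right_log[OF ev] show ?thesis
  proof eventually_elim
    case (elim \<epsilon>)
    define L where "L = \<bar>ln \<epsilon>\<bar>"
    have \<epsilon>: "0 < \<epsilon>" "\<epsilon> < 1" and L: "1 < L" "\<kappa>1 * L + (1 - \<kappa>) / 4 * L + \<tau> \<le> T L"
      using elim by (auto simp: L_def)
    have eL: "exp L = 1 / \<epsilon>" using \<epsilon> by (simp add: L_def abs_if exp_minus inverse_eq_divide)
    have T0: "0 \<le> T L" using L \<kappa>1 \<kappa> \<tau> by (intro order_trans[OF _ L(2)]) auto
    show ?case
    proof (intro allI impI)
      fix Q assume FC: "Fc \<Omega> \<epsilon> Q \<le> ereal C"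
      then have Q: "Q \<in> C_eps \<epsilon> \<Omega>" by (auto simp: Fc_def split: if_splits)
      define v E D where "v = field \<epsilon> Q" "E = xy_energy (lat \<epsilon> \<Omega>) (field \<epsilon> Q)" "D = sq \<epsilon> \<Omega>"
      note defs = this
      have F: "Fc \<Omega> \<epsilon> Q = ereal (E / L)" using Fc_eq_energy[OF Q \<Omega> \<epsilon>(1)] by (simp add: defs L_def)
      then have EC: "E \<le> C * L" using FC L by (simp add: divide_le_eq)
      have fZ: "finite (lat \<epsilon> \<Omega>)" by (rule finite_lat[OF \<Omega> \<epsilon>(1)])
      have vn: "\<And>i. i \<in> lat \<epsilon> \<Omega> \<Longrightarrow> norm (v i) = 1" unfolding defs by (rule field_norm[OF Q])
      have DZ: "D \<subseteq> squares (lat \<epsilon> \<Omega>)" unfolding defs by (rule sq_squares[OF \<epsilon>(1)])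
      define N where "N = card {i\<in>D. vort v i \<noteq> 0}"
      have N: "real N \<le> 2 * C * L" using card_vortices_le[OF fZ DZ, of v] vn EC by (simp add: N_def defs)
      define l where "l = ln (1 + \<tau>)"
      have l: "0 < l" "l \<le> \<tau>" using \<tau> ln_add_one_self_le_self[of \<tau>] by (auto simp: l_def)
      \<comment> \<open>The largest number of dilations for which n + N factors 1 + \<tau> stay
        below \<open>exp (T L)\<close>, up to N of them being reserved for mergers.\<close>
      define n where "n = nat \<lfloor>T L / l - N\<rfloor>"
      \<comment> \<open>Since ln (1 + \<tau>) <= \<tau>, dividing by \<open>l\<close> and
        multiplying by \<tau> loses nothing. The summand \<tau> pays for rounding n down.\<close>
      have TN: "\<kappa>1 * L + \<tau> \<le> \<tau> * (T L / l - N)"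
      proof -
        have "T L \<le> \<tau> * (T L / l)" using l T0 mult_right_mono[OF l(2), of "T L / l"] by simp
        moreover have "\<tau> * N \<le> (1 - \<kappa>) / 4 * L"
        proof -
          have "\<tau> * N \<le> \<tau> * (2 * C * L)" using N \<tau> by (intro mult_left_mono) auto
          also have "\<dots> = 2 * C * \<tau> * L" by simp
          also have "\<dots> \<le> (1 - \<kappa>) / 4 * L" using \<tau>C L by (intro mult_right_mono) auto
          finally show ?thesis .
        qed
        ultimately show ?thesis using L by (simp add: right_diff_distrib)
      qed
      have X0: "0 \<le> T L / l - N"
      proof -
        have "0 \<le> \<tau> * (T L / l - N)" using TN L \<kappa>1 \<tau> by (intro order_trans[OF _ TN]) auto
        then show ?thesis using \<tau> by (simp add: zero_le_mult_iff)
      qed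
      have n1: "real n \<le> T L / l - N" "T L / l - N - 1 \<le> real n" using X0 by (auto simp: n_def)
      have n\<tau>: "\<kappa>1 * L \<le> \<tau> * real n"
      proof -
        have "\<tau> * (T L / l - N - 1) \<le> \<tau> * real n" using n1 \<tau> by (intro mult_left_mono) auto
        then show ?thesis using TN by (simp add: right_diff_distrib)
      qed
      from LB[OF fZ DZ, of v n] vn obtain \<B> where B: "finite \<B>" "\<forall>B\<in>\<B>. 0 < snd B" "bsep \<tau> \<B>" "covers \<B> D (vort v)"
        "sum snd \<B> \<le> (1 + \<tau>) ^ (n + N) * (real N * K)"
        "\<kappa>1 * pi * \<tau> * real n * of_int (total_deg D (vort v) \<B>) \<le> E"
        unfolding N_def by (auto simp: defs)
      define \<rho> where "\<rho> = 1 / L\<^sup>2"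
      have \<rho>: "\<epsilon> * sum snd \<B> \<le> \<rho>"
      proof -
        have "(1 + \<tau>) ^ (n + N) = exp (real (n + N) * l)"
          using \<tau> by (simp add: l_def exp_of_nat_mult del: of_nat_add)
        also have "\<dots> \<le> exp (T L)"
        proof -
          have "real (n + N) * l \<le> (T L / l) * l" using n1 l by (intro mult_right_mono) auto
          then show ?thesis using l by simp
        qed
        also have "\<dots> = (1 / \<epsilon>) / (L ^ 3 * (2 * C * K))"
        proof -
          have "exp (3 * ln L) = L ^ 3" using L exp_of_nat_mult[of 3 "ln L"] by simp
          then show ?thesis using C K by (simp add: T_def exp_diff eL)
        qed
        finally have p: "(1 + \<tau>) ^ (n + N) \<le> (1 / \<epsilon>) / (L ^ 3 * (2 * C * K))" .
        have "\<epsilon> * sum snd \<B> \<le> \<epsilon> * ((1 / \<epsilon>) / (L ^ 3 * (2 * C * K)) * (2 * C * L * K))"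
        proof (rule mult_left_mono, rule order_trans[OF B(5)], rule mult_mono[OF p])
          show "real N * K \<le> 2 * C * L * K" using N K by (intro mult_right_mono) auto
        qed (use \<epsilon> L C K in auto)
        also have "\<dots> = \<rho>" using \<epsilon> C K L by (simp add: \<rho>_def field_simps power2_eq_square power3_eq_cube)
        finally show ?thesis .
      qed
      define J where "J = {B\<in>\<B>. interior_ball D B}"
      have fJ: "finite J" using B by (simp add: J_def)
      from weighted_points_list[OF fJ, of "bdeg D (vort v)" "\<lambda>B. \<epsilon> *\<^sub>R fst B"] obtain xs :: "(real \<times> (real^2)) list" where
        xs: "\<forall>p\<in>set xs. \<bar>fst p\<bar> = 1" "int (length xs) = (\<Sum>B\<in>J. \<bar>bdeg D (vort v) B\<bar>)"
        "\<forall>\<phi>. (\<Sum>p\<leftarrow>xs. fst p * \<phi> (snd p)) = (\<Sum>B\<in>J. of_int (bdeg D (vort v) B) * \<phi> (\<epsilon> *\<^sub>R fst B))" by blast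
      have len: "real (length xs) = of_int (total_deg D (vort v) \<B>)"
        using xs(2) unfolding total_deg_def J_def by (metis of_int_of_nat_eq)
      have "\<kappa> * pi * real (length xs) * L \<le> \<kappa>1 * \<kappa>1 * pi * real (length xs) * L"
        using \<kappa>2 L by (intro mult_right_mono) auto
      also have "\<dots> = \<kappa>1 * pi * real (length xs) * (\<kappa>1 * L)" by simp
      also have "\<dots> \<le> \<kappa>1 * pi * real (length xs) * (\<tau> * real n)"
        using n\<tau> \<kappa>1 by (intro mult_left_mono) auto
      also have "\<dots> \<le> E" using B(6) unfolding len by (simp add: mult_ac)
      finally have "\<kappa> * pi * real (length xs) \<le> E / L" using L by (simp add: pos_le_divide_eq)
      then have low: "ereal (\<kappa> * pi * real (length xs)) \<le> Fc \<Omega> \<epsilon> Q" by (simp add: F)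
      have "\<bar>jac_pairing \<Omega> \<epsilon> Q \<phi> - pi * point_pairing xs \<phi>\<bar> \<le> flat_err C \<epsilon>" if \<phi>: "adm \<Omega> \<phi>" for \<phi>
      proof -
        let ?S = "\<Sum>i\<in>D. of_int (vort v i) * \<phi> (\<epsilon> *\<^sub>R pos i)"
        have 1: "\<bar>jac_pairing \<Omega> \<epsilon> Q \<phi> - pi * ?S\<bar> \<le> 40 * \<epsilon> * E"
          using jacobian_vorticity[OF \<epsilon>(1) \<Omega> Q \<phi>] by (simp add: defs)
        have "\<epsilon> * E \<le> \<epsilon> * (C * L)" using EC \<epsilon> by (intro mult_left_mono) auto
        then have 2: "40 * \<epsilon> * E \<le> 40 * C * (\<epsilon> * L)" by (simp add: mult_ac)
        have "\<bar>?S - point_pairing xs \<phi>\<bar> \<le> real N * (4 * \<rho> + 4 * \<epsilon>)"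
          using vortex_balls_flat[OF \<epsilon>(1) \<Omega> vn \<phi> B(1,2,3) _ B(4)[unfolded defs(3)] \<rho>] \<tau>
          unfolding point_pairing_def xs(3)[rule_format] J_def N_def by (simp add: defs(3))
        also have "\<dots> \<le> (2 * C * L) * (4 * \<rho> + 4 * \<epsilon>)" using N \<epsilon> by (intro mult_right_mono) (auto simp: \<rho>_def)
        also have "\<dots> = 2 * C * (4 / L + 4 * (\<epsilon> * L))" using L by (simp add: \<rho>_def field_simps power2_eq_square)
        finally have "pi * \<bar>?S - point_pairing xs \<phi>\<bar> \<le> pi * (2 * C * (4 / L + 4 * (\<epsilon> * L)))" by (intro mult_left_mono) auto
        then have 3: "\<bar>pi * ?S - pi * point_pairing xs \<phi>\<bar> \<le> pi * (2 * C * (4 / L + 4 * (\<epsilon> * L)))"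
          by (simp add: right_diff_distrib[symmetric] abs_mult)
        show ?thesis using 1 2 3 unfolding flat_err_def L_def[symmetric] by linarith
      qed
      then show "\<exists>xs. (\<forall>p\<in>set xs. \<bar>fst p\<bar> = 1) \<and> ereal (\<kappa> * pi * real (length xs)) \<le> Fc \<Omega> \<epsilon> Q \<and>
        (\<forall>\<phi>. adm \<Omega> \<phi> \<longrightarrow> \<bar>jac_pairing \<Omega> \<epsilon> Q \<phi> - pi * point_pairing xs \<phi>\<bar> \<le> flat_err C \<epsilon>)"
        using xs(1) low by blast
    qed
  qed
qed

section \<open>Compactness and lower semicontinuity\<close>

text \<open>For the upper bound, each point lies in at most one set of a disjoint family; for the
  lower bound, a partition isolates every atom.\<close>

lemma total_variation_dirac_sum:
  assumes \<Omega>: "open \<Omega>" and inj: "inj_on x {1..m}" and sub: "x ` {1..m} \<subseteq> \<Omega>"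
  shows "total_variation (dirac_sum m z x) \<Omega> = ereal (\<Sum>k = 1..m. \<bar>of_int (z k)\<bar>)"
proof (rule antisym)
  show "total_variation (dirac_sum m z x) \<Omega> \<le> ereal (\<Sum>k = 1..m. \<bar>of_int (z k)\<bar>)"
    unfolding total_variation_def
  proof (rule SUP_least)
    fix E :: "nat \<Rightarrow> (real^2) set"
    assume "E \<in> {E. range E \<subseteq> sets borel \<and> disjoint_family E \<and> \<Union> (range E) = \<Omega>}"
    then have dis: "disjoint_family E" by blast
    show "(\<Sum>n. ereal \<bar>dirac_sum m z x (E n)\<bar>) \<le> ereal (\<Sum>k = 1..m. \<bar>of_int (z k)\<bar>)"
    proof (intro suminf_bound allI)
      fix N
      have "(\<Sum>n<N. \<bar>dirac_sum m z x (E n)\<bar>) \<le> (\<Sum>n<N. \<Sum>k = 1..m. \<bar>of_int (z k)\<bar> * indicator (E n) (x k))"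
        unfolding dirac_sum_def
        by (intro sum_mono order_trans[OF sum_abs]) (simp add: abs_mult)
      also have "\<dots> = (\<Sum>k = 1..m. \<bar>of_int (z k)\<bar> * (\<Sum>n<N. indicator (E n) (x k)))"
        by (subst sum.swap) (simp add: sum_distrib_left)
      also have "\<dots> \<le> (\<Sum>k = 1..m. \<bar>of_int (z k)\<bar> * 1)"
      proof (intro sum_mono mult_left_mono)
        fix k
        have "disjoint_family_on E {..<N}" using dis by (rule disjoint_family_on_mono[rotated]) simp
        then have "(\<Sum>n<N. indicator (E n) (x k)) = (indicator (\<Union>n<N. E n) (x k) :: real)"
          by (subst indicator_UN_disjoint) auto
        then show "(\<Sum>n<N. indicator (E n) (x k)) \<le> (1::real)" by (simp add: indicator_def)
      qed simp
      finally show "(\<Sum>n<N. ereal \<bar>dirac_sum m z x (E n)\<bar>) \<le> ereal (\<Sum>k = 1..m. \<bar>of_int (z k)\<bar>)"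
        by simp
    qed simp
  qed
  \<comment> \<open>Index 0 takes what is left of \<Omega>, indices 1 to m the atoms, and the empty
    sets complete the sequence.\<close>
  define E where "E n = (if n = 0 then \<Omega> - x ` {1..m} else if n \<le> m then {x n} else {})" for n
  have E: "E \<in> {E. range E \<subseteq> sets borel \<and> disjoint_family E \<and> \<Union> (range E) = \<Omega>}"
  proof (intro CollectI conjI)
    have "finite (x ` {1..m})" by simp
    then have "x ` {1..m} \<in> sets borel" by (intro borel_closed finite_imp_closed)
    then show "range E \<subseteq> sets borel" using \<Omega> by (auto simp: E_def)
    show "disjoint_family E" unfolding disjoint_family_on_def
    proof (intro ballI impI equals0I)
      fix a b y assume ab: "a \<noteq> b" "y \<in> E a \<inter> E b"
      have key: "y \<in> E n \<longleftrightarrow> (if n = 0 then y \<in> \<Omega> \<and> y \<notin> x ` {1..m} else n \<le> m \<and> y = x n)" for n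
        by (simp add: E_def)
      have ne: "n \<in> {1..m} \<and> y = x n" if "y \<in> E n" "n \<noteq> 0" for n using that unfolding key by simp
      consider "a = 0" "b \<noteq> 0" | "a \<noteq> 0" "b = 0" | "a \<noteq> 0" "b \<noteq> 0" using ab(1) by fastforce
      then show False
      proof cases
        case 1
        then have "y \<in> E 0" "y \<in> E b" using ab(2) by auto
        then show ?thesis using ne[of b] key[of 0] 1 by (auto simp del: atLeastAtMost_iff)
      next
        case 2
        then have "y \<in> E 0" "y \<in> E a" using ab(2) by auto
        then show ?thesis using ne[of a] key[of 0] 2 by (auto simp del: atLeastAtMost_iff)
      next
        case 3
        then have "x a = x b" "a \<in> {1..m}" "b \<in> {1..m}" using ab(2) ne[of a] ne[of b] by auto
        then show ?thesis using ab(1) inj by (meson inj_onD)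
      qed
    qed
    show "\<Union> (range E) = \<Omega>"
    proof (intro equalityI subsetI)
      fix y assume "y \<in> \<Omega>"
      show "y \<in> \<Union> (range E)"
      proof (cases "y \<in> x ` {1..m}")
        case True
        then obtain k where "1 \<le> k" "k \<le> m" "y = x k" by auto
        then have "y \<in> E k" by (simp add: E_def)
        then show ?thesis by blast
      next
        case False
        then have "y \<in> E 0" using \<open>y \<in> \<Omega>\<close> by (simp add: E_def)
        then show ?thesis by blast
      qed
    qed (use sub in \<open>auto simp: E_def split: if_splits\<close>)
  qed
  have val: "dirac_sum m z x (E n) = of_int (z n)" if n: "n \<in> {1..m}" for n
  proof -
    have "dirac_sum m z x (E n) = (\<Sum>k = 1..m. if k = n then of_int (z k) else 0)"
      unfolding dirac_sum_def
    proof (rule sum.cong[OF refl])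
      fix k assume "k \<in> {1..m}"
      then have "x k = x n \<longleftrightarrow> k = n" using inj_on_eq_iff[OF inj _ n] by simp
      then show "of_int (z k) * indicator (E n) (x k) = (if k = n then real_of_int (z k) else 0)"
        using n by (simp add: E_def)
    qed
    also have "\<dots> = of_int (z n)" using n by simp
    finally show ?thesis .
  qed
  have "ereal (\<Sum>k = 1..m. \<bar>of_int (z k)\<bar>) = (\<Sum>n = 1..m. ereal \<bar>dirac_sum m z x (E n)\<bar>)"
    using val by simp
  also have "\<dots> \<le> (\<Sum>n<Suc m. ereal \<bar>dirac_sum m z x (E n)\<bar>)"
    by (intro sum_mono2) auto
  also have "\<dots> \<le> (\<Sum>n. ereal \<bar>dirac_sum m z x (E n)\<bar>)" by (rule suminf_upper) simp
  also have "\<dots> \<le> total_variation (dirac_sum m z x) \<Omega>"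
    unfolding total_variation_def by (rule SUP_upper[OF E])
  finally show "ereal (\<Sum>k = 1..m. \<bar>of_int (z k)\<bar>) \<le> total_variation (dirac_sum m z x) \<Omega>" .
qed

text \<open>Signed tents of equal height on disjoint balls. The height is at once the sup bound and
  the value, up to sign, at points of nonzero weight; hence n unit masses anywhere pair to at most n
  times that height, while the given measure pairs to its full mass times it.\<close>

lemma bump_function:
  fixes x :: "nat \<Rightarrow> real^2" and z :: "nat \<Rightarrow> int"
  assumes \<Omega>: "open \<Omega>" and inj: "inj_on x {1..m}" and sub: "x ` {1..m} \<subseteq> \<Omega>"
  shows "\<exists>\<phi> a. 0 < a \<and> \<phi> \<in> C01c \<Omega> \<and> C01_norm \<Omega> \<phi> \<le> 1 \<and> (\<forall>y. \<bar>\<phi> y\<bar> \<le> a) \<and>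
    dirac_pairing m z x \<phi> = a * (\<Sum>k = 1..m. \<bar>of_int (z k)\<bar>)"
proof -
  have "\<exists>l>0. cball (x k) l \<subseteq> \<Omega> \<and> (\<forall>j\<in>{1..m}. j \<noteq> k \<longrightarrow> 2 * l \<le> dist (x j) (x k))" if k: "k \<in> {1..m}" for k
  proof -
    obtain l1 where l1: "0 < l1" "cball (x k) l1 \<subseteq> \<Omega>"
      using \<Omega> sub k open_contains_cball[of \<Omega>] by blast
    have "finite (x ` ({1..m} - {k}))" by simp
    then obtain l2 where l2: "0 < l2" "\<And>y. y \<in> x ` ({1..m} - {k}) \<Longrightarrow> y \<noteq> x k \<Longrightarrow> l2 \<le> dist (x k) y"
      using finite_set_avoid[of "x ` ({1..m} - {k})" "x k"] by blast
    have "2 * (min l1 (l2 / 2)) \<le> dist (x j) (x k)" if "j \<in> {1..m}" "j \<noteq> k" for j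
    proof -
      have "x j \<noteq> x k" using inj_on_eq_iff[OF inj that(1) k] that(2) by simp
      then have "l2 \<le> dist (x k) (x j)" using l2(2)[of "x j"] that by auto
      then show ?thesis by (simp add: dist_commute)
    qed
    moreover have "cball (x k) (min l1 (l2 / 2)) \<subseteq> \<Omega>" using l1(2) by auto
    ultimately show ?thesis using l1 l2 by (intro exI[of _ "min l1 (l2 / 2)"]) auto
  qed
  then obtain l where l: "\<And>k. k \<in> {1..m} \<Longrightarrow> 0 < l k \<and> cball (x k) (l k) \<subseteq> \<Omega> \<and>
      (\<forall>j\<in>{1..m}. j \<noteq> k \<longrightarrow> 2 * l k \<le> dist (x j) (x k))" by metis
  \<comment> \<open>The inserted 1 keeps the minimum meaningful when there are no points.\<close>
  define q where "q = Min (insert 1 (l ` {1..m}))"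
  have q0: "0 < q" unfolding q_def by (subst Min_gr_iff) (use l in auto)
  have ql: "q \<le> l k" if "k \<in> {1..m}" for k unfolding q_def using that by (intro Min_le) auto
  \<comment> \<open>Normalisation: after division by c the sup norm is at most q / c and the
    Lipschitz constant, bounded crudely by summing m tents, at most m / c.\<close>
  define c where "c = q + real m"
  have c: "0 < c" using q0 by (simp add: c_def)
  define g where "g k y = of_int (sgn (z k)) * max 0 (q - dist y (x k)) / c" for k and y :: "real^2"
  define \<phi> where "\<phi> y = (\<Sum>k = 1..m. g k y)" for y
  have sg: "\<bar>real_of_int (sgn (z k))\<bar> \<le> 1" for k by (simp add: sgn_if)
  have g0: "g k y = 0" if "q \<le> dist y (x k)" for k y using that by (simp add: g_def)
  have gb: "\<bar>g k y\<bar> \<le> q / c" for k y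
  proof -
    have "\<bar>real_of_int (sgn (z k))\<bar> * \<bar>max 0 (q - dist y (x k))\<bar> \<le> 1 * q"
      using sg q0 by (intro mult_mono) auto
    then show ?thesis using c by (simp add: g_def abs_mult divide_right_mono)
  qed
  have orth: "g j y = 0 \<or> g k y = 0" if "j \<in> {1..m}" "k \<in> {1..m}" "j \<noteq> k" for j k y
  proof (rule ccontr)
    assume "\<not> ?thesis"
    then have "dist y (x j) < q" "dist y (x k) < q" using g0 by (meson not_le)+
    then have "dist (x j) (x k) < 2 * q" using dist_triangle[of "x j" "x k" y] by (simp add: dist_commute)
    moreover have "2 * l k \<le> dist (x j) (x k)" using l[OF that(2)] that by auto
    ultimately show False using ql[OF that(2)] by linarith
  qed
  have \<phi>b: "\<bar>\<phi> y\<bar> \<le> q / c" for y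
    unfolding \<phi>_def using q0 c by (intro sum_at_most_one_nonzero(2) orth gb) auto
  have gl: "\<bar>g k y - g k y'\<bar> \<le> dist y y' / c" for k y y'
  proof -
    have "\<bar>max 0 (q - dist y (x k)) - max 0 (q - dist y' (x k))\<bar> \<le> \<bar>dist y (x k) - dist y' (x k)\<bar>" by linarith
    also have "\<dots> \<le> dist y y'" using dist_triangle[of y "x k" y'] dist_triangle[of y' "x k" y] by (simp add: dist_commute abs_le_iff)
    finally have "\<bar>real_of_int (sgn (z k))\<bar> * \<bar>max 0 (q - dist y (x k)) - max 0 (q - dist y' (x k))\<bar> \<le> 1 * dist y y'"
      using sg by (intro mult_mono) auto
    then have "\<bar>real_of_int (sgn (z k)) * (max 0 (q - dist y (x k)) - max 0 (q - dist y' (x k)))\<bar> / c \<le> dist y y' / c"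
      using c by (intro divide_right_mono) (auto simp: abs_mult)
    then show ?thesis using c by (simp add: g_def right_diff_distrib diff_divide_distrib[symmetric])
  qed
  have \<phi>l: "\<bar>\<phi> y - \<phi> y'\<bar> \<le> real m / c * dist y y'" for y y'
  proof -
    have "\<bar>\<phi> y - \<phi> y'\<bar> \<le> (\<Sum>k = 1..m. dist y y' / c)"
      unfolding \<phi>_def sum_subtractf[symmetric] by (rule sum_abs[THEN order_trans], rule sum_mono, rule gl)
    then show ?thesis by simp
  qed
  have supp: "closure {y. \<phi> y \<noteq> 0} \<subseteq> (\<Union>k\<in>{1..m}. cball (x k) q)"
  proof (rule closure_minimal)
    show "{y. \<phi> y \<noteq> 0} \<subseteq> (\<Union>k\<in>{1..m}. cball (x k) q)"
    proof
      fix y assume "y \<in> {y. \<phi> y \<noteq> 0}"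
      then have "\<exists>k\<in>{1..m}. g k y \<noteq> 0" unfolding \<phi>_def by (metis (mono_tags) mem_Collect_eq sum.neutral)
      then obtain k where "k \<in> {1..m}" "dist y (x k) \<le> q" using g0 by (meson linear)
      then show "y \<in> (\<Union>k\<in>{1..m}. cball (x k) q)" by (auto simp: dist_commute)
    qed
  qed auto
  have U: "compact (\<Union>k\<in>{1..m}. cball (x k) q)" by (intro compact_UN) auto
  have U\<Omega>: "(\<Union>k\<in>{1..m}. cball (x k) q) \<subseteq> \<Omega>" using l ql by fastforce
  have "compact (closure {y. \<phi> y \<noteq> 0})"
    using U supp by (meson closed_closure compact_Int_closed compact_imp_closed bounded_subset compact_imp_bounded compact_eq_bounded_closed)
  moreover have "(real m / c)-lipschitz_on \<Omega> \<phi>" using \<phi>l c by (intro lipschitz_onI) (auto simp: dist_real_def)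
  ultimately have 1: "\<phi> \<in> C01c \<Omega>" using supp U\<Omega> by (auto simp: C01c_def)
  have "C01_norm \<Omega> \<phi> \<le> ennreal (q / c) + ennreal (real m / c)"
    unfolding C01_norm_def
  proof (intro add_mono SUP_least)
    show "ennreal \<bar>\<phi> y\<bar> \<le> ennreal (q / c)" for y using \<phi>b by (intro ennreal_leI)
    fix p assume "p \<in> \<Omega> \<times> \<Omega>"
    show "(case p of (y, y') \<Rightarrow> ennreal (\<bar>\<phi> y - \<phi> y'\<bar> / dist y y')) \<le> ennreal (real m / c)"
    proof (cases p)
      case (Pair y y')
      have "\<bar>\<phi> y - \<phi> y'\<bar> / dist y y' \<le> real m / c"
        using \<phi>l[of y y'] c by (cases "y = y'") (simp_all add: pos_divide_le_eq)
      then show ?thesis using Pair by (simp add: ennreal_leI)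
    qed
  qed
  also have "\<dots> = ennreal (q / c + real m / c)" using q0 c by (intro ennreal_plus[symmetric]) auto
  also have "q / c + real m / c = 1" using c by (simp add: c_def add_divide_distrib[symmetric])
  finally have 2: "C01_norm \<Omega> \<phi> \<le> 1" by simp
  have "of_int (z k) * \<phi> (x k) = (q / c) * \<bar>of_int (z k)\<bar>" if k: "k \<in> {1..m}" for k
  proof -
    have "\<phi> (x k) = (\<Sum>j\<in>{k}. g j (x k))"
      unfolding \<phi>_def
    proof (intro sum.mono_neutral_right ballI)
      fix j assume "j \<in> {1..m} - {k}"
      then have "2 * l k \<le> dist (x k) (x j)" using l[OF k] by (auto simp: dist_commute)
      then show "g j (x k) = 0" using ql[OF k] l[OF k] by (intro g0) auto
    qed (use k in auto)
    then show ?thesis using q0 by (simp add: g_def sgn_if)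
  qed
  then have 3: "dirac_pairing m z x \<phi> = (q / c) * (\<Sum>k = 1..m. \<bar>of_int (z k)\<bar>)"
    unfolding dirac_pairing_def sum_distrib_left by (intro sum.cong) auto
  have "0 < q / c" using q0 c by simp
  then show ?thesis using 1 2 \<phi>b 3 by (intro exI[of _ \<phi>] exI[of _ "q / c"] conjI allI)
qed

section \<open>Lower semicontinuity by testing with the bump function\<close>

lemma point_pairing_le:
  assumes "\<forall>p\<in>set xs. \<bar>fst p\<bar> = 1" "\<forall>y. \<bar>\<phi> y\<bar> \<le> a"
  shows "\<bar>point_pairing xs \<phi>\<bar> \<le> real (length xs) * a"
  using assms(1)
proof (induction xs)
  case (Cons p xs)
  have "\<bar>fst p * \<phi> (snd p)\<bar> \<le> a" using Cons.prems assms(2) by (simp add: abs_mult)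
  then show ?case using Cons by (simp add: point_pairing_def distrib_right)
qed (simp add: point_pairing_def)

text \<open>Tested with \<open>bump_function\<close>, closeness in the dual norm says that the total
  degree exceeds the number of unit points by less than one; integrality removes the excess. No
  convergence of the individual points is involved.\<close>

lemma flat_lower_bound:
  fixes e :: "'i \<Rightarrow> real" and Q :: "'i \<Rightarrow> real^2 \<Rightarrow> real^2^2"
  assumes \<Omega>: "open \<Omega>" "bounded \<Omega>" and inj: "inj_on x {1..m}" and sub: "x ` {1..m} \<subseteq> \<Omega>"
    and e: "filterlim e (at_right 0) F" and C: "\<forall>\<^sub>F i in F. Fc \<Omega> (e i) (Q i) \<le> ereal C"
    and conv: "((\<lambda>i. dual_norm \<Omega> (jac_defect \<Omega> (e i) (Q i) m z x)) \<longlongrightarrow> 0) F"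
    and \<kappa>: "0 < \<kappa>" "\<kappa> < 1"
  shows "\<forall>\<^sub>F i in F. ereal (\<kappa> * pi * (\<Sum>k = 1..m. \<bar>of_int (z k)\<bar>)) \<le> Fc \<Omega> (e i) (Q i)"
proof -
  define S where "S = (\<Sum>k = 1..m. \<bar>z k\<bar>)"
  have S: "(\<Sum>k = 1..m. \<bar>of_int (z k)\<bar>) = real_of_int S" by (simp add: S_def)
  from bump_function[OF \<Omega>(1) inj sub, of z, unfolded S]
  obtain \<phi> a where \<phi>: "0 < a" "\<phi> \<in> C01c \<Omega>" "C01_norm \<Omega> \<phi> \<le> 1" "\<forall>y. \<bar>\<phi> y\<bar> \<le> a"
    "dirac_pairing m z x \<phi> = a * real_of_int S"
    by (elim exE conjE)
  have adm: "adm \<Omega> \<phi>" by (rule C01c_imp_adm[OF \<Omega>(1) \<phi>(2,3)])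
  define C' where "C' = max C 1"
  have C': "0 < C'" by (simp add: C'_def)
  \<comment> \<open>Two errors of this size add up to half of \<open>pi * a\<close>, the value of
    one unit of degree.\<close>
  define \<delta> where "\<delta> = pi * a / 4"
  have \<delta>: "0 < \<delta>" using \<phi>(1) by (simp add: \<delta>_def)
  have 1: "\<forall>\<^sub>F i in F. dual_norm \<Omega> (jac_defect \<Omega> (e i) (Q i) m z x) < ennreal \<delta>"
    using conv \<delta> by (intro order_tendstoD(2)[OF conv]) simp
  have 2: "\<forall>\<^sub>F i in F. flat_err C' (e i) < \<delta>"
    using filterlim_compose[OF flat_err_tendsto[of C'] e] \<delta> by (intro order_tendstoD(2)) auto
  note 3 = eventually_compose_filterlim[OF vortex_structure[OF \<Omega>(2) \<kappa> C'] e]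
  show ?thesis using 1 2 3 C
  proof eventually_elim
    case (elim i)
    have "ereal C \<le> ereal C'" by (simp add: C'_def)
    then have "Fc \<Omega> (e i) (Q i) \<le> ereal C'" using elim(4) order_trans by blast
    then obtain xs where xs: "\<forall>p\<in>set xs. \<bar>fst p\<bar> = 1" "ereal (\<kappa> * pi * real (length xs)) \<le> Fc \<Omega> (e i) (Q i)"
      "\<bar>jac_pairing \<Omega> (e i) (Q i) \<phi> - pi * point_pairing xs \<phi>\<bar> \<le> flat_err C' (e i)"
      using elim(3) adm by blast
    have "ennreal \<bar>jac_defect \<Omega> (e i) (Q i) m z x \<phi>\<bar> \<le> dual_norm \<Omega> (jac_defect \<Omega> (e i) (Q i) m z x)"
      unfolding dual_norm_def using \<phi>(2,3) by (intro SUP_upper) auto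
    then have "ennreal \<bar>jac_defect \<Omega> (e i) (Q i) m z x \<phi>\<bar> < ennreal \<delta>" using elim(1) by (rule le_less_trans)
    then have "\<bar>jac_defect \<Omega> (e i) (Q i) m z x \<phi>\<bar> < \<delta>" by (simp add: ennreal_less_iff)
    then have "\<bar>jac_pairing \<Omega> (e i) (Q i) \<phi> - pi * (a * real_of_int S)\<bar> < \<delta>"
      by (simp add: jac_defect_def \<phi>(5))
    then have "pi * (a * real_of_int S) \<le> pi * point_pairing xs \<phi> + 2 * \<delta>" using xs(3) elim(2) by linarith
    also have "\<dots> \<le> pi * (real (length xs) * a) + 2 * \<delta>"
      using point_pairing_le[OF xs(1) \<phi>(4)] by (intro add_right_mono mult_left_mono) (auto simp: abs_le_iff)
    also have "\<dots> = pi * (a * (real (length xs) + 1 / 2))" by (simp add: \<delta>_def algebra_simps)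
    finally have "real_of_int S \<le> real (length xs) + 1 / 2" using \<phi>(1) by simp
    then have "S \<le> int (length xs)" by linarith
    then have "real_of_int S \<le> real (length xs)" by linarith
    then have "\<kappa> * pi * real_of_int S \<le> \<kappa> * pi * real (length xs)" using \<kappa> by (intro mult_left_mono) auto
    then show ?case using xs(2) unfolding S by (meson ereal_less_eq(3) order_trans)
  qed
qed

lemma flat_liminf:
  fixes e :: "'i \<Rightarrow> real" and Q :: "'i \<Rightarrow> real^2 \<Rightarrow> real^2^2"
  assumes "open \<Omega>" "bounded \<Omega>" "inj_on x {1..m}" "x ` {1..m} \<subseteq> \<Omega>"
    "filterlim e (at_right 0) F" "\<forall>\<^sub>F i in F. Fc \<Omega> (e i) (Q i) \<le> ereal C"
    "((\<lambda>i. dual_norm \<Omega> (jac_defect \<Omega> (e i) (Q i) m z x)) \<longlongrightarrow> 0) F"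
  shows "ereal (pi * (\<Sum>k = 1..m. \<bar>of_int (z k)\<bar>)) \<le> Liminf F (\<lambda>i. Fc \<Omega> (e i) (Q i))"
proof (rule ereal_le_epsilon2)
  fix d :: real assume d: "0 < d"
  let ?S = "\<Sum>k = 1..m. \<bar>real_of_int (z k)\<bar>"
  have S0: "0 \<le> ?S" by (intro sum_nonneg) auto
  \<comment> \<open>Chosen so that (1 - \<kappa>) pi S <= d; the maximum keeps \<kappa> positive,
    and S + 1 avoids dividing by zero when the measure vanishes.\<close>
  define \<kappa> where "\<kappa> = max (1 / 2) (1 - d / (pi * (?S + 1)))"
  have p: "0 < pi * (?S + 1)" by (intro mult_pos_pos pi_gt_zero) (use S0 in linarith)
  have \<kappa>: "0 < \<kappa>" "\<kappa> < 1" using d p by (auto simp: \<kappa>_def max_def)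
  have "1 - d / (pi * (?S + 1)) \<le> \<kappa>" by (simp add: \<kappa>_def)
  then have "(1 - \<kappa>) * (pi * ?S) \<le> d / (pi * (?S + 1)) * (pi * ?S)" using S0 by (intro mult_right_mono) auto
  also have "\<dots> \<le> d / (pi * (?S + 1)) * (pi * (?S + 1))" using S0 d p by (intro mult_left_mono) auto
  also have "\<dots> = d" using less_imp_neq[OF p] by (metis nonzero_eq_divide_eq)
  finally have "pi * ?S \<le> \<kappa> * pi * ?S + d" by (simp add: algebra_simps)
  then have "ereal (pi * ?S) \<le> ereal (\<kappa> * pi * ?S) + ereal d" by simp
  also have "\<dots> \<le> Liminf F (\<lambda>i. Fc \<Omega> (e i) (Q i)) + ereal d"
    by (intro add_right_mono Liminf_bounded flat_lower_bound[OF assms \<kappa>])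
  finally show "ereal (pi * ?S) \<le> Liminf F (\<lambda>i. Fc \<Omega> (e i) (Q i)) + ereal d" .
qed

section \<open>Extraction of a limit measure\<close>

lemma common_subsequence:
  fixes f :: "nat \<Rightarrow> nat \<Rightarrow> 'a :: metric_space"
  assumes S: "compact S" and f: "\<And>n k. f n k \<in> S"
  shows "\<exists>r l. strict_mono (r :: nat \<Rightarrow> nat) \<and> (\<forall>k<M. l k \<in> S \<and> (\<lambda>n. f (r n) k) \<longlonglongrightarrow> l k)"
proof (induction M)
  case 0 show ?case by (intro exI[of _ id]) (auto simp: strict_mono_def)
next
  case (Suc M)
  then obtain r l where r: "strict_mono (r :: nat \<Rightarrow> nat)" "\<And>k. k < M \<Longrightarrow> l k \<in> S \<and> (\<lambda>n. f (r n) k) \<longlonglongrightarrow> l k" by blast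
  obtain a s where s: "a \<in> S" "strict_mono (s :: nat \<Rightarrow> nat)" "((\<lambda>n. f (r n) M) \<circ> s) \<longlonglongrightarrow> a"
    using S f unfolding compact_def by (metis (no_types, lifting))
  have "strict_mono (r \<circ> s)" using r(1) s(2) by (rule strict_mono_o)
  moreover have "(l(M := a)) k \<in> S \<and> (\<lambda>n. f ((r \<circ> s) n) k) \<longlonglongrightarrow> (l(M := a)) k" if "k < Suc M" for k
  proof (cases "k = M")
    case True then show ?thesis using s by (simp add: o_def)
  next
    case False
    then have "k < M" using that by simp
    then show ?thesis using r(2)[of k] LIMSEQ_subseq_LIMSEQ[OF conjunct2[OF r(2)[of k]] s(2)] False by (simp add: o_def)
  qed
  ultimately show ?case by blast
qed

text \<open>The Jacobians are close in the dual norm to lists of boundedly many signed points, hence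
  to points of a fixed finite power of a compact set. Masses that escape to the boundary disappear
  because admissible test functions vanish there.\<close>

theorem compactness:
  fixes \<epsilon> :: "nat \<Rightarrow> real" and Q :: "nat \<Rightarrow> real^2 \<Rightarrow> real^2^2"
  assumes \<Omega>: "open \<Omega>" "bounded \<Omega>" and \<epsilon>: "\<forall>n. \<epsilon> n > 0" "\<epsilon> \<longlonglongrightarrow> 0"
    and C: "\<forall>n. Fc \<Omega> (\<epsilon> n) (Q n) \<le> ereal C"
  shows "\<exists>(r :: nat \<Rightarrow> nat) (m :: nat) (z :: nat \<Rightarrow> int) (x :: nat \<Rightarrow> real^2).
    strict_mono r \<and> inj_on x {1..m} \<and> x ` {1..m} \<subseteq> \<Omega> \<and>
    (\<lambda>n. dual_norm \<Omega> (jac_defect \<Omega> (\<epsilon> (r n)) (Q (r n)) m z x)) \<longlonglongrightarrow> 0"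
proof -
  have fl: "filterlim \<epsilon> (at_right 0) sequentially"
    using \<epsilon> by (intro tendsto_imp_filterlim_at_right) auto
  define C' where "C' = max C 1"
  have C': "0 < C'" "ereal C \<le> ereal C'" by (auto simp: C'_def)
  \<comment> \<open>From \<open>vortex_structure\<close> with \<kappa> = 1 / 2: each point costs at
    least pi / 2.\<close>
  define M where "M = nat \<lceil>2 * C' / pi\<rceil>"
  define G where "G n xs \<longleftrightarrow> (\<forall>\<phi>. adm \<Omega> \<phi> \<longrightarrow>
      \<bar>jac_pairing \<Omega> (\<epsilon> n) (Q n) \<phi> - pi * point_pairing xs \<phi>\<bar> \<le> flat_err C' (\<epsilon> n))" for n xs
  have "\<forall>\<^sub>F n in sequentially. \<exists>xs. (\<forall>p\<in>set xs. \<bar>fst p\<bar> = 1) \<and> length xs \<le> M \<and> G n xs"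
  proof -
    have "\<forall>\<^sub>F n in sequentially. \<forall>Q. Fc \<Omega> (\<epsilon> n) Q \<le> ereal C' \<longrightarrow>
      (\<exists>xs. (\<forall>p\<in>set xs. \<bar>fst p\<bar> = 1) \<and> ereal (1 / 2 * pi * real (length xs)) \<le> Fc \<Omega> (\<epsilon> n) Q \<and>
      (\<forall>\<phi>. adm \<Omega> \<phi> \<longrightarrow> \<bar>jac_pairing \<Omega> (\<epsilon> n) Q \<phi> - pi * point_pairing xs \<phi>\<bar> \<le> flat_err C' (\<epsilon> n)))"
      by (rule eventually_compose_filterlim[OF vortex_structure[OF \<Omega>(2) _ _ C'(1)] fl]) auto
    then show ?thesis
    proof eventually_elim
      case (elim n)
      have F: "Fc \<Omega> (\<epsilon> n) (Q n) \<le> ereal C'" using C C'(2) order_trans by blast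
      with elim obtain xs where xs: "\<forall>p\<in>set xs. \<bar>fst p\<bar> = 1" "ereal (1 / 2 * pi * real (length xs)) \<le> Fc \<Omega> (\<epsilon> n) (Q n)"
        "G n xs" unfolding G_def by blast
      have "ereal (1 / 2 * pi * real (length xs)) \<le> ereal C'" using xs(2) F by (rule order_trans)
      then have "real (length xs) \<le> 2 * C' / pi" by (simp add: field_simps)
      then have "length xs \<le> M" unfolding M_def by linarith
      then show ?case using xs by blast
    qed
  qed
  then obtain n0 where n0: "\<And>n. n0 \<le> n \<Longrightarrow> \<exists>xs. (\<forall>p\<in>set xs. \<bar>fst p\<bar> = 1) \<and> length xs \<le> M \<and> G n xs"
    unfolding eventually_sequentially by blast
  have "\<exists>xs. (\<forall>p\<in>set xs. \<bar>fst p\<bar> = 1) \<and> length xs \<le> M \<and> (n0 \<le> n \<longrightarrow> G n xs)" for n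
  proof (cases "n0 \<le> n")
    case True then show ?thesis using n0 by blast
  next
    case False then show ?thesis by (intro exI[of _ "[]"]) simp
  qed
  then obtain xs where xs: "\<And>n. \<forall>p\<in>set (xs n). \<bar>fst p\<bar> = 1" "\<And>n. length (xs n) \<le> M" "\<And>n. n0 \<le> n \<Longrightarrow> G n (xs n)"
    by metis
  obtain R where R: "\<And>y. y \<in> \<Omega> \<Longrightarrow> norm y \<le> R" "0 \<le> R"
    using \<Omega>(2) unfolding bounded_iff by (meson norm_ge_zero order_trans linear)
  \<comment> \<open>Lists are padded to length \<open>M\<close> by weight 0; points outside
    \<Omega>, such as centres of balls may be, are erased as well, since test functions do not see
    them.\<close>
  define f where "f n k = (if k < length (xs n) \<and> snd (xs n ! k) \<in> \<Omega> then xs n ! k else (0, 0))" for n k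
  define S :: "(real \<times> (real^2)) set" where "S = {-1, 0, 1} \<times> cball 0 R"
  have "compact S" unfolding S_def by (intro compact_Times finite_imp_compact compact_cball) simp
  moreover have "f n k \<in> S" for n k
  proof (cases "k < length (xs n) \<and> snd (xs n ! k) \<in> \<Omega>")
    case True
    then have "\<bar>fst (xs n ! k)\<bar> = 1" "norm (snd (xs n ! k)) \<le> R" using xs(1)[of n] R by auto
    then have "fst (xs n ! k) \<in> {-1, 0, 1}" "snd (xs n ! k) \<in> cball 0 R" by auto
    then show ?thesis using True by (simp only: f_def S_def mem_Times_iff if_True simp_thms)
  next
    case False
    then have "f n k = (0, 0)" unfolding f_def by (rule if_not_P)
    then show ?thesis using R(2) by (simp add: S_def)
  qed
  ultimately obtain r l where r: "strict_mono (r :: nat \<Rightarrow> nat)"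
    and l: "\<And>k. k < M \<Longrightarrow> l k \<in> S" "\<And>k. k < M \<Longrightarrow> (\<lambda>n. f (r n) k) \<longlonglongrightarrow> l k"
    using common_subsequence[of S f M] by blast
  have pair: "point_pairing (xs n) \<phi> = (\<Sum>k<M. fst (f n k) * \<phi> (snd (f n k)))" if "adm \<Omega> \<phi>" for n \<phi>
  proof -
    have "point_pairing (xs n) \<phi> = (\<Sum>k<length (xs n). fst (xs n ! k) * \<phi> (snd (xs n ! k)))"
      by (simp add: point_pairing_def sum_list_sum_nth atLeast0LessThan)
    also have "\<dots> = (\<Sum>k<length (xs n). fst (f n k) * \<phi> (snd (f n k)))"
      using that by (intro sum.cong refl) (simp add: f_def adm_def)
    also have "\<dots> = (\<Sum>k<M. fst (f n k) * \<phi> (snd (f n k)))"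
      using xs(2)[of n] by (intro sum.mono_neutral_left) (auto simp: f_def)
    finally show ?thesis .
  qed
  \<comment> \<open>Limit points on the boundary are left out; they contribute nothing to any
    pairing.\<close>
  define A where "A = {k. k < M \<and> snd (l k) \<in> \<Omega>}"
  define X where "X = (\<lambda>k. snd (l k)) ` A"
  have fA: "finite A" "finite X" by (auto simp: A_def X_def)
  define w where "w y = (\<Sum>k\<in>{k\<in>A. snd (l k) = y}. fst (l k))" for y
  have w: "of_int \<lfloor>w y\<rfloor> = w y" for y
  proof -
    have "fst (l k) \<in> \<int>" if "k \<in> A" for k using l(1)[of k] that by (auto simp: A_def S_def)
    then have "w y \<in> \<int>" unfolding w_def by (intro Ints_sum) auto
    then show ?thesis by (rule of_int_floor)
  qed
  define m where "m = card X"
  obtain x where x: "bij_betw x {1..m} X" using ex_bij_betw_nat_finite_1[OF fA(2)] unfolding m_def by blast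
  define z where "z k = \<lfloor>w (x k)\<rfloor>" for k
  have inj: "inj_on x {1..m}" and im: "x ` {1..m} = X" using x by (auto simp: bij_betw_def)
  have sub: "x ` {1..m} \<subseteq> \<Omega>" unfolding im by (auto simp: X_def A_def)
  have lim: "dirac_pairing m z x \<phi> = (\<Sum>k<M. fst (l k) * \<phi> (snd (l k)))" if "adm \<Omega> \<phi>" for \<phi>
  proof -
    have "dirac_pairing m z x \<phi> = (\<Sum>k = 1..m. w (x k) * \<phi> (x k))"
      by (simp add: dirac_pairing_def z_def w)
    also have "\<dots> = (\<Sum>y\<in>X. w y * \<phi> y)" using sum.reindex_bij_betw[OF x, of "\<lambda>y. w y * \<phi> y"] .
    also have "\<dots> = (\<Sum>y\<in>X. \<Sum>k\<in>{k\<in>A. snd (l k) = y}. fst (l k) * \<phi> (snd (l k)))"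
      unfolding w_def sum_distrib_right by (intro sum.cong refl) simp
    also have "\<dots> = (\<Sum>k\<in>A. fst (l k) * \<phi> (snd (l k)))"
      using fA by (intro sum.group) (auto simp: X_def)
    also have "\<dots> = (\<Sum>k<M. fst (l k) * \<phi> (snd (l k)))"
      using that by (intro sum.mono_neutral_left) (auto simp: A_def adm_def)
    finally show ?thesis .
  qed
  define h where "h n = flat_err C' (\<epsilon> n) + pi * (\<Sum>k<M. \<bar>fst (f n k) - fst (l k)\<bar> + dist (snd (f n k)) (snd (l k)))" for n
  have bound: "dual_norm \<Omega> (jac_defect \<Omega> (\<epsilon> n) (Q n) m z x) \<le> ennreal (h n)" if n: "n0 \<le> n" for n
  proof (rule dual_norm_le[OF \<Omega>(1)])
    fix \<phi> assume \<phi>: "adm \<Omega> \<phi>"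
    have "\<bar>point_pairing (xs n) \<phi> - dirac_pairing m z x \<phi>\<bar>
        \<le> (\<Sum>k<M. \<bar>fst (f n k) - fst (l k)\<bar> + dist (snd (f n k)) (snd (l k)))"
      unfolding pair[OF \<phi>] lim[OF \<phi>] sum_subtractf[symmetric]
    proof (rule sum_abs[THEN order_trans], rule sum_mono)
      fix k assume "k \<in> {..<M}"
      then have s: "\<bar>fst (l k)\<bar> \<le> 1" using l(1)[of k] by (auto simp: S_def)
      have "fst (f n k) * \<phi> (snd (f n k)) - fst (l k) * \<phi> (snd (l k))
         = (fst (f n k) - fst (l k)) * \<phi> (snd (f n k)) + fst (l k) * (\<phi> (snd (f n k)) - \<phi> (snd (l k)))"
        by (simp add: algebra_simps)
      also have "\<bar>\<dots>\<bar> \<le> \<bar>fst (f n k) - fst (l k)\<bar> * \<bar>\<phi> (snd (f n k))\<bar> + \<bar>fst (l k)\<bar> * \<bar>\<phi> (snd (f n k)) - \<phi> (snd (l k))\<bar>"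
        by (rule abs_triangle_ineq[THEN order_trans]) (simp add: abs_mult)
      also have "\<dots> \<le> \<bar>fst (f n k) - fst (l k)\<bar> * 1 + 1 * dist (snd (f n k)) (snd (l k))"
        using \<phi> s by (intro add_mono mult_mono) (auto simp: adm_def)
      finally show "\<bar>fst (f n k) * \<phi> (snd (f n k)) - fst (l k) * \<phi> (snd (l k))\<bar>
          \<le> \<bar>fst (f n k) - fst (l k)\<bar> + dist (snd (f n k)) (snd (l k))" by simp
    qed
    then have "pi * \<bar>point_pairing (xs n) \<phi> - dirac_pairing m z x \<phi>\<bar>
        \<le> pi * (\<Sum>k<M. \<bar>fst (f n k) - fst (l k)\<bar> + dist (snd (f n k)) (snd (l k)))" by (intro mult_left_mono) auto
    then have "\<bar>pi * point_pairing (xs n) \<phi> - pi * dirac_pairing m z x \<phi>\<bar>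
        \<le> pi * (\<Sum>k<M. \<bar>fst (f n k) - fst (l k)\<bar> + dist (snd (f n k)) (snd (l k)))"
      by (simp add: right_diff_distrib[symmetric] abs_mult)
    moreover have "\<bar>jac_pairing \<Omega> (\<epsilon> n) (Q n) \<phi> - pi * point_pairing (xs n) \<phi>\<bar> \<le> flat_err C' (\<epsilon> n)"
      using xs(3)[OF n] \<phi> unfolding G_def by blast
    ultimately show "\<bar>jac_defect \<Omega> (\<epsilon> n) (Q n) m z x \<phi>\<bar> \<le> h n"
      unfolding jac_defect_def h_def by linarith
  qed
  have sub_fl: "filterlim r sequentially sequentially" using r by (rule filterlim_subseq)
  have t1: "(\<lambda>n. \<bar>fst (f (r n) k) - fst (l k)\<bar> + dist (snd (f (r n) k)) (snd (l k))) \<longlonglongrightarrow> 0" if "k < M" for k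
  proof -
    have "(\<lambda>n. \<bar>fst (f (r n) k) - fst (l k)\<bar> + dist (snd (f (r n) k)) (snd (l k)))
        \<longlonglongrightarrow> \<bar>fst (l k) - fst (l k)\<bar> + dist (snd (l k)) (snd (l k))"
      by (intro tendsto_intros l(2)[OF that])
    then show ?thesis by simp
  qed
  have "(\<lambda>n. flat_err C' (\<epsilon> (r n))) \<longlonglongrightarrow> 0"
    using filterlim_compose[OF filterlim_compose[OF flat_err_tendsto[of C'] fl] sub_fl] .
  then have "(\<lambda>n. h (r n)) \<longlonglongrightarrow> 0 + pi * (\<Sum>k<M. 0)"
    unfolding h_def by (intro tendsto_intros t1) auto
  then have up: "(\<lambda>n. ennreal (h (r n))) \<longlonglongrightarrow> ennreal 0" by (intro tendsto_ennrealI) simp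
  have "\<forall>\<^sub>F n in sequentially. n0 \<le> r n" using sub_fl by (simp add: filterlim_at_top)
  then have ev: "\<forall>\<^sub>F n in sequentially. dual_norm \<Omega> (jac_defect \<Omega> (\<epsilon> (r n)) (Q (r n)) m z x) \<le> ennreal (h (r n))"
    by eventually_elim (rule bound)
  have "(\<lambda>n. dual_norm \<Omega> (jac_defect \<Omega> (\<epsilon> (r n)) (Q (r n)) m z x)) \<longlonglongrightarrow> 0"
    by (rule tendsto_sandwich[OF _ ev tendsto_const up[unfolded ennreal_0]]) simp
  then show ?thesis using r inj sub by blast
qed

section \<open>A single vortex\<close>

text \<open>Position relative to the centre of the square j. Both coordinates are half-integers, so
  no lattice point hits the singularity.\<close>

definition rel :: "int \<times> int \<Rightarrow> int \<times> int \<Rightarrow> complex" where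
  "rel j i = Complex (of_int (fst i - fst j) - 1/2) (of_int (snd i - snd j) - 1/2)"

definition vortex :: "int \<times> int \<Rightarrow> int \<times> int \<Rightarrow> complex" where
  "vortex j i = sgn (rel j i)"

lemma rel_step: "rel j (i + dx) = rel j i + 1" "rel j (i + dy) = rel j i + \<i>"
  by (simp_all add: rel_def complex_eq_iff)

lemma half_int_ge: "1/2 \<le> \<bar>real_of_int k - 1/2\<bar>"
proof (cases "k \<le> 0")
  case True then have "real_of_int k \<le> 0" by simp
  then show ?thesis by linarith
next
  case False then have "1 \<le> real_of_int k" by simp
  then show ?thesis by linarith
qed

lemma rel_nonzero [simp]: "rel j i \<noteq> 0"
  using half_int_ge[of "fst i - fst j"] by (auto simp: rel_def complex_eq_iff)

lemma norm_vortex [simp]: "norm (vortex j i) = 1"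
  by (simp add: vortex_def norm_sgn)

lemma Arg_sgn_quotient:
  assumes "z \<noteq> 0" "w \<noteq> 0" shows "Arg (sgn w / sgn z) = Arg (w / z)"
proof -
  have "sgn w / sgn z = of_real (norm z / norm w) * (w / z)"
    using assms by (simp add: sgn_eq field_simps)
  then show ?thesis using assms Arg_times_of_real[of "norm z / norm w" "w / z"] by (simp only: zero_less_divide_iff zero_less_norm_iff) simp
qed

text \<open>Rotated by \<zeta>, both points lie in the right half-plane, where arguments are below
  pi / 2 in size and their difference cannot leave (-pi, pi].\<close>

lemma Arg_quotient_half_plane:
  assumes "0 < Re (\<zeta> * z)" "0 < Re (\<zeta> * w)"
  shows "Arg (w / z) = Arg (\<zeta> * w) - Arg (\<zeta> * z)"
proof -
  have nz: "z \<noteq> 0" "w \<noteq> 0" "\<zeta> \<noteq> 0" using assms by auto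
  have b: "\<bar>Arg (\<zeta> * z)\<bar> < pi / 2" "\<bar>Arg (\<zeta> * w)\<bar> < pi / 2" using assms Arg_Re_pos by blast+
  have "sgn (w / z) = sgn ((\<zeta> * w) / (\<zeta> * z))" using nz by simp
  also have "\<dots> = sgn (\<zeta> * w) / sgn (\<zeta> * z)" by (rule sgn_divide)
  also have "\<dots> = cis (Arg (\<zeta> * w)) / cis (Arg (\<zeta> * z))"
    using nz by (subst (1 2) cis_Arg) auto
  also have "\<dots> = cis (Arg (\<zeta> * w) - Arg (\<zeta> * z))" by (rule cis_divide)
  finally show ?thesis using b by (intro cis_Arg_unique) auto
qed

lemma vortex_bonds:
  "hb (vortex j) i = Arg ((rel j i + 1) / rel j i)" "vb (vortex j) i = Arg ((rel j i + \<i>) / rel j i)"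
  unfolding hb_def vb_def vortex_def rel_step[symmetric] by (intro Arg_sgn_quotient rel_nonzero)+

text \<open>At the central square each side is seen under a right angle. Any other square lies
  strictly on one side of a coordinate axis through the centre; in that half-plane the argument is
  single-valued and the circulation telescopes to 0.\<close>

lemma circulation_vortex: "circulation (vortex j) i = (if i = j then 2 * pi else 0)"
proof -
  define z where "z = rel j i"
  have c: "circulation (vortex j) i
     = Arg ((z + 1) / z) + Arg ((z + 1 + \<i>) / (z + 1)) - Arg ((z + 1 + \<i>) / (z + \<i>)) - Arg ((z + \<i>) / z)"
    unfolding circulation_def vortex_bonds rel_step z_def by (simp add: ac_simps)
  show ?thesis
  proof (cases "i = j")
    case True
    then have z: "z = Complex (-1/2) (-1/2)" by (simp add: z_def rel_def)
    have e: "(z + 1) / z = \<i>" "(z + 1 + \<i>) / (z + 1) = \<i>" "(z + 1 + \<i>) / (z + \<i>) = -\<i>" "(z + \<i>) / z = -\<i>"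
      by (simp_all add: z complex_eq_iff Re_divide Im_divide power2_eq_square)
    show ?thesis unfolding c e using True by (simp add: Arg_ii Arg_minus_ii)
  next
    case False
    have RI: "Re z = of_int (fst i - fst j) - 1/2" "Im z = of_int (snd i - snd j) - 1/2"
      by (simp_all add: z_def rel_def)
    have "fst i - fst j \<noteq> 0 \<or> snd i - snd j \<noteq> 0" using False by (simp add: prod_eq_iff)
    then consider "1 \<le> fst i - fst j" | "fst i - fst j \<le> -1" | "1 \<le> snd i - snd j" | "snd i - snd j \<le> -1"
      by linarith
    then obtain \<zeta> where "0 < Re (\<zeta> * z) \<and> 0 < Re (\<zeta> * (z + 1)) \<and> 0 < Re (\<zeta> * (z + \<i>)) \<and> 0 < Re (\<zeta> * (z + 1 + \<i>))"
    proof cases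
      case 1
      then have "1 \<le> real_of_int (fst i - fst j)" by linarith
      then show ?thesis using RI by (intro that[of 1]) simp
    next
      case 2
      then have "real_of_int (fst i - fst j) \<le> -1" by linarith
      then show ?thesis using RI by (intro that[of "-1"]) simp
    next
      case 3
      then have "1 \<le> real_of_int (snd i - snd j)" by linarith
      then show ?thesis using RI by (intro that[of "-\<i>"]) simp
    next
      case 4
      then have "real_of_int (snd i - snd j) \<le> -1" by linarith
      then show ?thesis using RI by (intro that[of "\<i>"]) simp
    qed
    then show ?thesis using False unfolding c by (simp add: Arg_quotient_half_plane[where \<zeta> = \<zeta>])
  qed
qed

text \<open>The bound pi / 2 instead of pi leaves room for the contributions of the other vortices
  before the sum of angles wraps around.\<close>

lemma vortex_bond_le: "\<bar>hb (vortex j) i\<bar> \<le> pi / 2" "\<bar>vb (vortex j) i\<bar> \<le> pi / 2"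
proof -
  define z where "z = rel j i"
  have h: "1/2 \<le> \<bar>Re z\<bar>" "1/2 \<le> \<bar>Im z\<bar>" using half_int_ge[of "fst i - fst j"] half_int_ge[of "snd i - snd j"] by (simp_all add: z_def rel_def)
  then have "(1/2)\<^sup>2 \<le> (Re z)\<^sup>2" "(1/2)\<^sup>2 \<le> (Im z)\<^sup>2" using power_mono[OF h(1), of 2] power_mono[OF h(2), of 2] by simp_all
  then have q: "1/4 \<le> (Re z)\<^sup>2" "1/4 \<le> (Im z)\<^sup>2" by (simp_all add: power2_eq_square)
  have arg: "\<bar>Arg w\<bar> \<le> pi / 2" if "0 \<le> Re w" for w
    using that Arg_Re_nonneg by blast
  have "0 \<le> Re z * (Re z + 1) + (Im z)\<^sup>2" "0 \<le> (Re z)\<^sup>2 + Im z * (Im z + 1)"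
    using q zero_le_power2[of "Re z + 1/2"] zero_le_power2[of "Im z + 1/2"]
    by (simp_all add: power2_eq_square algebra_simps)
  then have "0 \<le> Re ((z + 1) / z)" "0 \<le> Re ((z + \<i>) / z)"
    by (simp_all add: Re_divide power2_eq_square algebra_simps)
  then show "\<bar>hb (vortex j) i\<bar> \<le> pi / 2" "\<bar>vb (vortex j) i\<bar> \<le> pi / 2"
    unfolding vortex_bonds z_def[symmetric] by (blast intro: arg)+
qed

section \<open>Energy of a single vortex\<close>

lemma sgn_diff_le:
  fixes z w :: complex assumes "z \<noteq> 0"
  shows "norm (sgn w - sgn z) \<le> 2 * norm (w - z) / norm z"
proof (cases "w = 0")
  case True then show ?thesis using assms by (simp add: norm_sgn)
next
  case False
  have "sgn w - sgn z = (w - z) /\<^sub>R norm z + (inverse (norm w) - inverse (norm z)) *\<^sub>R w"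
    by (simp add: sgn_div_norm algebra_simps)
  then have "norm (sgn w - sgn z) \<le> norm ((w - z) /\<^sub>R norm z) + norm ((inverse (norm w) - inverse (norm z)) *\<^sub>R w)"
    by (metis norm_triangle_ineq)
  also have "norm ((w - z) /\<^sub>R norm z) = norm (w - z) / norm z" by (simp add: divide_inverse mult.commute)
  also have "norm ((inverse (norm w) - inverse (norm z)) *\<^sub>R w) = \<bar>norm z - norm w\<bar> / norm z"
  proof -
    have "(inverse (norm w) - inverse (norm z)) * norm w = (norm z - norm w) / norm z"
      using assms False by (simp add: field_simps)
    then show ?thesis by (metis abs_mult abs_norm_cancel norm_scaleR abs_divide)
  qed
  also have "\<dots> \<le> norm (w - z) / norm z"
    using norm_triangle_ineq3[of z w] by (intro divide_right_mono) (auto simp: norm_minus_commute)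
  finally show ?thesis by simp
qed

text \<open>The two forward bonds of a lattice point, measured by squared chords; this is twice
  their energy.\<close>

definition vortex_density :: "complex \<Rightarrow> real" where
  "vortex_density z = (norm (sgn (z + 1) - sgn z))\<^sup>2 + (norm (sgn (z + \<i>) - sgn z))\<^sup>2"

lemma vortex_density_le_8: "vortex_density z \<le> 8"
proof -
  have "norm (sgn a - sgn b) \<le> 2" for a b :: complex
    using norm_triangle_ineq4[of "sgn a" "sgn b"] by (auto simp: norm_sgn split: if_splits)
  then have "(norm (sgn a - sgn b))\<^sup>2 \<le> 2\<^sup>2" for a b :: complex by (intro power_mono) auto
  from this[of "z + 1" z] this[of "z + \<i>" z] show ?thesis by (simp add: vortex_density_def)
qed

text \<open>The chord \<open>2 - 2 cos a\<close> is compared with \<open>sin\<^sup>2 a\<close>, since the squared sines of the two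
  angles add up to \<open>1/|z|\<^sup>2\<close> up to lower order.\<close>

lemma chord_sin_le:
  fixes z w :: complex
  assumes z: "1 < norm z" and d: "norm (w - z) = 1"
  shows "(norm (sgn w - sgn z))\<^sup>2 \<le> (Im (cnj z * w) / norm z)\<^sup>2 * (1 / ((norm z - 1)\<^sup>2 * (1 - 1 / (norm z)\<^sup>2)))"
proof -
  have nw: "norm z - 1 \<le> norm w" using norm_triangle_ineq3[of z w] d by (simp add: norm_minus_commute)
  then have nz: "z \<noteq> 0" "w \<noteq> 0" using z by auto
  define co where "co = Re (cnj z * w) / (norm z * norm w)"
  define si where "si = Im (cnj z * w) / (norm z * norm w)"
  have cs: "co\<^sup>2 + si\<^sup>2 = 1"
  proof -
    have "(Re (cnj z * w))\<^sup>2 + (Im (cnj z * w))\<^sup>2 = (norm z * norm w)\<^sup>2"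
      by (simp only: cmod_power2[symmetric] norm_mult complex_mod_cnj)
    then show ?thesis using nz by (simp add: co_def si_def power_divide add_divide_distrib[symmetric])
  qed
  have n1: "norm (sgn z) = 1" "norm (sgn w) = 1" using nz by (auto simp: norm_sgn)
  have "(norm (sgn w - sgn z))\<^sup>2 = (norm (sgn w))\<^sup>2 + (norm (sgn z))\<^sup>2 - 2 * (Re (sgn z) * Re (sgn w) + Im (sgn z) * Im (sgn w))"
    unfolding cmod_power2 by (simp add: power2_diff algebra_simps)
  also have "Re (sgn z) * Re (sgn w) + Im (sgn z) * Im (sgn w) = co"
    using nz by (simp add: co_def sgn_eq Re_divide_of_real Im_divide_of_real add_divide_distrib)
  finally have ch: "(norm (sgn w - sgn z))\<^sup>2 = 2 - 2 * co" using n1 by simp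
  \<comment> \<open>This rough bound keeps 1 + co close to 2, so that 1 - co = si^2 / (1 + co) is
    close to si^2 / 2.\<close>
  have "norm (sgn w - sgn z) \<le> 2 / norm z" using sgn_diff_le[OF nz(1), of w] d by simp
  then have "(norm (sgn w - sgn z))\<^sup>2 \<le> (2 / norm z)\<^sup>2" by (intro power_mono) auto
  then have lo: "2 * (1 - 1 / (norm z)\<^sup>2) \<le> 1 + co" using ch by (simp add: power_divide)
  have "1 < (norm z)\<^sup>2" using z by (simp add: one_less_power)
  then have k: "0 < 1 - 1 / (norm z)\<^sup>2" by (simp only: diff_gt_0_iff_gt) (subst divide_less_eq_1_pos, auto)
  have "co\<^sup>2 \<le> 1\<^sup>2" using cs zero_le_power2[of si] by (simp only: one_power2)
  then have c1: "co \<le> 1" by (rule power2_le_imp_le) simp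
  have "(2 - 2 * co) * X = (1 - co) * (2 * X)" for X by (simp add: algebra_simps)
  then have "(2 - 2 * co) * (1 - 1 / (norm z)\<^sup>2) = (1 - co) * (2 * (1 - 1 / (norm z)\<^sup>2))" .
  also have "\<dots> \<le> (1 - co) * (1 + co)" using lo c1 by (intro mult_left_mono) auto
  also have "\<dots> = si\<^sup>2" using cs by (simp add: algebra_simps power2_eq_square)
  finally have up: "2 - 2 * co \<le> si\<^sup>2 / (1 - 1 / (norm z)\<^sup>2)" using k by (simp only: pos_le_divide_eq)
  have "si\<^sup>2 = (Im (cnj z * w) / norm z)\<^sup>2 * (1 / (norm w)\<^sup>2)" by (simp add: si_def power_divide power_mult_distrib)
  also have "\<dots> \<le> (Im (cnj z * w) / norm z)\<^sup>2 * (1 / (norm z - 1)\<^sup>2)"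
    using nw z by (intro mult_left_mono divide_left_mono power_mono mult_pos_pos) auto
  finally have "si\<^sup>2 / (1 - 1 / (norm z)\<^sup>2) \<le> (Im (cnj z * w) / norm z)\<^sup>2 * (1 / (norm z - 1)\<^sup>2) / (1 - 1 / (norm z)\<^sup>2)"
    using k by (intro divide_right_mono) auto
  also have "\<dots> = (Im (cnj z * w) / norm z)\<^sup>2 * (1 / ((norm z - 1)\<^sup>2 * (1 - 1 / (norm z)\<^sup>2)))" by simp
  finally show ?thesis using up unfolding ch by (rule order_trans[rotated])
qed

text \<open>The cross products of z with the two unit steps are - Im z and Re z, whose squares add
  up to |z|^2.\<close>

lemma vortex_density_le:
  assumes z: "1 < norm z"
  shows "vortex_density z \<le> 1 / ((norm z - 1)\<^sup>2 * (1 - 1 / (norm z)\<^sup>2))"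
proof -
  let ?W = "1 / ((norm z - 1)\<^sup>2 * (1 - 1 / (norm z)\<^sup>2))"
  have "vortex_density z \<le> (Im (cnj z * (z + 1)) / norm z)\<^sup>2 * ?W + (Im (cnj z * (z + \<i>)) / norm z)\<^sup>2 * ?W"
    unfolding vortex_density_def using z by (intro add_mono chord_sin_le) auto
  also have "\<dots> = ((Im (cnj z * (z + 1)) / norm z)\<^sup>2 + (Im (cnj z * (z + \<i>)) / norm z)\<^sup>2) * ?W"
    by (rule distrib_right[symmetric])
  also have "(Im (cnj z * (z + 1)) / norm z)\<^sup>2 + (Im (cnj z * (z + \<i>)) / norm z)\<^sup>2 = 1"
  proof -
    have "(norm z)\<^sup>2 = (Re z)\<^sup>2 + (Im z)\<^sup>2" by (rule cmod_power2)
    moreover have "(norm z)\<^sup>2 \<noteq> 0" using z by auto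
    moreover have "Im (cnj z * (z + 1)) = - Im z" "Im (cnj z * (z + \<i>)) = Re z" by (simp_all add: algebra_simps)
    ultimately show ?thesis by (simp add: power_divide add_divide_distrib[symmetric])
  qed
  finally show ?thesis by simp
qed

lemma norm_rel: "norm (rel j i) = dist (pos i) (pos j + vector [1/2, 1/2])"
  by (simp add: rel_def cmod_def dist_norm norm_real2 algebra_simps)

text \<open>Number of points times density: of order r^2 points with density about 1 / r^2, so that
  the bound does not depend on r. All boundary corrections are of relative size 1 / K.\<close>

lemma ring_density_sum:
  assumes F: "finite F" and r: "2 \<le> r" and q: "1 < q"
    and ring: "\<And>i. i \<in> F \<Longrightarrow> r \<le> norm (rel j i) \<and> norm (rel j i) < q * r"
    and K: "2 \<le> K" "K \<le> r"
  shows "(\<Sum>i\<in>F. vortex_density (rel j i)) \<le> pi * (q\<^sup>2 - 1 + 6 * q / K) * (1 / ((1 - 1 / K)\<^sup>2 * (1 - 1 / K\<^sup>2)))"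
proof -
  let ?B = "1 / ((1 - 1 / K)\<^sup>2 * (1 - 1 / K\<^sup>2))"
  have K1: "0 < 1 - 1 / K" "0 < 1 - 1 / K\<^sup>2" using K by (auto simp: one_less_power)
  have B0: "0 \<le> ?B" using K1 by simp
  have each: "vortex_density (rel j i) \<le> ?B / r\<^sup>2" if i: "i \<in> F" for i
  proof -
    define n where "n = norm (rel j i)"
    have n: "r \<le> n" "K \<le> n" "1 < n" using ring[OF i] K by (auto simp: n_def)
    have a: "0 < r * (1 - 1 / K)" using r K1 by (intro mult_pos_pos) auto
    have "r * (1 - 1 / K) \<le> n * (1 - 1 / n)"
      using n K by (intro mult_mono diff_mono divide_left_mono) auto
    also have "n * (1 - 1 / n) = n - 1" using n by (simp add: right_diff_distrib)
    finally have 1: "(r * (1 - 1 / K))\<^sup>2 \<le> (n - 1)\<^sup>2" using a by (intro power_mono) auto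
    have 2: "1 - 1 / K\<^sup>2 \<le> 1 - 1 / n\<^sup>2"
      using n K by (intro diff_mono divide_left_mono power_mono mult_pos_pos zero_less_power) auto
    have "vortex_density (rel j i) \<le> 1 / ((n - 1)\<^sup>2 * (1 - 1 / n\<^sup>2))"
      using vortex_density_le[of "rel j i"] n(3) by (simp add: n_def)
    also have "\<dots> \<le> 1 / ((r * (1 - 1 / K))\<^sup>2 * (1 - 1 / K\<^sup>2))"
    proof (rule divide_left_mono)
      show "(r * (1 - 1 / K))\<^sup>2 * (1 - 1 / K\<^sup>2) \<le> (n - 1)\<^sup>2 * (1 - 1 / n\<^sup>2)"
        using 1 2 K1 by (intro mult_mono) auto
      have "0 < (r * (1 - 1 / K))\<^sup>2 * (1 - 1 / K\<^sup>2)" using a K1 r by (intro mult_pos_pos zero_less_power) auto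
      moreover have "0 < (n - 1)\<^sup>2 * (1 - 1 / n\<^sup>2)" using n K1 2 by (intro mult_pos_pos zero_less_power) auto
      ultimately show "0 < (n - 1)\<^sup>2 * (1 - 1 / n\<^sup>2) * ((r * (1 - 1 / K))\<^sup>2 * (1 - 1 / K\<^sup>2))" by (rule mult_pos_pos[rotated])
    qed simp
    also have "\<dots> = ?B / r\<^sup>2" by (simp add: power_mult_distrib)
    finally show ?thesis .
  qed
  \<comment> \<open>The inner radius is lowered by 1 because \<open>annulus_card_le\<close> asks for
    strict inequalities.\<close>
  have "real (card F) \<le> pi * ((q * r + 1)\<^sup>2 - ((r - 1) - 1)\<^sup>2)"
  proof (rule annulus_card_le[OF F])
    show "1 \<le> r - 1" using r by simp
    have "1 * r \<le> q * r" using q r by (intro mult_right_mono) auto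
    then show "r - 1 \<le> q * r" by simp
    show "r - 1 < dist (pos i) (pos j + vector [1/2, 1/2]) \<and> dist (pos i) (pos j + vector [1/2, 1/2]) < q * r" if "i \<in> F" for i
      using ring[OF that] unfolding norm_rel by linarith
  qed
  also have "\<dots> \<le> pi * ((q\<^sup>2 - 1 + 6 * q / K) * r\<^sup>2)"
  proof (rule mult_left_mono)
    have "1 * r \<le> q * r" using q r by (intro mult_right_mono) auto
    then have "(q * r + 1)\<^sup>2 - (r - 1 - 1)\<^sup>2 \<le> (q\<^sup>2 - 1) * r\<^sup>2 + 6 * (q * r)"
      by (simp add: power2_eq_square algebra_simps)
    also have "6 * (q * r) \<le> 6 * q / K * r\<^sup>2"
    proof -
      have "(6 * (q * r)) * 1 \<le> (6 * (q * r)) * (r / K)" using q r K by (intro mult_left_mono) auto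
      then show ?thesis by (simp add: power2_eq_square mult_ac)
    qed
    finally show "(q * r + 1)\<^sup>2 - (r - 1 - 1)\<^sup>2 \<le> (q\<^sup>2 - 1 + 6 * q / K) * r\<^sup>2" by (simp add: distrib_right)
  qed simp
  finally have card: "real (card F) \<le> pi * (q\<^sup>2 - 1 + 6 * q / K) * r\<^sup>2" by (simp add: mult.assoc)
  have "(\<Sum>i\<in>F. vortex_density (rel j i)) \<le> real (card F) * (?B / r\<^sup>2)"
    using sum_mono[of F, OF each] by simp
  also have "\<dots> \<le> pi * (q\<^sup>2 - 1 + 6 * q / K) * r\<^sup>2 * (?B / r\<^sup>2)"
    using card B0 by (intro mult_right_mono) auto
  also have "\<dots> = pi * (q\<^sup>2 - 1 + 6 * q / K) * ?B" using r by simp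
  finally show ?thesis .
qed

lemma small_rel_card:
  assumes F: "finite F" and K: "0 \<le> K" and sm: "\<And>i. i \<in> F \<Longrightarrow> norm (rel j i) < K"
  shows "real (card F) \<le> (2 * K + 4)\<^sup>2"
proof -
  define m where "m = \<lceil>K\<rceil> + 1"
  have m: "1 \<le> m" "of_int m \<le> K + 2" "K + 1 \<le> of_int m"
    using K ceiling_correct[of K] by (auto simp: m_def)
  have "F \<subseteq> {fst j - m + 1..fst j + m} \<times> {snd j - m + 1..snd j + m}"
  proof
    fix i assume "i \<in> F"
    then have "\<bar>Re (rel j i)\<bar> < K" "\<bar>Im (rel j i)\<bar> < K"
      using sm[of i] abs_Re_le_cmod[of "rel j i"] abs_Im_le_cmod[of "rel j i"] by auto
    then have "\<bar>of_int (fst i - fst j) - 1/2 :: real\<bar> < of_int m - 1" "\<bar>of_int (snd i - snd j) - 1/2 :: real\<bar> < of_int m - 1"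
      using m by (auto simp: rel_def)
    then have "\<bar>fst i - fst j\<bar> \<le> m - 1" "\<bar>snd i - snd j\<bar> \<le> m - 1" by linarith+
    then show "i \<in> {fst j - m + 1..fst j + m} \<times> {snd j - m + 1..snd j + m}"
      by (auto simp: mem_Times_iff)
  qed
  then have "card F \<le> card ({fst j - m + 1..fst j + m} \<times> {snd j - m + 1..snd j + m})" by (intro card_mono) auto
  also have "\<dots> = nat (2 * m) * nat (2 * m)" by (simp add: card_cartesian_product)
  finally have "real (card F) \<le> real (nat (2 * m) * nat (2 * m))" by linarith
  also have "\<dots> = (2 * of_int m)\<^sup>2" using m by (simp add: power2_eq_square)
  also have "\<dots> \<le> (2 * K + 4)\<^sup>2" using m by (intro power_mono) auto
  finally show ?thesis .
qed

text \<open>Geometric rings of ratio 1 + \<tau>: their number is about ln Rm / ln (1 + \<tau>), and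
  each carries at most a constant \<open>c\<close>. The core contributes a bounded amount.
  \<open>C0\<close> depends on \<delta> alone, not on the set, the centre or the radius.\<close>

lemma vortex_energy_sum:
  assumes \<delta>: "0 < (\<delta> :: real)"
  shows "\<exists>C0. \<forall>F j Rm. finite F \<longrightarrow> 1 \<le> Rm \<longrightarrow> (\<forall>i\<in>F. norm (rel j i) \<le> Rm) \<longrightarrow>
    (\<Sum>i\<in>F. vortex_density (rel j i)) \<le> (2 * pi + \<delta>) * ln Rm + C0"
proof -
  \<comment> \<open>The constant of a ring divided by ln (1 + \<tau>), with K = 1 / \<tau>^2. The
    leading terms are pi * 2 \<tau> over \<tau>.\<close>
  have "((\<lambda>\<tau>::real. pi * ((1 + \<tau>)\<^sup>2 - 1 + 6 * (1 + \<tau>) * \<tau>\<^sup>2) * (1 / ((1 - \<tau>\<^sup>2)\<^sup>2 * (1 - (\<tau>\<^sup>2)\<^sup>2))) / ln (1 + \<tau>))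
      \<longlongrightarrow> 2 * pi) (at_right 0)" by real_asymp
  then have "\<forall>\<^sub>F \<tau> in at_right 0. pi * ((1 + \<tau>)\<^sup>2 - 1 + 6 * (1 + \<tau>) * \<tau>\<^sup>2) * (1 / ((1 - \<tau>\<^sup>2)\<^sup>2 * (1 - (\<tau>\<^sup>2)\<^sup>2))) / ln (1 + \<tau>) < 2 * pi + \<delta>"
    using \<delta> by (intro order_tendstoD(2)) auto
  moreover have "\<forall>\<^sub>F \<tau> in at_right 0. \<tau> \<in> {0<..<1/2::real}" by (rule eventually_at_right_real) simp
  ultimately have "\<forall>\<^sub>F \<tau> in at_right 0. pi * ((1 + \<tau>)\<^sup>2 - 1 + 6 * (1 + \<tau>) * \<tau>\<^sup>2) * (1 / ((1 - \<tau>\<^sup>2)\<^sup>2 * (1 - (\<tau>\<^sup>2)\<^sup>2))) / ln (1 + \<tau>) < 2 * pi + \<delta>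
    \<and> \<tau> \<in> {0<..<1/2::real}" by (rule eventually_conj)
  from eventually_happens[OF this] obtain \<tau> :: real where
    \<tau>1: "pi * ((1 + \<tau>)\<^sup>2 - 1 + 6 * (1 + \<tau>) * \<tau>\<^sup>2) * (1 / ((1 - \<tau>\<^sup>2)\<^sup>2 * (1 - (\<tau>\<^sup>2)\<^sup>2))) / ln (1 + \<tau>) < 2 * pi + \<delta>"
    and \<tau>: "0 < \<tau>" "\<tau> < 1/2" by auto
  define K q where "K = 1 / \<tau>\<^sup>2" and "q = 1 + \<tau>"
  define c where "c = pi * (q\<^sup>2 - 1 + 6 * q / K) * (1 / ((1 - 1 / K)\<^sup>2 * (1 - 1 / K\<^sup>2)))"
  have q: "1 < q" using \<tau> by (simp add: q_def)
  define l where "l = ln q"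
  have l: "0 < l" using q by (simp add: l_def)
  have t2: "\<tau>\<^sup>2 \<le> 1 / 4"
  proof -
    have "\<tau> * \<tau> \<le> (1/2) * (1/2)" using \<tau> by (intro mult_mono) auto
    then show ?thesis by (simp add: power2_eq_square)
  qed
  have K: "2 \<le> K" unfolding K_def using t2 \<tau> by (subst pos_le_divide_eq) auto
  have cl: "c / l < 2 * pi + \<delta>" using \<tau>1 by (simp add: c_def l_def q_def K_def power_divide)
  have c0: "0 \<le> c"
  proof -
    have "1 \<le> q\<^sup>2" using q by (simp add: one_le_power)
    moreover have "1 / K \<le> 1" "1 / K\<^sup>2 \<le> 1" using K by (auto simp: one_le_power)
    ultimately show ?thesis unfolding c_def using q K by (intro mult_nonneg_nonneg divide_nonneg_nonneg add_nonneg_nonneg) auto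
  qed
  show ?thesis
  proof (intro exI[of _ "c + 8 * (2 * K + 4)\<^sup>2"] allI impI)
    fix F j Rm assume F: "finite F" and Rm: "1 \<le> Rm" and b: "\<forall>i\<in>F. norm (rel j i) \<le> Rm"
    define F0 F1 where "F0 = {i\<in>F. norm (rel j i) < K}" and "F1 = {i\<in>F. K \<le> norm (rel j i)}"
    \<comment> \<open>The number of the ring containing the point, counted from radius K.\<close>
    define idx where "idx i = nat \<lfloor>ln (norm (rel j i) / K) / l\<rfloor>" for i
    define N where "N = nat \<lfloor>ln Rm / l\<rfloor>"
    have fin: "finite F0" "finite F1" using F by (auto simp: F0_def F1_def)
    have "F = F0 \<union> F1" "F0 \<inter> F1 = {}" by (auto simp: F0_def F1_def)
    then have split: "(\<Sum>i\<in>F. vortex_density (rel j i)) = (\<Sum>i\<in>F0. vortex_density (rel j i)) + (\<Sum>i\<in>F1. vortex_density (rel j i))"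
      using fin by (simp add: sum.union_disjoint)
    have "(\<Sum>i\<in>F0. vortex_density (rel j i)) \<le> (\<Sum>i\<in>F0. 8)" by (intro sum_mono vortex_density_le_8)
    also have "\<dots> = real (card F0) * 8" by simp
    also have "\<dots> \<le> (2 * K + 4)\<^sup>2 * 8" using K by (intro mult_right_mono small_rel_card[OF fin(1)]) (auto simp: F0_def)
    finally have s0: "(\<Sum>i\<in>F0. vortex_density (rel j i)) \<le> 8 * (2 * K + 4)\<^sup>2" by simp
    have id: "K * q ^ idx i \<le> norm (rel j i) \<and> norm (rel j i) < q * (K * q ^ idx i) \<and> idx i \<le> N" if i: "i \<in> F1" for i
    proof -
      define n where "n = norm (rel j i)"
      have n: "K \<le> n" "n \<le> Rm" using i b by (auto simp: F1_def n_def)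
      have nK: "1 \<le> n / K" using n K by (simp add: pos_le_divide_eq)
      then have ln0: "0 \<le> ln (n / K) / l" using l by simp
      have f: "real (idx i) \<le> ln (n / K) / l" "ln (n / K) / l < real (idx i) + 1"
        using ln0 unfolding idx_def n_def[symmetric] by linarith+
      have e: "q ^ k = exp (real k * l)" for k using q by (simp add: l_def exp_of_nat_mult)
      have ne: "n / K = exp (ln (n / K))" using nK by simp
      have "real (idx i) * l \<le> ln (n / K)" "ln (n / K) < (real (idx i) + 1) * l"
        using f l by (simp_all add: pos_le_divide_eq pos_divide_less_eq)
      then have "exp (real (idx i) * l) \<le> exp (ln (n / K))" "exp (ln (n / K)) < exp (real (Suc (idx i)) * l)"
        by (simp_all only: exp_le_cancel_iff exp_less_cancel_iff of_nat_Suc add.commute)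
      then have "q ^ idx i \<le> n / K" "n / K < q ^ Suc (idx i)"
        by (simp_all only: e ne[symmetric])
      then have "K * q ^ idx i \<le> n" "n < q * (K * q ^ idx i)"
        using K by (simp_all add: pos_le_divide_eq pos_divide_less_eq mult_ac)
      moreover have "idx i \<le> N"
      proof -
        have "n / K \<le> Rm / 1" using n K nK by (intro frac_le) auto
        then have "ln (n / K) \<le> ln Rm" using nK Rm by (subst ln_le_cancel_iff) auto
        then have "ln (n / K) / l \<le> ln Rm / l" using l by (intro divide_right_mono) auto
        then show ?thesis unfolding idx_def N_def n_def[symmetric] by (intro nat_mono floor_mono)
      qed
      ultimately show ?thesis by (simp add: n_def)
    qed
    have "(\<Sum>i\<in>F1. vortex_density (rel j i)) = (\<Sum>k\<in>{..N}. \<Sum>i\<in>{i\<in>F1. idx i = k}. vortex_density (rel j i))"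
      using id fin by (intro sum.group[symmetric]) auto
    also have "\<dots> \<le> (\<Sum>k\<in>{..N}. c)"
    proof (rule sum_mono)
      fix k
      have "1 \<le> q ^ k" using q by (intro one_le_power) auto
      then have Kk: "K \<le> K * q ^ k" using K by simp
      then have Kk2: "2 \<le> K * q ^ k" using K by linarith
      show "(\<Sum>i\<in>{i\<in>F1. idx i = k}. vortex_density (rel j i)) \<le> c"
        unfolding c_def using Kk Kk2 K id fin q by (intro ring_density_sum[where r = "K * q ^ k"]) auto
    qed
    also have "\<dots> = c * (real N + 1)" by simp
    also have "\<dots> \<le> c * (ln Rm / l + 1)"
    proof (rule mult_left_mono[OF _ c0])
      have "0 \<le> ln Rm / l" using Rm l by simp
      then show "real N + 1 \<le> ln Rm / l + 1" unfolding N_def by linarith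
    qed
    also have "\<dots> = c / l * ln Rm + c" by (simp add: algebra_simps)
    also have "\<dots> \<le> (2 * pi + \<delta>) * ln Rm + c" using cl Rm by (intro add_right_mono mult_right_mono) auto
    finally show "(\<Sum>i\<in>F. vortex_density (rel j i)) \<le> (2 * pi + \<delta>) * ln Rm + (c + 8 * (2 * K + 4)\<^sup>2)"
      using s0 split by linarith
  qed
qed

section \<open>The recovery sequence\<close>

text \<open>Multiplying unit complex numbers adds angles; conjugation reverses the sign of a
  vortex.\<close>

definition multi_vortex :: "nat \<Rightarrow> (nat \<Rightarrow> real) \<Rightarrow> (nat \<Rightarrow> int \<times> int) \<Rightarrow> int \<times> int \<Rightarrow> complex" where
  "multi_vortex M s j i = (\<Prod>k<M. if 0 < s k then vortex (j k) i else cnj (vortex (j k) i))"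

lemma norm_multi_vortex [simp]: "norm (multi_vortex M s j i) = 1"
  unfolding multi_vortex_def prod_norm[symmetric] by (intro prod.neutral) simp

lemma prod_cis: "(\<Prod>k<M. cis (a k)) = cis (\<Sum>k<M. a k)" for M :: nat
  by (induction M) (simp_all add: cis_mult)

lemma multi_vortex_quotient:
  assumes s: "\<And>k. k < M \<Longrightarrow> \<bar>s k\<bar> = 1"
  shows "multi_vortex M s j i' / multi_vortex M s j i = cis (\<Sum>k<M. s k * Arg (vortex (j k) i' / vortex (j k) i))"
  unfolding prod_cis[symmetric] multi_vortex_def prod_dividef[symmetric]
proof (rule prod.cong[OF refl])
  fix k assume "k \<in> {..<M}"
  then have k: "\<bar>s k\<bar> = 1" using s by simp
  let ?a = "Arg (vortex (j k) i' / vortex (j k) i)"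
  have c: "vortex (j k) i' / vortex (j k) i = cis ?a" by (rule cis_bond[symmetric]) simp_all
  show "(if 0 < s k then vortex (j k) i' else cnj (vortex (j k) i')) / (if 0 < s k then vortex (j k) i else cnj (vortex (j k) i)) = cis (s k * ?a)"
  proof (cases "0 < s k")
    case True
    then have "s k = 1" using k by simp
    then show ?thesis using c by simp
  next
    case False
    then have "s k = -1" using k by simp
    moreover have "cnj (vortex (j k) i') / cnj (vortex (j k) i) = cis (- ?a)"
    proof -
      have "cnj (vortex (j k) i') / cnj (vortex (j k) i) = cnj (vortex (j k) i' / vortex (j k) i)" by simp
      also have "\<dots> = cnj (cis ?a)" by (rule arg_cong[OF c])
      finally show ?thesis by (simp only: cis_cnj)
    qed
    ultimately show ?thesis by simp
  qed
qed

lemma vortex_step_le: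
  "norm (vortex j (i + dx) - vortex j i) \<le> 2 / norm (rel j i)"
  "norm (vortex j (i + dy) - vortex j i) \<le> 2 / norm (rel j i)"
  using sgn_diff_le[OF rel_nonzero, of "rel j i + 1" j i] sgn_diff_le[OF rel_nonzero, of "rel j i + \<i>" j i]
  by (simp_all add: vortex_def rel_step)

lemma angle_le_chord:
  assumes "norm (z :: complex) = 1" "norm w = 1"
  shows "\<bar>Arg (w / z)\<bar> \<le> 3 * norm (w - z)"
proof -
  have b: "\<bar>Arg (w / z)\<bar> \<le> pi" using Arg_bounded[of "w / z"] by auto
  have "(Arg (w / z))\<^sup>2 / 18 \<le> (norm (w - z))\<^sup>2 / 2"
    using one_minus_cos_ge[OF b] chord_square[OF assms] by simp
  then have "(Arg (w / z))\<^sup>2 \<le> (3 * norm (w - z))\<^sup>2" by (simp add: power_mult_distrib)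
  then show ?thesis by (metis abs_le_square_iff abs_norm_cancel abs_mult abs_numeral)
qed

text \<open>If two vortices were both closer than half the separation to the same lattice point,
  they would be too close to each other.\<close>

lemma separated_far:
  fixes j :: "nat \<Rightarrow> int \<times> int"
  assumes sep: "\<And>k l. k < M \<Longrightarrow> l < M \<Longrightarrow> k \<noteq> l \<Longrightarrow> D \<le> dist (pos (j k)) (pos (j l))"
  shows "\<exists>k0. \<forall>k<M. k \<noteq> k0 \<longrightarrow> D / 2 \<le> norm (rel (j k) i)"
proof (cases "\<exists>k0<M. norm (rel (j k0) i) < D / 2")
  case True
  then obtain k0 where k0: "k0 < M" "norm (rel (j k0) i) < D / 2" by blast
  have "D / 2 \<le> norm (rel (j k) i)" if "k < M" "k \<noteq> k0" for k
  proof -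
    have "D \<le> dist (pos (j k)) (pos (j k0))" using sep that k0 by blast
    also have "\<dots> \<le> norm (rel (j k) i) + norm (rel (j k0) i)"
      unfolding norm_rel
      using dist_triangle[of "pos (j k) + vector [1/2, 1/2]" "pos (j k0) + vector [1/2, 1/2]" "pos i"]
      by (simp add: dist_commute)
    finally show ?thesis using k0(2) by linarith
  qed
  then show ?thesis by (intro exI[of _ k0]) simp
next
  case False
  then show ?thesis by (intro exI[of _ 0] allI impI) (meson not_less)
qed

text \<open>Angles add modulo 2 pi, and here exactly: one vortex may contribute pi / 2 to a bond and
  all others together less than 1, so the sum stays in the principal range. This is where the
  separation 12 M + 1 comes from.\<close>

lemma multi_vortex_circulation:
  assumes s: "\<And>k. k < M \<Longrightarrow> \<bar>s k\<bar> = 1" and D: "12 * real M + 1 \<le> D"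
    and sep: "\<And>k l. k < M \<Longrightarrow> l < M \<Longrightarrow> k \<noteq> l \<Longrightarrow> D \<le> dist (pos (j k)) (pos (j l))"
  shows "circulation (multi_vortex M s j) i = (\<Sum>k<M. s k * circulation (vortex (j k)) i)"
proof -
  have D0: "0 < D" using D by simp
  have key: "Arg (cis (\<Sum>k<M. s k * a k)) = (\<Sum>k<M. s k * a k)"
    if a: "\<And>k. k < M \<Longrightarrow> \<bar>a k\<bar> \<le> pi / 2" and k0: "\<And>k. k < M \<Longrightarrow> k \<noteq> k0 \<Longrightarrow> \<bar>a k\<bar> \<le> 12 / D" for a k0
  proof -
    have "\<bar>\<Sum>k<M. s k * a k\<bar> \<le> (\<Sum>k<M. \<bar>a k\<bar>)"
      using s by (intro order_trans[OF sum_abs] sum_mono) (simp add: abs_mult)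
    also have "\<dots> \<le> (\<Sum>k<M. (if k = k0 then pi / 2 else 0) + 12 / D)"
    proof (rule sum_mono)
      fix k assume "k \<in> {..<M}"
      then show "\<bar>a k\<bar> \<le> (if k = k0 then pi / 2 else 0) + 12 / D"
        using a[of k] k0[of k] D0 by (auto intro: add_increasing2)
    qed
    also have "\<dots> \<le> pi / 2 + real M * (12 / D)" by (simp add: sum.distrib sum.delta)
    also have "real M * (12 / D) < 1" using D D0 by (simp add: field_simps)
    also have "pi / 2 + 1 < pi" using pi_gt3 by simp
    finally show ?thesis by (intro Arg_cis) auto
  qed
  have H: "hb (multi_vortex M s j) i = (\<Sum>k<M. s k * hb (vortex (j k)) i)" for i
  proof -
    have "\<exists>k0. \<forall>k<M. k \<noteq> k0 \<longrightarrow> D / 2 \<le> norm (rel (j k) i)" by (rule separated_far) (rule sep)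
    then obtain k0 where k0: "\<And>k. k < M \<Longrightarrow> k \<noteq> k0 \<Longrightarrow> D / 2 \<le> norm (rel (j k) i)" by auto
    have e: "multi_vortex M s j (i + dx) / multi_vortex M s j i = cis (\<Sum>k<M. s k * hb (vortex (j k)) i)"
      unfolding hb_def by (rule multi_vortex_quotient) (rule s)
    show ?thesis unfolding hb_def[of "multi_vortex M s j"] e
    proof (rule key[OF vortex_bond_le(1)])
      fix k assume "k < M" "k \<noteq> k0"
      \<comment> \<open>An angle is at most 3 chords and a chord at most 2 / |rel|; with |rel| >= D
        / 2 this is 12 / D.\<close>
      then have "2 / norm (rel (j k) i) \<le> 2 / (D / 2)" using k0 D0 by (intro divide_left_mono mult_pos_pos) auto
      then show "\<bar>hb (vortex (j k)) i\<bar> \<le> 12 / D"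
        using angle_le_chord[of "vortex (j k) i" "vortex (j k) (i + dx)"] vortex_step_le(1)[of "j k" i] by (simp add: hb_def)
    qed
  qed
  have V: "vb (multi_vortex M s j) i = (\<Sum>k<M. s k * vb (vortex (j k)) i)" for i
  proof -
    have "\<exists>k0. \<forall>k<M. k \<noteq> k0 \<longrightarrow> D / 2 \<le> norm (rel (j k) i)" by (rule separated_far) (rule sep)
    then obtain k0 where k0: "\<And>k. k < M \<Longrightarrow> k \<noteq> k0 \<Longrightarrow> D / 2 \<le> norm (rel (j k) i)" by auto
    have e: "multi_vortex M s j (i + dy) / multi_vortex M s j i = cis (\<Sum>k<M. s k * vb (vortex (j k)) i)"
      unfolding vb_def by (rule multi_vortex_quotient) (rule s)
    show ?thesis unfolding vb_def[of "multi_vortex M s j"] e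
    proof (rule key[OF vortex_bond_le(2)])
      fix k assume "k < M" "k \<noteq> k0"
      then have "2 / norm (rel (j k) i) \<le> 2 / (D / 2)" using k0 D0 by (intro divide_left_mono mult_pos_pos) auto
      then show "\<bar>vb (vortex (j k)) i\<bar> \<le> 12 / D"
        using angle_le_chord[of "vortex (j k) i" "vortex (j k) (i + dy)"] vortex_step_le(2)[of "j k" i] by (simp add: vb_def)
    qed
  qed
  show ?thesis
    unfolding circulation_def H V by (simp add: sum.distrib[symmetric] sum_subtractf[symmetric] algebra_simps)
qed

text \<open>Young's inequality with parameter t between the single large term and the sum of the
  small ones. If k0 is out of range there is no large term.\<close>

lemma square_sum_one_large:
  fixes a :: "nat \<Rightarrow> real"
  assumes a: "\<And>k. k < M \<Longrightarrow> 0 \<le> a k" and k0: "\<And>k. k < M \<Longrightarrow> k \<noteq> k0 \<Longrightarrow> a k \<le> r" and r: "0 \<le> r" and t: "0 < t"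
  shows "(\<Sum>k<M. a k)\<^sup>2 \<le> (1 + t) * (\<Sum>k<M. (a k)\<^sup>2) + (1 + 1 / t) * (real M * r)\<^sup>2"
proof -
  define b where "b = (if k0 < M then a k0 else 0)"
  define R where "R = real M * r"
  have b0: "0 \<le> b" "0 \<le> R" using a r by (auto simp: b_def R_def)
  have "(\<Sum>k<M. a k) \<le> (\<Sum>k<M. (if k = k0 then b else 0) + r)"
  proof (rule sum_mono)
    fix k assume "k \<in> {..<M}"
    then show "a k \<le> (if k = k0 then b else 0) + r" using k0[of k] r by (auto simp: b_def)
  qed
  also have "\<dots> \<le> b + R" using b0 by (simp add: sum.distrib sum.delta R_def)
  finally have "(\<Sum>k<M. a k)\<^sup>2 \<le> (b + R)\<^sup>2" using a by (intro power_mono sum_nonneg) auto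
  also have "\<dots> \<le> (1 + t) * b\<^sup>2 + (1 + 1 / t) * R\<^sup>2"
  proof -
    have "0 \<le> (t * b - R)\<^sup>2 / t" using t by simp
    also have "\<dots> = t * b\<^sup>2 - 2 * b * R + R\<^sup>2 / t" using t by (simp add: power2_eq_square field_simps)
    finally show ?thesis by (simp add: power2_sum distrib_right)
  qed
  also have "b\<^sup>2 \<le> (\<Sum>k<M. (a k)\<^sup>2)"
  proof (cases "k0 < M")
    case True
    then have "(a k0)\<^sup>2 \<le> (\<Sum>k<M. (a k)\<^sup>2)" by (intro member_le_sum[of k0 "{..<M}" "\<lambda>k. (a k)\<^sup>2"]) auto
    then show ?thesis using True by (simp add: b_def)
  qed (simp add: b_def sum_nonneg)
  finally show ?thesis using t by (simp add: R_def)
qed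

text \<open>At each point all vortices but one contribute chords of size at most 4 / D, so the
  interaction is estimated uniformly and multiplied by the number of lattice points. With D of order
  gap / \<epsilon> this is of order 1 / gap^2.\<close>

lemma multi_vortex_energy:
  assumes Z: "finite Z" and D: "0 < D" and t: "0 < t"
    and sep: "\<And>k l. k < M \<Longrightarrow> l < M \<Longrightarrow> k \<noteq> l \<Longrightarrow> D \<le> dist (pos (j k)) (pos (j l))"
  shows "xy_energy Z (multi_vortex M s j) \<le> (1 + t) / 2 * (\<Sum>k<M. \<Sum>i\<in>Z. vortex_density (rel (j k) i))
    + (1 + 1 / t) * (real M * (4 / D))\<^sup>2 * real (card Z)"
proof -
  let ?v = "multi_vortex M s j"
  have fh: "finite (hbonds Z)" "finite (vbonds Z)" "hbonds Z \<subseteq> Z" "vbonds Z \<subseteq> Z" using Z by (auto simp: hbonds_def vbonds_def)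
  have diff: "norm (?v i' - ?v i) \<le> (\<Sum>k<M. norm (vortex (j k) i' - vortex (j k) i))" for i i'
  proof -
    have "norm (?v i' - ?v i) \<le> (\<Sum>k<M. norm ((if 0 < s k then vortex (j k) i' else cnj (vortex (j k) i'))
        - (if 0 < s k then vortex (j k) i else cnj (vortex (j k) i))))"
      unfolding multi_vortex_def by (rule norm_prod_diff) auto
    also have "\<dots> = (\<Sum>k<M. norm (vortex (j k) i' - vortex (j k) i))"
      by (intro sum.cong refl) (auto simp: complex_cnj_diff[symmetric] simp del: complex_cnj_diff)
    finally show ?thesis .
  qed
  let ?R = "(1 + 1 / t) * (real M * (4 / D))\<^sup>2"
  have each: "(norm (?v i' - ?v i))\<^sup>2 \<le> (1 + t) * (\<Sum>k<M. (norm (vortex (j k) i' - vortex (j k) i))\<^sup>2) + ?R"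
    if st: "\<And>k. norm (vortex (j k) i' - vortex (j k) i) \<le> 2 / norm (rel (j k) i)" for i i'
  proof -
    have "\<exists>k0. \<forall>k<M. k \<noteq> k0 \<longrightarrow> D / 2 \<le> norm (rel (j k) i)" by (rule separated_far) (rule sep)
    then obtain k0 where k0: "\<And>k. k < M \<Longrightarrow> k \<noteq> k0 \<Longrightarrow> D / 2 \<le> norm (rel (j k) i)" by auto
    have "norm (vortex (j k) i' - vortex (j k) i) \<le> 4 / D" if "k < M" "k \<noteq> k0" for k
    proof -
      have "2 / norm (rel (j k) i) \<le> 2 / (D / 2)" using k0[OF that] D by (intro divide_left_mono mult_pos_pos) auto
      then show ?thesis using st[of k] by simp
    qed
    note sq = square_sum_one_large[of M "\<lambda>k. norm (vortex (j k) i' - vortex (j k) i)" k0 "4 / D" t, OF _ this _ t]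
    have "(norm (?v i' - ?v i))\<^sup>2 \<le> (\<Sum>k<M. norm (vortex (j k) i' - vortex (j k) i))\<^sup>2"
      using diff by (intro power_mono) auto
    also have "\<dots> \<le> (1 + t) * (\<Sum>k<M. (norm (vortex (j k) i' - vortex (j k) i))\<^sup>2) + ?R"
      using D by (intro sq) auto
    finally show ?thesis .
  qed
  have "xy_energy Z ?v = (\<Sum>i\<in>hbonds Z. (norm (?v (i + dx) - ?v i))\<^sup>2 / 2) + (\<Sum>i\<in>vbonds Z. (norm (?v (i + dy) - ?v i))\<^sup>2 / 2)"
  proof -
    have "1 - cos (hb ?v i) = (norm (?v (i + dx) - ?v i))\<^sup>2 / 2" "1 - cos (vb ?v i) = (norm (?v (i + dy) - ?v i))\<^sup>2 / 2" for i
      unfolding hb_def vb_def by (subst chord_square; simp)+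
    then show ?thesis by (simp only: xy_energy_def)
  qed
  also have "\<dots> \<le> (\<Sum>i\<in>Z. (norm (?v (i + dx) - ?v i))\<^sup>2 / 2) + (\<Sum>i\<in>Z. (norm (?v (i + dy) - ?v i))\<^sup>2 / 2)"
    using fh Z by (intro add_mono sum_mono2) auto
  also have "\<dots> \<le> (\<Sum>i\<in>Z. ((1 + t) * (\<Sum>k<M. (norm (vortex (j k) (i + dx) - vortex (j k) i))\<^sup>2) + ?R) / 2)
       + (\<Sum>i\<in>Z. ((1 + t) * (\<Sum>k<M. (norm (vortex (j k) (i + dy) - vortex (j k) i))\<^sup>2) + ?R) / 2)"
    by (intro add_mono sum_mono divide_right_mono each vortex_step_le) auto
  also have "\<dots> = (\<Sum>i\<in>Z. (1 + t) / 2 * (\<Sum>k<M. vortex_density (rel (j k) i)) + ?R)"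
    unfolding sum.distrib[symmetric]
  proof (rule sum.cong[OF refl])
    fix i
    have "vortex_density (rel (j k) i) = (norm (vortex (j k) (i + dx) - vortex (j k) i))\<^sup>2 + (norm (vortex (j k) (i + dy) - vortex (j k) i))\<^sup>2" for k
      by (simp add: vortex_density_def vortex_def rel_step)
    moreover have "((1 + t) * A + R) / 2 + ((1 + t) * B + R) / 2 = (1 + t) / 2 * (A + B) + R" for A B R
      by (simp add: field_simps)
    ultimately show "((1 + t) * (\<Sum>k<M. (norm (vortex (j k) (i + dx) - vortex (j k) i))\<^sup>2) + ?R) / 2
       + ((1 + t) * (\<Sum>k<M. (norm (vortex (j k) (i + dy) - vortex (j k) i))\<^sup>2) + ?R) / 2
      = (1 + t) / 2 * (\<Sum>k<M. vortex_density (rel (j k) i)) + ?R"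
      by (simp only: sum.distrib)
  qed
  also have "\<dots> = (1 + t) / 2 * (\<Sum>k<M. \<Sum>i\<in>Z. vortex_density (rel (j k) i)) + ?R * real (card Z)"
    unfolding sum.distrib sum_distrib_left[symmetric] by (subst sum.swap) simp
  finally show ?thesis .
qed

section \<open>From unit complex numbers on the lattice back to tensor fields\<close>

definition nearest :: "real \<Rightarrow> real^2 \<Rightarrow> int \<times> int" where
  "nearest \<epsilon> x = (\<lfloor>x $ 1 / \<epsilon> + 1/2\<rfloor>, \<lfloor>x $ 2 / \<epsilon> + 1/2\<rfloor>)"

text \<open>Halving the angle inverts the doubling done by \<open>A_map\<close>. The jump of
  \<open>Arg\<close> only flips the sign of the vector, which its tensor square does not
  notice.\<close>

definition half_angle :: "complex \<Rightarrow> real^2" where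
  "half_angle w = vector [cos (Arg w / 2), sin (Arg w / 2)]"

definition lift_field :: "real \<Rightarrow> (int \<times> int \<Rightarrow> complex) \<Rightarrow> real^2 \<Rightarrow> real^2^2" where
  "lift_field \<epsilon> v x = tensor (half_angle (v (nearest \<epsilon> x))) (half_angle (v (nearest \<epsilon> x)))"

lemma nearest_cell:
  assumes \<epsilon>: "0 < \<epsilon>" and w: "w \<in> unit_cell"
  shows "nearest \<epsilon> (\<epsilon> *\<^sub>R (pos i + w)) = i"
proof -
  have "- (1/2) \<le> w $ 1 \<and> w $ 1 < 1/2" "- (1/2) \<le> w $ 2 \<and> w $ 2 < 1/2" using w by (auto simp: unit_cell_def)
  then show ?thesis using \<epsilon> by (auto simp: nearest_def prod_eq_iff floor_eq_iff)
qed

lemma nearest_lattice: "0 < \<epsilon> \<Longrightarrow> nearest \<epsilon> (\<epsilon> *\<^sub>R pos i) = i"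
  using nearest_cell[of \<epsilon> 0 i] by (simp add: unit_cell_def)

lemma norm_half_angle [simp]: "norm (half_angle w) = 1"
  by (simp add: half_angle_def norm_real2)

lemma lift_field_C_eps:
  assumes \<epsilon>: "0 < \<epsilon>" shows "lift_field \<epsilon> v \<in> C_eps \<epsilon> \<Omega>"
proof -
  have "lift_field \<epsilon> v x \<in> S1_tensor" for x
  proof -
    have "half_angle w \<in> sphere 0 1" for w by (simp add: sphere_def dist_norm)
    then show ?thesis unfolding S1_tensor_def lift_field_def by blast
  qed
  moreover have "lift_field \<epsilon> v x = lift_field \<epsilon> v (\<epsilon> *\<^sub>R i)"
    if "i \<in> Z_eps \<epsilon> \<Omega>" "x \<in> (\<lambda>w. \<epsilon> *\<^sub>R (i + w)) ` unit_cell" for i x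
    using that nearest_cell[OF \<epsilon>] nearest_lattice[OF \<epsilon>] by (auto simp: Z_eps_eq lift_field_def)
  ultimately show ?thesis by (simp add: C_eps_def)
qed

lemma field_lift_field:
  assumes \<epsilon>: "0 < \<epsilon>" and v: "norm (v i) = 1"
  shows "field \<epsilon> (lift_field \<epsilon> v) i = v i"
proof -
  define \<theta> where "\<theta> = Arg (v i)"
  have "v i \<noteq> 0" using v by auto
  then have "cis \<theta> = v i" using v by (simp add: \<theta>_def cis_Arg sgn_div_norm)
  moreover have "field \<epsilon> (lift_field \<epsilon> v) i = Complex (2 * cos (\<theta> / 2) * cos (\<theta> / 2) - 1) (2 * cos (\<theta> / 2) * sin (\<theta> / 2))"
    by (simp add: field_tensor[where u = "half_angle (v i)"] lift_field_def nearest_lattice[OF \<epsilon>] half_angle_def \<theta>_def)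
  moreover have "2 * cos (\<theta> / 2) * cos (\<theta> / 2) - 1 = cos \<theta>" "2 * cos (\<theta> / 2) * sin (\<theta> / 2) = sin \<theta>"
    using cos_double_cos[of "\<theta> / 2"] sin_double[of "\<theta> / 2"] by (simp_all add: power2_eq_square mult_ac)
  ultimately show ?thesis by (simp add: cis.ctr)
qed

lemma lat_card_le:
  assumes R: "\<And>x. x \<in> \<Omega> \<Longrightarrow> norm x \<le> R" "0 \<le> R" and \<epsilon>: "0 < \<epsilon>" "\<epsilon> \<le> 1" and \<Omega>: "bounded \<Omega>"
  shows "real (card (lat \<epsilon> \<Omega>)) \<le> ((2 * R + 8) / \<epsilon>)\<^sup>2"
proof -
  have "real (card (lat \<epsilon> \<Omega>)) \<le> (2 * (R / \<epsilon> + 2) + 4)\<^sup>2"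
  proof (rule small_rel_card[OF finite_lat[OF \<Omega> \<epsilon>(1)]])
    show "0 \<le> R / \<epsilon> + 2" using R(2) \<epsilon> by simp
    fix i assume "i \<in> lat \<epsilon> \<Omega>"
    then have "norm (\<epsilon> *\<^sub>R pos i) \<le> R" by (intro R(1)) (simp add: lat_def)
    then have "norm (pos i) \<le> R / \<epsilon>" using \<epsilon> by (simp add: pos_le_divide_eq mult.commute)
    moreover have "norm (rel (0, 0) i) \<le> norm (pos i) + norm (vector [1/2, 1/2] :: real^2)"
      unfolding norm_rel dist_norm by (rule order_trans[OF norm_triangle_ineq4]) (use norm_triangle_ineq[of "pos (0,0)" "vector [1/2,1/2]"] in \<open>simp add: norm_real2\<close>)
    moreover have "norm (vector [1/2, 1/2] :: real^2) \<le> 1" using norm_real2_le[of "vector [1/2, 1/2]"] by simp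
    ultimately show "norm (rel (0, 0) i) < R / \<epsilon> + 2" by linarith
  qed
  also have "\<dots> \<le> ((2 * R + 8) / \<epsilon>)\<^sup>2"
    using R(2) \<epsilon> by (intro power_mono) (auto simp: field_simps)
  finally show ?thesis .
qed

lemma dist_lattice_cell:
  assumes "0 < \<epsilon>" shows "dist (\<epsilon> *\<^sub>R pos (cell \<epsilon> x)) x \<le> 2 * \<epsilon>"
proof -
  have f: "of_int \<lfloor>x $ 1 / \<epsilon>\<rfloor> \<le> x $ 1 / \<epsilon>" "x $ 1 / \<epsilon> \<le> of_int \<lfloor>x $ 1 / \<epsilon>\<rfloor> + 1"
    "of_int \<lfloor>x $ 2 / \<epsilon>\<rfloor> \<le> x $ 2 / \<epsilon>" "x $ 2 / \<epsilon> \<le> of_int \<lfloor>x $ 2 / \<epsilon>\<rfloor> + 1" by linarith+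
  have "x \<in> lowT \<epsilon> (cell \<epsilon> x) \<or> x \<in> uppT \<epsilon> (cell \<epsilon> x)"
    unfolding lowT_iff[OF assms] uppT_iff[OF assms] cell_def fst_conv snd_conv using f by linarith
  from dist_in_square[OF assms this] show ?thesis by (simp add: dist_commute)
qed

text \<open>The limit measure split into unit masses. The points y k need not be distinct: a mass of
  weight z appears as |z| copies of the same point.\<close>

locale recovery =
  fixes \<Omega> :: "(real^2) set" and M :: nat and s :: "nat \<Rightarrow> real" and y :: "nat \<Rightarrow> real^2"
  assumes \<Omega>: "open \<Omega>" "bounded \<Omega>" and s: "\<And>k. k < M \<Longrightarrow> \<bar>s k\<bar> = 1" and y: "\<And>k. k < M \<Longrightarrow> y k \<in> \<Omega>"
begin

text \<open>Coinciding points are pulled apart to distance \<open>|log \<epsilon>|\<^bsup>-1/4\<^esup>\<close>: this tends to \<open>0\<close>, and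
  the interaction energy, of order the inverse square of the separation, is \<open>o(|log \<epsilon>|)\<close>.\<close>

definition gap :: "real \<Rightarrow> real" where "gap \<epsilon> = 1 / sqrt (sqrt \<bar>ln \<epsilon>\<bar>)"

text \<open>The shift is proportional to the index k in the whole list; copies of one point are then
  at least \<open>gap\<close> apart, and no shift exceeds \<open>gap * M\<close>.\<close>

definition site :: "real \<Rightarrow> nat \<Rightarrow> real^2" where "site \<epsilon> k = y k + (gap \<epsilon> * real k) *\<^sub>R e1"

definition node :: "real \<Rightarrow> nat \<Rightarrow> int \<times> int" where "node \<epsilon> k = cell \<epsilon> (site \<epsilon> k)"

definition vfield :: "real \<Rightarrow> int \<times> int \<Rightarrow> complex" where "vfield \<epsilon> = multi_vortex M s (node \<epsilon>)"

definition Qrec :: "real \<Rightarrow> real^2 \<Rightarrow> real^2^2" where "Qrec \<epsilon> = lift_field \<epsilon> (vfield \<epsilon>)"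

lemma gap_tendsto: "(gap \<longlongrightarrow> 0) (at_right 0)"
proof -
  have "((\<lambda>L::real. 1 / sqrt (sqrt L)) \<longlongrightarrow> 0) at_top" by real_asymp
  from tendsto_at_right_log[OF this] show ?thesis by (simp add: gap_def[abs_def])
qed

lemma dist_node_site: "0 < \<epsilon> \<Longrightarrow> dist (\<epsilon> *\<^sub>R pos (node \<epsilon> k)) (site \<epsilon> k) \<le> 2 * \<epsilon>"
  unfolding node_def by (rule dist_lattice_cell)

lemma dist_node:
  assumes "0 < \<epsilon>" "k < M"
  shows "dist (\<epsilon> *\<^sub>R pos (node \<epsilon> k)) (y k) \<le> 2 * \<epsilon> + gap \<epsilon> * real M"
proof -
  have g: "0 \<le> gap \<epsilon>" by (simp add: gap_def)
  have "dist (site \<epsilon> k) (y k) = gap \<epsilon> * real k" using g by (simp add: site_def dist_norm)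
  also have "\<dots> \<le> gap \<epsilon> * real M" using g assms by (intro mult_left_mono) auto
  finally show ?thesis using dist_node_site[OF assms(1), of k] dist_triangle[of "\<epsilon> *\<^sub>R pos (node \<epsilon> k)" "y k" "site \<epsilon> k"]
    by linarith
qed

definition small :: "real \<Rightarrow> bool" where
  "small \<epsilon> \<longleftrightarrow> 0 < \<epsilon> \<and> \<epsilon> < 1 \<and> 1 < \<bar>ln \<epsilon>\<bar> \<and> 2 * (12 * real M + 1) * \<epsilon> + 8 * \<epsilon> \<le> gap \<epsilon> \<and>
    (\<forall>k<M. \<forall>l<M. k \<noteq> l \<longrightarrow> gap \<epsilon> \<le> dist (site \<epsilon> k) (site \<epsilon> l)) \<and> (\<forall>k<M. node \<epsilon> k \<in> sq \<epsilon> \<Omega>)"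

lemma eventually_small: "\<forall>\<^sub>F \<epsilon> in at_right 0. small \<epsilon>"
proof -
  have 1: "\<forall>\<^sub>F \<epsilon> in at_right 0. \<epsilon> \<in> {0<..<1::real}" by (rule eventually_at_right_real) simp
  have 2: "\<forall>\<^sub>F \<epsilon> in at_right 0. 1 < \<bar>ln (\<epsilon>::real)\<bar>" by (rule eventually_at_right_log[OF eventually_gt_at_top])
  have "\<forall>\<^sub>F L in at_top. (2 * (12 * real M + 1) + 8) * exp (- L) \<le> 1 / sqrt (sqrt L)" by real_asymp
  note 3 = eventually_at_right_log[OF this]
  have sep: "\<forall>\<^sub>F \<epsilon> in at_right 0. k \<noteq> l \<longrightarrow> gap \<epsilon> \<le> dist (site \<epsilon> k) (site \<epsilon> l)" if "k < M" "l < M" for k l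
  \<comment> \<open>Copies of one point are separated by the shifts alone; distinct points keep a
    positive distance while \<open>gap\<close> tends to 0.\<close>
  proof (cases "y k = y l")
    case True
    have "gap \<epsilon> \<le> dist (site \<epsilon> k) (site \<epsilon> l)" if "k \<noteq> l" for \<epsilon>
    proof -
      have "site \<epsilon> k - site \<epsilon> l = (gap \<epsilon> * (real k - real l)) *\<^sub>R e1"
        using True by (simp add: site_def algebra_simps)
      then have d: "dist (site \<epsilon> k) (site \<epsilon> l) = gap \<epsilon> * \<bar>real k - real l\<bar>"
        by (simp add: dist_norm abs_mult gap_def)
      have "1 \<le> \<bar>real k - real l\<bar>" using \<open>k \<noteq> l\<close> by linarith
      then have "gap \<epsilon> * 1 \<le> gap \<epsilon> * \<bar>real k - real l\<bar>" by (intro mult_left_mono) (auto simp: gap_def)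
      then show ?thesis by (simp add: d)
    qed
    then show ?thesis by simp
  next
    case False
    have "((\<lambda>\<epsilon>. dist (site \<epsilon> k) (site \<epsilon> l) - gap \<epsilon>) \<longlongrightarrow> dist (y k + (0 * real k) *\<^sub>R e1) (y l + (0 * real l) *\<^sub>R e1) - 0) (at_right 0)"
      unfolding site_def by (intro tendsto_intros gap_tendsto)
    moreover have "0 < dist (y k + (0 * real k) *\<^sub>R e1) (y l + (0 * real l) *\<^sub>R e1) - 0" using False by simp
    ultimately have "\<forall>\<^sub>F \<epsilon> in at_right 0. 0 < dist (site \<epsilon> k) (site \<epsilon> l) - gap \<epsilon>" by (rule order_tendstoD)
    then show ?thesis by (rule eventually_mono) simp
  qed
  have sep': "\<forall>\<^sub>F \<epsilon> in at_right 0. \<forall>k\<in>{..<M}. \<forall>l\<in>{..<M}. k \<noteq> l \<longrightarrow> gap \<epsilon> \<le> dist (site \<epsilon> k) (site \<epsilon> l)"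
    using sep by (intro eventually_ball_finite ballI) auto
  have mem: "\<forall>\<^sub>F \<epsilon> in at_right 0. node \<epsilon> k \<in> sq \<epsilon> \<Omega>" if k: "k < M" for k
  proof -
    obtain r where r: "0 < r" "ball (y k) r \<subseteq> \<Omega>" using \<Omega>(1) y[OF k] by (meson open_contains_ball)
    have "((\<lambda>\<epsilon>. 4 * \<epsilon> + gap \<epsilon> * real M) \<longlongrightarrow> 4 * 0 + 0 * real M) (at_right 0)" by (intro tendsto_intros gap_tendsto)
    then have "\<forall>\<^sub>F \<epsilon> in at_right 0. 4 * \<epsilon> + gap \<epsilon> * real M < r" using r(1) by (intro order_tendstoD(2)) auto
    with 1 show ?thesis
    proof eventually_elim
      case (elim \<epsilon>)
      then have \<epsilon>: "0 < \<epsilon>" by simp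
      have "x \<in> \<Omega>" if "x \<in> lowT \<epsilon> (node \<epsilon> k) \<or> x \<in> uppT \<epsilon> (node \<epsilon> k)" for x
      proof -
        have "dist x (y k) \<le> dist x (\<epsilon> *\<^sub>R pos (node \<epsilon> k)) + dist (\<epsilon> *\<^sub>R pos (node \<epsilon> k)) (y k)" by (rule dist_triangle)
        then have "dist x (y k) < r" using dist_in_square[OF \<epsilon> that] dist_node[OF \<epsilon> k] elim(2) by linarith
        then show ?thesis using r(2) by (auto simp: dist_commute)
      qed
      then show ?case unfolding sq_def lowset_def uppset_def by blast
    qed
  qed
  have mem': "\<forall>\<^sub>F \<epsilon> in at_right 0. \<forall>k\<in>{..<M}. node \<epsilon> k \<in> sq \<epsilon> \<Omega>"
    using mem by (intro eventually_ball_finite) auto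
  show ?thesis using 1 2 3 sep' mem'
  proof eventually_elim
    case (elim \<epsilon>)
    then have "exp (- \<bar>ln \<epsilon>\<bar>) = \<epsilon>" by (simp add: abs_if)
    then have "(2 * (12 * real M + 1) + 8) * \<epsilon> \<le> gap \<epsilon>" using elim(3) by (simp add: gap_def)
    then show ?case using elim unfolding small_def by (simp add: distrib_right)
  qed
qed

text \<open>Rounding the two sites to the lattice costs at most 4 \<epsilon>, which is at most half
  the gap; division by \<epsilon> passes to lattice units.\<close>

lemma node_sep:
  assumes "small \<epsilon>" "k < M" "l < M" "k \<noteq> l"
  shows "gap \<epsilon> / (2 * \<epsilon>) \<le> dist (pos (node \<epsilon> k)) (pos (node \<epsilon> l))"
proof -
  have \<epsilon>: "0 < \<epsilon>" "8 * \<epsilon> \<le> gap \<epsilon>" and g: "gap \<epsilon> \<le> dist (site \<epsilon> k) (site \<epsilon> l)"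
  proof -
    have "2 * (12 * real M + 1) * \<epsilon> + 8 * \<epsilon> \<le> gap \<epsilon>" "0 < \<epsilon>" using assms(1) by (auto simp: small_def)
    moreover have "0 \<le> 2 * (12 * real M + 1) * \<epsilon>" using \<open>0 < \<epsilon>\<close> by simp
    ultimately show "0 < \<epsilon>" "8 * \<epsilon> \<le> gap \<epsilon>" by linarith+
    show "gap \<epsilon> \<le> dist (site \<epsilon> k) (site \<epsilon> l)" using assms unfolding small_def by blast
  qed
  have "dist (site \<epsilon> k) (site \<epsilon> l) \<le> dist (\<epsilon> *\<^sub>R pos (node \<epsilon> k)) (site \<epsilon> k)
      + dist (\<epsilon> *\<^sub>R pos (node \<epsilon> k)) (\<epsilon> *\<^sub>R pos (node \<epsilon> l)) + dist (\<epsilon> *\<^sub>R pos (node \<epsilon> l)) (site \<epsilon> l)"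
    by metric
  then have "gap \<epsilon> / 2 \<le> dist (\<epsilon> *\<^sub>R pos (node \<epsilon> k)) (\<epsilon> *\<^sub>R pos (node \<epsilon> l))"
    using g dist_node_site[OF \<epsilon>(1), of k] dist_node_site[OF \<epsilon>(1), of l] \<epsilon>(2) by linarith
  also have "\<dots> = \<epsilon> * dist (pos (node \<epsilon> k)) (pos (node \<epsilon> l))"
    using \<epsilon>(1) by (simp add: dist_norm scaleR_diff_right[symmetric])
  finally show ?thesis using \<epsilon>(1) by (simp add: pos_divide_le_eq mult_ac)
qed

lemma gap_large: "small \<epsilon> \<Longrightarrow> 12 * real M + 1 \<le> gap \<epsilon> / (2 * \<epsilon>)"
  by (simp add: small_def pos_le_divide_eq algebra_simps)

lemma Qrec_C_eps: "small \<epsilon> \<Longrightarrow> Qrec \<epsilon> \<in> C_eps \<epsilon> \<Omega>"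
  unfolding Qrec_def by (rule lift_field_C_eps) (simp add: small_def)

lemma field_Qrec: "small \<epsilon> \<Longrightarrow> field \<epsilon> (Qrec \<epsilon>) = vfield \<epsilon>"
  unfolding Qrec_def by (rule ext, rule field_lift_field) (simp_all add: small_def vfield_def)

lemma vort_vfield:
  assumes "small \<epsilon>" "i \<in> sq \<epsilon> \<Omega>"
  shows "of_int (vort (vfield \<epsilon>) i) = (\<Sum>k<M. if node \<epsilon> k = i then s k else 0)"
proof -
  have \<epsilon>: "0 < \<epsilon>" using assms by (simp add: small_def)
  have "2 * pi * of_int (vort (vfield \<epsilon>) i) = circulation (vfield \<epsilon>) i"
    using sq_squares[OF \<epsilon>, of \<Omega>] assms(2) by (intro circulation_eq_vort[symmetric, of i "lat \<epsilon> \<Omega>"]) (auto simp: vfield_def)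
  also have "\<dots> = (\<Sum>k<M. s k * circulation (vortex (node \<epsilon> k)) i)"
    unfolding vfield_def using s gap_large[OF assms(1)] node_sep[OF assms(1)]
    by (rule multi_vortex_circulation)
  also have "\<dots> = (\<Sum>k<M. 2 * pi * (if node \<epsilon> k = i then s k else 0))"
    by (intro sum.cong refl) (auto simp: circulation_vortex)
  also have "\<dots> = 2 * pi * (\<Sum>k<M. if node \<epsilon> k = i then s k else 0)" by (rule sum_distrib_left[symmetric])
  finally show ?thesis by simp
qed

lemma vorticity_sum:
  assumes sm: "small \<epsilon>"
  shows "(\<Sum>i\<in>sq \<epsilon> \<Omega>. of_int (vort (vfield \<epsilon>) i) * f i) = (\<Sum>k<M. s k * f (node \<epsilon> k))"
proof -
  have fin: "finite (sq \<epsilon> \<Omega>)" using finite_lowset[OF \<Omega>(2)] sm by (simp add: sq_def small_def)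
  have "(\<Sum>i\<in>sq \<epsilon> \<Omega>. of_int (vort (vfield \<epsilon>) i) * f i) = (\<Sum>i\<in>sq \<epsilon> \<Omega>. \<Sum>k<M. if node \<epsilon> k = i then s k * f i else 0)"
  proof (rule sum.cong[OF refl])
    fix i assume "i \<in> sq \<epsilon> \<Omega>"
    then show "of_int (vort (vfield \<epsilon>) i) * f i = (\<Sum>k<M. if node \<epsilon> k = i then s k * f i else 0)"
      unfolding vort_vfield[OF sm \<open>i \<in> sq \<epsilon> \<Omega>\<close>] sum_distrib_right by (intro sum.cong refl) simp
  qed
  also have "\<dots> = (\<Sum>k<M. \<Sum>i\<in>sq \<epsilon> \<Omega>. if node \<epsilon> k = i then s k * f i else 0)" by (rule sum.swap)
  also have "\<dots> = (\<Sum>k<M. s k * f (node \<epsilon> k))"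
  proof (rule sum.cong[OF refl])
    fix k assume "k \<in> {..<M}"
    then have "node \<epsilon> k \<in> sq \<epsilon> \<Omega>" using sm by (simp add: small_def)
    then show "(\<Sum>i\<in>sq \<epsilon> \<Omega>. if node \<epsilon> k = i then s k * f i else 0) = s k * f (node \<epsilon> k)"
      using fin by (simp add: sum.delta')
  qed
  finally show ?thesis .
qed

lemma Qrec_flat:
  assumes sm: "small \<epsilon>" and \<phi>: "adm \<Omega> \<phi>"
  shows "\<bar>jac_pairing \<Omega> \<epsilon> (Qrec \<epsilon>) \<phi> - pi * (\<Sum>k<M. s k * \<phi> (y k))\<bar>
    \<le> 40 * \<epsilon> * xy_energy (lat \<epsilon> \<Omega>) (vfield \<epsilon>) + pi * (real M * (2 * \<epsilon> + gap \<epsilon> * real M))"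
proof -
  have \<epsilon>: "0 < \<epsilon>" using sm by (simp add: small_def)
  let ?S = "\<Sum>k<M. s k * \<phi> (\<epsilon> *\<^sub>R pos (node \<epsilon> k))"
  have 1: "\<bar>jac_pairing \<Omega> \<epsilon> (Qrec \<epsilon>) \<phi> - pi * ?S\<bar> \<le> 40 * \<epsilon> * xy_energy (lat \<epsilon> \<Omega>) (vfield \<epsilon>)"
    using jacobian_vorticity[OF \<epsilon> \<Omega>(2) Qrec_C_eps[OF sm] \<phi>]
    unfolding field_Qrec[OF sm] vorticity_sum[OF sm, of "\<lambda>i. \<phi> (\<epsilon> *\<^sub>R pos i)"] .
  have "\<bar>?S - (\<Sum>k<M. s k * \<phi> (y k))\<bar> \<le> (\<Sum>k<M. 2 * \<epsilon> + gap \<epsilon> * real M)"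
    unfolding sum_subtractf[symmetric]
  proof (rule sum_abs[THEN order_trans], rule sum_mono)
    fix k assume k: "k \<in> {..<M}"
    have "\<bar>\<phi> (\<epsilon> *\<^sub>R pos (node \<epsilon> k)) - \<phi> (y k)\<bar> \<le> dist (\<epsilon> *\<^sub>R pos (node \<epsilon> k)) (y k)" using \<phi> by (simp add: adm_def)
    then show "\<bar>s k * \<phi> (\<epsilon> *\<^sub>R pos (node \<epsilon> k)) - s k * \<phi> (y k)\<bar> \<le> 2 * \<epsilon> + gap \<epsilon> * real M"
      using dist_node[OF \<epsilon>, of k] s[of k] k by (simp add: right_diff_distrib[symmetric] abs_mult)
  qed
  then have "pi * \<bar>?S - (\<Sum>k<M. s k * \<phi> (y k))\<bar> \<le> pi * (real M * (2 * \<epsilon> + gap \<epsilon> * real M))"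
    by (intro mult_left_mono) auto
  then have "\<bar>pi * ?S - pi * (\<Sum>k<M. s k * \<phi> (y k))\<bar> \<le> pi * (real M * (2 * \<epsilon> + gap \<epsilon> * real M))"
    by (simp add: right_diff_distrib[symmetric] abs_mult)
  then show ?thesis using 1 by linarith
qed

lemma Qrec_energy:
  assumes t: "0 < t"
  shows "\<exists>A B. \<forall>\<epsilon>. small \<epsilon> \<longrightarrow> xy_energy (lat \<epsilon> \<Omega>) (vfield \<epsilon>)
    \<le> (1 + t) / 2 * (real M * ((2 * pi + t) * \<bar>ln \<epsilon>\<bar>)) + A + B * sqrt \<bar>ln \<epsilon>\<bar>"
proof -
  obtain R where R: "\<And>x. x \<in> \<Omega> \<Longrightarrow> norm x \<le> R" "0 \<le> R"
    using \<Omega>(2) unfolding bounded_iff by (meson norm_ge_zero order_trans linear)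
  obtain C0 where C0: "\<And>F j Rm. finite F \<Longrightarrow> 1 \<le> Rm \<Longrightarrow> (\<forall>i\<in>F. norm (rel j i) \<le> Rm) \<Longrightarrow>
    (\<Sum>i\<in>F. vortex_density (rel j i)) \<le> (2 * pi + t) * ln Rm + C0"
    using vortex_energy_sum[OF t] by metis
  \<comment> \<open>Bounds \<epsilon> times the distance from any lattice point of the domain to any
    node, including shift, rounding and the half-cell offset.\<close>
  define R2 where "R2 = 2 * R + real M + 5"
  define A where "A = (1 + t) / 2 * (real M * ((2 * pi + t) * ln R2 + C0))"
  \<comment> \<open>With 4 / D = 8 \<epsilon> / gap and at most ((2 R + 8) / \<epsilon>)^2 lattice
    points, the powers of \<epsilon> cancel; what remains is 1 / gap^2, the square root of |log
    \<epsilon>|.\<close>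
  define B where "B = (1 + 1 / t) * (8 * real M * (2 * R + 8))\<^sup>2"
  have "xy_energy (lat \<epsilon> \<Omega>) (vfield \<epsilon>) \<le> (1 + t) / 2 * (real M * ((2 * pi + t) * \<bar>ln \<epsilon>\<bar>)) + A + B * sqrt \<bar>ln \<epsilon>\<bar>"
    if sm: "small \<epsilon>" for \<epsilon>
  proof -
    have \<epsilon>: "0 < \<epsilon>" "\<epsilon> < 1" and L: "1 < \<bar>ln \<epsilon>\<bar>" using sm by (auto simp: small_def)
    have g: "0 < gap \<epsilon>" "gap \<epsilon> \<le> 1" using L by (auto simp: gap_def)
    define D where "D = gap \<epsilon> / (2 * \<epsilon>)"
    have D: "0 < D" using g \<epsilon> by (simp add: D_def)
    have fZ: "finite (lat \<epsilon> \<Omega>)" by (rule finite_lat[OF \<Omega>(2) \<epsilon>(1)])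
    have rel: "norm (rel (node \<epsilon> k) i) \<le> R2 / \<epsilon>" if k: "k < M" and i: "i \<in> lat \<epsilon> \<Omega>" for k i
    proof -
      have "norm (y k) \<le> R" by (rule R(1)[OF y[OF k]])
      moreover have "norm (\<epsilon> *\<^sub>R pos (node \<epsilon> k)) \<le> norm (y k) + dist (\<epsilon> *\<^sub>R pos (node \<epsilon> k)) (y k)"
        using norm_triangle_ineq2[of "\<epsilon> *\<^sub>R pos (node \<epsilon> k)" "y k"] by (simp add: dist_norm)
      moreover have "gap \<epsilon> * real M \<le> 1 * real M" using g by (intro mult_right_mono) auto
      ultimately have a: "norm (\<epsilon> *\<^sub>R pos (node \<epsilon> k)) \<le> R + (2 * \<epsilon> + real M)" using dist_node[OF \<epsilon>(1) k] by linarith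
      have b: "norm (\<epsilon> *\<^sub>R pos i) \<le> R" using i by (intro R(1)) (simp add: lat_def)
      have h: "norm (vector [1/2, 1/2] :: real^2) \<le> 1" using norm_real2_le[of "vector [1/2, 1/2]"] by simp
      have "norm (rel (node \<epsilon> k) i) \<le> norm (pos i) + (norm (pos (node \<epsilon> k)) + norm (vector [1/2, 1/2] :: real^2))"
        unfolding norm_rel dist_norm by (rule norm_triangle_ineq4[THEN order_trans]) (intro add_left_mono norm_triangle_ineq)
      then have "\<epsilon> * norm (rel (node \<epsilon> k) i) \<le> \<epsilon> * (norm (pos i) + (norm (pos (node \<epsilon> k)) + 1))"
        using h \<epsilon> by (intro mult_left_mono) auto
      also have "\<dots> = norm (\<epsilon> *\<^sub>R pos i) + norm (\<epsilon> *\<^sub>R pos (node \<epsilon> k)) + \<epsilon>" using \<epsilon> by (simp add: algebra_simps)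
      also have "\<dots> \<le> R2" using a b \<epsilon> by (simp add: R2_def)
      finally show ?thesis using \<epsilon> by (simp add: pos_le_divide_eq mult.commute)
    qed
    have R2: "1 \<le> R2" using R(2) by (simp add: R2_def)
    have "1 * 1 \<le> R2 * (1 / \<epsilon>)" using R2 \<epsilon> by (intro mult_mono) auto
    then have Rm: "1 \<le> R2 / \<epsilon>" by simp
    have lnR: "ln (R2 / \<epsilon>) = ln R2 + \<bar>ln \<epsilon>\<bar>" using \<epsilon> R2 by (simp add: ln_div abs_if)
    have "(\<Sum>k<M. \<Sum>i\<in>lat \<epsilon> \<Omega>. vortex_density (rel (node \<epsilon> k) i)) \<le> (\<Sum>k<M. (2 * pi + t) * ln (R2 / \<epsilon>) + C0)"
      using rel by (intro sum_mono C0 fZ Rm) auto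
    then have 1: "(1 + t) / 2 * (\<Sum>k<M. \<Sum>i\<in>lat \<epsilon> \<Omega>. vortex_density (rel (node \<epsilon> k) i))
        \<le> (1 + t) / 2 * (real M * ((2 * pi + t) * (ln R2 + \<bar>ln \<epsilon>\<bar>) + C0))"
      using t by (intro mult_left_mono) (auto simp: lnR)
    have 2: "(1 + 1 / t) * (real M * (4 / D))\<^sup>2 * real (card (lat \<epsilon> \<Omega>)) \<le> B * sqrt \<bar>ln \<epsilon>\<bar>"
    proof -
      have "(1 + 1 / t) * (real M * (4 / D))\<^sup>2 * real (card (lat \<epsilon> \<Omega>))
          \<le> (1 + 1 / t) * (real M * (4 / D))\<^sup>2 * ((2 * R + 8) / \<epsilon>)\<^sup>2"
        using lat_card_le[OF R \<epsilon>(1) _ \<Omega>(2)] \<epsilon> t by (intro mult_left_mono mult_nonneg_nonneg) auto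
      also have "\<dots> = (1 + 1 / t) * (real M * (4 / D) * ((2 * R + 8) / \<epsilon>))\<^sup>2"
        by (simp only: power_mult_distrib mult.assoc)
      also have "real M * (4 / D) * ((2 * R + 8) / \<epsilon>) = 8 * real M * (2 * R + 8) / gap \<epsilon>"
        using \<epsilon> g by (simp add: D_def field_simps)
      also have "(8 * real M * (2 * R + 8) / gap \<epsilon>)\<^sup>2 = (8 * real M * (2 * R + 8))\<^sup>2 * sqrt \<bar>ln \<epsilon>\<bar>"
        unfolding power_divide using L by (simp add: gap_def power_divide)
      finally show ?thesis by (simp add: B_def mult.assoc)
    qed
    have "xy_energy (lat \<epsilon> \<Omega>) (vfield \<epsilon>) \<le> (1 + t) / 2 * (\<Sum>k<M. \<Sum>i\<in>lat \<epsilon> \<Omega>. vortex_density (rel (node \<epsilon> k) i))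
      + (1 + 1 / t) * (real M * (4 / D))\<^sup>2 * real (card (lat \<epsilon> \<Omega>))"
      unfolding vfield_def D_def using fZ D[unfolded D_def] t node_sep[OF sm] by (rule multi_vortex_energy)
    also have "\<dots> \<le> (1 + t) / 2 * (real M * ((2 * pi + t) * (ln R2 + \<bar>ln \<epsilon>\<bar>) + C0)) + B * sqrt \<bar>ln \<epsilon>\<bar>"
      using 1 2 by linarith
    also have "\<dots> = (1 + t) / 2 * (real M * ((2 * pi + t) * \<bar>ln \<epsilon>\<bar>)) + A + B * sqrt \<bar>ln \<epsilon>\<bar>"
      by (simp add: A_def distrib_left)
    finally show ?thesis .
  qed
  then show ?thesis by blast
qed

section \<open>Limit of the energies of the recovery sequence\<close>

lemma Fc_Qrec:
  assumes sm: "small \<epsilon>"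
  shows "Fc \<Omega> \<epsilon> (Qrec \<epsilon>) = ereal (xy_energy (lat \<epsilon> \<Omega>) (vfield \<epsilon>) / \<bar>ln \<epsilon>\<bar>)"
proof -
  have "0 < \<epsilon>" using sm by (simp add: small_def)
  from Fc_eq_energy[OF Qrec_C_eps[OF sm] \<Omega>(2) this] show ?thesis unfolding field_Qrec[OF sm] .
qed

text \<open>The parameter t is fixed first, so that the leading coefficient is close to
  \<open>pi * M\<close>; the constant and the square root are then negligible against |log
  \<epsilon>|.\<close>

lemma Qrec_limsup:
  assumes d: "0 < d"
  shows "\<forall>\<^sub>F \<epsilon> in at_right 0. xy_energy (lat \<epsilon> \<Omega>) (vfield \<epsilon>) / \<bar>ln \<epsilon>\<bar> < pi * real M + d"
proof -
  have "((\<lambda>t. (1 + t) / 2 * (real M * (2 * pi + t))) \<longlongrightarrow> (1 + 0) / 2 * (real M * (2 * pi + 0))) (at_right 0)"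
    by (intro tendsto_intros) auto
  then have "\<forall>\<^sub>F t in at_right 0. (1 + t) / 2 * (real M * (2 * pi + t)) < pi * real M + d"
    using d by (intro order_tendstoD(2)) auto
  moreover have "\<forall>\<^sub>F t in at_right 0. t \<in> {0<..<1::real}" by (rule eventually_at_right_real) simp
  ultimately have "\<forall>\<^sub>F t in at_right 0. (1 + t) / 2 * (real M * (2 * pi + t)) < pi * real M + d \<and> t \<in> {0<..<1::real}"
    by (rule eventually_conj)
  from eventually_happens[OF this] obtain t :: real where
    t: "0 < t" "(1 + t) / 2 * (real M * (2 * pi + t)) < pi * real M + d" by auto
  obtain A B where AB: "\<And>\<epsilon>. small \<epsilon> \<Longrightarrow> xy_energy (lat \<epsilon> \<Omega>) (vfield \<epsilon>)
    \<le> (1 + t) / 2 * (real M * ((2 * pi + t) * \<bar>ln \<epsilon>\<bar>)) + A + B * sqrt \<bar>ln \<epsilon>\<bar>"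
    using Qrec_energy[OF t(1)] by blast
  define c where "c = (1 + t) / 2 * (real M * (2 * pi + t))"
  have "((\<lambda>L::real. c + A / L + B / sqrt L) \<longlongrightarrow> c + 0 + 0) at_top"
  proof (intro tendsto_intros)
    show "((\<lambda>L::real. A / L) \<longlongrightarrow> 0) at_top" "((\<lambda>L::real. B / sqrt L) \<longlongrightarrow> 0) at_top" by real_asymp+
  qed
  then have "\<forall>\<^sub>F L in at_top. c + A / L + B / sqrt L < pi * real M + d"
    using t(2) by (intro order_tendstoD(2)) (auto simp: c_def)
  from eventually_at_right_log[OF this] eventually_small show ?thesis
  proof eventually_elim
    case (elim \<epsilon>)
    define L where "L = \<bar>ln \<epsilon>\<bar>"
    have L: "1 < L" using elim(2) unfolding small_def L_def by blast
    have "xy_energy (lat \<epsilon> \<Omega>) (vfield \<epsilon>) / L \<le> ((1 + t) / 2 * (real M * ((2 * pi + t) * L)) + A + B * sqrt L) / L"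
      using AB[OF elim(2)] L by (intro divide_right_mono) (auto simp: L_def)
    also have "\<dots> = c + A / L + B * (sqrt L / L)" using L by (simp add: c_def add_divide_distrib)
    also have "sqrt L / L = 1 / sqrt L" using L by (simp add: field_simps)
    finally show ?case using elim(1) by (simp add: L_def)
  qed
qed

end

theorem theorem4p11:
  fixes \<Omega> :: "(real^2) set"
  assumes "open \<Omega>" and "bounded \<Omega>" and "simply_connected \<Omega>" and "lipschitz_boundary \<Omega>"
  shows
    "(\<forall>(\<epsilon> :: nat \<Rightarrow> real) (Q :: nat \<Rightarrow> real^2 \<Rightarrow> real^2^2) (C :: real).
        (\<forall>n. \<epsilon> n > 0) \<and> \<epsilon> \<longlonglongrightarrow> 0 \<and> (\<forall>n. Fc \<Omega> (\<epsilon> n) (Q n) \<le> ereal C) \<longrightarrow>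
        (\<exists>(r :: nat \<Rightarrow> nat) (m :: nat) (z :: nat \<Rightarrow> int) (x :: nat \<Rightarrow> real^2).
           strict_mono r \<and> inj_on x {1..m} \<and> x ` {1..m} \<subseteq> \<Omega> \<and>
           (\<lambda>n. dual_norm \<Omega> (jac_defect \<Omega> (\<epsilon> (r n)) (Q (r n)) m z x)) \<longlonglongrightarrow> 0 \<and>
           liminf (\<lambda>n. Fc \<Omega> (\<epsilon> (r n)) (Q (r n))) \<ge> ereal pi * total_variation (dirac_sum m z x) \<Omega> \<and>
           ereal pi * total_variation (dirac_sum m z x) \<Omega> = ereal (pi * (\<Sum>k = 1..m. \<bar>of_int (z k)\<bar>))))
     \<and>
     (\<forall>(m :: nat) (z :: nat \<Rightarrow> int) (x :: nat \<Rightarrow> real^2).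
        inj_on x {1..m} \<and> x ` {1..m} \<subseteq> \<Omega> \<longrightarrow>
        (\<exists>Q :: real \<Rightarrow> real^2 \<Rightarrow> real^2^2.
           ((\<lambda>\<epsilon>. dual_norm \<Omega> (jac_defect \<Omega> \<epsilon> (Q \<epsilon>) m z x)) \<longlongrightarrow> 0) (at_right 0) \<and>
           ((\<lambda>\<epsilon>. Fc \<Omega> \<epsilon> (Q \<epsilon>)) \<longlongrightarrow> ereal pi * total_variation (dirac_sum m z x) \<Omega>) (at_right 0) \<and>
           ereal pi * total_variation (dirac_sum m z x) \<Omega> = ereal (pi * (\<Sum>k = 1..m. \<bar>of_int (z k)\<bar>))))"
proof (intro conjI allI impI)
  fix \<epsilon> :: "nat \<Rightarrow> real" and Q :: "nat \<Rightarrow> real^2 \<Rightarrow> real^2^2" and C :: real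
  assume h: "(\<forall>n. \<epsilon> n > 0) \<and> \<epsilon> \<longlonglongrightarrow> 0 \<and> (\<forall>n. Fc \<Omega> (\<epsilon> n) (Q n) \<le> ereal C)"
  from compactness[OF assms(1,2), of \<epsilon> Q C] h obtain r :: "nat \<Rightarrow> nat" and m :: nat and z :: "nat \<Rightarrow> int" and x :: "nat \<Rightarrow> real^2" where
    r: "strict_mono r" "inj_on x {1..m}" "x ` {1..m} \<subseteq> \<Omega>"
    "(\<lambda>n. dual_norm \<Omega> (jac_defect \<Omega> (\<epsilon> (r n)) (Q (r n)) m z x)) \<longlonglongrightarrow> 0" by blast
  have tv: "ereal pi * total_variation (dirac_sum m z x) \<Omega> = ereal (pi * (\<Sum>k = 1..m. \<bar>of_int (z k)\<bar>))"
    unfolding total_variation_dirac_sum[OF assms(1) r(2,3)] by simp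
  have "filterlim (\<lambda>n. \<epsilon> (r n)) (at_right 0) sequentially"
    using h LIMSEQ_subseq_LIMSEQ[OF _ r(1), of \<epsilon> 0] by (intro tendsto_imp_filterlim_at_right) (auto simp: o_def)
  then have "ereal (pi * (\<Sum>k = 1..m. \<bar>of_int (z k)\<bar>)) \<le> liminf (\<lambda>n. Fc \<Omega> (\<epsilon> (r n)) (Q (r n)))"
    using h r(4) by (intro flat_liminf[OF assms(1,2) r(2,3), where C = C]) auto
  then show "\<exists>(r :: nat \<Rightarrow> nat) (m :: nat) (z :: nat \<Rightarrow> int) (x :: nat \<Rightarrow> real^2).
           strict_mono r \<and> inj_on x {1..m} \<and> x ` {1..m} \<subseteq> \<Omega> \<and>
           (\<lambda>n. dual_norm \<Omega> (jac_defect \<Omega> (\<epsilon> (r n)) (Q (r n)) m z x)) \<longlonglongrightarrow> 0 \<and>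
           liminf (\<lambda>n. Fc \<Omega> (\<epsilon> (r n)) (Q (r n))) \<ge> ereal pi * total_variation (dirac_sum m z x) \<Omega> \<and>
           ereal pi * total_variation (dirac_sum m z x) \<Omega> = ereal (pi * (\<Sum>k = 1..m. \<bar>of_int (z k)\<bar>))"
    using r tv by (intro exI[of _ r] exI[of _ m] exI[of _ z] exI[of _ x] conjI) simp_all
next
  fix m :: nat and z :: "nat \<Rightarrow> int" and x :: "nat \<Rightarrow> real^2"
  assume h: "inj_on x {1..m} \<and> x ` {1..m} \<subseteq> \<Omega>"
  then have inj: "inj_on x {1..m}" and sub: "x ` {1..m} \<subseteq> \<Omega>" by auto
  let ?S = "\<Sum>k = 1..m. \<bar>real_of_int (z k)\<bar>"
  have tv: "ereal pi * total_variation (dirac_sum m z x) \<Omega> = ereal (pi * ?S)"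
    unfolding total_variation_dirac_sum[OF assms(1) inj sub] by simp
  \<comment> \<open>Vortices of degree 1 or -1 only: a single vortex of degree z would cost of order
    z^2.\<close>
  from weighted_points_list[of "{1..m}" z x] obtain xs :: "(real \<times> (real^2)) list" where
    xs: "\<forall>p\<in>set xs. \<bar>fst p\<bar> = 1" "int (length xs) = (\<Sum>k = 1..m. \<bar>z k\<bar>)"
    "\<forall>\<phi>. (\<Sum>p\<leftarrow>xs. fst p * \<phi> (snd p)) = (\<Sum>k = 1..m. of_int (z k) * \<phi> (x k))" "snd ` set xs \<subseteq> x ` {1..m}"
    by auto
  define M where "M = length xs"
  define s y where "s k = fst (xs ! k)" and "y k = snd (xs ! k)" for k
  have MS: "real M = ?S"
  proof -
    have "real M = of_int (int M)" by simp
    then show ?thesis using xs(2) by (simp add: M_def)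
  qed
  have pair: "dirac_pairing m z x \<phi> = (\<Sum>k<M. s k * \<phi> (y k))" for \<phi>
    unfolding dirac_pairing_def xs(3)[rule_format, symmetric]
    by (simp add: sum_list_sum_nth atLeast0LessThan M_def s_def y_def)
  interpret recovery \<Omega> M s y
  proof
    fix k assume "k < M"
    then have "xs ! k \<in> set xs" by (simp add: M_def)
    then show "\<bar>s k\<bar> = 1" "y k \<in> \<Omega>" using xs(1,4) sub by (auto simp: s_def y_def)
  qed (use assms in auto)
  \<comment> \<open>The bound of \<open>Qrec_flat\<close> with the energy replaced by
    \<open>(pi * real M + 1) * \<bar>ln \<epsilon>\<bar>\<close>, which \<open>Qrec_limsup\<close>
    provides for d = 1.\<close>
  define e where "e \<epsilon> = 40 * (pi * real M + 1) * (\<epsilon> * \<bar>ln \<epsilon>\<bar>) + pi * (real M * (2 * \<epsilon> + gap \<epsilon> * real M))" for \<epsilon>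
  have "(e \<longlongrightarrow> 40 * (pi * real M + 1) * 0 + pi * (real M * (2 * 0 + 0 * real M))) (at_right 0)"
    unfolding e_def by (intro tendsto_intros tendsto_eps_log gap_tendsto)
  then have e0: "((\<lambda>\<epsilon>. ennreal (e \<epsilon>)) \<longlongrightarrow> ennreal 0) (at_right 0)" by (intro tendsto_ennrealI) simp
  have ev: "\<forall>\<^sub>F \<epsilon> in at_right 0. dual_norm \<Omega> (jac_defect \<Omega> \<epsilon> (Qrec \<epsilon>) m z x) \<le> ennreal (e \<epsilon>)"
    using eventually_small Qrec_limsup[OF zero_less_one]
  proof eventually_elim
    case (elim \<epsilon>)
    then have \<epsilon>: "0 < \<epsilon>" "1 < \<bar>ln \<epsilon>\<bar>" by (auto simp: small_def)
    show ?case
    proof (rule dual_norm_le[OF assms(1)])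
      fix \<phi> assume \<phi>: "adm \<Omega> \<phi>"
      have "xy_energy (lat \<epsilon> \<Omega>) (vfield \<epsilon>) \<le> (pi * real M + 1) * \<bar>ln \<epsilon>\<bar>"
      proof -
        have "0 < \<bar>ln \<epsilon>\<bar>" using \<epsilon> by linarith
        from elim(2)[unfolded pos_divide_less_eq[OF this]] show ?thesis by (rule less_imp_le)
      qed
      then have "40 * \<epsilon> * xy_energy (lat \<epsilon> \<Omega>) (vfield \<epsilon>) \<le> 40 * \<epsilon> * ((pi * real M + 1) * \<bar>ln \<epsilon>\<bar>)"
        using \<epsilon> by (intro mult_left_mono) auto
      then show "\<bar>jac_defect \<Omega> \<epsilon> (Qrec \<epsilon>) m z x \<phi>\<bar> \<le> e \<epsilon>"
        using Qrec_flat[OF elim(1) \<phi>] unfolding jac_defect_def pair e_def by (simp add: mult_ac)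
    qed
  qed
  have conv: "((\<lambda>\<epsilon>. dual_norm \<Omega> (jac_defect \<Omega> \<epsilon> (Qrec \<epsilon>) m z x)) \<longlongrightarrow> 0) (at_right 0)"
    by (rule tendsto_sandwich[OF _ ev tendsto_const e0[unfolded ennreal_0]]) simp
  have up: "\<forall>\<^sub>F \<epsilon> in at_right 0. Fc \<Omega> \<epsilon> (Qrec \<epsilon>) < ereal (pi * real M + d)" if "0 < d" for d
    using eventually_small Qrec_limsup[OF that] by eventually_elim (simp add: Fc_Qrec)
  \<comment> \<open>The lower half of the limit needs no computation: the general lower bound
    applies, since convergence in the dual norm is already established.\<close>
  have low: "ereal (pi * ?S) \<le> Liminf (at_right 0) (\<lambda>\<epsilon>. Fc \<Omega> \<epsilon> (Qrec \<epsilon>))"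
  proof (rule flat_liminf[OF assms(1,2) inj sub, where C = "pi * real M + 1"])
    show "\<forall>\<^sub>F \<epsilon> in at_right 0. Fc \<Omega> \<epsilon> (Qrec \<epsilon>) \<le> ereal (pi * real M + 1)"
      using up[OF zero_less_one] by eventually_elim simp
  qed (use conv filterlim_ident in auto)
  have "((\<lambda>\<epsilon>. Fc \<Omega> \<epsilon> (Qrec \<epsilon>)) \<longlongrightarrow> ereal (pi * ?S)) (at_right 0)"
  proof (rule order_tendstoI)
    fix a assume "a < ereal (pi * ?S)"
    then show "\<forall>\<^sub>F \<epsilon> in at_right 0. a < Fc \<Omega> \<epsilon> (Qrec \<epsilon>)" using low by (auto simp: le_Liminf_iff)
  next
    fix a assume "ereal (pi * ?S) < a"
    then obtain b where b: "ereal (pi * ?S) < ereal b" "ereal b < a" using ereal_dense2 by blast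
    then have "0 < b - pi * ?S" by simp
    from up[OF this] show "\<forall>\<^sub>F \<epsilon> in at_right 0. Fc \<Omega> \<epsilon> (Qrec \<epsilon>) < a"
      by (rule eventually_mono) (use b MS in \<open>auto intro: less_trans\<close>)
  qed
  then show "\<exists>Q :: real \<Rightarrow> real^2 \<Rightarrow> real^2^2.
           ((\<lambda>\<epsilon>. dual_norm \<Omega> (jac_defect \<Omega> \<epsilon> (Q \<epsilon>) m z x)) \<longlongrightarrow> 0) (at_right 0) \<and>
           ((\<lambda>\<epsilon>. Fc \<Omega> \<epsilon> (Q \<epsilon>)) \<longlongrightarrow> ereal pi * total_variation (dirac_sum m z x) \<Omega>) (at_right 0) \<and>
           ereal pi * total_variation (dirac_sum m z x) \<Omega> = ereal (pi * (\<Sum>k = 1..m. \<bar>of_int (z k)\<bar>))"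
    using conv tv by (intro exI[of _ Qrec] conjI) simp_all
qed

end
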